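(* Let $f\in C^1(\mathbb{R})$ be a strictly convex function with $f(0)=f'(0)=0$ and $\lim_{|v|\to\infty}\frac{f(v)}{|v|}=\infty$, and suppose there exist $q>1$, $r>0$ and $C>0$ such that $$0\le f'(a)-f'(b)\le C(a-b)^{q}\quad\text{for all } b\in(-r,0)\text{ and } a\in(0,r).$$ Let $\alpha\in L^\infty(0,\infty)$. Then there exists a compactly supported initial datum $u_0\in L^\infty(\mathbb{R})$ such that the corresponding entropy solution $u$ of $$\partial_t u+\partial_x f(u)=\alpha(t)u\quad (x\in\mathbb{R},\ t>0),\qquad u(x,0)=u_0(x)\quad (x\in\mathbb{R}),$$ satisfies $$u(\cdot,t)\notin BV^{s}_{loc}(\mathbb{R})\quad\text{for all } s>1/q \text{ and all } t>0.$$
   Context: For $s>0$, a function $v:\mathbb{R}\to\mathbb{R}$ belongs to $BV^s_{loc}(\mathbb{R})$ if for all $a<b$ its $TV^s$ variation on $[a,b]$, $$\sup\sum_{i=2}^n|v(x_i)-v(x_{i-1})|^{1/s},$$ is finite, the supremum being over all $n\ge2$ and all $a\le x_1<\dots<x_n\le b$. A function defined only almost everywhere belongs to $BV^s_{loc}(\mathbb{R})$ if some representative does. "Entropy solution" means Kruzhkov entropy solution: $u\in L^\infty(\mathbb{R}\times(0,T))$ for every $T>0$, $u\in C([0,\infty);L^1_{loc}(\mathbb{R}))$, $u(\cdot,0)=u_0$, and for every $k\in\mathbb{R}$, $\partial_t|u-k|+\partial_x\big(\mathrm{sgn}(u-k)(f(u)-f(k))\big)\le \mathrm{sgn}(u-k)\,\alpha(t)u$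 in the sense of distributions on $\mathbb{R}\times(0,\infty)$. *)

theory Defs
  imports "HOL-Analysis.Analysis"
begin

definition strictly_convex_on :: "real set \<Rightarrow> (real \<Rightarrow> real) \<Rightarrow> bool" where
  "strictly_convex_on S f \<longleftrightarrow> convex S \<and>
     (\<forall>x\<in>S. \<forall>y\<in>S. x \<noteq> y \<longrightarrow>
       (\<forall>\<theta>. 0 < \<theta> \<and> \<theta> < 1 \<longrightarrow> f ((1 - \<theta>) * x + \<theta> * y) < (1 - \<theta>) * f x + \<theta> * f y))"

text \<open>
  Functions are representatives of their classes modulo null sets. Measurability is with respect to
  the completed Lebesgue measure, so that every representative is admitted.
\<close>

definition Linfty_on :: "'a::euclidean_space set \<Rightarrow> ('a \<Rightarrow> real) \<Rightarrow> bool" where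
  "Linfty_on S g \<longleftrightarrow>
     g \<in> borel_measurable (lebesgue_on S) \<and> (\<exists>M. AE x in lebesgue_on S. \<bar>g x\<bar> \<le> M)"

definition TVs :: "real \<Rightarrow> (real \<Rightarrow> real) \<Rightarrow> real \<Rightarrow> real \<Rightarrow> ereal" where
  "TVs s v a b =
     Sup {ereal (\<Sum>i=2..n. \<bar>v (x i) - v (x (i - 1))\<bar> powr (1 / s)) | (n::nat) (x::nat \<Rightarrow> real).
            n \<ge> 2 \<and> strict_mono_on {1..n} x \<and> a \<le> x 1 \<and> x n \<le> b}"

definition BVs_loc :: "real \<Rightarrow> (real \<Rightarrow> real) \<Rightarrow> bool" where
  "BVs_loc s v \<longleftrightarrow> (\<forall>a b. a < b \<longrightarrow> TVs s v a b < \<infinity>)"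

definition BVs_loc_ae :: "real \<Rightarrow> (real \<Rightarrow> real) \<Rightarrow> bool" where
  "BVs_loc_ae s v \<longleftrightarrow> (\<exists>w. (AE x in lebesgue. w x = v x) \<and> BVs_loc s w)"

primrec Ck :: "nat \<Rightarrow> ('a::euclidean_space \<Rightarrow> real) \<Rightarrow> bool" where
  "Ck 0 \<phi> \<longleftrightarrow> continuous_on UNIV \<phi>"
| "Ck (Suc k) \<phi> \<longleftrightarrow>
     \<phi> differentiable_on UNIV \<and> (\<forall>i\<in>Basis. Ck k (\<lambda>p. frechet_derivative \<phi> (at p) i))"

text \<open>
  Nonnegative test functions on \<open>\<real> \<times> (0, \<infinity>)\<close>, extended by zero to the plane; points are pairs \<open>(x, t)\<close>.
\<close>

definition test_function :: "(real \<times> real \<Rightarrow> real) \<Rightarrow> bool" where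
  "test_function \<phi> \<longleftrightarrow>
     (\<forall>k. Ck k \<phi>) \<and> (\<forall>p. 0 \<le> \<phi> p) \<and>
     compact (closure {p. \<phi> p \<noteq> 0}) \<and> closure {p. \<phi> p \<noteq> 0} \<subseteq> UNIV \<times> {0<..}"

definition continuous_L1_loc :: "(real \<Rightarrow> real \<Rightarrow> real) \<Rightarrow> bool" where
  "continuous_L1_loc u \<longleftrightarrow>
     (\<forall>a b. \<forall>t\<ge>0. integrable (lebesgue_on {a..b}) (\<lambda>x. u x t)) \<and>
     (\<forall>a b. \<forall>t\<ge>0. ((\<lambda>\<tau>. integral\<^sup>L (lebesgue_on {a..b}) (\<lambda>x. \<bar>u x \<tau> - u x t\<bar>)) \<longlongrightarrow> 0)
                     (at t within {0..}))"

text \<open>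
  The last conjunct is the entropy inequality
  \<open>\<partial>\<^sub>t \<bar>u - k\<bar> + \<partial>\<^sub>x (sgn (u - k) (f u - f k)) \<le> sgn (u - k) \<alpha>(t) u\<close> tested against \<open>\<phi> \<ge> 0\<close>,
  with the derivatives moved onto \<open>\<phi>\<close>.
\<close>

definition entropy_solution ::
  "(real \<Rightarrow> real) \<Rightarrow> (real \<Rightarrow> real) \<Rightarrow> (real \<Rightarrow> real) \<Rightarrow> (real \<Rightarrow> real \<Rightarrow> real) \<Rightarrow> bool" where
  "entropy_solution f \<alpha> u0 u \<longleftrightarrow>
     (\<forall>T>0. Linfty_on (UNIV \<times> {0<..<T}) (\<lambda>(x, t). u x t)) \<and>
     continuous_L1_loc u \<and>
     (AE x in lebesgue. u x 0 = u0 x) \<and>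
     (\<forall>k \<phi>. test_function \<phi> \<longrightarrow>
        0 \<le> integral\<^sup>L (lebesgue_on (UNIV \<times> {0<..}))
              (\<lambda>(x, t). \<bar>u x t - k\<bar> * deriv (\<lambda>\<tau>. \<phi> (x, \<tau>)) t
                      + sgn (u x t - k) * (f (u x t) - f k) * deriv (\<lambda>\<xi>. \<phi> (\<xi>, t)) x
                      + sgn (u x t - k) * \<alpha> t * u x t * \<phi> (x, t)))"

end

theory Submission
  imports Defs
begin

text \<open>
  The source is removed by \<open>v = exp (- \<beta> t) u\<close> with \<open>\<beta> = \<integral>\<^sub>0\<^sup>t \<alpha>\<close>, which turns the flux into
  \<open>F t v = exp (- \<beta> t) f (exp (\<beta> t) v)\<close>. For this flux an explicit solution is obtained by gluing rarefaction
  fans centred at the nodes \<open>z i = - 1 / ln (i + 2)\<close>. Between two neighbouring nodes there is exactly one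
  shock; it never leaves its interval, so no two shocks ever interact. If \<open>a > 0 > b\<close> are the one-sided values at the
  shock, the node distance is a sum of differences \<open>f' a - f' b\<close> (with rescaled arguments), hence at most
  \<open>C\<^sub>t (a - b) powr q\<close>. As \<open>\<Sum> (z (i + 1) - z i) powr p = \<infinity>\<close> for every \<open>p < 1\<close>, the variation of order \<open>s > 1 / q\<close>
  is infinite at every time.

  Every entropy solution \<open>w\<close> satisfies Kruzhkov's inequality not only against constants but against the glued
  solution: a fan is a limit of staircases of small rarefaction jumps, and at a shock the bracket has the right
  sign by convexity. Constant \<open>w\<close> gives that the glued function is an entropy solution; general \<open>w\<close>
  gives uniqueness, without doubling of variables.
\<close>

section \<open>Smooth approximation of test functions\<close>

text \<open>\<open>\<alpha>\<close> is merely bounded and measurable, so \<beta> is only Lipschitz,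
  and the rescaling turns Kruzhkov's constants k into moving values k exp (- \<beta> t). The change
  of variable is therefore carried out on the entropy inequalities, by averaging over k with a
  moving weight, and not on the equation. f is only C^1, so fans need not be differentiable. Fans
  and shocks are handled through a potential E, whose derivatives exist by convexity and continuity
  alone. The fans start at age 1, which makes the initial datum bounded. The nodes converge to 0,
  which keeps the support compact; packets near 0 are short and carry small values at all times, so
  truncations to finitely many nodes converge uniformly and nothing is ever glued at the
  accumulation point. One datum serves all t and s because neither enters the choice of the nodes.
  Equality of solutions holds only almost everywhere, so jumps are read off at points near a shock
  taken from a set of full measure.\<close>

fun diffn :: "nat \<Rightarrow> (real \<Rightarrow> real) \<Rightarrow> bool" where
  "diffn 0 a \<longleftrightarrow> continuous_on UNIV a"
| "diffn (Suc k) a \<longleftrightarrow> (\<exists>a'. (\<forall>x. (a has_real_derivative a' x) (at x)) \<and> diffn k a')"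

lemma diffn_cont: "diffn k a \<Longrightarrow> continuous_on UNIV a"
  by (cases k) (auto intro: DERIV_continuous_on)

lemma diffn_Suc_D: "diffn (Suc k) a \<Longrightarrow> diffn k a"
proof (induction k arbitrary: a)
  case 0
  then show ?case using diffn_cont by fastforce
qed auto

lemma diffn_add: "diffn k a \<Longrightarrow> diffn k b \<Longrightarrow> diffn k (\<lambda>x. a x + b x)"
proof (induction k arbitrary: a b)
  case (Suc k)
  then obtain a' b' where "\<And>x. (a has_real_derivative a' x) (at x)" "\<And>x. (b has_real_derivative b' x) (at x)"
    "diffn k a'" "diffn k b'" by auto
  with Suc.IH[of a' b'] show ?case
    by (auto intro!: exI[of _ "\<lambda>x. a' x + b' x"] DERIV_add)
qed (auto intro: continuous_intros)

lemma diffn_mult: "diffn k a \<Longrightarrow> diffn k b \<Longrightarrow> diffn k (\<lambda>x. a x * b x)"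
proof (induction k arbitrary: a b)
  case (Suc k)
  then obtain a' b' where d: "\<And>x. (a has_real_derivative a' x) (at x)" "\<And>x. (b has_real_derivative b' x) (at x)"
    and k: "diffn k a'" "diffn k b'" by auto
  have "diffn k a" "diffn k b" using Suc.prems diffn_Suc_D by blast+
  then have "diffn k (\<lambda>x. a' x * b x + b' x * a x)"
    by (intro diffn_add Suc.IH k)
  with d show ?case by (auto intro!: exI[of _ "\<lambda>x. a' x * b x + b' x * a x"] DERIV_mult)
qed (auto intro: continuous_intros)

lemma diffn_const: "diffn k (\<lambda>x. c)"
  by (induction k arbitrary: c) (auto intro: DERIV_const)

lemma diffn_affine: "diffn k a \<Longrightarrow> diffn k (\<lambda>x. a (c * x + d))"
proof (induction k arbitrary: a)
  case 0
  then show ?case using continuous_on_compose2[of UNIV a UNIV "\<lambda>x. c * x + d"]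
    by (simp add: continuous_on_add continuous_on_mult)
next
  case (Suc k)
  then obtain a' where d: "\<And>x. (a has_real_derivative a' x) (at x)" and k: "diffn k a'" by auto
  have "((\<lambda>x. a (c * x + d)) has_real_derivative a' (c * x + d) * c) (at x)" for x
  proof (rule DERIV_chain2[where f=a, OF d])
    show "((\<lambda>x. c * x + d) has_real_derivative c) (at x)"
      by (auto intro!: derivative_eq_intros)
  qed
  moreover have "diffn k (\<lambda>x. a' (c * x + d) * c)"
    by (rule diffn_mult[OF Suc.IH[OF k] diffn_const])
  ultimately show ?case by (auto intro!: exI[of _ "\<lambda>x. a' (c * x + d) * c"])
qed

section \<open>Flat exponentials and a smooth bump\<close>

definition expflat :: "real poly \<Rightarrow> real \<Rightarrow> real" where
  "expflat p x = (if x > 0 then poly p (1 / x) * exp (- (1 / x)) else 0)"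

lemma poly_exp_tendsto_0: "((\<lambda>y::real. poly p y * exp (- y)) \<longlongrightarrow> 0) at_top"
proof (induction p)
  case 0
  show ?case by simp
next
  case (pCons a p)
  have "((\<lambda>y::real. y ^ n * exp (- y)) \<longlongrightarrow> 0) at_top" for n
    using tendsto_power_div_exp_0[of n] by (simp add: exp_minus divide_inverse)
  then have "((\<lambda>y::real. poly q y * exp (- y)) \<longlongrightarrow> 0) at_top" for q :: "real poly"
    unfolding poly_altdef sum_distrib_right mult.assoc
    using tendsto_null_sum[where f = "\<lambda>y n. coeff q n * (y ^ n * exp (- y))"] tendsto_mult_right_zero by blast
  then show ?case .
qed

text \<open>Differentiating p(1/x) exp(-1/x) gives x^(-2) (p - p')(1/x) exp(-1/x), again a member of
  the family; this closure is what makes \<open>diffn_expflat\<close> an immediate induction over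
  arbitrary p.\<close>

lemma expflat_deriv:
  "(expflat p has_real_derivative expflat ([:0,0,1:] * (p - pderiv p)) x) (at x)"
proof -
  let ?q = "[:0,0,1:] * (p - pderiv p)"
  consider "x > 0" | "x < 0" | "x = 0" by linarith
  then show ?thesis
  proof cases
    case 1
    have "((\<lambda>x. poly p (1 / x) * exp (- (1 / x))) has_real_derivative expflat ?q x) (at x)"
    proof -
      have i: "((\<lambda>x. 1 / x) has_real_derivative - ((1 / x) ^ 2)) (at x)"
        using 1 DERIV_inverse[of x] by (simp add: inverse_eq_divide power_divide numeral_2_eq_2)
      have "((\<lambda>x. poly p (1 / x) * exp (- (1 / x))) has_real_derivative
          poly (pderiv p) (1 / x) * - ((1 / x) ^ 2) * exp (- (1 / x)) + exp (- (1 / x)) * - (- ((1 / x) ^ 2)) * poly p (1 / x)) (at x)"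
        by (intro DERIV_mult DERIV_chain2[OF poly_DERIV i] DERIV_chain2[OF DERIV_exp] DERIV_minus i)
      then show ?thesis
        using 1 by (simp add: expflat_def algebra_simps power2_eq_square)
    qed
    moreover have "\<forall>\<^sub>F y in nhds x. y \<in> {0<..}" using 1 by (intro eventually_nhds_in_open) auto
    then have "\<forall>\<^sub>F y in nhds x. expflat p y = poly p (1 / y) * exp (- (1 / y))"
      by eventually_elim (auto simp: expflat_def)
    ultimately show ?thesis by (subst DERIV_cong_ev) auto
  next
    case 2
    have "\<forall>\<^sub>F y in nhds x. y \<in> {..<0}" using 2 by (intro eventually_nhds_in_open) auto
    then have "\<forall>\<^sub>F y in nhds x. expflat p y = 0"
      by eventually_elim (auto simp: expflat_def)
    then have "(expflat p has_real_derivative 0) (at x) \<longleftrightarrow> ((\<lambda>_. 0::real) has_real_derivative 0) (at x)"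
      by (subst DERIV_cong_ev[of x x _ "\<lambda>_. 0"]) auto
    then show ?thesis using 2 by (simp add: expflat_def)
  next
    case 3
    \<comment> \<open>With y = 1/h the difference quotient at 0 from the right is y p(y) exp(-y),
      whence the extra factor \<open>[:0,1:]\<close>.\<close>
    have "((\<lambda>y. poly ([:0,1:] * p) y * exp (- y)) \<longlongrightarrow> 0) at_top" by (rule poly_exp_tendsto_0)
    then have "((\<lambda>h. poly ([:0,1:] * p) (1 / h) * exp (- (1 / h))) \<longlongrightarrow> 0) (at_right 0)"
      by (rule filterlim_compose) (use filterlim_inverse_at_top_right in \<open>simp add: inverse_eq_divide\<close>)
    then have "((\<lambda>h. (expflat p (x + h) - expflat p x) / h) \<longlongrightarrow> 0) (at_right 0)"
      by (rule Lim_transform_eventually)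
        (auto simp: eventually_at_right_field expflat_def 3 intro!: exI[of _ 1])
    moreover have "((\<lambda>h. (expflat p (x + h) - expflat p x) / h) \<longlongrightarrow> 0) (at_left 0)"
      by (rule Lim_transform_eventually[OF tendsto_const])
        (auto simp: eventually_at_left_field expflat_def 3 intro!: exI[of _ "-1"])
    ultimately have "((\<lambda>h. (expflat p (x + h) - expflat p x) / h) \<longlongrightarrow> 0) (at 0)"
      by (rule filterlim_split_at_real[rotated])
    then show ?thesis unfolding DERIV_def by (simp add: 3 expflat_def)
  qed
qed

lemma diffn_expflat: "diffn k (expflat p)"
proof (induction k arbitrary: p)
  case 0
  show ?case using DERIV_continuous_on[OF has_field_derivative_at_within[OF expflat_deriv]] by simp
next
  case (Suc k)
  show ?case unfolding diffn.simps
    by (intro exI[of _ "expflat ([:0,0,1:] * (p - pderiv p))"] conjI allI expflat_deriv Suc.IH)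
qed

text \<open>Writing 1 * x and (-1) * x gives both factors the shape that \<open>diffn_affine\<close>
  expects.\<close>

definition bump :: "real \<Rightarrow> real" where
  "bump x = expflat 1 (1 * x + 1) * expflat 1 ((-1) * x + 1)"

lemma diffn_bump: "diffn k bump"
  unfolding bump_def[abs_def] by (intro diffn_mult diffn_affine diffn_expflat)

lemma bump_nonneg: "0 \<le> bump x"
  by (simp add: bump_def expflat_def)

lemma bump_0: "0 < bump 0"
  by (simp add: bump_def expflat_def)

lemma bump_outside: "\<bar>x\<bar> \<ge> 1 \<Longrightarrow> bump x = 0"
  by (auto simp: bump_def expflat_def)

text \<open>A C^1 test function together with its partial derivatives as explicit arguments, so that
  integrands can name them. The cutoffs and cones used later are only C^1, hence the notion is
  weaker than \<open>test_function\<close>. Vanishing off K is demanded of the partials as well,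
  which spares arguments at the boundary of K.\<close>

definition C1test where
  "C1test K \<psi> \<psi>x \<psi>t \<longleftrightarrow> continuous_on UNIV \<psi> \<and> continuous_on UNIV \<psi>x \<and> continuous_on UNIV \<psi>t \<and>
     (\<forall>x t. ((\<lambda>y. \<psi> (y, t)) has_real_derivative \<psi>x (x, t)) (at x)) \<and>
     (\<forall>x t. ((\<lambda>s. \<psi> (x, s)) has_real_derivative \<psi>t (x, t)) (at t)) \<and>
     (\<forall>p::real\<times>real. 0 \<le> \<psi> p) \<and> (\<forall>p. p \<notin> K \<longrightarrow> \<psi> p = (0::real) \<and> \<psi>x p = 0 \<and> \<psi>t p = 0)"

lemma has_derivative_of_partials:
  fixes \<psi> :: "real \<times> real \<Rightarrow> real"
  assumes x: "\<And>x t. ((\<lambda>y. \<psi> (y, t)) has_real_derivative \<psi>x (x, t)) (at x)"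
    and t: "\<And>x t. ((\<lambda>s. \<psi> (x, s)) has_real_derivative \<psi>t (x, t)) (at t)"
    and c: "continuous_on UNIV \<psi>t"
  shows "(\<psi> has_derivative (\<lambda>h. \<psi>x p * fst h + \<psi>t p * snd h)) (at p)"
proof -
  obtain x0 t0 where p: "p = (x0, t0)" by (cases p)
  have "((\<lambda>(x, t). \<psi> (x, t)) has_derivative
      (\<lambda>(tx, ty). \<psi>x (x0, t0) * tx + blinfun_mult_right (\<psi>t (x0, t0)) ty)) (at (x0, t0) within UNIV \<times> UNIV)"
  proof (rule has_derivative_partialsI[where fy = "\<lambda>x y. blinfun_mult_right (\<psi>t (x, y))"])
    show "((\<lambda>y. \<psi> (y, t0)) has_derivative (*) (\<psi>x (x0, t0))) (at x0)"
      using x by (simp add: has_field_derivative_def)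
    show "((\<lambda>y. \<psi> (x, y)) has_derivative blinfun_mult_right (\<psi>t (x, y))) (at y)" for x y
      using t by (simp add: has_field_derivative_def)
    have "continuous_on UNIV (\<lambda>p. blinfun_mult_right (\<psi>t p))"
      using c by (intro continuous_intros)
    then show "continuous (at (x0, t0) within UNIV \<times> UNIV) (\<lambda>(x, y). blinfun_mult_right (\<psi>t (x, y)))"
      by (simp add: continuous_on_eq_continuous_at split_beta')
  qed auto
  then show ?thesis by (simp add: p split_beta')
qed

lemma Ck_SucI:
  fixes \<psi> :: "real \<times> real \<Rightarrow> real"
  assumes d: "\<And>p. (\<psi> has_derivative (\<lambda>h. \<psi>x p * fst h + \<psi>t p * snd h)) (at p)"
    and "Ck k \<psi>x" "Ck k \<psi>t"
  shows "Ck (Suc k) \<psi>"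
proof -
  have "frechet_derivative \<psi> (at p) = (\<lambda>h. \<psi>x p * fst h + \<psi>t p * snd h)" for p
    using frechet_derivative_at[OF d[of p]] by simp
  moreover have "\<psi> differentiable_on UNIV"
    using d by (auto simp: differentiable_on_def differentiable_def)
  ultimately show ?thesis
    using assms(2,3) by (auto simp: Basis_prod_def)
qed

text \<open>The kernel is a product because each partial derivative then hits one factor and leaves
  a convolution of the same form; smoothness becomes an induction with a and b arbitrary.\<close>

definition conv2 where
  "conv2 K g a b p = integral K (\<lambda>q. g q * (a (fst p - fst q) * b (snd p - snd q)))"
  for g :: "real \<times> real \<Rightarrow> real"

lemma continuous_on_conv2:
  assumes "continuous_on UNIV g" "continuous_on UNIV a" "continuous_on UNIV b"
  shows "continuous_on UNIV (conv2 (cbox l h) g a b)"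
  unfolding conv2_def[abs_def]
  by (rule integral_continuous_on_param)
    (unfold split_beta, intro continuous_intros continuous_on_compose2[OF assms(1)] continuous_on_compose2[OF assms(2)] continuous_on_compose2[OF assms(3)], auto)

lemma conv2_deriv_x:
  assumes g: "continuous_on UNIV g" and a': "continuous_on UNIV a'" and b: "continuous_on UNIV b"
    and d: "\<And>x. (a has_real_derivative a' x) (at x)"
  shows "((\<lambda>y. conv2 (cbox l h) g a b (y, t)) has_real_derivative conv2 (cbox l h) g a' b (x, t)) (at x)"
  unfolding conv2_def fst_conv snd_conv
proof (rule leibniz_rule_field_derivative[where U=UNIV and fx = "\<lambda>y q. g q * (a' (y - fst q) * b (t - snd q))"])
  have a: "continuous_on UNIV a" using d by (intro DERIV_continuous_on) auto
  show "((\<lambda>y. g q * (a (y - fst q) * b (t - snd q))) has_real_derivative g q * (a' (y - fst q) * b (t - snd q))) (at y)" for y q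
    using DERIV_cmult[OF DERIV_cmult_right[OF DERIV_shift[THEN iffD1, of a "a' (y - fst q)" y "- fst q"]], of "b (t - snd q)" "g q"] d
    by (simp add: mult_ac)
  show "(\<lambda>q. g q * (a (y - fst q) * b (t - snd q))) integrable_on cbox l h" for y
    by (intro integrable_continuous continuous_intros continuous_on_compose2[OF a] continuous_on_compose2[OF b] continuous_on_subset[OF g]) auto
  show "continuous_on (UNIV \<times> cbox l h) (\<lambda>(y, q). g q * (a' (y - fst q) * b (t - snd q)))"
    unfolding split_beta
    by (intro continuous_intros continuous_on_compose2[OF a'] continuous_on_compose2[OF b] continuous_on_compose2[OF g]) auto
qed auto

lemma conv2_deriv_t:
  assumes g: "continuous_on UNIV g" and a: "continuous_on UNIV a" and b': "continuous_on UNIV b'"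
    and d: "\<And>x. (b has_real_derivative b' x) (at x)"
  shows "((\<lambda>s. conv2 (cbox l h) g a b (x, s)) has_real_derivative conv2 (cbox l h) g a b' (x, t)) (at t)"
  unfolding conv2_def fst_conv snd_conv
proof (rule leibniz_rule_field_derivative[where U=UNIV and fx = "\<lambda>s q. g q * (a (x - fst q) * b' (s - snd q))"])
  have b: "continuous_on UNIV b" using d by (intro DERIV_continuous_on) auto
  show "((\<lambda>s. g q * (a (x - fst q) * b (s - snd q))) has_real_derivative g q * (a (x - fst q) * b' (s - snd q))) (at s)" for s q
    using DERIV_cmult[OF DERIV_cmult[OF DERIV_shift[THEN iffD1, of b "b' (s - snd q)" s "- snd q"]], of "g q" "a (x - fst q)"] d
    by (simp add: mult_ac)
  show "(\<lambda>q. g q * (a (x - fst q) * b (s - snd q))) integrable_on cbox l h" for s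
    by (intro integrable_continuous continuous_intros continuous_on_compose2[OF a] continuous_on_compose2[OF b] continuous_on_subset[OF g]) auto
  show "continuous_on (UNIV \<times> cbox l h) (\<lambda>(s, q). g q * (a (x - fst q) * b' (s - snd q)))"
    unfolding split_beta
    by (intro continuous_intros continuous_on_compose2[OF a] continuous_on_compose2[OF b'] continuous_on_compose2[OF g]) auto
qed auto

lemma Ck_conv2:
  assumes g: "continuous_on UNIV g"
  shows "diffn k a \<Longrightarrow> diffn k b \<Longrightarrow> Ck k (conv2 (cbox l h) g a b)"
proof (induction k arbitrary: a b)
  case 0
  then show ?case using continuous_on_conv2[OF g] by auto
next
  case (Suc k)
  then obtain a' b' where d: "\<And>x. (a has_real_derivative a' x) (at x)" "\<And>x. (b has_real_derivative b' x) (at x)"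
    and k: "diffn k a'" "diffn k b'" by auto
  have k2: "diffn k a" "diffn k b" using Suc.prems diffn_Suc_D by blast+
  note cont = diffn_cont[OF k(1)] diffn_cont[OF k(2)] diffn_cont[OF k2(1)] diffn_cont[OF k2(2)]
  show ?case
  proof (rule Ck_SucI)
    show "(conv2 (cbox l h) g a b has_derivative (\<lambda>v. conv2 (cbox l h) g a' b p * fst v + conv2 (cbox l h) g a b' p * snd v)) (at p)" for p
      by (rule has_derivative_of_partials)
       (intro conv2_deriv_x conv2_deriv_t continuous_on_conv2 g cont d)+
  qed (intro Suc.IH k k2)+
qed

section \<open>Integrals of functions with bounded support\<close>

lemma lborel_integral_reflect:
  fixes g :: "'a::euclidean_space \<Rightarrow> real"
  assumes [measurable]: "g \<in> borel_measurable borel"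
  shows "(\<integral>q. g (p - q) \<partial>lborel) = (\<integral>q. g q \<partial>lborel)"
proof -
  have "lborel = density (distr lborel borel (\<lambda>x. p - x)) (\<lambda>_. 1)"
    using lborel_affine[of "-1" p] by simp
  then have "lborel = distr lborel borel (\<lambda>x. p - x)"
    by (simp add: density_1)
  then have "(\<integral>q. g q \<partial>lborel) = (\<integral>q. g q \<partial>(distr lborel borel (\<lambda>x. p - x)))"
    by simp
  also have "\<dots> = (\<integral>q. g (p - q) \<partial>lborel)"
    by (subst integral_distr) auto
  finally show ?thesis by simp
qed

lemma uniformly_continuous_compact_support:
  fixes g :: "'a::euclidean_space \<Rightarrow> real"
  assumes g: "continuous_on UNIV g" and z: "\<And>p. p \<notin> K \<Longrightarrow> g p = 0" and K: "bounded K" and "e > 0"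
  obtains d where "d > 0" "\<And>p q. dist p q < d \<Longrightarrow> \<bar>g p - g q\<bar> < e"
proof -
  obtain B where B: "K \<subseteq> cball 0 B" using bounded_any_center[of K 0] K by (auto simp: subset_iff)
  have "uniformly_continuous_on (cball 0 (B + 1)) g"
    by (rule compact_uniformly_continuous) (auto intro: continuous_on_subset[OF g])
  then obtain d where d: "d > 0" "\<And>p q. p \<in> cball 0 (B+1) \<Longrightarrow> q \<in> cball 0 (B+1) \<Longrightarrow> dist q p < d \<Longrightarrow> dist (g q) (g p) < e"
    unfolding uniformly_continuous_on_def using \<open>e > 0\<close> by metis
  have "\<bar>g p - g q\<bar> < e" if pq: "dist p q < min d 1" for p q
  proof (cases "p \<in> K \<or> q \<in> K")
    case True
    have "norm p \<le> norm q + dist p q" "norm q \<le> norm p + dist p q"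
      using norm_triangle_ineq2[of p q] norm_triangle_ineq2[of q p] by (auto simp: dist_norm norm_minus_commute)
    moreover have "norm p \<le> B \<or> norm q \<le> B" using True B by (metis mem_cball_0 subsetD)
    ultimately have "p \<in> cball 0 (B+1)" "q \<in> cball 0 (B+1)"
      using pq by auto
    then show ?thesis using d(2)[of q p] pq by (simp add: dist_real_def)
  qed (simp add: z \<open>e > 0\<close>)
  then show thesis using that[of "min d 1"] \<open>d > 0\<close> by simp
qed

lemma integrable_bounded_support:
  fixes g :: "'a::euclidean_space \<Rightarrow> real"
  assumes "g \<in> borel_measurable borel" and z: "\<And>p. p \<notin> K \<Longrightarrow> g p = 0" and K: "bounded K"
    and B: "\<And>p. p \<in> K \<Longrightarrow> \<bar>g p\<bar> \<le> B"
  shows "integrable lborel g"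
proof -
  obtain a where a: "K \<subseteq> cbox (-a) a" using bounded_subset_cbox_symmetric[OF K] by metis
  show ?thesis
  proof (rule Bochner_Integration.integrable_bound)
    show "integrable lborel (\<lambda>p. indicator (cbox (-a) a) p * \<bar>B\<bar>)"
      by (intro integrable_mult_indicator[where 'b=real, simplified] integrable_mult_left) (auto simp: emeasure_lborel_cbox_eq)
    have "\<bar>g p\<bar> \<le> indicator (cbox (-a) a) p * \<bar>B\<bar>" for p
    proof (cases "p \<in> K")
      case True
      then show ?thesis using a B[of p] by (auto simp: indicator_def)
    qed (simp add: z)
    then show "AE p in lborel. norm (g p) \<le> norm (indicator (cbox (-a) a) p * \<bar>B\<bar>)"
      by (auto simp: abs_mult)
  qed (use assms in auto)
qed

lemma integrable_continuous_support:
  fixes g :: "'a::euclidean_space \<Rightarrow> real"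
  assumes g: "continuous_on UNIV g" and z: "\<And>p. p \<notin> K \<Longrightarrow> g p = 0" and K: "bounded K"
  shows "integrable lborel g"
proof -
  have "compact (closure K)" using K by simp
  then have "bounded (g ` closure K)"
    using g continuous_on_subset by (blast intro: compact_imp_bounded compact_continuous_image)
  then obtain B where "\<And>p. p \<in> closure K \<Longrightarrow> \<bar>g p\<bar> \<le> B"
    unfolding bounded_iff by auto
  then show ?thesis
    using closure_subset[of K]
    by (intro integrable_bounded_support[OF _ z K, where B=B]) (auto intro: borel_measurable_continuous_onI g)
qed

lemma integral_lborel_support:
  fixes g :: "'a::euclidean_space \<Rightarrow> real"
  assumes g: "continuous_on UNIV g" and z: "\<And>p. p \<notin> cbox a b \<Longrightarrow> g p = 0"
  shows "integral (cbox a b) g = (\<integral>p. g p \<partial>lborel)"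
proof -
  have "integral (cbox a b) g = integral UNIV g"
  proof -
    have "(\<lambda>x. if x \<in> cbox a b then g x else 0) = g" using z by auto
    then show ?thesis using integral_restrict_UNIV[of "cbox a b" g] by simp
  qed
  also have "\<dots> = (\<integral>p. g p \<partial>lborel)"
    by (rule integral_lborel) (rule integrable_continuous_support[OF g z], auto)
  finally show ?thesis .
qed

text \<open>The mollification is read in two ways. With the kernel carrying the variable it is a
  \<open>conv2\<close>, hence smooth; with \<psi> carrying it, its partials are the mollifications
  of \<open>\<psi>x\<close> and \<open>\<psi>t\<close>, hence uniformly close to them. The bound e <
  \<tau> keeps the enlarged support at positive times.\<close>

lemma C1test_approx:
  assumes \<psi>: "C1test (cbox (-R, \<tau>) (R, T)) \<psi> \<psi>x \<psi>t" and e: "0 < e" "e < \<tau>"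
  obtains \<phi> \<phi>x \<phi>t where "test_function \<phi>" "C1test (cbox (-R-e, \<tau>-e) (R+e, T+e)) \<phi> \<phi>x \<phi>t"
    "\<And>p. \<bar>\<phi> p - \<psi> p\<bar> \<le> e" "\<And>p. \<bar>\<phi>x p - \<psi>x p\<bar> \<le> e" "\<And>p. \<bar>\<phi>t p - \<psi>t p\<bar> \<le> e"
proof -
  let ?K = "cbox (-R, \<tau>) (R, T)"
  have c: "continuous_on UNIV \<psi>" "continuous_on UNIV \<psi>x" "continuous_on UNIV \<psi>t"
    and dx: "\<And>x t. ((\<lambda>y. \<psi> (y, t)) has_real_derivative \<psi>x (x, t)) (at x)"
    and dt: "\<And>x t. ((\<lambda>s. \<psi> (x, s)) has_real_derivative \<psi>t (x, t)) (at t)"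
    and nn: "\<And>p. 0 \<le> \<psi> p" and z: "\<And>p. p \<notin> ?K \<Longrightarrow> \<psi> p = 0" "\<And>p. p \<notin> ?K \<Longrightarrow> \<psi>x p = 0" "\<And>p. p \<notin> ?K \<Longrightarrow> \<psi>t p = 0"
    using \<psi> unfolding C1test_def by blast+
  obtain d1 where d1: "d1 > 0" "\<And>p q. dist p q < d1 \<Longrightarrow> \<bar>\<psi> p - \<psi> q\<bar> < e"
    using uniformly_continuous_compact_support[OF c(1) z(1) bounded_cbox e(1)] by blast
  obtain d2 where d2: "d2 > 0" "\<And>p q. dist p q < d2 \<Longrightarrow> \<bar>\<psi>x p - \<psi>x q\<bar> < e"
    using uniformly_continuous_compact_support[OF c(2) z(2) bounded_cbox e(1)] by blast
  obtain d3 where d3: "d3 > 0" "\<And>p q. dist p q < d3 \<Longrightarrow> \<bar>\<psi>t p - \<psi>t q\<bar> < e"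
    using uniformly_continuous_compact_support[OF c(3) z(3) bounded_cbox e(1)] by blast
  \<comment> \<open>A point of the square of half-width r has norm at most 2 r, which must stay
    below all three moduli of continuity; r \<le> e limits the growth of the support.\<close>
  define r where "r = min e (min d1 (min d2 d3)) / 3"
  have r: "r > 0" "r \<le> e" "2 * r < d1" "2 * r < d2" "2 * r < d3" using e d1 d2 d3 by (auto simp: r_def min_def)
  let ?Q = "cbox (-r, -r) (r, r)"
  define k0 where "k0 q = bump (fst q / r) * bump (snd q / r)" for q :: "real \<times> real"
  have bump_c: "continuous_on S (\<lambda>x. bump (f x))" if "continuous_on S f" for S :: "'a::topological_space set" and f
    by (rule continuous_on_compose2[OF diffn_cont[OF diffn_bump] that]) auto
  have k0c: "continuous_on UNIV k0" unfolding k0_def[abs_def] by (intro continuous_intros bump_c) (use r in auto)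
  have k0z: "k0 q = 0" if "q \<notin> ?Q" for q
  proof -
    have "\<bar>fst q / r\<bar> \<ge> 1 \<or> \<bar>snd q / r\<bar> \<ge> 1" using that r by (cases q) (auto simp: field_simps abs_le_iff)
    then show ?thesis by (auto simp: k0_def bump_outside)
  qed
  define m where "m = (\<integral>q. k0 q \<partial>lborel)"
  have k0i: "integrable lborel k0" by (rule integrable_continuous_support[OF k0c k0z]) auto
  have k0nn: "0 \<le> k0 q" for q by (simp add: k0_def bump_nonneg)
  have "m \<noteq> 0"
  proof
    assume "m = 0"
    then have "integral ?Q k0 = 0" using integral_lborel_support[OF k0c k0z] by (simp add: m_def)
    moreover have "box (-r, -r) (r, r) \<noteq> {}" using r by (auto simp: box_ne_empty Basis_prod_def)
    ultimately have "\<forall>q\<in>?Q. k0 q = 0"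
      using integral_cbox_eq_0_iff[of "(-r,-r)" "(r,r)" k0] k0nn continuous_on_subset[OF k0c]
      by auto
    then have "k0 (0, 0) = 0" using r by (auto simp: cbox_Pair_eq)
    then show False using bump_0 by (simp add: k0_def)
  qed
  then have m: "m > 0" using k0nn by (simp add: m_def order_less_le integral_nonneg_AE)
  define k where "k q = k0 q / m" for q
  have kc: "continuous_on UNIV k" unfolding k_def[abs_def] by (intro continuous_intros k0c) (use m in auto)
  have kz: "k q = 0" if "q \<notin> ?Q" for q using k0z[OF that] by (simp add: k_def)
  have knn: "0 \<le> k q" for q using k0nn m by (simp add: k_def)
  have k1: "(\<integral>q. k q \<partial>lborel) = 1" using m by (simp add: k_def m_def)
  have ki: "integrable lborel k" by (rule integrable_continuous_support[OF kc kz]) auto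
  define M where "M g p = (\<integral>q. g (p - q) * k q \<partial>lborel)" for g :: "real \<times> real \<Rightarrow> real" and p
  have gi: "integrable lborel (\<lambda>q. g (p - q) * k q)" if "continuous_on UNIV g" for g p
    by (rule integrable_continuous_support[where K = ?Q])
      (auto simp: kz intro!: continuous_intros kc continuous_on_compose2[OF that])
  have M_approx: "\<bar>M g p - g p\<bar> \<le> e"
    if g: "continuous_on UNIV g" and d: "\<And>p q. dist p q < d \<Longrightarrow> \<bar>g p - g q\<bar> < e" "2 * r < d" for g d p
  proof -
    have "M g p - g p = (\<integral>q. (g (p - q) - g p) * k q \<partial>lborel)"
      using gi[OF g, of p] ki k1 by (simp add: M_def left_diff_distrib)
    also have "\<bar>\<dots>\<bar> \<le> (\<integral>q. \<bar>(g (p - q) - g p) * k q\<bar> \<partial>lborel)" by (rule integral_abs_bound)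
    also have "\<dots> \<le> (\<integral>q. e * k q \<partial>lborel)"
    proof (rule integral_mono)
      show "integrable lborel (\<lambda>q. \<bar>(g (p - q) - g p) * k q\<bar>)"
        using gi[OF g, of p] ki by (auto simp: left_diff_distrib)
      show "integrable lborel (\<lambda>q. e * k q)" using ki by simp
      show "\<bar>(g (p - q) - g p) * k q\<bar> \<le> e * k q" for q
      proof (cases "q \<in> ?Q")
        case True
        then have "norm q \<le> 2 * r" using norm_Pair_le[of "fst q" "snd q"] by (cases q) (auto simp: cbox_Pair_eq)
        then have "dist (p - q) p < d" using d by (simp add: dist_norm)
        then have "\<bar>g (p - q) - g p\<bar> \<le> e" using d(1) less_imp_le by blast
        then show ?thesis using knn[of q] by (simp add: abs_mult mult_right_mono)
      qed (simp add: kz)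
    qed
    also have "\<dots> = e" using k1 by simp
    finally show ?thesis .
  qed
  have Mz: "M g p = 0" if "\<And>p. p \<notin> ?K \<Longrightarrow> g p = 0" and "p \<notin> cbox (-R-e, \<tau>-e) (R+e, T+e)" for g p
  proof -
    have "g (p - q) * k q = 0" for q
    proof (cases "q \<in> ?Q")
      case True
      then have "p - q \<notin> ?K" using that(2) r(1,2) by (cases p; cases q) (auto simp: cbox_Pair_eq)
      then show ?thesis using that(1) by simp
    qed (simp add: kz)
    then have "(\<lambda>q. g (p - q) * k q) = (\<lambda>q. 0)" by (rule ext)
    then show ?thesis by (simp add: M_def)
  qed
  \<comment> \<open>The normalising factor 1 / m goes entirely into b, so that the kernel is exactly
    \<open>a (fst q) * b (snd q)\<close>.\<close>
  define a b where "a = (\<lambda>x. bump (x / r))" and "b = (\<lambda>x. bump (x / r) * (1 / m))"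
  have dn: "diffn n a" "diffn n b" for n
  proof -
    have "diffn n (\<lambda>x. bump (x / r))"
      using diffn_affine[OF diffn_bump, of n "1 / r" 0] by simp
    from this diffn_mult[OF this diffn_const[of n "1 / m"]]
    show "diffn n a" "diffn n b" unfolding a_def b_def by this
  qed
  have kab: "k q = a (fst q) * b (snd q)" for q by (simp add: k_def k0_def a_def b_def)
  have Mconv: "M \<psi> p = conv2 ?K \<psi> a b p" for p
  proof -
    have "continuous_on UNIV (\<lambda>q. \<psi> q * k (p - q))"
      by (intro continuous_intros c continuous_on_compose2[OF kc]) auto
    then have "conv2 ?K \<psi> a b p = (\<integral>q. \<psi> q * k (p - q) \<partial>lborel)"
      using integral_lborel_support[of "\<lambda>q. \<psi> q * k (p - q)" "(-R, \<tau>)" "(R, T)"] z(1)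
      by (simp add: conv2_def kab)
    also have "\<dots> = (\<integral>q. \<psi> (p - q) * k (p - (p - q)) \<partial>lborel)"
      by (rule lborel_integral_reflect[symmetric, of "\<lambda>q. \<psi> q * k (p - q)"])
        (intro borel_measurable_continuous_onI continuous_intros c continuous_on_compose2[OF kc], auto)
    finally show ?thesis by (simp add: M_def)
  qed
  have MQ: "M g p = integral ?Q (\<lambda>q. g (p - q) * k q)" if g: "continuous_on UNIV g" for g p
    unfolding M_def
    by (rule integral_lborel_support[symmetric]) (auto simp: kz intro!: continuous_intros kc continuous_on_compose2[OF g])
  have Mx: "((\<lambda>y. M \<psi> (y, t)) has_real_derivative M \<psi>x (x, t)) (at x)" for x t
    unfolding MQ[OF c(1)] MQ[OF c(2)]
  proof (rule leibniz_rule_field_derivative[where U=UNIV and fx = "\<lambda>y q. \<psi>x ((y, t) - q) * k q"])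
    show "((\<lambda>y. \<psi> ((y, t) - q) * k q) has_real_derivative \<psi>x ((y, t) - q) * k q) (at y)" for y q
      using DERIV_cmult_right[OF DERIV_shift[THEN iffD1, of "\<lambda>y. \<psi> (y, t - snd q)" _ y "- fst q"], OF dx, of "k q"]
      by (cases q) simp
    show "(\<lambda>q. \<psi> ((y, t) - q) * k q) integrable_on ?Q" for y
      by (intro integrable_continuous continuous_intros continuous_on_compose2[OF c(1)] continuous_on_subset[OF kc]) auto
    show "continuous_on (UNIV \<times> ?Q) (\<lambda>(y, q). \<psi>x ((y, t) - q) * k q)"
      unfolding split_beta
      by (intro continuous_intros continuous_on_compose2[OF c(2)] continuous_on_compose2[OF kc]) auto
  qed auto
  have Mt: "((\<lambda>s. M \<psi> (x, s)) has_real_derivative M \<psi>t (x, t)) (at t)" for x t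
    unfolding MQ[OF c(1)] MQ[OF c(3)]
  proof (rule leibniz_rule_field_derivative[where U=UNIV and fx = "\<lambda>s q. \<psi>t ((x, s) - q) * k q"])
    show "((\<lambda>s. \<psi> ((x, s) - q) * k q) has_real_derivative \<psi>t ((x, s) - q) * k q) (at s)" for s q
      using DERIV_cmult_right[OF DERIV_shift[THEN iffD1, of "\<lambda>s. \<psi> (x - fst q, s)" _ s "- snd q"], OF dt, of "k q"]
      by (cases q) simp
    show "(\<lambda>q. \<psi> ((x, s) - q) * k q) integrable_on ?Q" for s
      by (intro integrable_continuous continuous_intros continuous_on_compose2[OF c(1)] continuous_on_subset[OF kc]) auto
    show "continuous_on (UNIV \<times> ?Q) (\<lambda>(s, q). \<psi>t ((x, s) - q) * k q)"
      unfolding split_beta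
      by (intro continuous_intros continuous_on_compose2[OF c(3)] continuous_on_compose2[OF kc]) auto
  qed auto
  have Mc: "continuous_on UNIV (M g)" if g: "continuous_on UNIV g" for g
  proof -
    have "continuous_on UNIV (\<lambda>p. integral ?Q (\<lambda>q. g (p - q) * k q))"
      by (rule integral_continuous_on_param)
        (unfold split_beta, intro continuous_intros continuous_on_compose2[OF g] continuous_on_compose2[OF kc], auto)
    then show ?thesis unfolding MQ[OF g] by simp
  qed
  have Mnn: "0 \<le> M \<psi> p" for p unfolding M_def by (intro integral_nonneg_AE) (simp add: nn knn)
  show thesis
  proof
    show "C1test (cbox (-R-e, \<tau>-e) (R+e, T+e)) (M \<psi>) (M \<psi>x) (M \<psi>t)"
      unfolding C1test_def using Mx Mt Mc c Mnn Mz z by blast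
    have "Ck n (M \<psi>)" for n
    proof -
      have "M \<psi> = conv2 ?K \<psi> a b" using Mconv by (rule ext)
      then show ?thesis using Ck_conv2[OF c(1) dn(1) dn(2)] by simp
    qed
    moreover have cl: "closure {p. M \<psi> p \<noteq> 0} \<subseteq> cbox (-R-e, \<tau>-e) (R+e, T+e)"
    proof (rule closure_minimal[OF _ closed_cbox])
      show "{p. M \<psi> p \<noteq> 0} \<subseteq> cbox (-R-e, \<tau>-e) (R+e, T+e)" using Mz[of \<psi>] z(1) by blast
    qed
    moreover have "cbox (-R-e, \<tau>-e) (R+e, T+e) \<subseteq> UNIV \<times> {0<..}" using e by (auto simp: cbox_Pair_eq)
    moreover have "compact (closure {p. M \<psi> p \<noteq> 0})"
      using cl by (metis bounded_cbox bounded_subset closed_closure compact_eq_bounded_closed)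
    ultimately show "test_function (M \<psi>)"
      unfolding test_function_def using Mnn by blast
  qed (use M_approx[OF c(1) d1(2)] M_approx[OF c(2) d2(2)] M_approx[OF c(3) d3(2)] r in auto)
qed

section \<open>Gluing Kruzhkov inequalities along a curve\<close>

text \<open>A piecewise quadratic C^1 transition from 0 to 1: 2 z^2 up to 1/2 and 1 - 2 (1 - z)^2
  after it. Its derivative is the tent of height 2 over [0, 1], the source of the factors 2 in the
  error bounds. Truncated squares reduce differentiation to the single formula
  \<open>DERIV_max0_sq\<close>.\<close>

definition chi :: "real \<Rightarrow> real" where
  "chi z = 2 * ((max 0 z)\<^sup>2 - 2 * (max 0 (z - 1/2))\<^sup>2 + (max 0 (z - 1))\<^sup>2)"

definition chi' :: "real \<Rightarrow> real" where
  "chi' z = 4 * (max 0 z - 2 * max 0 (z - 1/2) + max 0 (z - 1))"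

lemma DERIV_max0_sq: "((\<lambda>z::real. (max 0 (z - a))\<^sup>2) has_real_derivative 2 * max 0 (z - a)) (at z)"
proof -
  have 0: "((\<lambda>z::real. (max 0 z)\<^sup>2) has_real_derivative 2 * max 0 z) (at z)" for z :: real
  proof -
    consider "z > 0" | "z < 0" | "z = 0" by linarith
    then show ?thesis
    proof cases
      case 1
      have "\<forall>\<^sub>F y in nhds z. y \<in> {0<..}" using 1 by (intro eventually_nhds_in_open) auto
      then have "\<forall>\<^sub>F y in nhds z. (max 0 y)\<^sup>2 = y\<^sup>2" by eventually_elim (auto simp: max_def)
      moreover have "((\<lambda>z. z\<^sup>2) has_real_derivative 2 * z) (at z)"
        using DERIV_pow[of 2 z] by simp
      ultimately show ?thesis using 1 DERIV_cong_ev[of z z "\<lambda>z. (max 0 z)\<^sup>2" "\<lambda>z. z\<^sup>2"] by simp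
    next
      case 2
      have "\<forall>\<^sub>F y in nhds z. y \<in> {..<0}" using 2 by (intro eventually_nhds_in_open) auto
      then have "\<forall>\<^sub>F y in nhds z. (max 0 y)\<^sup>2 = 0" by eventually_elim (auto simp: max_def)
      then show ?thesis using 2 DERIV_cong_ev[of z z "\<lambda>z. (max 0 z)\<^sup>2" "\<lambda>z. 0"] by simp
    next
      case 3
      have "((\<lambda>h::real. \<bar>h\<bar>) \<longlongrightarrow> 0) (at 0)" using tendsto_rabs_zero[OF tendsto_ident_at] by simp
      then have "((\<lambda>h::real. (max 0 h)\<^sup>2 / h) \<longlongrightarrow> 0) (at 0)"
        by (rule Lim_null_comparison[rotated])
          (auto simp: eventually_at_filter max_def power2_eq_square intro!: always_eventually)
      then show ?thesis using 3 by (simp add: DERIV_def)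
    qed
  qed
  show ?thesis
    using DERIV_shift[THEN iffD1, of "\<lambda>z. (max 0 z)\<^sup>2" _ z "-a"] 0 by simp
qed

lemma DERIV_chi: "(chi has_real_derivative chi' z) (at z)"
proof -
  have "((\<lambda>z. 2 * ((max 0 (z - 0))\<^sup>2 - 2 * (max 0 (z - 1/2))\<^sup>2 + (max 0 (z - 1))\<^sup>2)) has_real_derivative
      2 * (2 * max 0 (z - 0) - 2 * (2 * max 0 (z - 1/2)) + 2 * max 0 (z - 1))) (at z)"
    by (intro DERIV_cmult DERIV_add DERIV_diff DERIV_max0_sq)
  then show ?thesis by (simp add: chi_def[abs_def] chi'_def algebra_simps)
qed

lemma continuous_on_chi: "continuous_on UNIV chi" "continuous_on UNIV chi'"
  unfolding chi_def[abs_def] chi'_def[abs_def] by (intro continuous_intros)+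

lemma chi_le0: "z \<le> 0 \<Longrightarrow> chi z = 0"
  by (simp add: chi_def max_def)

lemma chi_ge1: "z \<ge> 1 \<Longrightarrow> chi z = 1"
  by (simp add: chi_def max_def power2_eq_square algebra_simps)

lemma chi'_nonneg: "0 \<le> chi' z"
  by (auto simp: chi'_def max_def)

lemma chi'_le: "chi' z \<le> 2"
  by (auto simp: chi'_def max_def)

lemma chi'_outside: "z \<le> 0 \<or> z \<ge> 1 \<Longrightarrow> chi' z = 0"
  by (auto simp: chi'_def max_def)

lemma chi_mono: "y \<le> z \<Longrightarrow> chi y \<le> chi z"
  by (rule DERIV_nonneg_imp_nondecreasing) (auto intro: DERIV_chi chi'_nonneg)

lemma chi_bounds: "0 \<le> chi z" "chi z \<le> 1"
proof -
  show "0 \<le> chi z" using chi_mono[of "min 0 z" z] chi_le0[of "min 0 z"] by simp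
  show "chi z \<le> 1" using chi_mono[of z "max 1 z"] chi_ge1[of "max 1 z"] by simp
qed

text \<open>The limit at y = 0 is 0 because the transition starts at 0 instead of being centred
  there; hence joins along a curve are stated with the strict condition
  \<open>P p > 0\<close>.\<close>

lemma chi_tendsto: "(\<lambda>n. chi (real n * y)) \<longlonglongrightarrow> (if y > 0 then 1 else 0)"
proof (cases "y > 0")
  case True
  obtain N where N: "real N * y > 1" using reals_Archimedean3[OF True] by blast
  have "\<forall>n\<ge>N. chi (real n * y) = 1"
  proof (intro allI impI chi_ge1)
    fix n assume "n \<ge> N"
    then have "real N * y \<le> real n * y" using True by simp
    then show "1 \<le> real n * y" using N by linarith
  qed
  then have "\<forall>\<^sub>F n in sequentially. chi (real n * y) = 1" unfolding eventually_sequentially by blast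
  then show ?thesis using True by (simp add: tendsto_eventually)
next
  case False
  then have "chi (real n * y) = 0" for n by (intro chi_le0) (simp add: mult_nonneg_nonpos)
  then show ?thesis using False by simp
qed

section \<open>Test functions multiplied by factors defined for positive time\<close>

lemma borel_measurable_fst_snd [measurable]:
  "fst \<in> borel_measurable (borel :: (real \<times> real) measure)"
  "snd \<in> borel_measurable (borel :: (real \<times> real) measure)"
  by (auto intro!: borel_measurable_continuous_onI continuous_intros)

lemma C1test_nonneg: "C1test K \<psi> \<psi>x \<psi>t \<Longrightarrow> 0 \<le> \<psi> p"
  unfolding C1test_def by blast

lemma C1test_outside:
  assumes "C1test K \<psi> \<psi>x \<psi>t" "p \<notin> K"
  shows "\<psi> p = 0" "\<psi>x p = 0" "\<psi>t p = 0"
  using assms unfolding C1test_def by blast+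

text \<open>The half-plane of positive times and the complement of K are open and cover the plane;
  on the first both factors are continuous, on the second the product is 0.\<close>

lemma continuous_on_mult_support:
  fixes f c :: "real \<times> real \<Rightarrow> real"
  assumes f: "continuous_on UNIV f" and c: "continuous_on (UNIV \<times> {0<..}) c"
    and z: "\<And>p. p \<notin> K \<Longrightarrow> f p = 0" and K: "closed K" "K \<subseteq> UNIV \<times> {0<..}"
  shows "continuous_on UNIV (\<lambda>p. f p * c p)"
proof -
  have "continuous_on (UNIV \<times> {0<..}) (\<lambda>p. f p * c p)"
    by (intro continuous_intros c continuous_on_subset[OF f]) auto
  moreover have "continuous_on (- K) (\<lambda>p. f p * c p)"
    by (rule continuous_on_eq[of _ "\<lambda>_. 0"]) (auto simp: z)
  ultimately have "continuous_on ((UNIV \<times> {0<..}) \<union> - K) (\<lambda>p. f p * c p)"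
    using K by (intro continuous_on_open_Un) (auto simp: open_Times)
  moreover have "(UNIV \<times> {0<..}) \<union> - K = UNIV" using K by blast
  ultimately show ?thesis by simp
qed

text \<open>Since \<psi> vanishes below \<tau>, regularity of c for positive times is what counts.
  The level functions of the shocks are of this kind: they come from E, whose time derivative is
  established for t > 0.\<close>

lemma C1test_mult:
  assumes \<psi>: "C1test K \<psi> \<psi>x \<psi>t" and K: "closed K" "K \<subseteq> UNIV \<times> {\<tau>..}" "0 < \<tau>"
    and c: "continuous_on (UNIV \<times> {0<..}) c" "continuous_on (UNIV \<times> {0<..}) cx" "continuous_on (UNIV \<times> {0<..}) ct"
    and cx: "\<And>x t. t > 0 \<Longrightarrow> ((\<lambda>y. c (y, t)) has_real_derivative cx (x, t)) (at x)"
    and ct: "\<And>x t. t > 0 \<Longrightarrow> ((\<lambda>s. c (x, s)) has_real_derivative ct (x, t)) (at t)"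
    and nn: "\<And>p. snd p > 0 \<Longrightarrow> 0 \<le> c p"
  shows "C1test K (\<lambda>p. \<psi> p * c p) (\<lambda>p. \<psi>x p * c p + \<psi> p * cx p) (\<lambda>p. \<psi>t p * c p + \<psi> p * ct p)"
proof -
  have pc: "continuous_on UNIV \<psi>" "continuous_on UNIV \<psi>x" "continuous_on UNIV \<psi>t"
    and dx: "\<And>x t. ((\<lambda>y. \<psi> (y, t)) has_real_derivative \<psi>x (x, t)) (at x)"
    and dt: "\<And>x t. ((\<lambda>s. \<psi> (x, s)) has_real_derivative \<psi>t (x, t)) (at t)"
    and pnn: "\<And>p. 0 \<le> \<psi> p" and z: "\<And>p. p \<notin> K \<Longrightarrow> \<psi> p = 0" "\<And>p. p \<notin> K \<Longrightarrow> \<psi>x p = 0" "\<And>p. p \<notin> K \<Longrightarrow> \<psi>t p = 0"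
    using \<psi> unfolding C1test_def by blast+
  have K0: "K \<subseteq> UNIV \<times> {0<..}" using K by (force simp: subset_iff)
  have out: "(x, t) \<notin> K" if "t < \<tau>" for x t using K that by (force simp: subset_iff)
  note ms = continuous_on_mult_support[OF _ _ _ K(1) K0]
  show ?thesis
    unfolding C1test_def
  proof (intro conjI allI impI)
    show "continuous_on UNIV (\<lambda>p. \<psi> p * c p)"
      by (rule ms[OF pc(1) c(1) z(1)])
    show "continuous_on UNIV (\<lambda>p. \<psi>x p * c p + \<psi> p * cx p)"
      by (intro continuous_on_add ms[OF pc(2) c(1) z(2)] ms[OF pc(1) c(2) z(1)])
    show "continuous_on UNIV (\<lambda>p. \<psi>t p * c p + \<psi> p * ct p)"
      by (intro continuous_on_add ms[OF pc(3) c(1) z(3)] ms[OF pc(1) c(3) z(1)])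
    show "((\<lambda>y. \<psi> (y, t) * c (y, t)) has_real_derivative \<psi>x (x, t) * c (x, t) + \<psi> (x, t) * cx (x, t)) (at x)" for x t
    proof (cases "t > 0")
      case True
      show ?thesis using DERIV_mult[OF dx cx[OF True], of t x] by (simp add: mult.commute)
    next
      case False
      then have "t < \<tau>" using K by simp
      then show ?thesis by (simp add: z out)
    qed
    show "((\<lambda>s. \<psi> (x, s) * c (x, s)) has_real_derivative \<psi>t (x, t) * c (x, t) + \<psi> (x, t) * ct (x, t)) (at t)" for x t
    proof (cases "t > 0")
      case True
      show ?thesis using DERIV_mult[OF dt ct[OF True], of x x] by (simp add: mult.commute)
    next
      case False
      then have t: "t < \<tau>" using K by simp
      then have "\<forall>\<^sub>F s in nhds t. s \<in> {..<\<tau>}" by (intro eventually_nhds_in_open) auto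
      then have "\<forall>\<^sub>F s in nhds t. \<psi> (x, s) * c (x, s) = 0" by eventually_elim (simp add: z out)
      then show ?thesis using DERIV_cong_ev[of t t "\<lambda>s. \<psi> (x, s) * c (x, s)" "\<lambda>_. 0" 0 0] t by (simp add: z out)
    qed
    show "0 \<le> \<psi> p * c p" for p
      using pnn nn K0 z by (cases "p \<in> K") (auto intro!: mult_nonneg_nonneg)
  qed (simp_all add: z)
qed

section \<open>Kruzhkov's inequality against a comparison function\<close>

locale kruzhkov =
  fixes F :: "real \<Rightarrow> real \<Rightarrow> real" and R \<tau> T :: real and w :: "real \<times> real \<Rightarrow> real"
  assumes tau: "0 < \<tau>" "\<tau> \<le> T"
    and F_cont: "continuous_on UNIV (\<lambda>q. F (fst q) (snd q))"
    and F_lip: "\<And>B. \<exists>L\<ge>0. \<forall>t\<in>{\<tau>..T}. \<forall>a\<in>{-B..B}. \<forall>b\<in>{-B..B}. \<bar>F t a - F t b\<bar> \<le> L * \<bar>a - b\<bar>"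
    and w_meas [measurable]: "w \<in> borel_measurable borel"
    and w_bdd: "\<exists>B. \<forall>p. \<bar>w p\<bar> \<le> B"
begin

definition K where "K = cbox (-R, \<tau>) (R, T)"

text \<open>Kruzhkov's entropy flux for the entropy |a - b|; it is symmetric in a and b and
  continuous across a = b.\<close>

definition Q where "Q t a b = sgn (a - b) * (F t a - F t b)"

definition I where "I U \<psi>x \<psi>t p = \<bar>w p - U p\<bar> * \<psi>t p + Q (snd p) (w p) (U p) * \<psi>x p"

text \<open>Boundedness is asked on K because the test functions live there; fans are unbounded on
  the plane.\<close>

definition adm where "adm U \<longleftrightarrow> U \<in> borel_measurable borel \<and> (\<exists>B. \<forall>p\<in>K. \<bar>U p\<bar> \<le> B)"
  for U :: "real \<times> real \<Rightarrow> real"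

text \<open>The entropy inequality between the fixed function \<open>w\<close> and a candidate solution \<open>U\<close>, up to the
error \<open>e\<close>. The normalisation \<open>\<psi> \<le> 1\<close> gives the error a meaning; approximating \<open>U\<close> then amounts to
letting \<open>e\<close> tend to 0. Nothing but \<open>KI 0\<close> for constants is ever assumed of \<open>w\<close>.\<close>

definition KI where "KI e U \<longleftrightarrow> (\<forall>\<psi> \<psi>x \<psi>t. C1test K \<psi> \<psi>x \<psi>t \<longrightarrow> (\<forall>p. \<psi> p \<le> 1) \<longrightarrow>
   -e \<le> (\<integral>p. I U \<psi>x \<psi>t p \<partial>lborel))"

lemma K_props: "closed K" "bounded K" "compact K" "K \<subseteq> UNIV \<times> {\<tau>..}"
  by (simp_all add: K_def compact_cbox bounded_cbox closed_cbox) (auto simp: cbox_Pair_eq)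

lemma K_mem: "p \<in> K \<Longrightarrow> snd p \<in> {\<tau>..T} \<and> snd p > 0"
  using tau by (cases p) (auto simp: K_def cbox_Pair_eq)

lemma F_measurable [measurable]:
  assumes [measurable]: "f \<in> borel_measurable M" "g \<in> borel_measurable M"
  shows "(\<lambda>x. F (f x) (g x)) \<in> borel_measurable M"
  using measurable_compose[OF borel_measurable_Pair[OF assms] borel_measurable_continuous_onI[OF F_cont]] by simp

lemma I_measurable [measurable]:
  assumes [measurable]: "U \<in> borel_measurable borel" "\<psi>x \<in> borel_measurable borel" "\<psi>t \<in> borel_measurable borel"
  shows "I U \<psi>x \<psi>t \<in> borel_measurable borel"
  unfolding I_def[abs_def] Q_def by measurable

lemma Q_bound:
  assumes "\<bar>F t a - F t b\<bar> \<le> L * \<bar>a - b\<bar>"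
  shows "\<bar>Q t a b\<bar> \<le> L * \<bar>a - b\<bar>"
  using assms by (auto simp: Q_def abs_mult sgn_real_def)

text \<open>If a and b lie on the same side of c, the two fluxes differ by the increment of F from a
  to b up to sign. If c separates them, the triangle inequality through c loses nothing because |c -
  a| + |c - b| = |a - b|.\<close>

lemma Q_diff_bound:
  assumes l: "\<And>a b. a \<in> {-B..B} \<Longrightarrow> b \<in> {-B..B} \<Longrightarrow> \<bar>F t a - F t b\<bar> \<le> L * \<bar>a - b\<bar>"
    and m: "c \<in> {-B..B}" "a \<in> {-B..B}" "b \<in> {-B..B}"
  shows "\<bar>Q t c a - Q t c b\<bar> \<le> L * \<bar>a - b\<bar>"
proof -
  note ab = l[OF m(2,3)] and ca = l[OF m(1,2)] and cb = l[OF m(1,3)]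
  consider "(c > a \<and> c > b) \<or> (c < a \<and> c < b)" | "a \<le> c \<and> c \<le> b" | "b \<le> c \<and> c \<le> a" by linarith
  then show ?thesis
  proof cases
    case 1
    then show ?thesis using ab by (auto simp: Q_def sgn_real_def)
  next
    case 2
    then have "L * \<bar>c - a\<bar> + L * \<bar>c - b\<bar> = L * \<bar>a - b\<bar>" by (simp add: algebra_simps)
    moreover have "\<bar>Q t c a\<bar> \<le> L * \<bar>c - a\<bar>" "\<bar>Q t c b\<bar> \<le> L * \<bar>c - b\<bar>" using ca cb Q_bound by blast+
    ultimately show ?thesis by linarith
  next
    case 3
    then have "L * \<bar>c - a\<bar> + L * \<bar>c - b\<bar> = L * \<bar>a - b\<bar>" by (simp add: algebra_simps)
    moreover have "\<bar>Q t c a\<bar> \<le> L * \<bar>c - a\<bar>" "\<bar>Q t c b\<bar> \<le> L * \<bar>c - b\<bar>" using ca cb Q_bound by blast+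
    ultimately show ?thesis by linarith
  qed
qed

lemma C1test_bdd:
  assumes "C1test K \<psi> \<psi>x \<psi>t"
  obtains M where "M \<ge> 0" "\<And>p. \<bar>\<psi> p\<bar> \<le> M" "\<And>p. \<bar>\<psi>x p\<bar> \<le> M" "\<And>p. \<bar>\<psi>t p\<bar> \<le> M"
proof -
  have b: "\<exists>M. \<forall>p. \<bar>g p\<bar> \<le> M" if g: "continuous_on UNIV g" "\<And>p. p \<notin> K \<Longrightarrow> g p = 0" for g :: "real \<times> real \<Rightarrow> real"
  proof -
    have "bounded (g ` K)"
      using K_props(3) by (intro compact_imp_bounded compact_continuous_image continuous_on_subset[OF g(1)]) auto
    then obtain M where "\<forall>x\<in>g ` K. norm x \<le> M" unfolding bounded_iff by blast
    then have "\<bar>g p\<bar> \<le> max M 0" for p using g(2)[of p] by (cases "p \<in> K") (auto simp: le_max_iff_disj)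
    then show ?thesis by blast
  qed
  obtain M1 M2 M3 where "\<forall>p. \<bar>\<psi> p\<bar> \<le> M1" "\<forall>p. \<bar>\<psi>x p\<bar> \<le> M2" "\<forall>p. \<bar>\<psi>t p\<bar> \<le> M3"
    using b[of \<psi>] b[of \<psi>x] b[of \<psi>t] assms unfolding C1test_def by blast
  note M = this
  show thesis
  proof (rule that[of "\<bar>M1\<bar> + \<bar>M2\<bar> + \<bar>M3\<bar>"])
    show "\<bar>\<psi> p\<bar> \<le> \<bar>M1\<bar> + \<bar>M2\<bar> + \<bar>M3\<bar>" "\<bar>\<psi>x p\<bar> \<le> \<bar>M1\<bar> + \<bar>M2\<bar> + \<bar>M3\<bar>" "\<bar>\<psi>t p\<bar> \<le> \<bar>M1\<bar> + \<bar>M2\<bar> + \<bar>M3\<bar>" for p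
      using spec[OF M(1), of p] spec[OF M(2), of p] spec[OF M(3), of p] by linarith+
  qed simp
qed

lemma C1test_meas:
  assumes "C1test K \<psi> \<psi>x \<psi>t"
  shows "\<psi> \<in> borel_measurable borel" "\<psi>x \<in> borel_measurable borel" "\<psi>t \<in> borel_measurable borel"
  using assms unfolding C1test_def by (auto intro: borel_measurable_continuous_onI)

lemma common_bound:
  assumes "adm U1" "adm U2"
  obtains B L where "L \<ge> 0" "B \<ge> 0" "\<And>p. w p \<in> {-B..B}" "\<And>p. p \<in> K \<Longrightarrow> U1 p \<in> {-B..B}" "\<And>p. p \<in> K \<Longrightarrow> U2 p \<in> {-B..B}"
    "\<And>t a b. t \<in> {\<tau>..T} \<Longrightarrow> a \<in> {-B..B} \<Longrightarrow> b \<in> {-B..B} \<Longrightarrow> \<bar>F t a - F t b\<bar> \<le> L * \<bar>a - b\<bar>"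
proof -
  obtain B0 B1 B2 where B: "\<forall>p. \<bar>w p\<bar> \<le> B0" "\<forall>p\<in>K. \<bar>U1 p\<bar> \<le> B1" "\<forall>p\<in>K. \<bar>U2 p\<bar> \<le> B2"
    using w_bdd assms unfolding adm_def by blast
  define B where "B = \<bar>B0\<bar> + \<bar>B1\<bar> + \<bar>B2\<bar>"
  obtain L where "L\<ge>0" "\<forall>t\<in>{\<tau>..T}. \<forall>a\<in>{-B..B}. \<forall>b\<in>{-B..B}. \<bar>F t a - F t b\<bar> \<le> L * \<bar>a - b\<bar>"
    using F_lip by blast
  moreover have "w p \<in> {-B..B}" for p using spec[OF B(1), of p] by (auto simp: B_def)
  moreover have "U1 p \<in> {-B..B}" if "p \<in> K" for p using bspec[OF B(2) that] by (auto simp: B_def)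
  moreover have "U2 p \<in> {-B..B}" if "p \<in> K" for p using bspec[OF B(3) that] by (auto simp: B_def)
  moreover have "B \<ge> 0" by (simp add: B_def)
  ultimately show thesis by (intro that[of L B]) blast+
qed

lemma I_integrable:
  assumes U: "adm U" and \<psi>: "C1test K \<psi> \<psi>x \<psi>t"
  shows "integrable lborel (I U \<psi>x \<psi>t)"
proof -
  obtain B L where BL: "L \<ge> 0" "B \<ge> 0" "\<And>p. w p \<in> {-B..B}" "\<And>p. p \<in> K \<Longrightarrow> U p \<in> {-B..B}"
    "\<And>t a b. t \<in> {\<tau>..T} \<Longrightarrow> a \<in> {-B..B} \<Longrightarrow> b \<in> {-B..B} \<Longrightarrow> \<bar>F t a - F t b\<bar> \<le> L * \<bar>a - b\<bar>"
    using common_bound[OF U U] by metis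
  obtain M where M: "M \<ge> 0" "\<And>p. \<bar>\<psi> p\<bar> \<le> M" "\<And>p. \<bar>\<psi>x p\<bar> \<le> M" "\<And>p. \<bar>\<psi>t p\<bar> \<le> M"
    using C1test_bdd[OF \<psi>] by blast
  have [measurable]: "U \<in> borel_measurable borel" using U by (simp add: adm_def)
  note [measurable] = C1test_meas[OF \<psi>]
  show ?thesis
  proof (rule integrable_bounded_support[OF _ _ K_props(2)])
    show "I U \<psi>x \<psi>t \<in> borel_measurable borel" by measurable
    show "I U \<psi>x \<psi>t p = 0" if "p \<notin> K" for p using C1test_outside[OF \<psi> that] by (simp add: I_def)
    show "\<bar>I U \<psi>x \<psi>t p\<bar> \<le> 2 * B * M + L * (2 * B) * M" if p: "p \<in> K" for p
    proof -
      have wU: "\<bar>w p - U p\<bar> \<le> 2 * B" using BL(3)[of p] BL(4)[OF p] by auto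
      have "\<bar>Q (snd p) (w p) (U p)\<bar> \<le> L * \<bar>w p - U p\<bar>"
        using BL K_mem[OF p] p by (intro Q_bound) auto
      also have "\<dots> \<le> L * (2 * B)" using wU BL by (intro mult_left_mono)
      finally have "\<bar>Q (snd p) (w p) (U p)\<bar> * \<bar>\<psi>x p\<bar> \<le> L * (2 * B) * M"
        using M BL by (intro mult_mono) auto
      moreover have "\<bar>w p - U p\<bar> * \<bar>\<psi>t p\<bar> \<le> 2 * B * M" using wU M BL by (intro mult_mono) auto
      ultimately show ?thesis unfolding I_def
        using abs_triangle_ineq[of "\<bar>w p - U p\<bar> * \<psi>t p" "Q (snd p) (w p) (U p) * \<psi>x p"] by (simp add: abs_mult)
    qed
  qed
qed

lemma KI_mono: "KI e U \<Longrightarrow> e \<le> e' \<Longrightarrow> KI e' U"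
  unfolding KI_def by fastforce

text \<open>The integrand is Lipschitz in U on K, with a constant involving the bounds on
  \<open>\<psi>x\<close> and \<open>\<psi>t\<close>. These bounds are not uniform over test
  functions, so \<psi> is fixed before \<epsilon> tends to 0.\<close>

lemma KI_close:
  assumes U: "adm U" and ap: "\<And>\<epsilon>. \<epsilon> > 0 \<Longrightarrow> \<exists>U'. adm U' \<and> KI \<epsilon> U' \<and> (\<forall>p\<in>K. \<bar>U' p - U p\<bar> \<le> \<epsilon>)"
  shows "KI 0 U"
  unfolding KI_def
proof (intro allI impI)
  fix \<psi> \<psi>x \<psi>t assume \<psi>: "C1test K \<psi> \<psi>x \<psi>t" "\<forall>p. \<psi> p \<le> 1"
  obtain M where M: "M \<ge> 0" "\<And>p. \<bar>\<psi> p\<bar> \<le> M" "\<And>p. \<bar>\<psi>x p\<bar> \<le> M" "\<And>p. \<bar>\<psi>t p\<bar> \<le> M"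
    using C1test_bdd[OF \<psi>(1)] by blast
  \<comment> \<open>Bounding |U| + 1 instead of U gives an interval [-B, B] that also contains every
    approximation within \<epsilon> \<le> 1, so that one Lipschitz constant L serves all of
    them.\<close>
  have "adm (\<lambda>p. \<bar>U p\<bar> + 1)"
  proof -
    obtain B where "\<forall>p\<in>K. \<bar>U p\<bar> \<le> B" using U by (auto simp: adm_def)
    then have "\<forall>p\<in>K. \<bar>\<bar>U p\<bar> + 1\<bar> \<le> B + 1" by auto
    moreover have "(\<lambda>p. \<bar>U p\<bar> + 1) \<in> borel_measurable borel"
    proof -
      have [measurable]: "U \<in> borel_measurable borel" using U by (simp add: adm_def)
      show ?thesis by measurable
    qed
    ultimately show ?thesis unfolding adm_def by blast
  qed
  then obtain B L where BL: "L \<ge> 0" "B \<ge> 0" "\<And>p. w p \<in> {-B..B}" "\<And>p. p \<in> K \<Longrightarrow> U p \<in> {-B..B}"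
     "\<And>p. p \<in> K \<Longrightarrow> \<bar>U p\<bar> + 1 \<in> {-B..B}"
    "\<And>t a b. t \<in> {\<tau>..T} \<Longrightarrow> a \<in> {-B..B} \<Longrightarrow> b \<in> {-B..B} \<Longrightarrow> \<bar>F t a - F t b\<bar> \<le> L * \<bar>a - b\<bar>"
    using common_bound[OF U, of "\<lambda>p. \<bar>U p\<bar> + 1"] by metis
  define m where "m = measure lborel K"
  have ind: "integrable lborel (\<lambda>p. c * indicator K p)" for c :: real
    unfolding K_def by (intro integrable_mult_right integrable_real_indicator) (auto simp: emeasure_lborel_cbox_eq)
  have key: "- \<epsilon> - \<epsilon> * (M + L * M) * m \<le> (\<integral>p. I U \<psi>x \<psi>t p \<partial>lborel)" if e: "0 < \<epsilon>" "\<epsilon> \<le> 1" for \<epsilon>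
  proof -
    obtain U' where U': "adm U'" "KI \<epsilon> U'" "\<forall>p\<in>K. \<bar>U' p - U p\<bar> \<le> \<epsilon>" using ap e by blast
    have "(\<integral>p. I U' \<psi>x \<psi>t p \<partial>lborel) - (\<integral>p. I U \<psi>x \<psi>t p \<partial>lborel) = (\<integral>p. I U' \<psi>x \<psi>t p - I U \<psi>x \<psi>t p \<partial>lborel)"
      using I_integrable U U' \<psi> by (intro Bochner_Integration.integral_diff[symmetric]) blast+
    also have "\<dots> \<le> (\<integral>p. \<epsilon> * (M + L * M) * indicator K p \<partial>lborel)"
    proof (rule integral_mono)
      show "integrable lborel (\<lambda>p. I U' \<psi>x \<psi>t p - I U \<psi>x \<psi>t p)"
        using I_integrable U U' \<psi> by (intro Bochner_Integration.integrable_diff) blast+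
      show "I U' \<psi>x \<psi>t p - I U \<psi>x \<psi>t p \<le> \<epsilon> * (M + L * M) * indicator K p" for p
      proof (cases "p \<in> K")
        case True
        have d: "\<bar>U' p - U p\<bar> \<le> \<epsilon>" using U' True by blast
        then have U'B: "U' p \<in> {-B..B}" using BL(5)[OF True] e by auto
        have "\<bar>Q (snd p) (w p) (U' p) - Q (snd p) (w p) (U p)\<bar> \<le> L * \<bar>U' p - U p\<bar>"
          using K_mem[OF True] BL True U'B by (intro Q_diff_bound[where B=B]) auto
        also have "\<dots> \<le> L * \<epsilon>" using d BL by (intro mult_left_mono)
        finally have "\<bar>Q (snd p) (w p) (U' p) - Q (snd p) (w p) (U p)\<bar> * \<bar>\<psi>x p\<bar> \<le> L * \<epsilon> * M"
          using M BL e by (intro mult_mono) auto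
        then have 1: "(Q (snd p) (w p) (U' p) - Q (snd p) (w p) (U p)) * \<psi>x p \<le> L * \<epsilon> * M"
          by (metis abs_le_D1 abs_mult)
        have "\<bar>\<bar>w p - U' p\<bar> - \<bar>w p - U p\<bar>\<bar> * \<bar>\<psi>t p\<bar> \<le> \<epsilon> * M"
          using M e d by (intro mult_mono) auto
        then have 2: "(\<bar>w p - U' p\<bar> - \<bar>w p - U p\<bar>) * \<psi>t p \<le> \<epsilon> * M"
          by (metis abs_le_D1 abs_mult)
        show ?thesis using 1 2 True by (simp add: I_def algebra_simps)
      qed (simp add: C1test_outside[OF \<psi>(1)] I_def)
    qed (rule ind)
    also have "\<dots> = \<epsilon> * (M + L * M) * m" by (simp add: m_def)
    finally have "(\<integral>p. I U' \<psi>x \<psi>t p \<partial>lborel) - \<epsilon> * (M + L * M) * m \<le> (\<integral>p. I U \<psi>x \<psi>t p \<partial>lborel)" by simp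
    moreover have "- \<epsilon> \<le> (\<integral>p. I U' \<psi>x \<psi>t p \<partial>lborel)" using U'(2) \<psi> unfolding KI_def by blast
    ultimately show ?thesis by linarith
  qed
  have "((\<lambda>\<epsilon>. - \<epsilon> - \<epsilon> * (M + L * M) * m) \<longlongrightarrow> - 0 - 0 * (M + L * M) * m) (at_right 0)"
    by (intro tendsto_intros)
  then have "- 0 - 0 * (M + L * M) * m \<le> (\<integral>p. I U \<psi>x \<psi>t p \<partial>lborel)"
    by (rule tendsto_upperbound) (auto simp: eventually_at_right_field intro!: exI[of _ 1] key)
  then show "- 0 \<le> (\<integral>p. I U \<psi>x \<psi>t p \<partial>lborel)" by simp
qed

text \<open>Jump of the entropy times \<open>Pt\<close> plus jump of the entropy flux times
  \<open>Px\<close>: the entropy production of the transition from U1 to U2 across the level curve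
  of a function with these partials.\<close>

definition Br where "Br U1 U2 Px Pt p =
  (\<bar>w p - U2 p\<bar> - \<bar>w p - U1 p\<bar>) * Pt p + (Q (snd p) (w p) (U2 p) - Q (snd p) (w p) (U1 p)) * Px p"

lemma adm_join:
  assumes "adm U1" "adm U2" "P \<in> borel_measurable borel"
  shows "adm (\<lambda>p. if P p > (0::real) then U2 p else U1 p)"
proof -
  have [measurable]: "U1 \<in> borel_measurable borel" "U2 \<in> borel_measurable borel" using assms by (auto simp: adm_def)
  note [measurable] = assms(3)
  obtain B1 B2 where "\<forall>p\<in>K. \<bar>U1 p\<bar> \<le> B1" "\<forall>p\<in>K. \<bar>U2 p\<bar> \<le> B2" using assms unfolding adm_def by blast
  note B = this
  have "\<forall>p\<in>K. \<bar>if P p > 0 then U2 p else U1 p\<bar> \<le> max B1 B2"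
  proof
    fix p assume p: "p \<in> K"
    show "\<bar>if P p > 0 then U2 p else U1 p\<bar> \<le> max B1 B2"
      using max.coboundedI1[OF bspec[OF B(1) p], of B2] max.coboundedI2[OF bspec[OF B(2) p], of B1]
      by simp
  qed
  moreover have "(\<lambda>p. if P p > 0 then U2 p else U1 p) \<in> borel_measurable borel" by measurable
  ultimately show ?thesis unfolding adm_def by blast
qed

text \<open>Test with \<open>\<psi> * chi (n * P)\<close> and \<open>\<psi> * (1 - chi (n * P))\<close>: the derivatives of the cutoff contribute the
concentrated bracket \<open>Br\<close>, whose sign decides whether the join is admissible.\<close>

lemma KI_join:
  assumes U1: "adm U1" "KI e1 U1" and U2: "adm U2" "KI e2 U2"
    and P [measurable]: "P \<in> borel_measurable borel"
    and Pc: "continuous_on (UNIV \<times> {0<..}) P" "continuous_on (UNIV \<times> {0<..}) Px" "continuous_on (UNIV \<times> {0<..}) Pt"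
    and Px: "\<And>x t. t > 0 \<Longrightarrow> ((\<lambda>y. P (y, t)) has_real_derivative Px (x, t)) (at x)"
    and Pt: "\<And>x t. t > 0 \<Longrightarrow> ((\<lambda>s. P (x, s)) has_real_derivative Pt (x, t)) (at t)"
    and err: "\<And>\<psi> \<psi>x \<psi>t n. C1test K \<psi> \<psi>x \<psi>t \<Longrightarrow> (\<And>p. \<psi> p \<le> 1) \<Longrightarrow> n \<ge> n0 \<Longrightarrow>
      integrable lborel (\<lambda>p. \<psi> p * (real n * chi' (real n * P p)) * Br U1 U2 Px Pt p) \<Longrightarrow>
      (\<integral>p. \<psi> p * (real n * chi' (real n * P p)) * Br U1 U2 Px Pt p \<partial>lborel) \<le> err"
  shows "KI (e1 + e2 + err) (\<lambda>p. if P p > 0 then U2 p else U1 p)"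
  unfolding KI_def
proof (intro allI impI)
  fix \<psi> \<psi>x \<psi>t assume \<psi>: "C1test K \<psi> \<psi>x \<psi>t" and le1: "\<forall>p. \<psi> p \<le> 1"
  note [measurable] = C1test_meas[OF \<psi>]
  have [measurable]: "U1 \<in> borel_measurable borel" "U2 \<in> borel_measurable borel" "chi \<in> borel_measurable borel"
    using U1 U2 by (auto simp: adm_def intro: borel_measurable_continuous_onI continuous_on_chi)
  have nn: "0 \<le> \<psi> p" for p by (rule C1test_nonneg[OF \<psi>])
  define c where "c n p = chi (real n * P p)" for n p
  define cx where "cx n p = chi' (real n * P p) * (real n * Px p)" for n p
  define ct where "ct n p = chi' (real n * P p) * (real n * Pt p)" for n p
  have cont: "continuous_on (UNIV \<times> {0<..}) (c n)" "continuous_on (UNIV \<times> {0<..}) (cx n)" "continuous_on (UNIV \<times> {0<..}) (ct n)" for n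
    unfolding c_def[abs_def] cx_def[abs_def] ct_def[abs_def]
    by (intro continuous_intros Pc continuous_on_compose2[OF continuous_on_chi(1)] continuous_on_compose2[OF continuous_on_chi(2)]; auto)+
  have dcx: "((\<lambda>y. c n (y, t)) has_real_derivative cx n (x, t)) (at x)" if "t > 0" for n x t
    unfolding c_def cx_def by (rule DERIV_chain2[OF DERIV_chi DERIV_cmult[OF Px[OF that]]])
  have dct: "((\<lambda>s. c n (x, s)) has_real_derivative ct n (x, t)) (at t)" if "t > 0" for n x t
    unfolding c_def ct_def by (rule DERIV_chain2[OF DERIV_chi DERIV_cmult[OF Pt[OF that]]])
  have cb: "0 \<le> c n p" "c n p \<le> 1" for n p using chi_bounds by (auto simp: c_def)
  define A1 where "A1 n = I U1 (\<lambda>p. \<psi>x p * (1 - c n p) + \<psi> p * (- cx n p)) (\<lambda>p. \<psi>t p * (1 - c n p) + \<psi> p * (- ct n p))" for n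
  define A2 where "A2 n = I U2 (\<lambda>p. \<psi>x p * c n p + \<psi> p * cx n p) (\<lambda>p. \<psi>t p * c n p + \<psi> p * ct n p)" for n
  define D where "D n p = \<psi> p * (real n * chi' (real n * P p)) * Br U1 U2 Px Pt p" for n p
  define S where "S n p = (1 - c n p) * I U1 \<psi>x \<psi>t p + c n p * I U2 \<psi>x \<psi>t p" for n p
  let ?U = "\<lambda>p. if P p > 0 then U2 p else U1 p"
  have T1: "C1test K (\<lambda>p. \<psi> p * (1 - c n p)) (\<lambda>p. \<psi>x p * (1 - c n p) + \<psi> p * (- cx n p)) (\<lambda>p. \<psi>t p * (1 - c n p) + \<psi> p * (- ct n p))" for n
  proof (rule C1test_mult[OF \<psi> K_props(1) K_props(4) tau(1)])
    show "((\<lambda>y. 1 - c n (y, t)) has_real_derivative - cx n (x, t)) (at x)" if "t > 0" for x t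
      using DERIV_diff[OF DERIV_const[of 1 "at x"] dcx[OF that]] by simp
    show "((\<lambda>s. 1 - c n (x, s)) has_real_derivative - ct n (x, t)) (at t)" if "t > 0" for x t
      using DERIV_diff[OF DERIV_const[of 1 "at t"] dct[OF that]] by simp
  qed (use cb in \<open>auto intro!: continuous_on_diff continuous_on_minus continuous_on_const cont\<close>)
  have T2: "C1test K (\<lambda>p. \<psi> p * c n p) (\<lambda>p. \<psi>x p * c n p + \<psi> p * cx n p) (\<lambda>p. \<psi>t p * c n p + \<psi> p * ct n p)" for n
    by (rule C1test_mult[OF \<psi> K_props(1) K_props(4) tau(1) cont dcx dct cb(1)])
  have le: "\<psi> p * (1 - c n p) \<le> 1 \<and> \<psi> p * c n p \<le> 1" for n p
    using mult_mono[OF spec[OF le1, of p], of "1 - c n p" 1] mult_mono[OF spec[OF le1, of p], of "c n p" 1] cb[of n p] nn[of p] by auto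
  have i1: "integrable lborel (A1 n)" "- e1 \<le> (\<integral>p. A1 n p \<partial>lborel)" for n
    using I_integrable[OF U1(1) T1[of n]] U1(2) T1[of n] le[of _ n] unfolding A1_def KI_def by blast+
  have i2: "integrable lborel (A2 n)" "- e2 \<le> (\<integral>p. A2 n p \<partial>lborel)" for n
    using I_integrable[OF U2(1) T2[of n]] U2(2) T2[of n] le[of _ n] unfolding A2_def KI_def by blast+
  have j: "integrable lborel (I U1 \<psi>x \<psi>t)" "integrable lborel (I U2 \<psi>x \<psi>t)"
    using I_integrable U1 U2 \<psi> by blast+
  have Sm[measurable]: "S n \<in> borel_measurable lborel" for n
    unfolding S_def[abs_def] c_def by measurable
  have Sb: "\<bar>S n p\<bar> \<le> \<bar>I U1 \<psi>x \<psi>t p\<bar> + \<bar>I U2 \<psi>x \<psi>t p\<bar>" for n p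
  proof -
    have "\<bar>S n p\<bar> \<le> \<bar>1 - c n p\<bar> * \<bar>I U1 \<psi>x \<psi>t p\<bar> + \<bar>c n p\<bar> * \<bar>I U2 \<psi>x \<psi>t p\<bar>"
      unfolding S_def abs_mult[symmetric] by (rule abs_triangle_ineq)
    also have "\<dots> \<le> 1 * \<bar>I U1 \<psi>x \<psi>t p\<bar> + 1 * \<bar>I U2 \<psi>x \<psi>t p\<bar>"
      using cb[of n p] by (intro add_mono mult_right_mono) auto
    finally show ?thesis by simp
  qed
  have Si: "integrable lborel (S n)" for n
    by (rule Bochner_Integration.integrable_bound[of _ "\<lambda>p. \<bar>I U1 \<psi>x \<psi>t p\<bar> + \<bar>I U2 \<psi>x \<psi>t p\<bar>"])
      (use j Sb in auto)
  have sum: "A1 n p + A2 n p - S n p = D n p" for n p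
    unfolding A1_def A2_def S_def D_def I_def Br_def cx_def ct_def by (simp add: algebra_simps)
  have Di: "integrable lborel (D n)" for n
    using Bochner_Integration.integrable_diff[OF Bochner_Integration.integrable_add[OF i1(1)[of n] i2(1)[of n]] Si[of n]] by (simp add: sum)
  have SD: "(\<integral>p. S n p \<partial>lborel) = (\<integral>p. A1 n p \<partial>lborel) + (\<integral>p. A2 n p \<partial>lborel) - (\<integral>p. D n p \<partial>lborel)" for n
  proof -
    have "(\<integral>p. D n p \<partial>lborel) = (\<integral>p. A1 n p + A2 n p - S n p \<partial>lborel)" by (simp add: sum)
    also have "\<dots> = (\<integral>p. A1 n p \<partial>lborel) + (\<integral>p. A2 n p \<partial>lborel) - (\<integral>p. S n p \<partial>lborel)"
      using i1(1)[of n] i2(1)[of n] Si[of n] by simp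
    finally show ?thesis by simp
  qed
  \<comment> \<open>Only n \<ge> n0 is used, so the bracket has to be controlled merely where 0 < n
    P < 1 for large n: a layer on one side of the curve.\<close>
  have Slow: "- (e1 + e2 + err) \<le> (\<integral>p. S n p \<partial>lborel)" if "n \<ge> n0" for n
    using SD[of n] i1(2)[of n] i2(2)[of n] err[OF \<psi> _ that] Di[of n] le1 unfolding D_def by (smt (verit, best))
  have "(\<lambda>n. \<integral>p. S n p \<partial>lborel) \<longlonglongrightarrow> (\<integral>p. I ?U \<psi>x \<psi>t p \<partial>lborel)"
  proof (rule integral_dominated_convergence[where w = "\<lambda>p. \<bar>I U1 \<psi>x \<psi>t p\<bar> + \<bar>I U2 \<psi>x \<psi>t p\<bar>"])
    show "I ?U \<psi>x \<psi>t \<in> borel_measurable lborel" by measurable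
    show "integrable lborel (\<lambda>p. \<bar>I U1 \<psi>x \<psi>t p\<bar> + \<bar>I U2 \<psi>x \<psi>t p\<bar>)" using j by auto
    show "AE p in lborel. (\<lambda>n. S n p) \<longlonglongrightarrow> I ?U \<psi>x \<psi>t p"
    proof (rule AE_I2)
      fix p
      have "(\<lambda>n. S n p) \<longlonglongrightarrow> (1 - (if P p > 0 then 1 else 0)) * I U1 \<psi>x \<psi>t p + (if P p > 0 then 1 else 0) * I U2 \<psi>x \<psi>t p"
        unfolding S_def c_def by (intro tendsto_intros chi_tendsto)
      then show "(\<lambda>n. S n p) \<longlonglongrightarrow> I ?U \<psi>x \<psi>t p" by (cases "P p > 0") (simp_all add: I_def)
    qed
  qed (use Sb in auto)
  then show "- (e1 + e2 + err) \<le> (\<integral>p. I ?U \<psi>x \<psi>t p \<partial>lborel)"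
  proof (rule tendsto_lowerbound)
    show "\<forall>\<^sub>F n in sequentially. - (e1 + e2 + err) \<le> (\<integral>p. S n p \<partial>lborel)"
      using Slow unfolding eventually_sequentially by blast
  qed simp
qed

text \<open>The bracket with \<open>Px\<close> and \<open>- Pt\<close> replaced by the jumps of the
  solution and of the flux. For c outside (u2, u1) the two products cancel exactly. For c inside,
  their sum is 2 (u1 - u2) times the amount by which F at c exceeds its chord, hence at most 0 by
  convexity.\<close>

lemma shock_bracket:
  assumes F: "convex_on UNIV (F t)" and u: "u2 < u1"
  shows "(\<bar>c - u2\<bar> - \<bar>c - u1\<bar>) * - (F t u1 - F t u2) + (Q t c u2 - Q t c u1) * (u1 - u2) \<le> 0"
proof -
  consider "c \<ge> u1" | "c \<le> u2" | "u2 < c" "c < u1" by linarith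
  then show ?thesis
  proof cases
    case 1
    then have "\<bar>c - u2\<bar> - \<bar>c - u1\<bar> = u1 - u2" "Q t c u2 - Q t c u1 = F t u1 - F t u2"
      using u by (auto simp: Q_def sgn_real_def)
    then show ?thesis by (simp only:) (simp add: algebra_simps)
  next
    case 2
    then have "\<bar>c - u2\<bar> - \<bar>c - u1\<bar> = u2 - u1" "Q t c u2 - Q t c u1 = F t u2 - F t u1"
      using u by (auto simp: Q_def sgn_real_def)
    then show ?thesis by (simp only:) (simp add: algebra_simps)
  next
    case 3
    then have e: "\<bar>c - u2\<bar> - \<bar>c - u1\<bar> = 2 * c - u1 - u2" "Q t c u2 - Q t c u1 = 2 * F t c - F t u1 - F t u2"
      by (auto simp: Q_def)
    have "F t c * (u1 - u2) \<le> F t u2 * (u1 - c) + F t u1 * (c - u2)"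
    proof -
      define l where "l = (c - u2) / (u1 - u2)"
      have l: "0 \<le> l" "l \<le> 1" using 3 by (auto simp: l_def)
      have lu: "l * (u1 - u2) = c - u2" using u by (simp add: l_def)
      have c: "(1 - l) * u2 + l * u1 = c" using lu by (simp add: algebra_simps)
      have "F t c \<le> (1 - l) * F t u2 + l * F t u1"
        using convex_onD[OF F l, of u2 u1] c by simp
      then have "F t c * (u1 - u2) \<le> ((1 - l) * F t u2 + l * F t u1) * (u1 - u2)"
        using u by (intro mult_right_mono) auto
      also have "\<dots> = F t u2 * ((u1 - u2) - l * (u1 - u2)) + F t u1 * (l * (u1 - u2))" by (simp add: algebra_simps)
      also have "\<dots> = F t u2 * (u1 - c) + F t u1 * (c - u2)" unfolding lu by simp
      finally show ?thesis .
    qed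
    then show ?thesis unfolding e by (simp add: algebra_simps)
  qed
qed

text \<open>The relation between the jumps and the derivatives of P is required wherever P > 0
  inside K, not only on the curve. A difference of two potentials E provides this, and it makes the
  bracket nonpositive throughout, so that the join costs no error.\<close>

lemma KI_shock:
  assumes U1: "adm U1" "KI e1 U1" and U2: "adm U2" "KI e2 U2"
    and P [measurable]: "P \<in> borel_measurable borel"
    and Pc: "continuous_on (UNIV \<times> {0<..}) P" "continuous_on (UNIV \<times> {0<..}) Px" "continuous_on (UNIV \<times> {0<..}) Pt"
    and Px: "\<And>x t. t > 0 \<Longrightarrow> ((\<lambda>y. P (y, t)) has_real_derivative Px (x, t)) (at x)"
    and Pt: "\<And>x t. t > 0 \<Longrightarrow> ((\<lambda>s. P (x, s)) has_real_derivative Pt (x, t)) (at t)"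
    and F: "\<And>t. convex_on UNIV (F t)"
    and RH: "\<And>p. p \<in> K \<Longrightarrow> P p > 0 \<Longrightarrow> U2 p < U1 p \<and> Px p = U1 p - U2 p \<and> Pt p = - (F (snd p) (U1 p) - F (snd p) (U2 p))"
  shows "KI (e1 + e2) (\<lambda>p. if P p > 0 then U2 p else U1 p)"
proof -
  have "KI (e1 + e2 + 0) (\<lambda>p. if P p > 0 then U2 p else U1 p)"
  proof (rule KI_join[OF U1 U2 P Pc Px Pt])
    fix \<psi> \<psi>x \<psi>t and n :: nat
    assume \<psi>: "C1test K \<psi> \<psi>x \<psi>t"
    have "\<psi> p * (real n * chi' (real n * P p)) * Br U1 U2 Px Pt p \<le> 0" for p
    proof (cases "p \<in> K \<and> P p > 0")
      case True
      then have "Br U1 U2 Px Pt p \<le> 0" using shock_bracket[OF F] RH unfolding Br_def by simp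
      moreover have "0 \<le> \<psi> p * (real n * chi' (real n * P p))" using C1test_nonneg[OF \<psi>] chi'_nonneg by simp
      ultimately show ?thesis by (simp add: mult_nonneg_nonpos)
    next
      case False
      then have "\<psi> p = 0 \<or> chi' (real n * P p) = 0"
        using C1test_outside(1)[OF \<psi>, of p] chi'_outside[of "real n * P p"] by (cases "p \<in> K") (auto simp: mult_nonneg_nonpos)
      then show ?thesis by auto
    qed
    then have "0 \<le> (\<integral>p. - (\<psi> p * (real n * chi' (real n * P p)) * Br U1 U2 Px Pt p) \<partial>lborel)"
      by (intro Bochner_Integration.integral_nonneg) simp
    then show "(\<integral>p. \<psi> p * (real n * chi' (real n * P p)) * Br U1 U2 Px Pt p \<partial>lborel) \<le> 0"
      by simp
  qed auto
  then show ?thesis by simp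
qed

text \<open>Error count: the strip of width 1/n to the right of the curve has area (T - \<tau>) / n,
  the cutoff has slope at most 2 n, \<psi> is at most 1 and the bracket at most \<epsilon>. The
  product 2 \<epsilon> (T - \<tau>) is independent of n.\<close>

lemma KI_line:
  assumes U1: "adm U1" "KI e1 U1" and U2: "adm U2" "KI e2 U2"
    and \<xi> [measurable]: "\<xi> \<in> borel_measurable borel"
    and \<xi>c: "continuous_on {0<..} \<xi>'" and \<xi>d: "\<And>t. t > 0 \<Longrightarrow> (\<xi> has_real_derivative \<xi>' t) (at t)"
    and \<epsilon>: "\<epsilon> \<ge> 0" and d0: "d0 > 0"
    and br: "\<And>p. p \<in> K \<Longrightarrow> \<xi> (snd p) < fst p \<Longrightarrow> fst p < \<xi> (snd p) + d0 \<Longrightarrow>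
       Q (snd p) (w p) (U2 p) - Q (snd p) (w p) (U1 p) - \<xi>' (snd p) * (\<bar>w p - U2 p\<bar> - \<bar>w p - U1 p\<bar>) \<le> \<epsilon>"
  shows "KI (e1 + e2 + 2 * \<epsilon> * (T - \<tau>)) (\<lambda>p. if fst p > \<xi> (snd p) then U2 p else U1 p)"
proof -
  have \<xi>c0: "continuous_on {0<..} \<xi>" using \<xi>d by (auto intro!: DERIV_continuous_on intro: has_field_derivative_at_within)
  obtain n0 :: nat where n0: "n0 > 0" "1 / real n0 < d0"
    using reals_Archimedean[OF d0] by (metis inverse_eq_divide zero_less_Suc)
  have "KI (e1 + e2 + 2 * \<epsilon> * (T - \<tau>)) (\<lambda>p. if fst p - \<xi> (snd p) > 0 then U2 p else U1 p)"
  proof (rule KI_join[OF U1 U2, where Px = "\<lambda>p. 1" and Pt = "\<lambda>p. - \<xi>' (snd p)" and ?n0.0 = n0])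
    show "continuous_on (UNIV \<times> {0<..}) (\<lambda>p. fst p - \<xi> (snd p))"
      by (intro continuous_intros continuous_on_compose2[OF \<xi>c0]) auto
    show "continuous_on (UNIV \<times> {0<..}) (\<lambda>p::real \<times> real. - \<xi>' (snd p))"
      by (intro continuous_intros continuous_on_compose2[OF \<xi>c]) auto
    show "((\<lambda>y. fst (y, t) - \<xi> (snd (y, t))) has_real_derivative 1) (at x)" for x t
      using DERIV_diff[OF DERIV_ident[of "at x"] DERIV_const[of "\<xi> t" "at x"]] by simp
    show "((\<lambda>s. fst (x, s) - \<xi> (snd (x, s))) has_real_derivative - \<xi>' (snd (x, t))) (at t)" if "t > 0" for x t
      using DERIV_diff[OF DERIV_const[of x "at t"] \<xi>d[OF that]] by simp
    fix \<psi> \<psi>x \<psi>t and n :: nat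
    assume \<psi>: "C1test K \<psi> \<psi>x \<psi>t" and le1: "\<And>p. \<psi> p \<le> 1" and n: "n0 \<le> n"
    let ?D = "\<lambda>p. \<psi> p * (real n * chi' (real n * (fst p - \<xi> (snd p)))) * Br U1 U2 (\<lambda>p. 1) (\<lambda>p. - \<xi>' (snd p)) p"
    assume D: "integrable lborel ?D"
    have npos: "real n > 0" using n n0 by simp
    have nd: "1 / real n < d0"
    proof -
      have "1 / real n \<le> 1 / real n0" using n n0 by (simp add: frac_le)
      then show ?thesis using n0 by simp
    qed
    define Z where "Z = {p. snd p \<in> {\<tau>..T} \<and> \<xi> (snd p) < fst p \<and> fst p < \<xi> (snd p) + 1 / real n}"
    have Zm: "Z \<in> sets borel" unfolding Z_def by measurable
    have "emeasure lborel Z = emeasure (lborel \<Otimes>\<^sub>M lborel) Z" by (simp add: lborel_prod)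
    also have "\<dots> = (\<integral>\<^sup>+ t. emeasure lborel ((\<lambda>x. (x, t)) -` Z) \<partial>lborel)"
      by (rule lborel_pair.emeasure_pair_measure_alt2) (use Zm in \<open>unfold lborel_prod, simp\<close>)
    also have "\<dots> = (\<integral>\<^sup>+ t. ennreal (1 / real n) * indicator {\<tau>..T} t \<partial>lborel)"
    proof (rule nn_integral_cong)
      fix t :: real
      have "(\<lambda>x. (x, t)) -` Z = (if t \<in> {\<tau>..T} then {\<xi> t <..< \<xi> t + 1 / real n} else {})"
        by (auto simp: Z_def)
      then show "emeasure lborel ((\<lambda>x. (x, t)) -` Z) = ennreal (1 / real n) * indicator {\<tau>..T} t"
        by simp
    qed
    also have "\<dots> = ennreal (1 / real n) * ennreal (T - \<tau>)"
      using tau by (subst nn_integral_cmult_indicator) auto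
    also have "\<dots> = ennreal ((T - \<tau>) / real n)"
      using tau by (subst ennreal_mult[symmetric]) auto
    finally have Ze: "emeasure lborel Z = ennreal ((T - \<tau>) / real n)" .
    then have Zme: "measure lborel Z = (T - \<tau>) / real n" using tau by (simp add: measure_def)
    have "(\<integral>p. ?D p \<partial>lborel) \<le> (\<integral>p. 2 * real n * \<epsilon> * indicator Z p \<partial>lborel)"
    proof (rule integral_mono[OF D])
      show "integrable lborel (\<lambda>p. 2 * real n * \<epsilon> * indicator Z p)"
        using Zm Ze by (intro integrable_mult_right integrable_real_indicator) auto
      fix p
      show "?D p \<le> 2 * real n * \<epsilon> * indicator Z p"
      proof (cases "p \<in> K \<and> 0 < fst p - \<xi> (snd p) \<and> fst p - \<xi> (snd p) < 1 / real n")
        case True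
        then have pZ: "p \<in> Z" using K_mem[of p] by (auto simp: Z_def)
        have "Br U1 U2 (\<lambda>p. 1) (\<lambda>p. - \<xi>' (snd p)) p \<le> \<epsilon>"
          using br[of p] True nd by (simp add: Br_def algebra_simps)
        moreover have c0: "0 \<le> \<psi> p * (real n * chi' (real n * (fst p - \<xi> (snd p))))"
          using C1test_nonneg[OF \<psi>] chi'_nonneg by simp
        ultimately have "?D p \<le> \<psi> p * (real n * chi' (real n * (fst p - \<xi> (snd p)))) * \<epsilon>"
          by (intro mult_left_mono)
        also have "\<dots> \<le> 1 * (real n * 2) * \<epsilon>"
          using C1test_nonneg[OF \<psi>] le1 chi'_le chi'_nonneg \<epsilon> by (intro mult_mono mult_left_mono) auto
        finally show ?thesis using pZ by simp
      next
        case False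
        have "\<psi> p = 0 \<or> chi' (real n * (fst p - \<xi> (snd p))) = 0"
        proof (cases "p \<in> K")
          case True
          then have "real n * (fst p - \<xi> (snd p)) \<le> 0 \<or> real n * (fst p - \<xi> (snd p)) \<ge> 1"
            using False npos by (auto simp: field_simps mult_nonneg_nonpos not_less)
          then show ?thesis using chi'_outside by blast
        qed (simp add: C1test_outside[OF \<psi>])
        then show ?thesis using \<epsilon> by auto
      qed
    qed
    also have "\<dots> = 2 * \<epsilon> * (T - \<tau>)" using Zme npos by simp
    finally show "(\<integral>p. ?D p \<partial>lborel) \<le> 2 * \<epsilon> * (T - \<tau>)" .
  qed auto
  then show ?thesis by simp
qed

text \<open>An upward jump from a to b travelling with the chord speed violates the entropy
  condition only for c between a and b, and there by at most \<omega> (b - a), where \<omega> bounds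
  the deviation of partial chord slopes from \<sigma>. As \<omega> vanishes with the size of the
  jump, many small jumps together still cost little.\<close>

lemma chord_bracket:
  assumes ab: "a < b" and \<sigma>: "\<sigma> = (F t b - F t a) / (b - a)"
    and l: "\<And>c. a \<le> c \<Longrightarrow> c \<le> b \<Longrightarrow> \<bar>F t c - F t a - \<sigma> * (c - a)\<bar> \<le> \<omega> * (c - a) \<and> \<bar>F t b - F t c - \<sigma> * (b - c)\<bar> \<le> \<omega> * (b - c)"
    and om: "0 \<le> \<omega>"
  shows "Q t c b - Q t c a - \<sigma> * (\<bar>c - b\<bar> - \<bar>c - a\<bar>) \<le> \<omega> * (b - a)"
proof -
  have s: "\<sigma> * (b - a) = F t b - F t a" using ab by (simp add: \<sigma>)
  have p: "0 \<le> \<omega> * (b - a)" using ab om by simp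
  consider "c \<ge> b" | "c \<le> a" | "a < c" "c < b" by linarith
  then show ?thesis
  proof cases
    case 1
    then have "\<bar>c - b\<bar> - \<bar>c - a\<bar> = - (b - a)" "Q t c b - Q t c a = - (F t b - F t a)"
      using ab by (auto simp: Q_def sgn_real_def)
    then show ?thesis using s p by (simp add: right_diff_distrib)
  next
    case 2
    then have "\<bar>c - b\<bar> - \<bar>c - a\<bar> = b - a" "Q t c b - Q t c a = F t b - F t a"
      using ab by (auto simp: Q_def sgn_real_def)
    then show ?thesis using s p by (simp add: right_diff_distrib)
  next
    case 3
    then have e: "\<bar>c - b\<bar> - \<bar>c - a\<bar> = (b - c) - (c - a)" "Q t c b - Q t c a = (F t b - F t c) - (F t c - F t a)"
      by (auto simp: Q_def)
    have "F t b - F t c - \<sigma> * (b - c) \<le> \<omega> * (b - c)" "- (F t c - F t a - \<sigma> * (c - a)) \<le> \<omega> * (c - a)"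
      using l[of c] 3 by auto
    then show ?thesis unfolding e by (simp add: algebra_simps)
  qed
qed

end

section \<open>The Legendre transform of a time-dependent flux\<close>

lemma DERIV_squeezeI:
  fixes e :: "real \<Rightarrow> real"
  assumes "\<And>\<epsilon>. \<epsilon> > 0 \<Longrightarrow> \<forall>\<^sub>F y in at x. \<bar>e y - e x - (y - x) * D\<bar> \<le> \<epsilon> * \<bar>y - x\<bar>"
  shows "(e has_real_derivative D) (at x)"
  unfolding has_field_derivative_iff
proof (rule tendstoI)
  fix \<epsilon> :: real assume "\<epsilon> > 0"
  then have "\<forall>\<^sub>F y in at x. \<bar>e y - e x - (y - x) * D\<bar> \<le> \<epsilon> / 2 * \<bar>y - x\<bar>" by (intro assms) simp
  moreover have "\<forall>\<^sub>F y in at x. y \<noteq> x" by (simp add: eventually_at_filter)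
  ultimately show "\<forall>\<^sub>F y in at x. dist ((e y - e x) / (y - x)) D < \<epsilon>"
  proof eventually_elim
    case (elim y)
    have "(e y - e x) / (y - x) - D = (e y - e x - (y - x) * D) / (y - x)" using elim by (simp add: field_simps)
    then have "\<bar>(e y - e x) / (y - x) - D\<bar> \<le> \<epsilon> / 2" using elim by (simp add: abs_divide pos_divide_le_eq)
    then show ?case using \<open>\<epsilon> > 0\<close> by (simp add: dist_real_def)
  qed
qed

locale flux =
  fixes f f' \<beta> :: "real \<Rightarrow> real"
  assumes f_deriv: "\<And>x. (f has_real_derivative f' x) (at x)"
    and f'_cont: "continuous_on UNIV f'"
    and f'_mono: "strict_mono f'"
    and f_0 [simp]: "f 0 = 0" and f'_0 [simp]: "f' 0 = 0"
    and f'_top: "filterlim f' at_top at_top" and f'_bot: "filterlim f' at_bot at_bot"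
    and \<beta>_cont: "continuous_on UNIV \<beta>"
begin

text \<open>\<open>E\<close> is the Legendre transform of \<open>Phi\<close> in its first argument; \<open>G = \<partial>E/\<partial>y\<close> is a rarefaction fan
centred at the origin, of age 1 at \<open>t = 0\<close> because \<open>Phi\<close> starts from \<open>f\<close> rather than from 0, and
\<open>\<partial>E/\<partial>t = - F t G\<close>.\<close>

definition F where "F t v = exp (- \<beta> t) * f (exp (\<beta> t) * v)"
definition F' where "F' t v = f' (exp (\<beta> t) * v)"
definition Phi where "Phi v t = f v + integral {0..t} (\<lambda>\<tau>. F \<tau> v)"
definition H where "H v t = f' v + integral {0..t} (\<lambda>\<tau>. F' \<tau> v)"
definition G where "G y t = (THE v. H v t = y)"
definition E where "E y t = y * G y t - Phi (G y t) t"

lemma f_cont: "continuous_on UNIV f"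
  using f_deriv by (meson DERIV_continuous_on has_field_derivative_at_within)

lemma F_0 [simp]: "F t 0 = 0" and F'_0 [simp]: "F' t 0 = 0"
  by (simp_all add: F_def F'_def)

lemma F_deriv: "(F t has_real_derivative F' t v) (at v)"
proof -
  have "((\<lambda>v. exp (- \<beta> t) * f (exp (\<beta> t) * v)) has_real_derivative exp (- \<beta> t) * (f' (exp (\<beta> t) * v) * exp (\<beta> t))) (at v)"
    by (intro DERIV_cmult DERIV_chain2[OF f_deriv] DERIV_cmult_Id)
  moreover have "exp (- \<beta> t) * (f' (exp (\<beta> t) * v) * exp (\<beta> t)) = F' t v"
    by (simp add: F'_def exp_minus field_simps)
  ultimately show ?thesis by (simp add: F_def[abs_def])
qed

lemma F_continuous: "continuous_on UNIV (\<lambda>q. F (fst q) (snd q))"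
  and F'_continuous: "continuous_on UNIV (\<lambda>q. F' (fst q) (snd q))"
  unfolding F_def F'_def
  by (intro continuous_intros continuous_on_compose2[OF f_cont] continuous_on_compose2[OF f'_cont] continuous_on_compose2[OF \<beta>_cont]; auto)+

lemma F_continuous_on2 [continuous_intros]:
  assumes "continuous_on S a" "continuous_on S b"
  shows "continuous_on S (\<lambda>x. F (a x) (b x))" "continuous_on S (\<lambda>x. F' (a x) (b x))"
  using continuous_on_compose2[OF F_continuous continuous_on_Pair[OF assms]]
    continuous_on_compose2[OF F'_continuous continuous_on_Pair[OF assms]] by auto

lemma F'_mono: "v < w \<Longrightarrow> F' t v < F' t w"
  unfolding F'_def by (intro strict_monoD[OF f'_mono] mult_strict_left_mono) auto

lemma F'_mono_le: "v \<le> w \<Longrightarrow> F' t v \<le> F' t w"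
  using F'_mono[of v w t] by (cases "v = w") auto

lemma F_convex: "convex_on UNIV (F t)"
  by (rule convex_on_realI[where f' = "F' t"]) (auto intro: F_deriv F'_mono_le)

lemma F_nonneg: "0 \<le> F t v"
proof -
  consider "v > 0" | "v < 0" | "v = 0" by linarith
  then show ?thesis
  proof cases
    case 1
    then obtain z where "0 < z" "F t v - F t 0 = (v - 0) * F' t z" using MVT2[of 0 v "F t" "F' t"] F_deriv by blast
    then show ?thesis using 1 F'_mono_le[of 0 z t] by simp
  next
    case 2
    then obtain z where "z < 0" "F t 0 - F t v = (0 - v) * F' t z" using MVT2[of v 0 "F t" "F' t"] F_deriv by blast
    then show ?thesis using 2 F'_mono_le[of z 0 t] by (simp add: mult_nonneg_nonpos2 zero_le_mult_iff mult_nonpos_nonpos)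
  qed simp
qed

lemma Phi_deriv: assumes "t \<ge> 0" shows "((\<lambda>v. Phi v t) has_real_derivative H v t) (at v)"
proof -
  have "((\<lambda>v. integral (cbox 0 t) (\<lambda>\<tau>. F \<tau> v)) has_real_derivative integral (cbox 0 t) (\<lambda>\<tau>. F' \<tau> v)) (at v)"
  proof (rule leibniz_rule_field_derivative[where U=UNIV and fx = "\<lambda>v \<tau>. F' \<tau> v"])
    show "(\<lambda>\<tau>. F \<tau> v) integrable_on cbox 0 t" for v
      by (intro integrable_continuous continuous_intros)
    show "continuous_on (UNIV \<times> cbox 0 t) (\<lambda>(v, \<tau>). F' \<tau> v)"
      unfolding split_beta by (intro continuous_intros)
  qed (auto intro: F_deriv)
  then show ?thesis unfolding Phi_def H_def by (intro DERIV_add f_deriv) simp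
qed

lemma integral_param_deriv:
  assumes g: "continuous_on UNIV g" and t: "t > (0::real)"
  shows "((\<lambda>s. integral {0..s} g) has_real_derivative g t) (at t)"
proof -
  have "((\<lambda>s. integral {0..s} g) has_real_derivative g t) (at t within {0..t + 1})"
    using t by (intro integral_has_real_derivative continuous_on_subset[OF g]) auto
  moreover have "at t within {0..t + 1} = at t" using t by (intro at_within_interior) (simp add: interior_atLeastAtMost_real)
  ultimately show ?thesis by simp
qed

lemma Phi_deriv_t: "t > 0 \<Longrightarrow> ((\<lambda>t. Phi v t) has_real_derivative F t v) (at t)"
  unfolding Phi_def using DERIV_add[OF DERIV_const integral_param_deriv] 
  by (auto intro!: derivative_eq_intros integral_param_deriv continuous_intros)

lemma F'_int: "(\<lambda>\<tau>. F' \<tau> v) integrable_on {0..t}" "(\<lambda>\<tau>. F \<tau> v) integrable_on {0..t}"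
  by (intro integrable_continuous_interval continuous_intros)+

section \<open>The characteristic map H and its inverse, the fan profile G\<close>

lemma H_mono: "v < w \<Longrightarrow> H v t < H w t"
  unfolding H_def by (intro add_less_le_mono strict_monoD[OF f'_mono] integral_le F'_int F'_mono_le) auto

lemma H_diff_ge: "v \<le> w \<Longrightarrow> f' w - f' v \<le> H w t - H v t"
proof -
  assume "v \<le> w"
  then have "integral {0..t} (\<lambda>\<tau>. F' \<tau> v) \<le> integral {0..t} (\<lambda>\<tau>. F' \<tau> w)"
    by (intro integral_le F'_int F'_mono_le)
  then show ?thesis unfolding H_def by simp
qed

lemma H_0 [simp]: "H 0 t = 0"
  by (simp add: H_def)

lemma H_ge: "v \<ge> 0 \<Longrightarrow> f' v \<le> H v t" and H_le: "v \<le> 0 \<Longrightarrow> H v t \<le> f' v"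
  using H_diff_ge[of 0 v t] H_diff_ge[of v 0 t] by auto

lemma H_cont: "continuous_on UNIV (\<lambda>v. H v t)"
proof -
  have "continuous_on UNIV (\<lambda>v. integral (cbox 0 t) (\<lambda>\<tau>. F' \<tau> v))"
    by (rule integral_continuous_on_param) (unfold split_beta, intro continuous_intros)
  then show ?thesis unfolding H_def[abs_def] by (intro continuous_intros f'_cont) simp
qed

lemma H_cont_t: "continuous_on {0..} (H v)"
proof -
  have c: "continuous_on {0..T} (\<lambda>t. integral {0..t} (\<lambda>\<tau>. F' \<tau> v))" for T
    by (rule indefinite_integral_continuous_1[OF F'_int(1)])
  have "continuous (at t within {0..}) (\<lambda>t. integral {0..t} (\<lambda>\<tau>. F' \<tau> v))" if "t \<ge> 0" for t
  proof -
    have "at t within {0..} = at t within {0..t+1}"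
      by (rule at_within_nhd[of t "{..<t+1}"]) auto
    then show ?thesis using c[of "t+1"] that by (auto simp: continuous_on_eq_continuous_within)
  qed
  then have "continuous_on {0..} (\<lambda>t. integral {0..t} (\<lambda>\<tau>. F' \<tau> v))"
    by (simp add: continuous_on_eq_continuous_within)
  then show ?thesis unfolding H_def[abs_def] by (intro continuous_intros)
qed

text \<open>The integral term has the sign of v and only pushes H further away from 0 than f', so
  unboundedness of f' in both directions carries over and the intermediate value theorem
  applies.\<close>

lemma H_surj: "\<exists>v. H v t = y"
proof -
  have "\<forall>\<^sub>F x in at_top. y \<le> f' x" using f'_top unfolding filterlim_at_top by blast
  then have "\<forall>\<^sub>F x in at_top. y \<le> f' x \<and> 0 \<le> x" by (intro eventually_conj eventually_ge_at_top)
  then obtain b where b: "b \<ge> 0" "f' b \<ge> y" using eventually_happens[of _ at_top] by fastforce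
  have "\<forall>\<^sub>F x in at_bot. f' x \<le> y" using f'_bot unfolding filterlim_at_bot by blast
  then have "\<forall>\<^sub>F x in at_bot. f' x \<le> y \<and> x \<le> 0" by (intro eventually_conj eventually_le_at_bot)
  then obtain a where a: "a \<le> 0" "f' a \<le> y" using eventually_happens[of _ at_bot] by fastforce
  have "H a t \<le> y" "y \<le> H b t" "a \<le> b" using a b H_le[of a t] H_ge[of b t] by linarith+
  then show ?thesis using IVT'[of "\<lambda>v. H v t" a y b] continuous_on_subset[OF H_cont] by blast
qed

lemma H_inj: "H v t = H w t \<Longrightarrow> v = w"
  using H_mono[of v w t] H_mono[of w v t] by (cases v w rule: linorder_cases) auto

lemma H_G [simp]: "H (G y t) t = y"
  unfolding G_def proof (rule theI')
  show "\<exists>!v. H v t = y" using H_surj[of t y] by (auto dest: H_inj)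
qed

lemma G_H [simp]: "G (H v t) t = v"
  by (rule H_inj[of _ t]) simp

lemma H_less_iff: "H v t < H w t \<longleftrightarrow> v < w"
  using H_mono[of v w t] H_mono[of w v t] by (cases v w rule: linorder_cases) auto

lemma G_less_iff: "G y t < v \<longleftrightarrow> y < H v t" "v < G y t \<longleftrightarrow> H v t < y"
  using H_less_iff[of "G y t" t v] H_less_iff[of v t "G y t"] by simp_all

lemma G_le_iff: "G y t \<le> v \<longleftrightarrow> y \<le> H v t" "v \<le> G y t \<longleftrightarrow> H v t \<le> y"
  using G_less_iff[of v y t] G_less_iff[of y t v] by (simp_all add: linorder_not_less[symmetric])

lemma G_mono: "y < z \<Longrightarrow> G y t < G z t"
  by (simp add: G_less_iff)

lemma G_0 [simp]: "G 0 t = 0"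
  using G_H[of 0 t] by simp

text \<open>Joint continuity without an inverse function theorem, since f' need not be
  differentiable. Monotonicity suffices: G y t < a means y < H a t, and H a is continuous in time
  for fixed a.\<close>

lemma G_tendsto:
  assumes "t0 \<ge> 0"
  shows "((\<lambda>q. G (fst q) (snd q)) \<longlongrightarrow> G y0 t0) (at (y0, t0) within UNIV \<times> {0..})"
proof -
  let ?A = "at (y0, t0) within UNIV \<times> {0::real..}"
  have fs: "((\<lambda>q. fst q) \<longlongrightarrow> y0) ?A" using tendsto_fst[OF tendsto_ident_at, of "(y0, t0)"] by simp
  have Ht: "((\<lambda>q. H v (snd q)) \<longlongrightarrow> H v t0) ?A" for v
  proof -
    have "continuous_on (UNIV \<times> {0..}) (\<lambda>q::real \<times> real. H v (snd q))"
      by (rule continuous_on_compose2[OF H_cont_t]) (auto intro!: continuous_intros)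
    then show ?thesis using assms by (auto simp: continuous_on_def)
  qed
  show ?thesis
  proof (rule order_tendstoI)
    fix a assume "a < G y0 t0"
    then have "H a t0 < y0" by (simp add: G_less_iff)
    then have "\<forall>\<^sub>F q in ?A. H a (snd q) < fst q" 
      using order_tendstoD(2)[OF tendsto_diff[OF Ht fs], of a 0] by (simp add: less_diff_eq)
    then show "\<forall>\<^sub>F q in ?A. a < G (fst q) (snd q)" by eventually_elim (simp add: G_less_iff)
  next
    fix a assume "G y0 t0 < a"
    then have "y0 < H a t0" by (simp add: G_less_iff)
    then have "\<forall>\<^sub>F q in ?A. fst q < H a (snd q)"
      using order_tendstoD(1)[OF tendsto_diff[OF Ht fs], of 0 a] by simp
    then show "\<forall>\<^sub>F q in ?A. G (fst q) (snd q) < a" by eventually_elim (simp add: G_less_iff)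
  qed
qed

lemma G_continuous: "continuous_on (UNIV \<times> {0..}) (\<lambda>q. G (fst q) (snd q))"
  using G_tendsto by (auto simp: continuous_on_def)

text \<open>The Fenchel-Young inequality: y v - Phi v t has slope y - H v t in v, which changes sign
  from plus to minus at v = G y t.\<close>

lemma E_ge: assumes "t \<ge> 0" shows "y * v - Phi v t \<le> E y t"
proof -
  let ?g = "G y t"
  consider "v > ?g" | "v < ?g" | "v = ?g" by linarith
  then show ?thesis
  proof cases
    case 1
    then obtain z where z: "?g < z" "Phi v t - Phi ?g t = (v - ?g) * H z t"
      using MVT2[of ?g v "\<lambda>v. Phi v t" "\<lambda>v. H v t"] Phi_deriv[OF assms] by blast
    then have "(v - ?g) * y \<le> (v - ?g) * H z t"
      using 1 by (intro mult_left_mono) (simp_all add: G_less_iff G_le_iff less_imp_le)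
    then show ?thesis using z by (simp add: E_def algebra_simps)
  next
    case 2
    then obtain z where z: "z < ?g" "Phi ?g t - Phi v t = (?g - v) * H z t"
      using MVT2[of v ?g "\<lambda>v. Phi v t" "\<lambda>v. H v t"] Phi_deriv[OF assms] by blast
    then have "(?g - v) * H z t \<le> (?g - v) * y"
      using 2 by (intro mult_left_mono) (simp_all add: G_less_iff G_le_iff less_imp_le)
    then show ?thesis using z by (simp add: E_def algebra_simps)
  qed (simp add: E_def)
qed

text \<open>Envelope argument: testing the Fenchel-Young inequality at z with the maximiser for y,
  and conversely, traps the error of the linearisation between 0 and (z - y) (G z t - G y t). Only
  continuity of G enters.\<close>

lemma E_deriv_y: assumes t: "t \<ge> 0" shows "((\<lambda>y. E y t) has_real_derivative G y t) (at y)"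
proof (rule DERIV_squeezeI)
  fix \<epsilon> :: real assume \<epsilon>: "\<epsilon> > 0"
  have "continuous_on UNIV (\<lambda>y. G y t)"
    using t by (intro continuous_on_compose2[OF G_continuous, of UNIV "\<lambda>y. (y, t)", simplified] continuous_intros) auto
  then have "((\<lambda>y. G y t) \<longlongrightarrow> G y t) (at y)" by (simp add: continuous_on_def)
  then have "\<forall>\<^sub>F z in at y. dist (G z t) (G y t) < \<epsilon>" using \<epsilon> by (rule tendstoD)
  then show "\<forall>\<^sub>F z in at y. \<bar>E z t - E y t - (z - y) * G y t\<bar> \<le> \<epsilon> * \<bar>z - y\<bar>"
  proof eventually_elim
    case (elim z)
    have "z * G y t - Phi (G y t) t \<le> E z t" "y * G z t - Phi (G z t) t \<le> E y t" using E_ge[OF t] by blast+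
    then have "0 \<le> E z t - E y t - (z - y) * G y t" "E z t - E y t - (z - y) * G y t \<le> (z - y) * (G z t - G y t)"
      by (simp_all add: E_def algebra_simps)
    moreover have "(z - y) * (G z t - G y t) \<le> \<bar>z - y\<bar> * \<epsilon>"
    proof -
      have "(z - y) * (G z t - G y t) \<le> \<bar>z - y\<bar> * \<bar>G z t - G y t\<bar>" by (metis abs_ge_self abs_mult)
      also have "\<dots> \<le> \<bar>z - y\<bar> * \<epsilon>" using elim by (intro mult_left_mono) (auto simp: dist_real_def)
      finally show ?thesis .
    qed
    ultimately show ?case by (simp add: mult.commute)
  qed
qed

text \<open>The increment of E lies between minus the increments of \<open>Phi\<close> at the two
  maximisers G y t and G y s. By the mean value theorem in time and continuity of F and G both equal
  - (s - t) F t (G y t) up to a small error.\<close>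

lemma E_deriv_t: assumes t: "t > 0" shows "((\<lambda>t. E y t) has_real_derivative - F t (G y t)) (at t)"
proof (rule DERIV_squeezeI)
  fix \<epsilon> :: real assume \<epsilon>: "\<epsilon> > 0"
  let ?g = "G y t"
  have "isCont (\<lambda>q. F (fst q) (snd q)) (t, ?g)"
    using F_continuous by (auto simp: continuous_on_eq_continuous_at simp del: split_paired_All)
  then obtain d where d: "d > 0" "\<And>q. dist q (t, ?g) < d \<Longrightarrow> dist (F (fst q) (snd q)) (F t ?g) < \<epsilon>"
    unfolding continuous_at_eps_delta using \<epsilon> by (metis fst_conv snd_conv)
  have d': "\<bar>F s v - F t ?g\<bar> < \<epsilon>" if "\<bar>s - t\<bar> < d / 2" "\<bar>v - ?g\<bar> < d / 2" for s v
  proof -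
    have "dist (s, v) (t, ?g) \<le> \<bar>s - t\<bar> + \<bar>v - ?g\<bar>"
      using norm_Pair_le[of "s - t" "v - ?g"] by (simp add: dist_norm)
    then show ?thesis using d(2)[of "(s, v)"] that by (simp add: dist_real_def)
  qed
  have Gt: "continuous_on {0<..} (\<lambda>t. G y t)"
    by (intro continuous_on_compose2[OF G_continuous, of "{0<..}" "\<lambda>t. (y, t)", simplified] continuous_intros) auto
  then have "((\<lambda>t. G y t) \<longlongrightarrow> ?g) (at t within {0<..})"
    using t unfolding continuous_on_def by blast
  then have "((\<lambda>t. G y t) \<longlongrightarrow> ?g) (at t)"
    using t at_within_open[of t "{0<..}"] by simp
  then have "\<forall>\<^sub>F s in at t. dist (G y s) ?g < d / 2" using d(1) by (intro tendstoD) auto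
  moreover have "\<forall>\<^sub>F s in at t. s \<in> {0<..}" using t by (intro eventually_at_in_open') auto
  moreover have "\<forall>\<^sub>F s in at t. dist s t < d / 2" using d(1) by (intro tendstoD[OF tendsto_ident_at]) auto
  ultimately show "\<forall>\<^sub>F s in at t. \<bar>E y s - E y t - (s - t) * - F t ?g\<bar> \<le> \<epsilon> * \<bar>s - t\<bar>"
  proof eventually_elim
    case (elim s)
    have mv: "\<bar>Phi v s - Phi v t - (s - t) * F t ?g\<bar> \<le> \<epsilon> * \<bar>s - t\<bar>" if v: "\<bar>v - ?g\<bar> < d / 2" for v
    proof -
      have "\<exists>z. \<bar>z - t\<bar> \<le> \<bar>s - t\<bar> \<and> Phi v s - Phi v t = (s - t) * F z v"
      proof -
        consider "s > t" | "s < t" | "s = t" by linarith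
        then show ?thesis
        proof cases
          case 1
          then obtain z where "t < z" "z < s" "Phi v s - Phi v t = (s - t) * F z v"
            using MVT2[of t s "Phi v" "\<lambda>z. F z v"] Phi_deriv_t t by force
          then show ?thesis by (intro exI[of _ z]) auto
        next
          case 2
          then obtain z where "s < z" "z < t" "Phi v t - Phi v s = (t - s) * F z v"
            using MVT2[of s t "Phi v" "\<lambda>z. F z v"] Phi_deriv_t elim(2) by force
          then show ?thesis by (intro exI[of _ z]) (auto simp: algebra_simps)
        qed (auto intro: exI[of _ t])
      qed
      then obtain z where z: "\<bar>z - t\<bar> \<le> \<bar>s - t\<bar>" "Phi v s - Phi v t = (s - t) * F z v" by blast
      have "\<bar>F z v - F t ?g\<bar> < \<epsilon>" using d'[of z v] v z(1) elim(3) by (simp add: dist_real_def)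
      moreover have "Phi v s - Phi v t - (s - t) * F t ?g = (s - t) * (F z v - F t ?g)"
        using z(2) by (simp add: algebra_simps)
      ultimately show ?thesis by (simp add: abs_mult mult.commute[of \<epsilon>] mult_left_mono)
    qed
    have "y * ?g - Phi ?g s \<le> E y s" "y * G y s - Phi (G y s) t \<le> E y t" using E_ge t elim(2) by auto
    then have "- (Phi ?g s - Phi ?g t) \<le> E y s - E y t" "E y s - E y t \<le> - (Phi (G y s) s - Phi (G y s) t)"
      by (simp_all add: E_def)
    then show ?case using mv[of ?g] mv[of "G y s"] elim(1) d(1) by (simp add: dist_real_def)
  qed
qed

lemma E_0 [simp]: "E 0 t = 0"
  by (simp add: E_def Phi_def)

lemma E_pos: assumes "t \<ge> 0" "y \<noteq> 0" shows "0 < E y t"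
proof -
  have G0: "(\<lambda>z. E z t) 0 = 0" by simp
  consider "y > 0" | "y < 0" using assms by linarith
  then show ?thesis
  proof cases
    case 1
    then obtain z where "0 < z" "E y t - E 0 t = (y - 0) * G z t"
      using MVT2[of 0 y "\<lambda>y. E y t" "\<lambda>y. G y t"] E_deriv_y[OF assms(1)] by blast
    then show ?thesis using 1 G_mono[of 0 z t] by simp
  next
    case 2
    then obtain z where "z < 0" "E 0 t - E y t = (0 - y) * G z t"
      using MVT2[of y 0 "\<lambda>y. E y t" "\<lambda>y. G y t"] E_deriv_y[OF assms(1)] by blast
    then show ?thesis using 2 G_mono[of z 0 t] by (simp add: mult_neg_neg)
  qed
qed

lemma E_continuous: "continuous_on (UNIV \<times> {0<..}) (\<lambda>q. E (fst q) (snd q))"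
proof -
  have "((\<lambda>(y, t). E y t) has_derivative
     (\<lambda>(ty, tt). G y0 t0 * ty + blinfun_mult_right (- F t0 (G y0 t0)) tt)) (at (y0, t0) within UNIV \<times> {0<..})"
    if t0: "t0 > 0" for y0 t0
  proof (rule has_derivative_partialsI[where fy = "\<lambda>y t. blinfun_mult_right (- F t (G y t))"])
    show "((\<lambda>y. E y t0) has_derivative (*) (G y0 t0)) (at y0)"
      using E_deriv_y[of t0 y0] t0 by (simp add: has_field_derivative_def)
    show "((\<lambda>t. E y t) has_derivative blinfun_mult_right (- F t (G y t))) (at t within {0<..})" if "t \<in> {0<..}" for y t
      using E_deriv_t[of t y] that has_derivative_at_withinI by (simp add: has_field_derivative_def)
    have "continuous_on (UNIV \<times> {0<..}) (\<lambda>q. blinfun_mult_right (- F (snd q) (G (fst q) (snd q))))"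
      by (intro continuous_intros continuous_on_subset[OF G_continuous]) auto
    then show "continuous (at (y0, t0) within UNIV \<times> {0<..}) (\<lambda>(y, t). blinfun_mult_right (- F t (G y t)))"
      using t0 by (auto simp: continuous_on_eq_continuous_within split_beta')
  qed (use t0 in auto)
  then have "continuous (at q within UNIV \<times> {0<..}) (\<lambda>(y, t). E y t)" if "q \<in> UNIV \<times> {0<..}" for q
    using that has_derivative_continuous by (cases q) blast
  then show ?thesis by (simp add: continuous_on_eq_continuous_within split_beta')
qed

lemma F_lip: "\<exists>L\<ge>0. \<forall>t\<in>{\<tau>..T}. \<forall>a\<in>{-B..B}. \<forall>b\<in>{-B..B}. \<bar>F t a - F t b\<bar> \<le> L * \<bar>a - b\<bar>"
proof -
  have "bounded ((\<lambda>q. F' (fst q) (snd q)) ` ({\<tau>..T} \<times> {-B..B}))"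
    by (intro compact_imp_bounded compact_continuous_image continuous_on_subset[OF F'_continuous] compact_Times) auto
  then obtain L where L: "\<forall>x\<in>(\<lambda>q. F' (fst q) (snd q)) ` ({\<tau>..T} \<times> {-B..B}). norm x \<le> L"
    unfolding bounded_iff by blast
  have L': "\<bar>F' t v\<bar> \<le> \<bar>L\<bar>" if "t \<in> {\<tau>..T}" "v \<in> {-B..B}" for t v
    using bspec[OF L, of "F' t v"] that by force
  have "\<bar>F t a - F t b\<bar> \<le> \<bar>L\<bar> * \<bar>a - b\<bar>" if t: "t \<in> {\<tau>..T}" and ab: "a \<in> {-B..B}" "b \<in> {-B..B}" for t a b
    using field_differentiable_bound[of "{-B..B}" "F t" "F' t" "\<bar>L\<bar>" b a, OF _ has_field_derivative_at_within[OF F_deriv]] t ab L'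
    by (simp add: abs_minus_commute)
  then show ?thesis by (intro exI[of _ "\<bar>L\<bar>"]) auto
qed

text \<open>Clamping the time at 0 makes the fan continuous on the whole plane, so that its
  admissibility is immediate.\<close>

definition fan where "fan a p = G (fst p - a) (max 0 (snd p))"

lemma fan_continuous: "continuous_on UNIV (fan a)"
  unfolding fan_def[abs_def]
proof -
  have c: "continuous_on UNIV (\<lambda>p::real \<times> real. (fst p - a, max 0 (snd p)))" by (intro continuous_intros)
  have r: "range (\<lambda>p::real \<times> real. (fst p - a, max 0 (snd p))) \<subseteq> UNIV \<times> {0..}" by auto
  show "continuous_on UNIV (\<lambda>p. G (fst p - a) (max 0 (snd p)))"
    using continuous_on_compose2[OF G_continuous c r] by simp
qed

lemma fan_eq: "snd p > 0 \<Longrightarrow> fan a p = G (fst p - a) (snd p)"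
  by (simp add: fan_def)

text \<open>At every time f' e \<le> H e t, so a point closer than f' e to the centre sees values
  below e uniformly in time. This is why short packets carry small values forever.\<close>

lemma G_small: assumes "0 \<le> y" "y < f' e" "e > 0" shows "0 \<le> G y t" "G y t < e"
  using assms H_ge[of e t] by (auto simp: G_less_iff G_le_iff)

lemma G_small_neg: assumes "y \<le> 0" "f' (-e) < y" "e > 0" shows "G y t \<le> 0" "- e < G y t"
  using assms H_le[of "-e" t] by (auto simp: G_less_iff G_le_iff)

lemma borel_measurable_if_pos:
  fixes g :: "real \<Rightarrow> real"
  assumes "continuous_on {0<..} g"
  shows "(\<lambda>t. if t > 0 then g t else 0) \<in> borel_measurable borel"
  using borel_measurable_continuous_on_if[OF _ assms, of "\<lambda>_. 0"] by simp

lemma borel_measurable_if_pos2: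
  fixes g :: "real \<times> real \<Rightarrow> real"
  assumes "continuous_on (UNIV \<times> {0<..}) g"
  shows "(\<lambda>p. if snd p > 0 then g p else 0) \<in> borel_measurable borel"
proof -
  have "UNIV \<times> {0::real<..} \<in> sets (borel :: (real \<times> real) measure)" by (simp add: open_Times)
  moreover have "(p \<in> UNIV \<times> {0::real<..}) = (snd p > 0)" for p :: "real \<times> real" by (cases p) simp
  ultimately show ?thesis
    using borel_measurable_continuous_on_if[OF _ assms, of "\<lambda>_. 0"] by simp
qed

lemma Phi_slope:
  assumes "t \<ge> 0" "a < b"
  shows "H a t < (Phi b t - Phi a t) / (b - a)" "(Phi b t - Phi a t) / (b - a) < H b t"
proof -
  obtain z where z: "a < z" "z < b" "Phi b t - Phi a t = (b - a) * H z t"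
    using MVT2[of a b "\<lambda>v. Phi v t" "\<lambda>v. H v t"] Phi_deriv assms by blast
  then show "H a t < (Phi b t - Phi a t) / (b - a)" "(Phi b t - Phi a t) / (b - a) < H b t"
    using H_mono[of a z t] H_mono[of z b t] assms by simp_all
qed

end

section \<open>Fans and shocks\<close>

locale flux_test = flux f f' \<beta> for f f' \<beta> :: "real \<Rightarrow> real" +
  fixes R \<tau> T :: real and w :: "real \<times> real \<Rightarrow> real"
  assumes tau: "0 < \<tau>" "\<tau> \<le> T"
    and w_meas: "w \<in> borel_measurable borel" and w_bdd: "\<exists>B. \<forall>p. \<bar>w p\<bar> \<le> B"
begin

sublocale kruzhkov F R \<tau> T w
proof
qed (use tau w_meas w_bdd F_continuous F_lip in auto)

lemma adm_const: "adm (\<lambda>_. k)"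
  by (auto simp: adm_def)

lemma adm_continuous: assumes "continuous_on UNIV U" shows "adm U"
proof -
  have "bounded (U ` K)"
    using K_props(3) by (intro compact_imp_bounded compact_continuous_image continuous_on_subset[OF assms]) auto
  then obtain B where "\<forall>x\<in>U ` K. norm x \<le> B" unfolding bounded_iff by blast
  then have "\<forall>p\<in>K. \<bar>U p\<bar> \<le> B" by simp
  then show ?thesis using borel_measurable_continuous_onI[OF assms] unfolding adm_def by blast
qed

lemma KI_closed: "adm U \<Longrightarrow> (\<And>e. e > 0 \<Longrightarrow> KI e U) \<Longrightarrow> KI 0 U"
  by (rule KI_close) (auto intro!: exI[of _ U])

text \<open>A staircase of N steps of height h = 2 M / N. Each step line moves with its
  Rankine-Hugoniot speed and costs 2 \<omega> h (T - \<tau>), where \<omega> bounds the oscillation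
  of \<open>F'\<close> over one step; the total 4 M (T - \<tau>) \<omega> is small by uniform
  continuity of \<open>F'\<close>.\<close>

lemma KI_fan:
  assumes const: "\<And>k. KI 0 (\<lambda>_. k)"
  shows "KI 0 (fan a)"
proof (rule KI_close[OF adm_continuous[OF fan_continuous]])
  fix \<epsilon> :: real assume \<epsilon>: "\<epsilon> > 0"
  obtain M0 where M0: "\<forall>p\<in>K. \<bar>fan a p\<bar> \<le> M0" using adm_continuous[OF fan_continuous, of a] unfolding adm_def by blast
  define M where "M = \<bar>M0\<bar> + 1"
  have M: "M > 0" "\<And>p. p \<in> K \<Longrightarrow> \<bar>fan a p\<bar> \<le> M" using M0 unfolding M_def by force+
  \<comment> \<open>Chosen from the total error 4 M (T - \<tau>) \<omega>; the summand 1 covers T =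
    \<tau>.\<close>
  define \<omega> where "\<omega> = \<epsilon> / (4 * M * (T - \<tau>) + 1)"
  have den: "4 * M * (T - \<tau>) + 1 > 0" using M tau by (simp add: add_nonneg_pos)
  have \<omega>: "\<omega> > 0" "4 * M * (T - \<tau>) * \<omega> \<le> \<epsilon>"
  proof -
    show "\<omega> > 0" using \<epsilon> den by (simp add: \<omega>_def)
    have "4 * M * (T - \<tau>) * \<omega> = \<epsilon> * (4 * M * (T - \<tau>) / (4 * M * (T - \<tau>) + 1))" by (simp add: \<omega>_def)
    also have "\<dots> \<le> \<epsilon> * 1" using \<epsilon> den by (intro mult_left_mono) auto
    finally show "4 * M * (T - \<tau>) * \<omega> \<le> \<epsilon>" by simp
  qed
  have "uniformly_continuous_on ({\<tau>..T} \<times> {-M..M}) (\<lambda>q. F' (fst q) (snd q))"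
    by (intro compact_uniformly_continuous continuous_on_subset[OF F'_continuous] compact_Times) auto
  then obtain d where d: "d > 0" "\<And>q q'. q \<in> {\<tau>..T} \<times> {-M..M} \<Longrightarrow> q' \<in> {\<tau>..T} \<times> {-M..M} \<Longrightarrow> dist q' q < d \<Longrightarrow>
      dist (F' (fst q') (snd q')) (F' (fst q) (snd q)) < \<omega>"
    using \<omega>(1) unfolding uniformly_continuous_on_def by metis
  have d': "\<bar>F' t v - F' t v'\<bar> \<le> \<omega>" if "t \<in> {\<tau>..T}" "v \<in> {-M..M}" "v' \<in> {-M..M}" "\<bar>v - v'\<bar> < d" for t v v'
    using d(2)[of "(t, v')" "(t, v)"] that by (simp add: dist_Pair_Pair dist_real_def)
  obtain N :: nat where N: "2 * M / min d \<epsilon> < real N" using reals_Archimedean2 by blast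
  have mde: "min d \<epsilon> > 0" using d(1) \<epsilon> by simp
  have "0 < 2 * M / min d \<epsilon>" using M mde by (intro divide_pos_pos) auto
  then have Npos: "real N > 0" using N by linarith
  define h where "h = 2 * M / real N"
  have h: "h > 0" "h < d" "h < \<epsilon>" "real N * h = 2 * M"
  proof -
    show "h > 0" "real N * h = 2 * M" using Npos M by (simp_all add: h_def)
    have "2 * M < real N * min d \<epsilon>" using N mde by (simp add: pos_divide_less_eq)
    then have "2 * M < min d \<epsilon> * real N" by (simp only: mult.commute)
    then have "h < min d \<epsilon>" unfolding h_def using Npos by (subst pos_divide_less_eq)
    then show "h < d" "h < \<epsilon>" by auto
  qed
  define k where "k j = - M + real j * h" for j :: nat
  have kS: "k (Suc j) = k j + h" for j by (simp add: k_def algebra_simps)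
  have kM: "k j \<in> {-M..M}" if "j \<le> N" for j
  proof -
    have "real j * h \<le> real N * h" using that h by (intro mult_right_mono) auto
    then show ?thesis using h M by (simp add: k_def)
  qed
  \<comment> \<open>The chord slope of \<open>Phi\<close> over one step, shifted by a: its time
    derivative is the chord slope of F, the Rankine-Hugoniot speed, and it lies between the
    characteristic positions of the two step values.\<close>
  define x\<^sub>s where "x\<^sub>s j t = a + (Phi (k (Suc j)) t - Phi (k j) t) / h" for j t
  define xi where "xi j t = (if t > 0 then x\<^sub>s j t else 0)" for j t
  define xi' where "xi' j t = (F t (k (Suc j)) - F t (k j)) / h" for j t
  have slope: "H (k j) t < x\<^sub>s j t - a" "x\<^sub>s j t - a < H (k (Suc j)) t" if "t > 0" for j t
    using Phi_slope[of t "k j" "k (Suc j)"] that h by (simp_all add: x\<^sub>s_def kS)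
  have xsd: "(x\<^sub>s j has_real_derivative xi' j t) (at t)" if t: "t > 0" for j t
    unfolding x\<^sub>s_def[abs_def] xi'_def
    using DERIV_add[OF DERIV_const[of a "at t"] DERIV_cdivide[OF DERIV_diff[OF Phi_deriv_t[OF t, of "k (Suc j)"] Phi_deriv_t[OF t, of "k j"]], of h]] by simp
  have xid: "(xi j has_real_derivative xi' j t) (at t)" if t: "t > 0" for j t
  proof -
    have "\<forall>\<^sub>F s in nhds t. s \<in> {0<..}" using t by (intro eventually_nhds_in_open) auto
    then have "\<forall>\<^sub>F s in nhds t. xi j s = x\<^sub>s j s" by eventually_elim (simp add: xi_def)
    then show ?thesis using DERIV_cong_ev[of t t "xi j" "x\<^sub>s j" "xi' j t" "xi' j t"] xsd[OF t] by simp
  qed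
  have xim: "xi j \<in> borel_measurable borel" for j
    unfolding xi_def[abs_def]
    by (rule borel_measurable_if_pos) (use xsd in \<open>auto intro!: DERIV_continuous_on intro: has_field_derivative_at_within\<close>)
  \<comment> \<open>The staircase is built from the left, each stage overwriting everything to the
    right of the next step line. The lines are ordered, so stage j is the constant
    \<open>k j\<close> to the right of line j; \<open>Sk\<close> records this for the
    bracket.\<close>
  define S where "S = rec_nat (\<lambda>_. k 0) (\<lambda>j s p. if fst p > xi j (snd p) then k (Suc j) else s p)"
  have S0: "S 0 = (\<lambda>_. k 0)" and SS: "S (Suc j) = (\<lambda>p. if fst p > xi j (snd p) then k (Suc j) else S j p)" for j
    unfolding S_def by simp_all
  have Sk: "S j p = k j" if "fst p > xi j (snd p)" "snd p > 0" for j p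
  proof (cases j)
    case (Suc i)
    have "x\<^sub>s i (snd p) < x\<^sub>s j (snd p)" using slope(2)[OF that(2), of i] slope(1)[OF that(2), of j] unfolding Suc by linarith
    then show ?thesis using that Suc by (simp add: SS xi_def)
  qed (simp add: S0)
  have adm_S: "adm (S j)" for j
  proof (induction j)
    case (Suc j)
    have "adm (\<lambda>p. if fst p - xi j (snd p) > 0 then k (Suc j) else S j p)"
      by (intro adm_join Suc adm_const borel_measurable_diff borel_measurable_fst_snd
          measurable_compose[OF borel_measurable_fst_snd(2) xim])
    then show ?case by (simp add: SS)
  qed (simp add: S0 adm_const)
  have "j \<le> N \<Longrightarrow> KI (real j * (2 * (\<omega> * h) * (T - \<tau>))) (S j)" for j
  proof (induction j)
    case 0
    then show ?case using const by (simp add: S0)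
  next
    case (Suc j)
    have "KI (real j * (2 * (\<omega> * h) * (T - \<tau>)) + 0 + 2 * (\<omega> * h) * (T - \<tau>)) (S (Suc j))"
      unfolding SS
    proof (rule KI_line[OF adm_S _ adm_const const xim, where ?d0.0 = 1 and \<xi>' = "xi' j"])
      show "KI (real j * (2 * (\<omega> * h) * (T - \<tau>))) (S j)" using Suc by simp
      show "continuous_on {0<..} (xi' j)" unfolding xi'_def[abs_def] by (intro continuous_intros) (use h in auto)
      fix p assume p: "p \<in> K" "xi j (snd p) < fst p"
      let ?t = "snd p"
      have t: "?t \<in> {\<tau>..T}" "?t > 0" using K_mem p by auto
      have Sj: "S j p = k j" using Sk p t by blast
      have bracket: "Q ?t (w p) (k (Suc j)) - Q ?t (w p) (k j) - xi' j ?t * (\<bar>w p - k (Suc j)\<bar> - \<bar>w p - k j\<bar>) \<le> \<omega> * (k (Suc j) - k j)"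
      proof (rule chord_bracket)
        fix c assume c: "k j \<le> c" "c \<le> k (Suc j)"
        have kj: "k j \<in> {-M..M}" "k (Suc j) \<in> {-M..M}" using kM Suc.prems by simp_all
        have kk: "k j < k (Suc j)" using h by (simp add: kS)
        have mv: "\<exists>z. x \<le> z \<and> z \<le> y \<and> F ?t y - F ?t x = (y - x) * F' ?t z" if "x \<le> y" for x y
        proof (cases "x = y")
          case False
          then obtain z where "x < z" "z < y" "F ?t y - F ?t x = (y - x) * F' ?t z"
            using MVT2[of x y "F ?t" "F' ?t"] F_deriv \<open>x \<le> y\<close> by (metis order_le_imp_less_or_eq)
          then show ?thesis by (intro exI[of _ z]) simp
        qed auto
        obtain z0 where z0: "k j \<le> z0" "z0 \<le> k (Suc j)" "F ?t (k (Suc j)) - F ?t (k j) = h * F' ?t z0"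
          using mv[of "k j" "k (Suc j)"] kk by (auto simp: kS)
        obtain z1 where z1: "k j \<le> z1" "z1 \<le> c" "F ?t c - F ?t (k j) = (c - k j) * F' ?t z1" using mv[OF c(1)] by blast
        obtain z2 where z2: "c \<le> z2" "z2 \<le> k (Suc j)" "F ?t (k (Suc j)) - F ?t c = (k (Suc j) - c) * F' ?t z2" using mv[OF c(2)] by blast
        have s: "xi' j ?t = F' ?t z0" using z0 h by (simp add: xi'_def)
        have d1: "\<bar>F' ?t z1 - F' ?t z0\<bar> \<le> \<omega>" "\<bar>F' ?t z2 - F' ?t z0\<bar> \<le> \<omega>"
          using t kj z0 z1 z2 c h by (auto intro!: d' simp: kS)
        have "F ?t c - F ?t (k j) - xi' j ?t * (c - k j) = (F' ?t z1 - F' ?t z0) * (c - k j)"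
          unfolding s z1(3) by (simp add: algebra_simps)
        then have "\<bar>F ?t c - F ?t (k j) - xi' j ?t * (c - k j)\<bar> \<le> \<omega> * (c - k j)"
          using d1(1) c by (simp add: abs_mult mult_right_mono)
        moreover have "F ?t (k (Suc j)) - F ?t c - xi' j ?t * (k (Suc j) - c) = (F' ?t z2 - F' ?t z0) * (k (Suc j) - c)"
          unfolding s z2(3) by (simp add: algebra_simps)
        then have "\<bar>F ?t (k (Suc j)) - F ?t c - xi' j ?t * (k (Suc j) - c)\<bar> \<le> \<omega> * (k (Suc j) - c)"
          using d1(2) c by (simp add: abs_mult mult_right_mono)
        ultimately show "\<bar>F ?t c - F ?t (k j) - xi' j ?t * (c - k j)\<bar> \<le> \<omega> * (c - k j) \<and>
          \<bar>F ?t (k (Suc j)) - F ?t c - xi' j ?t * (k (Suc j) - c)\<bar> \<le> \<omega> * (k (Suc j) - c)" by blast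
      qed (use h \<omega> in \<open>simp_all add: kS xi'_def\<close>)
      then show "Q ?t (w p) (k (Suc j)) - Q ?t (w p) (S j p) - xi' j ?t * (\<bar>w p - k (Suc j)\<bar> - \<bar>w p - S j p\<bar>) \<le> \<omega> * h"
        by (simp add: Sj kS)
    qed (use xid \<omega> h in auto)
    then show ?case by (simp add: algebra_simps)
  qed
  then have KN: "KI (real N * (2 * (\<omega> * h) * (T - \<tau>))) (S N)" by simp
  have "real N * (2 * (\<omega> * h) * (T - \<tau>)) = (real N * h) * (2 * \<omega> * (T - \<tau>))" by simp
  also have "\<dots> = 4 * M * (T - \<tau>) * \<omega>" unfolding h(4) by simp
  also have "\<dots> \<le> \<epsilon>" by (rule \<omega>(2))
  finally have KN': "KI \<epsilon> (S N)" by (rule KI_mono[OF KN])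
  have close: "\<bar>S N p - fan a p\<bar> \<le> \<epsilon>" if p: "p \<in> K" for p
  proof -
    let ?t = "snd p" and ?y = "fst p - a"
    have t: "?t > 0" using K_mem p by auto
    \<comment> \<open>The value \<open>k i\<close> is taken where the characteristic coordinate lies
      between those of \<open>k (i - 1)\<close> and \<open>k (i + 1)\<close>, so the fan differs
      from \<open>k i\<close> by at most h. At the extreme indices one of the bounds is missing, and
      the bound M on the fan replaces it.\<close>
    have "\<exists>i\<le>j. S j p = k i \<and> (0 < i \<longrightarrow> H (k (i - 1)) ?t < ?y) \<and> (i < j \<longrightarrow> ?y < H (k (Suc i)) ?t)" for j
    proof (induction j)
      case (Suc j)
      show ?case
      proof (cases "fst p > xi j ?t")
        case True
        then have "H (k j) ?t < ?y" using slope(1)[OF t, of j] t by (simp add: xi_def)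
        then show ?thesis using True by (intro exI[of _ "Suc j"]) (simp add: SS)
      next
        case False
        from Suc obtain i where i: "i \<le> j" "S j p = k i" "0 < i \<longrightarrow> H (k (i - 1)) ?t < ?y" "i < j \<longrightarrow> ?y < H (k (Suc i)) ?t" by blast
        have "?y < H (k (Suc j)) ?t" using False slope(2)[OF t, of j] t by (simp add: xi_def)
        then have "?y < H (k (Suc i)) ?t" using i by (cases "i = j") auto
        then show ?thesis using i False by (intro exI[of _ i]) (simp add: SS)
      qed
    qed (simp add: S0)
    then obtain i where i: "i \<le> N" "S N p = k i" "0 < i \<longrightarrow> H (k (i - 1)) ?t < ?y" "i < N \<longrightarrow> ?y < H (k (Suc i)) ?t" by blast
    have fa: "fan a p = G ?y ?t" using t by (simp add: fan_eq)
    have "k i - h \<le> fan a p"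
    proof (cases i)
      case 0
      then show ?thesis using M(2)[OF p] h by (simp add: k_def)
    next
      case (Suc j)
      then have "k j < G ?y ?t" using i by (simp add: G_less_iff)
      then show ?thesis using Suc fa by (simp add: kS)
    qed
    moreover have "fan a p \<le> k i + h"
    proof (cases "i = N")
      case True
      then have "k i = M" using h by (simp add: k_def)
      then show ?thesis using M(2)[OF p] h by simp
    next
      case False
      then have "G ?y ?t < k (Suc i)" using i by (simp add: G_less_iff)
      then show ?thesis using fa by (simp add: kS)
    qed
    ultimately show ?thesis using i(2) h(3) by simp
  qed
  show "\<exists>U'. adm U' \<and> KI \<epsilon> U' \<and> (\<forall>p\<in>K. \<bar>U' p - fan a p\<bar> \<le> \<epsilon>)"
    using adm_S KN' close by blast
qed

text \<open>Across a stationary line at which the jump tends to 0 the bracket is small by Lipschitz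
  continuity, so the join becomes free when the error tends to 0. The line is a node, where a fan
  has the value 0.\<close>

lemma KI_node:
  assumes U1: "adm U1" "KI 0 U1" and U2: "adm U2" "KI 0 U2"
    and near: "\<And>\<eta>. \<eta> > 0 \<Longrightarrow> \<exists>d>0. \<forall>p\<in>K. z < fst p \<longrightarrow> fst p < z + d \<longrightarrow> \<bar>U2 p - U1 p\<bar> \<le> \<eta>"
  shows "KI 0 (\<lambda>p. if fst p > z then U2 p else U1 p)"
proof (rule KI_closed)
  have "adm (\<lambda>p. if fst p - z > 0 then U2 p else U1 p)" by (intro adm_join U1 U2) measurable
  then show "adm (\<lambda>p. if fst p > z then U2 p else U1 p)" by simp
  fix e :: real assume e: "e > 0"
  obtain B L where BL: "L \<ge> 0" "B \<ge> 0" "\<And>p. w p \<in> {-B..B}" "\<And>p. p \<in> K \<Longrightarrow> U1 p \<in> {-B..B}" "\<And>p. p \<in> K \<Longrightarrow> U2 p \<in> {-B..B}"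
    "\<And>t a b. t \<in> {\<tau>..T} \<Longrightarrow> a \<in> {-B..B} \<Longrightarrow> b \<in> {-B..B} \<Longrightarrow> \<bar>F t a - F t b\<bar> \<le> L * \<bar>a - b\<bar>"
    using common_bound[OF U1(1) U2(1)] by metis
  have den: "2 * L * (T - \<tau>) + 1 > 0" using BL(1) tau by (simp add: add_nonneg_pos)
  define \<eta> where "\<eta> = e / (2 * L * (T - \<tau>) + 1)"
  have \<eta>: "\<eta> > 0" "2 * (L * \<eta>) * (T - \<tau>) \<le> e"
  proof -
    show "\<eta> > 0" using e den by (simp add: \<eta>_def)
    have "2 * (L * \<eta>) * (T - \<tau>) = e * (2 * L * (T - \<tau>) / (2 * L * (T - \<tau>) + 1))" by (simp add: \<eta>_def)
    also have "\<dots> \<le> e * 1" using e den by (intro mult_left_mono) auto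
    finally show "2 * (L * \<eta>) * (T - \<tau>) \<le> e" by simp
  qed
  obtain d where d: "d > 0" "\<forall>p\<in>K. z < fst p \<longrightarrow> fst p < z + d \<longrightarrow> \<bar>U2 p - U1 p\<bar> \<le> \<eta>" using near[OF \<eta>(1)] by blast
  have "KI (0 + 0 + 2 * (L * \<eta>) * (T - \<tau>)) (\<lambda>p. if fst p > z then U2 p else U1 p)"
  proof (rule KI_line[OF U1 U2, where ?d0.0 = d and \<xi>' = "\<lambda>_. 0" and \<xi> = "\<lambda>_. z"])
    fix p assume p: "p \<in> K" "z < fst p" "fst p < z + d"
    have "\<bar>Q (snd p) (w p) (U2 p) - Q (snd p) (w p) (U1 p)\<bar> \<le> L * \<bar>U2 p - U1 p\<bar>"
      using K_mem[OF p(1)] BL p(1) by (intro Q_diff_bound[where B=B]) auto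
    also have "\<dots> \<le> L * \<eta>" using d p BL(1) by (intro mult_left_mono) auto
    finally show "Q (snd p) (w p) (U2 p) - Q (snd p) (w p) (U1 p) - 0 * (\<bar>w p - U2 p\<bar> - \<bar>w p - U1 p\<bar>) \<le> L * \<eta>"
      by simp
  qed (use BL \<eta> d in auto)
  then show "KI e (\<lambda>p. if fst p > z then U2 p else U1 p)" using KI_mono \<eta>(2) by fastforce
qed

end

section \<open>Packets between neighbouring nodes\<close>

locale packets = flux +
  fixes z :: "nat \<Rightarrow> real"
  assumes z_mono: "strict_mono z" and z_gap: "(\<lambda>i. z (Suc i) - z i) \<longlonglongrightarrow> 0"
begin

text \<open>The Lax--Oleinik comparison of two neighbouring fans: they meet along \<open>P i = 0\<close>. There
\<open>\<partial>P/\<partial>x\<close> and \<open>- \<partial>P/\<partial>t\<close> are the jumps of the solution and of the flux, so the Rankine--Hugoniot condition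
holds without the shock curve having to be solved for.\<close>

definition P where "P i x t = E (x - z i) t - E (x - z (Suc i)) t"
definition W where "W i x t = (if P i x t > 0 then G (x - z (Suc i)) t else G (x - z i) t)"
text \<open>Cells are open on the left and closed on the right, which makes the index unique; the
  value is 0 to the left of \<open>z 0\<close> and beyond all nodes.\<close>

definition V where "V x t = (if \<exists>i. z i < x \<and> x \<le> z (Suc i) then W (THE i. z i < x \<and> x \<le> z (Suc i)) x t else 0)"

lemma z_less: "i < j \<Longrightarrow> z i < z j"
  using z_mono by (rule strict_monoD)

lemma z_le: "i \<le> j \<Longrightarrow> z i \<le> z j"
  using z_less[of i j] by (cases "i = j") auto

lemma packet_unique:
  assumes "z i < x" "x \<le> z (Suc i)" "z j < x" "x \<le> z (Suc j)"
  shows "i = j"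
proof (rule ccontr)
  assume "i \<noteq> j"
  then consider "Suc i \<le> j" | "Suc j \<le> i" by linarith
  then show False using z_le[of "Suc i" j] z_le[of "Suc j" i] assms by cases auto
qed

lemma V_packet: assumes "z i < x" "x \<le> z (Suc i)" shows "V x t = W i x t"
proof -
  have "(THE i. z i < x \<and> x \<le> z (Suc i)) = i" using assms packet_unique by blast
  then show ?thesis using assms by (auto simp: V_def)
qed

lemma V_outside: "(\<And>i. \<not> (z i < x \<and> x \<le> z (Suc i))) \<Longrightarrow> V x t = 0"
  by (auto simp: V_def)

lemma packet_exists: assumes "z 0 < x" "x \<le> z N" shows "\<exists>i<N. z i < x \<and> x \<le> z (Suc i)"
  using assms(2)
proof (induction N)
  case (Suc N)
  show ?case
  proof (cases "x \<le> z N")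
    case True
    then show ?thesis using Suc.IH less_SucI by blast
  next
    case False
    then show ?thesis using Suc.prems by (intro exI[of _ N]) simp
  qed
qed (use assms in auto)

text \<open>Both fan centres are at most the packet length away, so the estimate holds whichever
  branch is active, and uniformly in time.\<close>

lemma W_small:
  assumes "z i < x" "x \<le> z (Suc i)" "e > 0" "z (Suc i) - z i < f' e" "z (Suc i) - z i < - f' (-e)"
  shows "\<bar>W i x t\<bar> < e"
proof (cases "P i x t > 0")
  case True
  then show ?thesis using G_small_neg[of "x - z (Suc i)" e t] assms by (simp add: W_def)
next
  case False
  then show ?thesis using G_small[of "x - z i" e t] assms by (simp add: W_def)
qed

lemma E_shift_deriv:
  assumes "t \<ge> 0"
  shows "((\<lambda>x. E (x - c) t) has_real_derivative G (x - c) t) (at x)"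
  using DERIV_chain2[OF E_deriv_y[OF assms] DERIV_diff[OF DERIV_ident DERIV_const]] by simp

text \<open>The x-derivative is the difference of the two fans, positive because their centres are
  ordered. Hence there is at most one zero per time slice: one shock per packet.\<close>

lemma P_mono: assumes "t \<ge> 0" "x < y" shows "P i x t < P i y t"
  unfolding P_def
proof (rule DERIV_pos_imp_increasing[OF assms(2)])
  fix x
  have "((\<lambda>x. E (x - z i) t - E (x - z (Suc i)) t) has_real_derivative G (x - z i) t - G (x - z (Suc i)) t) (at x)"
    by (intro DERIV_diff E_shift_deriv assms)
  moreover have "G (x - z (Suc i)) t < G (x - z i) t" using z_less[of i "Suc i"] by (intro G_mono) simp
  ultimately show "\<exists>D. ((\<lambda>x. E (x - z i) t - E (x - z (Suc i)) t) has_real_derivative D) (at x) \<and> 0 < D"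
    by (intro exI[of _ "G (x - z i) t - G (x - z (Suc i)) t"]) simp
qed

text \<open>E vanishes at its own centre and is positive elsewhere, so P has opposite signs at the
  two nodes at every time, which traps the shock.\<close>

lemma P_nodes: assumes "t \<ge> 0" shows "P i (z i) t < 0" "0 < P i (z (Suc i)) t"
  using E_pos[OF assms, of "z i - z (Suc i)"] E_pos[OF assms, of "z (Suc i) - z i"] z_less[of i "Suc i"]
  by (simp_all add: P_def)

lemma P_pos_imp: assumes "t \<ge> 0" "P i x t > 0" shows "z i < x"
  using P_mono[OF assms(1), of x "z i" i] P_nodes(1)[OF assms(1), of i] assms(2)
  by (cases x "z i" rule: linorder_cases) auto

lemma P_pos_right: assumes "t \<ge> 0" "z (Suc i) \<le> x" shows "P i x t > 0"
  using P_mono[OF assms(1), of "z (Suc i)" x i] P_nodes(2)[OF assms(1), of i] assms(2)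
  by (cases "x = z (Suc i)") auto

lemma gap_eventually_small:
  assumes "e > 0"
  shows "\<exists>n. \<forall>i\<ge>n. z (Suc i) - z i < f' e \<and> z (Suc i) - z i < - f' (-e)"
proof -
  have "0 < min (f' e) (- f' (-e))" using strict_monoD[OF f'_mono, of 0 e] strict_monoD[OF f'_mono, of "-e" 0] assms by simp
  then have "\<forall>\<^sub>F i in sequentially. z (Suc i) - z i < min (f' e) (- f' (-e))" by (rule order_tendstoD(2)[OF z_gap])
  then show ?thesis unfolding eventually_sequentially by auto
qed

end

section \<open>Gluing finitely many nodes and passing to the limit\<close>

locale packets_test = packets f f' \<beta> z + flux_test f f' \<beta> R \<tau> T w
  for f f' \<beta> :: "real \<Rightarrow> real" and z :: "nat \<Rightarrow> real" and R \<tau> T :: real and w :: "real \<times> real \<Rightarrow> real" +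
  assumes const: "\<And>k. KI 0 (\<lambda>_. k)"
begin

definition Pc where "Pc i p = (if snd p > 0 then P i (fst p) (snd p) else 0)"

text \<open>The glued function for the nodes up to \<open>z n\<close>, the last fan being continued
  to the right without end. Each stage adds a single shock, so one application of
  \<open>KI_shock\<close> per node suffices.\<close>

primrec A where
  "A 0 = (\<lambda>p. if fst p > z 0 then fan (z 0) p else 0)"
| "A (Suc n) = (\<lambda>p. if Pc n p > 0 then fan (z (Suc n)) p else A n p)"

definition Px where "Px i p = G (fst p - z i) (snd p) - G (fst p - z (Suc i)) (snd p)"
definition Pt where "Pt i p = - F (snd p) (G (fst p - z i) (snd p)) + F (snd p) (G (fst p - z (Suc i)) (snd p))"

lemma E_shift_cont: "continuous_on (UNIV \<times> {0<..}) (\<lambda>p. E (fst p - c) (snd p))"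
proof -
  have c: "continuous_on (UNIV \<times> {0<..}) (\<lambda>p::real \<times> real. (fst p - c, snd p))" by (intro continuous_intros)
  have r: "(\<lambda>p::real \<times> real. (fst p - c, snd p)) ` (UNIV \<times> {0<..}) \<subseteq> UNIV \<times> {0<..}" by auto
  show ?thesis using continuous_on_compose2[OF E_continuous c r] by simp
qed

lemma G_shift_cont: "continuous_on (UNIV \<times> {0<..}) (\<lambda>p. G (fst p - c) (snd p))"
proof -
  have c: "continuous_on (UNIV \<times> {0<..}) (\<lambda>p::real \<times> real. (fst p - c, snd p))" by (intro continuous_intros)
  have "continuous_on (UNIV \<times> {0<..}) (\<lambda>q. G (fst q) (snd q))"
    by (rule continuous_on_subset[OF G_continuous]) auto
  moreover have r: "(\<lambda>p::real \<times> real. (fst p - c, snd p)) ` (UNIV \<times> {0<..}) \<subseteq> UNIV \<times> {0<..}" by auto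
  ultimately show ?thesis using continuous_on_compose2[OF _ c r] by fastforce
qed

lemma Pc_cont: "continuous_on (UNIV \<times> {0<..}) (Pc i)"
proof (rule continuous_on_eq)
  show "continuous_on (UNIV \<times> {0<..}) (\<lambda>p. E (fst p - z i) (snd p) - E (fst p - z (Suc i)) (snd p))"
    by (intro continuous_intros E_shift_cont)
qed (auto simp: Pc_def P_def)

lemma Pc_meas: "Pc i \<in> borel_measurable borel"
proof -
  have "continuous_on (UNIV \<times> {0<..}) (\<lambda>p. E (fst p - z i) (snd p) - E (fst p - z (Suc i)) (snd p))"
    by (intro continuous_intros E_shift_cont)
  from borel_measurable_if_pos2[OF this] show ?thesis unfolding Pc_def[abs_def] P_def .
qed

lemma Pc_deriv_x: assumes "t > 0" shows "((\<lambda>y. Pc i (y, t)) has_real_derivative Px i (x, t)) (at x)"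
  using DERIV_diff[OF E_shift_deriv[of t "z i" x] E_shift_deriv[of t "z (Suc i)" x]] assms
  by (simp add: Pc_def P_def Px_def)

lemma Pc_deriv_t: assumes "t > 0" shows "((\<lambda>s. Pc i (x, s)) has_real_derivative Pt i (x, t)) (at t)"
proof -
  have d: "((\<lambda>s. P i x s) has_real_derivative Pt i (x, t)) (at t)"
    using DERIV_diff[OF E_deriv_t[OF assms, of "x - z i"] E_deriv_t[OF assms, of "x - z (Suc i)"]]
    by (simp add: P_def Pt_def)
  have "\<forall>\<^sub>F s in nhds t. s \<in> {0<..}" using assms by (intro eventually_nhds_in_open) auto
  then have "\<forall>\<^sub>F s in nhds t. Pc i (x, s) = P i x s" by eventually_elim (simp add: Pc_def)
  then show ?thesis using DERIV_cong_ev[of t t "\<lambda>s. Pc i (x, s)" "\<lambda>s. P i x s"] d by simp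
qed

lemma A_eq_fan: assumes "snd p > 0" "z n < fst p" "n = 0 \<or> Pc (n - 1) p > 0" shows "A n p = fan (z n) p"
  using assms by (cases n) auto

text \<open>The shock with index n - 1 lies to the left of \<open>z n\<close>, so only the last fan
  is seen there.\<close>

lemma A_right: assumes "snd p > 0" "z n < fst p" shows "A n p = fan (z n) p"
proof (rule A_eq_fan[OF assms])
  show "n = 0 \<or> Pc (n - 1) p > 0"
    using P_pos_right[of "snd p" "n - 1" "fst p"] assms by (cases n) (auto simp: Pc_def)
qed

lemma A_left: assumes "snd p > 0" "fst p \<le> z 0" shows "A n p = 0"
proof (induction n)
  case (Suc n)
  have "\<not> Pc n p > 0"
    using P_pos_imp[of "snd p" n "fst p"] assms z_le[of 0 n] by (auto simp: Pc_def)
  then show ?case using Suc by simp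
qed (use assms in auto)

lemma A_packet: assumes "snd p > 0" "z i < fst p" "fst p \<le> z (Suc i)" "i < n" shows "A n p = W i (fst p) (snd p)"
  using assms(4)
proof (induction n)
  case (Suc n)
  show ?case
  proof (cases "i = n")
    case True
    then show ?thesis using A_right[OF assms(1,2)] assms(1) by (simp add: W_def Pc_def fan_eq)
  next
    case False
    then have "i < n" using Suc by simp
    moreover have "\<not> Pc n p > 0"
      using P_pos_imp[of "snd p" n "fst p"] assms(1,3) z_le[of "Suc i" n] \<open>i < n\<close> by (auto simp: Pc_def)
    ultimately show ?thesis using Suc by simp
  qed
qed simp

lemma adm_A: "adm (A n)"
proof (induction n)
  case 0
  have "adm (\<lambda>p. if fst p - z 0 > 0 then fan (z 0) p else 0)"
    by (intro adm_join adm_const adm_continuous fan_continuous) measurable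
  then show ?case by simp
next
  case (Suc n)
  show ?case by (simp, intro adm_join Suc adm_continuous fan_continuous Pc_meas)
qed

lemma fan_near:
  assumes "\<eta> > 0"
  shows "\<exists>d>0. \<forall>p\<in>K. c < fst p \<longrightarrow> fst p < c + d \<longrightarrow> \<bar>fan c p\<bar> \<le> \<eta>"
proof (intro exI[of _ "f' \<eta>"] conjI ballI impI)
  show "0 < f' \<eta>" using strict_monoD[OF f'_mono assms] by simp
  fix p assume "p \<in> K" "c < fst p" "fst p < c + f' \<eta>"
  then show "\<bar>fan c p\<bar> \<le> \<eta>" using G_small[of "fst p - c" \<eta> "snd p"] K_mem[of p] assms by (simp add: fan_eq)
qed

lemma KI_A: "KI 0 (A n)"
proof (induction n)
  case 0
  show ?case unfolding A.simps
    by (rule KI_node[OF adm_const const adm_continuous[OF fan_continuous] KI_fan[OF const]])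
      (use fan_near in auto)
next
  case (Suc n)
  have "KI (0 + 0) (\<lambda>p. if Pc n p > 0 then fan (z (Suc n)) p else A n p)"
  proof (rule KI_shock[OF adm_A Suc adm_continuous[OF fan_continuous] KI_fan[OF const] Pc_meas Pc_cont _ _ Pc_deriv_x Pc_deriv_t F_convex])
    show "continuous_on (UNIV \<times> {0<..}) (Px n)"
      unfolding Px_def[abs_def] by (intro continuous_intros G_shift_cont)
    show "continuous_on (UNIV \<times> {0<..}) (Pt n)"
      unfolding Pt_def[abs_def] by (intro continuous_intros G_shift_cont)
    fix p assume p: "p \<in> K" "Pc n p > 0"
    have t: "snd p > 0" using K_mem p by blast
    \<comment> \<open>Beyond the shock curve the point is also beyond \<open>z n\<close>, where
      \<open>A n\<close> is a single fan. The jump is therefore one between two fans on all of P >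
      0, as \<open>KI_shock\<close> demands.\<close>
    have zn: "z n < fst p" using P_pos_imp[of "snd p" n "fst p"] p t by (simp add: Pc_def)
    have "A n p = G (fst p - z n) (snd p)" "fan (z (Suc n)) p = G (fst p - z (Suc n)) (snd p)"
      using A_right[OF t zn] t by (simp_all add: fan_eq)
    then show "fan (z (Suc n)) p < A n p \<and> Px n p = A n p - fan (z (Suc n)) p \<and>
        Pt n p = - (F (snd p) (A n p) - F (snd p) (fan (z (Suc n)) p))"
      using z_less[of n "Suc n"] by (simp add: Px_def Pt_def G_mono)
  qed auto
  then show ?case by simp
qed

text \<open>The cut is placed at a node, where the fan has the value 0; elsewhere it would create a
  genuine jump.\<close>

definition B where "B n p = (if fst p > z n then 0 else A n p)"

lemma adm_B: "adm (B n)"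
proof -
  have "adm (\<lambda>p. if fst p - z n > 0 then 0 else A n p)"
    by (intro adm_join adm_const adm_A) measurable
  then show ?thesis by (simp add: B_def[abs_def])
qed

lemma KI_B: "KI 0 (B n)"
  unfolding B_def[abs_def]
proof (rule KI_node[OF adm_A KI_A adm_const const])
  fix \<eta> :: real assume "\<eta> > 0"
  then obtain d where "d > 0" "\<forall>p\<in>K. z n < fst p \<longrightarrow> fst p < z n + d \<longrightarrow> \<bar>fan (z n) p\<bar> \<le> \<eta>" using fan_near by blast
  then show "\<exists>d>0. \<forall>p\<in>K. z n < fst p \<longrightarrow> fst p < z n + d \<longrightarrow> \<bar>0 - A n p\<bar> \<le> \<eta>"
    using A_right K_mem by (intro exI[of _ d]) auto
qed

definition Vr where "Vr p = (if snd p > 0 then V (fst p) (snd p) else 0)"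

lemma B_eq: assumes "snd p > 0" shows "B n p = (if fst p \<le> z n then V (fst p) (snd p) else 0)"
proof (cases "fst p \<le> z n")
  case True
  show ?thesis
  proof (cases "z 0 < fst p")
    case z0: True
    then obtain i where i: "i < n" "z i < fst p" "fst p \<le> z (Suc i)" using packet_exists True by blast
    then show ?thesis using A_packet[OF assms i(2,3,1)] V_packet[OF i(2,3)] True by (simp add: B_def)
  next
    case False
    then have "V (fst p) (snd p) = 0" using z_le[of 0] by (intro V_outside) (meson leD le_less_trans linorder_not_less zero_le)
    then show ?thesis using A_left[OF assms] False True by (simp add: B_def)
  qed
qed (simp add: B_def)

text \<open>To the right of \<open>z n\<close> all packets are short, so V stays below e there while
  the truncation is 0; to the left the two agree.\<close>

lemma B_close: assumes "e > 0" "\<And>i. i \<ge> n \<Longrightarrow> z (Suc i) - z i < f' e \<and> z (Suc i) - z i < - f' (-e)"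
  shows "snd p > 0 \<Longrightarrow> \<bar>B n p - V (fst p) (snd p)\<bar> < e"
proof (cases "fst p \<le> z n")
  case False
  assume t: "snd p > 0"
  show ?thesis
  proof (cases "\<exists>i. z i < fst p \<and> fst p \<le> z (Suc i)")
    case True
    then obtain i where i: "z i < fst p" "fst p \<le> z (Suc i)" by blast
    have "i \<ge> n" using False i z_le[of "Suc i" n] by (cases "i \<ge> n") auto
    then show ?thesis using W_small[OF i assms(1)] assms(2) V_packet[OF i] B_eq[OF t] False by simp
  next
    case no: False
    then show ?thesis using V_outside[of "fst p"] B_eq[OF t] False assms(1) by simp
  qed
qed (use assms B_eq in auto)

lemma Vr_meas: "Vr \<in> borel_measurable borel"
proof (rule borel_measurable_LIMSEQ_real)
  have [measurable]: "B n \<in> borel_measurable borel" for n using adm_B[of n] by (simp add: adm_def)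
  show "(\<lambda>p. if snd p > 0 then B n p else 0) \<in> borel_measurable borel" for n by measurable
  show "(\<lambda>n. if snd p > 0 then B n p else 0) \<longlonglongrightarrow> Vr p" for p
  proof (cases "snd p > 0")
    case True
    have "(\<lambda>n. B n p) \<longlonglongrightarrow> V (fst p) (snd p)"
    proof (rule LIMSEQ_I)
      fix e :: real assume e: "e > 0"
      then obtain n where n: "\<forall>i\<ge>n. z (Suc i) - z i < f' e \<and> z (Suc i) - z i < - f' (-e)" using gap_eventually_small by blast
      then show "\<exists>no. \<forall>n\<ge>no. norm (B n p - V (fst p) (snd p)) < e"
        using B_close[OF e _ True] by (intro exI[of _ n]) auto
    qed
    then show ?thesis using True by (simp add: Vr_def)
  qed (simp add: Vr_def)
qed

lemma adm_Vr: "adm Vr"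
proof -
  obtain n where n: "\<forall>i\<ge>n. z (Suc i) - z i < f' 1 \<and> z (Suc i) - z i < - f' (-1)" using gap_eventually_small[of 1] by auto
  obtain C where C: "\<forall>p\<in>K. \<bar>B n p\<bar> \<le> C" using adm_B[of n] by (auto simp: adm_def)
  have "\<bar>Vr p\<bar> \<le> C + 1" if p: "p \<in> K" for p
    using bspec[OF C p] B_close[of 1 n p] n K_mem[OF p] by (simp add: Vr_def)
  then show ?thesis using Vr_meas unfolding adm_def by blast
qed

text \<open>Uniform convergence of the truncations \<open>B n\<close> settles a possible
  accumulation point of the nodes: no join is performed there.\<close>

theorem KI_Vr: "KI 0 Vr"
proof (rule KI_close[OF adm_Vr])
  fix e :: real assume e: "e > 0"
  then obtain n where n: "\<forall>i\<ge>n. z (Suc i) - z i < f' e \<and> z (Suc i) - z i < - f' (-e)" using gap_eventually_small by blast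
  have "\<bar>B n p - Vr p\<bar> \<le> e" if p: "p \<in> K" for p
    using B_close[of e n p] e n K_mem[OF p] by (simp add: Vr_def)
  then show "\<exists>U'. adm U' \<and> KI e U' \<and> (\<forall>p\<in>K. \<bar>U' p - Vr p\<bar> \<le> e)"
    using adm_B[of n] KI_mono[OF KI_B[of n], of e] e by (intro exI[of _ "B n"]) auto
qed

end

section \<open>Removing the source term\<close>

lemma AE_lborel_snd:
  assumes "AE t in lborel. Q t"
  shows "AE p in (lborel :: (real \<times> real) measure). Q (snd p)"
proof -
  obtain N where N: "{t\<in>space lborel. \<not> Q t} \<subseteq> N" "emeasure lborel N = 0" "N \<in> sets lborel"
    using AE_E[OF assms] by metis
  have [measurable]: "N \<in> sets borel" using N by simp
  have nn: "N \<in> null_sets lborel" using N by auto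
  have "AE p in lborel \<Otimes>\<^sub>M lborel. snd p \<notin> N"
  proof (rule lborel_pair.AE_pair_measure)
    show "{p \<in> space (lborel \<Otimes>\<^sub>M lborel). snd p \<notin> N} \<in> sets (lborel \<Otimes>\<^sub>M (lborel :: real measure))"
      by measurable
  qed (simp add: AE_not_in[OF nn])
  then have "AE p in (lborel :: (real \<times> real) measure). snd p \<notin> N" unfolding lborel_prod .
  then show ?thesis by eventually_elim (use N in auto)
qed

section \<open>Primitives of bounded measurable functions\<close>

definition prim :: "(real \<Rightarrow> real) \<Rightarrow> real \<Rightarrow> real" where
  "prim c t = integral {0..t} c"

lemma prim_lebesgue:
  fixes c :: "real \<Rightarrow> real"
  assumes [measurable]: "c \<in> borel_measurable borel" and A: "\<And>t. \<bar>c t\<bar> \<le> A"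
  shows "c integrable_on {a..b}" "integral {a..b} c = (\<integral>s. indicator {a..b} s * c s \<partial>lborel)"
proof -
  have i: "integrable lborel (\<lambda>s. indicator {a..b} s * c s)"
    by (rule integrable_bounded_support[where K = "{a..b}" and B = A]) (use A in \<open>auto simp: indicator_def\<close>)
  then have "set_integrable lborel {a..b} c" by (simp add: set_integrable_def)
  from set_borel_integral_eq_integral[OF this]
  show "c integrable_on {a..b}" "integral {a..b} c = (\<integral>s. indicator {a..b} s * c s \<partial>lborel)"
    by (simp_all add: set_lebesgue_integral_def)
qed

lemma prim_nonpos: "t \<le> 0 \<Longrightarrow> prim c t = 0"
  by (cases "t = 0") (simp_all add: prim_def)

lemma prim_lip:
  assumes c: "c \<in> borel_measurable borel" and A: "\<And>t. \<bar>c t\<bar> \<le> A" and st: "0 \<le> s" "s \<le> t"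
  shows "\<bar>prim c t - prim c s\<bar> \<le> A * (t - s)"
proof -
  have "prim c s + integral {s..t} c = prim c t"
    unfolding prim_def using prim_lebesgue(1)[OF c A] st by (intro Henstock_Kurzweil_Integration.integral_combine) auto
  moreover have "norm (integral {s..t} c) \<le> integral {s..t} (\<lambda>_. A)"
    using prim_lebesgue(1)[OF c A] A by (intro integral_norm_bound_integral) auto
  ultimately show ?thesis using st by (simp add: mult.commute abs_le_iff)
qed

lemma prim_bound:
  assumes c: "c \<in> borel_measurable borel" and A: "\<And>t. \<bar>c t\<bar> \<le> A" and t: "t \<le> T" "0 \<le> T"
  shows "\<bar>prim c t\<bar> \<le> A * T"
proof (cases "t \<le> 0")
  case True
  have "0 \<le> A" using A[of 0] by simp
  then show ?thesis using True t by (simp add: prim_nonpos)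
next
  case False
  have "0 \<le> A" using A[of 0] by simp
  then have "A * t \<le> A * T" using t by (intro mult_left_mono)
  then show ?thesis using prim_lip[OF c A, of 0 t] False by (simp add: prim_nonpos)
qed

lemma continuous_on_prim:
  assumes c: "c \<in> borel_measurable borel" and A: "\<And>t. \<bar>c t\<bar> \<le> A"
  shows "continuous_on UNIV (prim c)"
proof -
  have A0: "A \<ge> 0" using A[of 0] by simp
  have lip: "\<bar>prim c t - prim c s\<bar> \<le> A * \<bar>t - s\<bar>" for s t
  proof -
    have *: "\<bar>prim c t - prim c s\<bar> \<le> A * (t - s)" if "s \<le> t" for s t
    proof -
      have p: "prim c x = prim c (max 0 x)" for x by (simp add: max_def prim_nonpos)
      have "\<bar>prim c (max 0 t) - prim c (max 0 s)\<bar> \<le> A * (max 0 t - max 0 s)"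
        using that by (intro prim_lip[OF c A]) auto
      also have "\<dots> \<le> A * (t - s)" using that A0 by (intro mult_left_mono) auto
      finally show ?thesis using p[of t] p[of s] by simp
    qed
    show ?thesis using *[of s t] *[of t s] by (cases "s \<le> t") (auto simp: abs_minus_commute)
  qed
  have "A-lipschitz_on UNIV (prim c)" using A0 lip by (intro lipschitz_onI) (auto simp: dist_real_def)
  then show ?thesis by (rule lipschitz_on_continuous_on)
qed

lemma prim_tendsto:
  assumes c [measurable]: "c \<in> borel_measurable borel" "\<And>n. d n \<in> borel_measurable borel"
    and A: "\<And>t. \<bar>c t\<bar> \<le> A" "\<And>n t. \<bar>d n t\<bar> \<le> A" and lim: "AE t in lborel. (\<lambda>n. d n t) \<longlonglongrightarrow> c t"
  shows "(\<lambda>n. prim (d n) t) \<longlonglongrightarrow> prim c t"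
  unfolding prim_def prim_lebesgue(2)[OF c(1) A(1)] prim_lebesgue(2)[OF c(2) A(2)]
proof (rule integral_dominated_convergence[where w = "\<lambda>s. indicator {0..t} s * A"])
  show "integrable lborel (\<lambda>s. indicator {0..t} s * A)"
    by (rule integrable_bounded_support[where K = "{0..t}" and B = "\<bar>A\<bar>"]) (auto simp: indicator_def)
  show "AE s in lborel. (\<lambda>n. indicator {0..t} s * d n s) \<longlonglongrightarrow> indicator {0..t} s * c s"
    using lim by eventually_elim (intro tendsto_intros)
qed (use A in \<open>auto simp: indicator_def\<close>)

text \<open>Measurability in the gauge-integral sense provides continuous functions converging
  almost everywhere; clamping them to [-A, A] does not disturb the limit, which already lies in this
  interval.\<close>

lemma continuous_AE_approx:
  fixes c :: "real \<Rightarrow> real"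
  assumes c: "c \<in> borel_measurable borel" and A: "\<And>t. \<bar>c t\<bar> \<le> A"
  obtains d where "\<And>n. continuous_on UNIV (d n)" "\<And>n t. \<bar>d n t\<bar> \<le> A" "AE t in lborel. (\<lambda>n. d n t) \<longlonglongrightarrow> c t"
proof -
  have "c \<in> borel_measurable lebesgue" using c by (simp add: measurable_completion)
  then have "c measurable_on UNIV" by (rule lebesgue_measurable_imp_measurable_on) simp
  then obtain N g where N: "negligible N" and g: "\<And>n. continuous_on UNIV (g n)"
    and lim: "\<And>x. x \<notin> N \<Longrightarrow> (\<lambda>n. g n x) \<longlonglongrightarrow> c x" unfolding measurable_on_def by auto
  define d where "d n t = max (- A) (min A (g n t))" for n :: nat and t
  show thesis
  proof
    show "continuous_on UNIV (d n)" for n unfolding d_def[abs_def] by (intro continuous_intros g)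
    show "\<bar>d n t\<bar> \<le> A" for n t using A[of t] by (auto simp: d_def)
    have "AE t in lebesgue. t \<notin> N" using N by (intro AE_not_in) (simp add: negligible_iff_null_sets)
    then have "AE t in lborel. t \<notin> N" by (simp add: AE_completion_iff)
    then show "AE t in lborel. (\<lambda>n. d n t) \<longlonglongrightarrow> c t"
    proof eventually_elim
      case (elim t)
      have "(\<lambda>n. d n t) \<longlonglongrightarrow> max (- A) (min A (c t))" unfolding d_def by (intro tendsto_intros lim elim)
      moreover have "max (- A) (min A (c t)) = c t" using A[of t] by auto
      ultimately show ?case by simp
    qed
  qed
qed

text \<open>Flux g (t, .) and source a (t) w are kept general, so that the given equation (flux f,
  source \<open>\<alpha>\<close>) and the rescaled one (flux F, no source) are both
  instances.\<close>

definition ef where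
  "ef g a w k \<psi> \<psi>x \<psi>t p = \<bar>w p - k\<bar> * \<psi>t p + sgn (w p - k) * (g (snd p) (w p) - g (snd p) k) * \<psi>x p
     + sgn (w p - k) * (a (snd p) * w p) * \<psi> p"
  for g :: "real \<Rightarrow> real \<Rightarrow> real" and a :: "real \<Rightarrow> real" and w :: "real \<times> real \<Rightarrow> real"

definition EI where
  "EI K g a w \<longleftrightarrow> (\<forall>k \<psi> \<psi>x \<psi>t. C1test K \<psi> \<psi>x \<psi>t \<longrightarrow> 0 \<le> (\<integral>p. ef g a w k \<psi> \<psi>x \<psi>t p \<partial>lborel))"

lemma ef_bound:
  assumes "\<bar>w p\<bar> \<le> B" "\<bar>k\<bar> \<le> B" "\<bar>g (snd p) (w p)\<bar> \<le> D" "\<bar>g (snd p) k\<bar> \<le> D" "\<bar>a (snd p)\<bar> \<le> A"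
    "\<bar>\<psi> p\<bar> \<le> M" "\<bar>\<psi>x p\<bar> \<le> M" "\<bar>\<psi>t p\<bar> \<le> M"
  shows "\<bar>ef g a w k \<psi> \<psi>x \<psi>t p\<bar> \<le> 2 * B * M + 2 * D * M + A * B * M"
proof -
  have s: "\<bar>sgn x\<bar> \<le> 1" for x :: real by (simp add: sgn_real_def)
  have pos: "0 \<le> B" "0 \<le> D" "0 \<le> A" "0 \<le> M" using assms by linarith+
  have wk: "\<bar>\<bar>w p - k\<bar>\<bar> \<le> 2 * B" using abs_triangle_ineq4[of "w p" k] assms(1,2) by linarith
  have gg: "\<bar>g (snd p) (w p) - g (snd p) k\<bar> \<le> 2 * D"
    using abs_triangle_ineq4[of "g (snd p) (w p)" "g (snd p) k"] assms(3,4) by linarith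
  have "\<bar>\<bar>w p - k\<bar> * \<psi>t p\<bar> \<le> 2 * B * M"
    unfolding abs_mult by (rule mult_mono[OF wk assms(8)]) (simp_all add: pos)
  moreover have "\<bar>sgn (w p - k) * (g (snd p) (w p) - g (snd p) k) * \<psi>x p\<bar> \<le> 1 * (2 * D) * M"
    unfolding abs_mult by (rule mult_mono[OF mult_mono[OF s gg] assms(7)]) (simp_all add: pos)
  moreover have "\<bar>sgn (w p - k) * (a (snd p) * w p) * \<psi> p\<bar> \<le> 1 * (A * B) * M"
    unfolding abs_mult by (rule mult_mono[OF mult_mono[OF s mult_mono[OF assms(5,1)]] assms(6)]) (simp_all add: pos)
  ultimately show ?thesis unfolding ef_def by linarith
qed

text \<open>Here a is the present source and c the rate to be removed. With c = a the source
  disappears; with a = 0 and a rate of the opposite sign it is restored.\<close>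

locale conv =
  fixes R \<tau> T :: real and g :: "real \<Rightarrow> real \<Rightarrow> real" and a c :: "real \<Rightarrow> real" and w :: "real \<times> real \<Rightarrow> real" and A Bw :: real
  assumes tau: "0 < \<tau>" "\<tau> \<le> T"
    and g_cont: "continuous_on UNIV (\<lambda>q. g (fst q) (snd q))"
    and a_meas [measurable]: "a \<in> borel_measurable borel" and a_bdd: "\<And>t. \<bar>a t\<bar> \<le> A"
    and c_meas [measurable]: "c \<in> borel_measurable borel" and c_bdd: "\<And>t. \<bar>c t\<bar> \<le> A"
    and w_meas [measurable]: "w \<in> borel_measurable borel" and w_bdd: "\<And>p. \<bar>w p\<bar> \<le> Bw"
begin

definition K where "K = cbox (-R, \<tau>) (R, T)"

abbreviation "\<gamma> \<equiv> prim c"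

lemma K_props: "closed K" "bounded K" "compact K" "K \<subseteq> UNIV \<times> {\<tau>..}"
  by (simp_all add: K_def compact_cbox bounded_cbox closed_cbox) (auto simp: cbox_Pair_eq)

lemma K_mem: "p \<in> K \<Longrightarrow> snd p \<in> {\<tau>..T} \<and> snd p > 0"
  using tau by (cases p) (auto simp: K_def cbox_Pair_eq)

lemma g_measurable [measurable]:
  assumes [measurable]: "f \<in> borel_measurable M" "h \<in> borel_measurable M"
  shows "(\<lambda>x. g (f x) (h x)) \<in> borel_measurable M"
  using measurable_compose[OF borel_measurable_Pair[OF assms] borel_measurable_continuous_onI[OF g_cont]] by simp

lemma g_bdd: obtains D where "\<And>t v. t \<in> {\<tau>..T} \<Longrightarrow> \<bar>v\<bar> \<le> B \<Longrightarrow> \<bar>g t v\<bar> \<le> D"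
proof -
  have "bounded ((\<lambda>q. g (fst q) (snd q)) ` ({\<tau>..T} \<times> {-B..B}))"
    by (intro compact_imp_bounded compact_continuous_image continuous_on_subset[OF g_cont] compact_Times) auto
  then obtain D where D: "\<forall>x\<in>(\<lambda>q. g (fst q) (snd q)) ` ({\<tau>..T} \<times> {-B..B}). norm x \<le> D"
    unfolding bounded_iff by blast
  have "\<bar>g t v\<bar> \<le> D" if "t \<in> {\<tau>..T}" "\<bar>v\<bar> \<le> B" for t v
    using bspec[OF D, of "g t v"] that by force
  then show thesis by (rule that)
qed

lemma cont_bdd:
  fixes \<phi> :: "real \<times> real \<Rightarrow> real"
  assumes "continuous_on UNIV \<phi>" "\<And>p. p \<notin> K \<Longrightarrow> \<phi> p = 0"
  shows "\<exists>M. \<forall>p. \<bar>\<phi> p\<bar> \<le> M"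
proof -
  have "bounded (\<phi> ` K)"
    using K_props(3) by (intro compact_imp_bounded compact_continuous_image continuous_on_subset[OF assms(1)]) auto
  then obtain M where M: "\<forall>x\<in>\<phi> ` K. norm x \<le> M" unfolding bounded_iff by blast
  have "\<bar>\<phi> p\<bar> \<le> \<bar>M\<bar>" for p using M assms(2)[of p] by (cases "p \<in> K") force+
  then show ?thesis by blast
qed

lemma test_bdd:
  assumes "C1test K \<psi> \<psi>x \<psi>t"
  obtains M where "M \<ge> 0" "\<And>p. \<bar>\<psi> p\<bar> \<le> M" "\<And>p. \<bar>\<psi>x p\<bar> \<le> M" "\<And>p. \<bar>\<psi>t p\<bar> \<le> M"
proof -
  obtain M1 M2 M3 where M: "\<forall>p. \<bar>\<psi> p\<bar> \<le> M1" "\<forall>p. \<bar>\<psi>x p\<bar> \<le> M2" "\<forall>p. \<bar>\<psi>t p\<bar> \<le> M3"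
    using cont_bdd[of \<psi>] cont_bdd[of \<psi>x] cont_bdd[of \<psi>t] assms unfolding C1test_def by blast
  show thesis
  proof (rule that[of "\<bar>M1\<bar> + \<bar>M2\<bar> + \<bar>M3\<bar>"])
    show "\<bar>\<psi> p\<bar> \<le> \<bar>M1\<bar> + \<bar>M2\<bar> + \<bar>M3\<bar>" "\<bar>\<psi>x p\<bar> \<le> \<bar>M1\<bar> + \<bar>M2\<bar> + \<bar>M3\<bar>" "\<bar>\<psi>t p\<bar> \<le> \<bar>M1\<bar> + \<bar>M2\<bar> + \<bar>M3\<bar>" for p
      using spec[OF M(1), of p] spec[OF M(2), of p] spec[OF M(3), of p] by linarith+
  qed simp
qed

lemma test_meas:
  assumes "C1test K \<psi> \<psi>x \<psi>t"
  shows "\<psi> \<in> borel_measurable borel" "\<psi>x \<in> borel_measurable borel" "\<psi>t \<in> borel_measurable borel"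
  using assms unfolding C1test_def by (auto intro: borel_measurable_continuous_onI)

lemma gamma_meas [measurable]: "prim c \<in> borel_measurable borel"
  by (rule borel_measurable_continuous_onI[OF continuous_on_prim[OF c_meas c_bdd]])

lemma gamma_bdd: "t \<in> {\<tau>..T} \<Longrightarrow> \<bar>\<gamma> t\<bar> \<le> A * T"
  using prim_bound[OF c_meas c_bdd, of t T] tau by simp

text \<open>The factor h (\<gamma> t) is only Lipschitz in time, as c is merely measurable.
  Continuous functions tending to c almost everywhere give C^1 factors; their primitives converge
  pointwise, and dominated convergence on K carries the inequality over.\<close>

lemma EI_lip:
  assumes EI: "EI K g a w" and \<psi>: "C1test K \<psi> \<psi>x \<psi>t"
    and h: "\<And>s. (h has_real_derivative h' s) (at s)" and h': "continuous_on UNIV h'" and hnn: "\<And>s. 0 \<le> h s"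
  shows "0 \<le> (\<integral>p. ef g a w k (\<lambda>p. \<psi> p * h (\<gamma> (snd p))) (\<lambda>p. \<psi>x p * h (\<gamma> (snd p)))
     (\<lambda>p. \<psi>t p * h (\<gamma> (snd p)) + \<psi> p * (h' (\<gamma> (snd p)) * c (snd p))) p \<partial>lborel)"
proof -
  have hc: "continuous_on UNIV h" using h by (meson DERIV_continuous_on has_field_derivative_at_within)
  note [measurable] = test_meas[OF \<psi>] borel_measurable_continuous_onI[OF hc] borel_measurable_continuous_onI[OF h']
  have A0: "A \<ge> 0" using a_bdd[of 0] by simp
  obtain d where d: "\<And>n. continuous_on UNIV (d n)" "\<And>n t. \<bar>d n t\<bar> \<le> A" "AE t in lborel. (\<lambda>n. d n t) \<longlonglongrightarrow> c t"
    using continuous_AE_approx[OF c_meas c_bdd] by metis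
  have dm [measurable]: "d n \<in> borel_measurable borel" for n by (rule borel_measurable_continuous_onI[OF d(1)])
  have pdc: "continuous_on UNIV (prim (d n))" for n by (rule continuous_on_prim[OF dm d(2)])
  note [measurable] = borel_measurable_continuous_onI[OF pdc]
  have pdd: "(prim (d n) has_real_derivative d n t) (at t)" if "t > 0" for n t
    unfolding prim_def[abs_def]
  proof -
    have "((\<lambda>s. integral {0..s} (d n)) has_real_derivative d n t) (at t within {0..t + 1})"
      using that by (intro integral_has_real_derivative continuous_on_subset[OF d(1)]) auto
    moreover have "at t within {0..t + 1} = at t" using that by (intro at_within_interior) (simp add: interior_atLeastAtMost_real)
    ultimately show "((\<lambda>s. integral {0..s} (d n)) has_real_derivative d n t) (at t)" by simp
  qed
  have pl: "(\<lambda>n. prim (d n) t) \<longlonglongrightarrow> \<gamma> t" for t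
    by (rule prim_tendsto[OF c_meas dm c_bdd d(2,3)])
  define X where "X b \<gamma> = ef g a w k (\<lambda>p. \<psi> p * h (\<gamma> (snd p))) (\<lambda>p. \<psi>x p * h (\<gamma> (snd p)))
     (\<lambda>p. \<psi>t p * h (\<gamma> (snd p)) + \<psi> p * (h' (\<gamma> (snd p)) * b (snd p)))" for b \<gamma> :: "real \<Rightarrow> real"
  have pos: "0 \<le> (\<integral>p. X (d n) (prim (d n)) p \<partial>lborel)" for n
  proof -
    have cc: "continuous_on (UNIV \<times> {0<..}) (\<lambda>p::real \<times> real. h (prim (d n) (snd p)))"
      "continuous_on (UNIV \<times> {0<..}) (\<lambda>p::real \<times> real. h' (prim (d n) (snd p)) * d n (snd p))"
      by (intro continuous_intros continuous_on_compose2[OF hc] continuous_on_compose2[OF h']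
          continuous_on_compose2[OF pdc] continuous_on_compose2[OF d(1)]; auto)+
    have "C1test K (\<lambda>p. \<psi> p * h (prim (d n) (snd p))) (\<lambda>p. \<psi>x p * h (prim (d n) (snd p)) + \<psi> p * 0)
        (\<lambda>p. \<psi>t p * h (prim (d n) (snd p)) + \<psi> p * (h' (prim (d n) (snd p)) * d n (snd p)))"
    proof (rule C1test_mult[OF \<psi> K_props(1,4) tau(1) cc(1) _ cc(2)])
      show "((\<lambda>s. h (prim (d n) (snd (x, s)))) has_real_derivative h' (prim (d n) (snd (x, t))) * d n (snd (x, t))) (at t)"
        if "t > 0" for x t :: real
        using DERIV_chain2[OF h pdd[OF that]] by simp
    qed (use hnn in auto)
    then show ?thesis using EI unfolding EI_def X_def by simp
  qed
  obtain M where M: "M \<ge> 0" "\<And>p. \<bar>\<psi> p\<bar> \<le> M" "\<And>p. \<bar>\<psi>x p\<bar> \<le> M" "\<And>p. \<bar>\<psi>t p\<bar> \<le> M" using test_bdd[OF \<psi>] by metis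
  define B where "B = max Bw \<bar>k\<bar>"
  obtain D where D: "\<And>t v. t \<in> {\<tau>..T} \<Longrightarrow> \<bar>v\<bar> \<le> B \<Longrightarrow> \<bar>g t v\<bar> \<le> D" using g_bdd by blast
  have "bounded (h ` {- (A * T)..A * T})" "bounded (h' ` {- (A * T)..A * T})"
    by (intro compact_imp_bounded compact_continuous_image continuous_on_subset[OF hc] continuous_on_subset[OF h']; simp)+
  then obtain H1 H2 where H: "\<forall>x\<in>h ` {- (A * T)..A * T}. norm x \<le> H1" "\<forall>x\<in>h' ` {- (A * T)..A * T}. norm x \<le> H2"
    unfolding bounded_iff by blast
  have hb: "\<bar>h s\<bar> \<le> \<bar>H1\<bar>" "\<bar>h' s\<bar> \<le> \<bar>H2\<bar>" if "\<bar>s\<bar> \<le> A * T" for s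
  proof -
    have "s \<in> {- (A * T)..A * T}" using that by auto
    then have "norm (h s) \<le> H1" "norm (h' s) \<le> H2" using H by blast+
    then show "\<bar>h s\<bar> \<le> \<bar>H1\<bar>" "\<bar>h' s\<bar> \<le> \<bar>H2\<bar>" by auto
  qed
  define M' where "M' = M * \<bar>H1\<bar> + M * (\<bar>H2\<bar> * A)"
  define C where "C = 2 * B * M' + 2 * D * M' + A * B * M'"
  have Xb: "\<bar>X b \<gamma> p\<bar> \<le> C * indicator K p" if b: "\<And>t. \<bar>b t\<bar> \<le> A" and \<gamma>: "\<And>t. t \<in> {\<tau>..T} \<Longrightarrow> \<bar>\<gamma> t\<bar> \<le> A * T" for b \<gamma> p
  proof (cases "p \<in> K")
    case True
    have t: "snd p \<in> {\<tau>..T}" using K_mem True by blast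
    note hb' = hb[OF \<gamma>[OF t]]
    have 1: "\<bar>x * h (\<gamma> (snd p))\<bar> \<le> M * \<bar>H1\<bar>" if "\<bar>x\<bar> \<le> M" for x
      unfolding abs_mult using that hb' M(1) by (intro mult_mono) auto
    have 2: "\<bar>\<psi> p * (h' (\<gamma> (snd p)) * b (snd p))\<bar> \<le> M * (\<bar>H2\<bar> * A)"
      unfolding abs_mult using hb' M b[of "snd p"] A0 by (intro mult_mono) auto
    have 0: "0 \<le> M * (\<bar>H2\<bar> * A)" using M A0 by simp
    have "\<bar>X b \<gamma> p\<bar> \<le> C"
      unfolding X_def C_def
    proof (rule ef_bound)
      show "\<bar>\<psi>t p * h (\<gamma> (snd p)) + \<psi> p * (h' (\<gamma> (snd p)) * b (snd p))\<bar> \<le> M'"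
        using 1[OF M(4)[of p]] 2 unfolding M'_def by linarith
      show "\<bar>\<psi> p * h (\<gamma> (snd p))\<bar> \<le> M'" using 1[OF M(2)[of p]] 0 unfolding M'_def by linarith
      show "\<bar>\<psi>x p * h (\<gamma> (snd p))\<bar> \<le> M'" using 1[OF M(3)[of p]] 0 unfolding M'_def by linarith
      show wB: "\<bar>w p\<bar> \<le> B" "\<bar>k\<bar> \<le> B" using w_bdd[of p] by (auto simp: B_def)
      show "\<bar>g (snd p) (w p)\<bar> \<le> D" "\<bar>g (snd p) k\<bar> \<le> D" using D[OF t wB(1)] D[OF t wB(2)] .
    qed (rule a_bdd)
    then show ?thesis using True by simp
  next
    case False
    then show ?thesis using C1test_outside[OF \<psi> False] by (simp add: X_def ef_def)
  qed
  have "(\<lambda>n. \<integral>p. X (d n) (prim (d n)) p \<partial>lborel) \<longlonglongrightarrow> (\<integral>p. X c \<gamma> p \<partial>lborel)"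
  proof (rule integral_dominated_convergence[where w = "\<lambda>p. C * indicator K p"])
    show "X c \<gamma> \<in> borel_measurable lborel" unfolding X_def ef_def[abs_def] by measurable
    show "X (d n) (prim (d n)) \<in> borel_measurable lborel" for n unfolding X_def ef_def[abs_def] by measurable
    show "integrable lborel (\<lambda>p. C * indicator K p)"
      unfolding K_def by (intro integrable_mult_right integrable_real_indicator) (auto simp: emeasure_lborel_cbox_eq)
    show "AE p in lborel. norm (X (d n) (prim (d n)) p) \<le> C * indicator K p" for n
      using Xb[OF d(2)] prim_bound[OF dm d(2)] tau by simp
    have "AE p in (lborel :: (real \<times> real) measure). (\<lambda>n. d n (snd p)) \<longlonglongrightarrow> c (snd p)" using AE_lborel_snd[OF d(3)] .
    then show "AE p in lborel. (\<lambda>n. X (d n) (prim (d n)) p) \<longlonglongrightarrow> X c \<gamma> p"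
    proof eventually_elim
      case (elim p)
      have hl: "(\<lambda>n. h (prim (d n) (snd p))) \<longlonglongrightarrow> h (\<gamma> (snd p))"
        using continuous_on_tendsto_compose[OF hc pl] by simp
      have h'l: "(\<lambda>n. h' (prim (d n) (snd p))) \<longlonglongrightarrow> h' (\<gamma> (snd p))"
        using continuous_on_tendsto_compose[OF h' pl] by simp
      show ?case unfolding X_def ef_def by (intro tendsto_intros hl h'l elim)
    qed
  qed
  then have "0 \<le> (\<integral>p. X c \<gamma> p \<partial>lborel)"
    by (rule tendsto_lowerbound) (use pos in auto)
  then show ?thesis by (simp add: X_def)
qed

end

section \<open>Preparations for averaging over Kruzhkov's constant\<close>

lemma DERIV_abs_sgn: "y \<noteq> 0 \<Longrightarrow> (abs has_real_derivative sgn y) (at y)" for y :: real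
proof -
  assume "y \<noteq> 0"
  then consider "y > 0" | "y < 0" by linarith
  then show ?thesis
  proof cases
    case 1
    have "\<forall>\<^sub>F x in nhds y. x \<in> {0<..}" using 1 by (intro eventually_nhds_in_open) auto
    then have "\<forall>\<^sub>F x in nhds y. \<bar>x\<bar> = x" by eventually_elim simp
    then show ?thesis using 1 DERIV_cong_ev[of y y abs "\<lambda>x. x" 1 1] by simp
  next
    case 2
    have "\<forall>\<^sub>F x in nhds y. x \<in> {..<0}" using 2 by (intro eventually_nhds_in_open) auto
    then have "\<forall>\<^sub>F x in nhds y. \<bar>x\<bar> = - x" by eventually_elim simp
    then show ?thesis using 2 DERIV_cong_ev[of y y abs "\<lambda>x. - x" "-1" "-1"] DERIV_minus[OF DERIV_ident, of y UNIV] by simp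
  qed
qed

lemma bump_minus: "bump (- x) = bump x"
  by (simp add: bump_def mult.commute)

lemma bump_continuous: "continuous_on UNIV bump"
  by (rule diffn_cont[OF diffn_bump])

lemma bump_integrable: "integrable lborel bump"
  by (rule integrable_continuous_support[OF bump_continuous, where K = "{-1..1}"])
    (use bump_outside in \<open>auto simp: abs_le_iff not_le abs_real_def split: if_splits\<close>)

lemma bump_integral_pos: "0 < (\<integral>z. bump z \<partial>lborel)"
proof -
  have z: "bump p = 0" if "p \<notin> cbox (-1) 1" for p using that bump_outside[of p] by (auto simp: abs_real_def)
  have "(\<integral>z. bump z \<partial>lborel) \<noteq> 0"
  proof
    assume "(\<integral>z. bump z \<partial>lborel) = 0"
    then have "integral {-1..1} bump = 0" using integral_lborel_support[OF bump_continuous z] by simp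
    then have "\<forall>x\<in>{-1..1}. bump x = 0"
      using integral_eq_0_iff[of "-1" 1 bump] bump_nonneg continuous_on_subset[OF bump_continuous] by auto
    then have "bump 0 = 0" by simp
    then show False using bump_0 by simp
  qed
  then show ?thesis using bump_nonneg by (simp add: order_less_le integral_nonneg_AE)
qed

text \<open>Oddness. It is the reason why averaging the sign over nearby constants returns sgn 0 = 0
  at the critical one.\<close>

lemma bump_sgn_integral: "(\<integral>z. bump z * sgn z \<partial>lborel) = 0"
  using lborel_integral_real_affine[of "-1" "\<lambda>z. bump z * sgn z" 0] by (simp add: bump_minus sgn_minus)

lemma bump_deriv_ex:
  obtains bd where "\<And>x. (bump has_real_derivative bd x) (at x)" "continuous_on UNIV bd" "\<And>x. \<bar>x\<bar> \<ge> 1 \<Longrightarrow> bd x = 0"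
proof -
  obtain bd where bd: "\<And>x. (bump has_real_derivative bd x) (at x)" "diffn 0 bd"
    using diffn_bump[of "Suc 0"] by auto
  moreover have "bd x = 0" if "\<bar>x\<bar> \<ge> 1" for x
    using DERIV_local_min[OF bd(1)[of x], of 1] bump_outside[OF that] bump_nonneg by simp
  ultimately show thesis using that[of bd] by simp
qed

text \<open>The exceptional point is for the kink of an absolute value, which the fundamental
  theorem tolerates.\<close>

lemma integral_deriv_except_zero:
  fixes m m' :: "real \<Rightarrow> real"
  assumes lr: "l \<le> r" and m: "continuous_on {l..r} m" and d: "\<And>x. x \<noteq> x0 \<Longrightarrow> (m has_real_derivative m' x) (at x)"
    and z: "m l = 0" "m r = 0" and m'z: "\<And>x. x \<notin> {l..r} \<Longrightarrow> m' x = 0" and i: "integrable lborel m'"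
  shows "(\<integral>x. m' x \<partial>lborel) = 0"
proof -
  have "(m' has_integral m r - m l) {l..r}"
    by (rule fundamental_theorem_of_calculus_interior_strong[of "{x0}"])
      (use lr m d in \<open>auto simp: has_real_derivative_iff_has_vector_derivative\<close>)
  then have "((\<lambda>x. if x \<in> {l..r} then m' x else 0) has_integral 0) UNIV"
    unfolding has_integral_restrict_UNIV using z by simp
  moreover have "(\<lambda>x. if x \<in> {l..r} then m' x else 0) = m'" using m'z by auto
  ultimately have "(m' has_integral 0) UNIV" by simp
  then show ?thesis using has_integral_integral_lborel[OF i] has_integral_unique by blast
qed

context conv
begin

text \<open>The constant \<kappa>0 for v = exp (- \<gamma>) w corresponds to the moving value exp
  (\<gamma> t) \<kappa>0 for w, which is no Kruzhkov constant. Instead, the inequality of w for each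
  constant k is tested with a weight that concentrates k exp (- \<gamma> t) near \<kappa>0 on the
  scale \<eta>, and the results are integrated over k. After substituting k = exp (\<gamma> t)
  (\<kappa>0 + \<eta> z), the time derivative of the weight becomes a total z-derivative, which
  integrates to 0, plus the change of the source from a to a - c. Then \<eta> tends to 0.\<close>

theorem EI_scale:
  assumes EI: "EI K g a w"
  shows "EI K (\<lambda>t v. exp (- \<gamma> t) * g t (exp (\<gamma> t) * v)) (\<lambda>t. a t - c t) (\<lambda>p. exp (- \<gamma> (snd p)) * w p)"
  unfolding EI_def
proof (intro allI impI)
  fix \<kappa>0 :: real and \<psi> \<psi>x \<psi>t :: "real \<times> real \<Rightarrow> real"
  assume \<psi>: "C1test K \<psi> \<psi>x \<psi>t"
  define g' where "g' t v = exp (- \<gamma> t) * g t (exp (\<gamma> t) * v)" for t v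
  define a' where "a' t = a t - c t" for t
  define v where "v p = exp (- \<gamma> (snd p)) * w p" for p
  obtain bd where bd: "\<And>x. (bump has_real_derivative bd x) (at x)" "continuous_on UNIV bd" "\<And>x. \<bar>x\<bar> \<ge> 1 \<Longrightarrow> bd x = 0"
    using bump_deriv_ex by metis
  note [measurable] = test_meas[OF \<psi>] borel_measurable_continuous_onI[OF bump_continuous] borel_measurable_continuous_onI[OF bd(2)]
  have gammac: "continuous_on UNIV \<gamma>" by (rule continuous_on_prim[OF c_meas c_bdd])
  have g'c: "continuous_on UNIV (\<lambda>q. g' (fst q) (snd q))"
    unfolding g'_def
    by (intro continuous_intros continuous_on_compose2[OF gammac] continuous_on_compose2[OF g_cont, of UNIV "\<lambda>q. (fst q, exp (\<gamma> (fst q)) * snd q)", simplified])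
      auto
  have g'k: "continuous_on UNIV (g' t)" for t
    using continuous_on_compose2[OF g'c, of UNIV "\<lambda>x. (t, x)"] by (simp add: continuous_on_Pair)
  have [measurable]: "a' \<in> borel_measurable borel" unfolding a'_def[abs_def] by measurable
  have [measurable]: "v \<in> borel_measurable borel" unfolding v_def[abs_def] by measurable
  have g'm [measurable]: "(\<lambda>x. g' (f x) (e x)) \<in> borel_measurable M" if [measurable]: "f \<in> borel_measurable M" "e \<in> borel_measurable M" for f e M
    using measurable_compose[OF borel_measurable_Pair[OF that] borel_measurable_continuous_onI[OF g'c]] by simp
  have A0: "A \<ge> 0" using a_bdd[of 0] by simp
  have Bw0: "Bw \<ge> 0" using w_bdd[of undefined] by linarith
  obtain M where M: "M \<ge> 0" "\<And>p. \<bar>\<psi> p\<bar> \<le> M" "\<And>p. \<bar>\<psi>x p\<bar> \<le> M" "\<And>p. \<bar>\<psi>t p\<bar> \<le> M" using test_bdd[OF \<psi>] by metis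
  \<comment> \<open>One of the two factors exp (- s) compensates |w - k| = exp (\<gamma>) |v -
    \<kappa>|, the other the Jacobian of the substitution in k.\<close>
  define h where "h \<eta> k s = exp (- 2 * s) * bump ((k * exp (- s) - \<kappa>0) / \<eta>)" for \<eta> k s :: real
  define h' where "h' \<eta> k s = exp (- 2 * s) * (- 2) * bump ((k * exp (- s) - \<kappa>0) / \<eta>)
      + bd ((k * exp (- s) - \<kappa>0) / \<eta>) * (k * (exp (- s) * - 1) / \<eta>) * exp (- 2 * s)" for \<eta> k s :: real
  have hd: "(h \<eta> k has_real_derivative h' \<eta> k s) (at s)" for \<eta> k s
  proof -
    have e: "((\<lambda>s. exp (- s)) has_real_derivative exp (- s) * - 1) (at s)"
      by (intro DERIV_chain2[OF DERIV_exp] DERIV_minus DERIV_ident)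
    have e2: "((\<lambda>s. exp (- 2 * s)) has_real_derivative exp (- 2 * s) * (- 2)) (at s)"
      by (intro DERIV_chain2[OF DERIV_exp] DERIV_cmult_Id)
    have "((\<lambda>s. (k * exp (- s) - \<kappa>0) / \<eta>) has_real_derivative k * (exp (- s) * - 1) / \<eta>) (at s)"
      using DERIV_cdivide[OF DERIV_diff[OF DERIV_cmult[OF e, of k] DERIV_const[of \<kappa>0]], of \<eta>] by simp
    from DERIV_mult[OF e2 DERIV_chain2[OF bd(1) this]] show ?thesis
      unfolding h_def h'_def by simp
  qed
  have hc2: "continuous_on UNIV (\<lambda>q. h \<eta> (fst q) (snd q))" "continuous_on UNIV (\<lambda>q. h' \<eta> (fst q) (snd q))" if "\<eta> > 0" for \<eta>
    unfolding h_def h'_def using that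
    by (intro continuous_intros continuous_on_compose2[OF bump_continuous] continuous_on_compose2[OF bd(2)]; auto)+
  have h'c: "continuous_on UNIV (h' \<eta> k)" if "\<eta> > 0" for \<eta> k
    using continuous_on_compose2[OF hc2(2)[OF that], of UNIV "\<lambda>s. (k, s)"] by (simp add: continuous_on_Pair)
  have hnn: "0 \<le> h \<eta> k s" for \<eta> k s by (simp add: h_def bump_nonneg)
  define \<Theta> where "\<Theta> \<eta> k = ef g a w k (\<lambda>p. \<psi> p * h \<eta> k (\<gamma> (snd p))) (\<lambda>p. \<psi>x p * h \<eta> k (\<gamma> (snd p)))
     (\<lambda>p. \<psi>t p * h \<eta> k (\<gamma> (snd p)) + \<psi> p * (h' \<eta> k (\<gamma> (snd p)) * c (snd p)))" for \<eta> k
  have pos: "0 \<le> (\<integral>p. \<Theta> \<eta> k p \<partial>lborel)" if "\<eta> > 0" for \<eta> k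
    unfolding \<Theta>_def by (rule EI_lip[OF EI \<psi> hd h'c[OF that] hnn])
  define j where "j \<kappa> p = ef g' a' v \<kappa> \<psi> \<psi>x \<psi>t p" for \<kappa> p
  define J where "J \<eta> p = (\<integral>z. bump z * j (\<kappa>0 + \<eta> * z) p \<partial>lborel)" for \<eta> p
  have v_bdd: "\<bar>v p\<bar> \<le> exp (A * T) * Bw" if "p \<in> K" for p
  proof -
    have "exp (- \<gamma> (snd p)) \<le> exp (A * T)" using gamma_bdd[of "snd p"] K_mem[OF that] by (auto simp: abs_le_iff)
    then show ?thesis unfolding v_def abs_mult using w_bdd Bw0 by (intro mult_mono) auto
  qed
  define B2 where "B2 = exp (A * T) * Bw + \<bar>\<kappa>0\<bar> + 1"
  have B2: "\<bar>v p\<bar> \<le> B2" if "p \<in> K" for p using v_bdd[OF that] by (simp add: B2_def)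
  have "bounded ((\<lambda>q. g' (fst q) (snd q)) ` ({\<tau>..T} \<times> {-B2..B2}))"
    by (intro compact_imp_bounded compact_continuous_image continuous_on_subset[OF g'c] compact_Times) auto
  then obtain D2 where D2: "\<forall>x\<in>(\<lambda>q. g' (fst q) (snd q)) ` ({\<tau>..T} \<times> {-B2..B2}). norm x \<le> D2"
    unfolding bounded_iff by blast
  have D2': "\<bar>g' t x\<bar> \<le> D2" if "t \<in> {\<tau>..T}" "\<bar>x\<bar> \<le> B2" for t x
    using bspec[OF D2, of "g' t x"] that by force
  define C where "C = 2 * B2 * M + 2 * D2 * M + (2 * A) * B2 * M"
  have jb: "\<bar>j \<kappa> p\<bar> \<le> C" if p: "p \<in> K" and \<kappa>: "\<bar>\<kappa>\<bar> \<le> B2" for \<kappa> p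
    unfolding j_def C_def
  proof (rule ef_bound)
    have t: "snd p \<in> {\<tau>..T}" using K_mem p by blast
    show "\<bar>g' (snd p) (v p)\<bar> \<le> D2" "\<bar>g' (snd p) \<kappa>\<bar> \<le> D2" using D2'[OF t] B2[OF p] \<kappa> by blast+
    show "\<bar>a' (snd p)\<bar> \<le> 2 * A" using a_bdd[of "snd p"] c_bdd[of "snd p"] abs_triangle_ineq4[of "a (snd p)" "c (snd p)"] unfolding a'_def by linarith
  qed (use B2[OF p] \<kappa> M in auto)
  have jz: "j \<kappa> p = 0" if "p \<notin> K" for \<kappa> p using C1test_outside[OF \<psi> that] by (simp add: j_def ef_def)
  have j_meas: "(\<lambda>z. bump z * j (\<kappa>0 + \<eta> * z) p) \<in> borel_measurable borel" for \<eta> p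
    unfolding j_def ef_def by measurable
  have inner: "(\<integral>k. \<Theta> \<eta> k p \<partial>lborel) = \<eta> * J \<eta> p" if \<eta>: "0 < \<eta>" "\<eta> \<le> 1" for \<eta> p
  proof (cases "p \<in> K")
    case False
    then show ?thesis using C1test_outside[OF \<psi> False] by (simp add: \<Theta>_def J_def jz[OF False] ef_def)
  next
    case True
    let ?s = "\<gamma> (snd p)" and ?t = "snd p"
    let ?E = "exp ?s"
    let ?k = "\<lambda>z. \<kappa>0 + \<eta> * z"
    \<comment> \<open>The z-derivative of \<open>\<bar>v p - ?k z\<bar> * ?k z * bump z\<close>. The
      singular factor 1 / \<eta> will stand in front of this term alone, and its integral vanishes,
      so \<eta> may tend to 0.\<close>
    define m' where "m' z = - \<eta> * sgn (v p - ?k z) * ?k z * bump z + \<bar>v p - ?k z\<bar> * \<eta> * bump z + \<bar>v p - ?k z\<bar> * ?k z * bd z" for z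
    have E1: "exp (- ?s) * ?E = 1" by (simp add: exp_minus)
    have E2: "exp (- 2 * ?s) = exp (- ?s) * exp (- ?s)" by (simp add: exp_add[symmetric])
    have th: "\<Theta> \<eta> (?E * \<kappa>0 + ?E * \<eta> * z) p * ?E = bump z * j (?k z) p - \<psi> p * c ?t / \<eta> * m' z" for z
    proof -
      have k: "?E * \<kappa>0 + ?E * \<eta> * z = ?E * ?k z" by (simp add: algebra_simps)
      have arg: "(?E * ?k z * exp (- ?s) - \<kappa>0) / \<eta> = z"
      proof -
        have "?E * ?k z * exp (- ?s) = ?k z * (exp (- ?s) * ?E)" by (simp only: mult_ac)
        also have "\<dots> = ?k z" unfolding E1 by simp
        finally have e: "?E * ?k z * exp (- ?s) = ?k z" .
        show ?thesis unfolding e using \<eta> by simp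
      qed
      have hh: "h \<eta> (?E * ?k z) ?s = exp (- 2 * ?s) * bump z" unfolding h_def arg ..
      define y where "y = bd z * ?k z / \<eta>"
      have hh': "h' \<eta> (?E * ?k z) ?s = - exp (- 2 * ?s) * (2 * bump z + y)"
      proof -
        have "?E * ?k z * (exp (- ?s) * - 1) / \<eta> = - (?k z * (exp (- ?s) * ?E)) / \<eta>" by (simp add: algebra_simps)
        also have "\<dots> = - ?k z / \<eta>" unfolding E1 by simp
        finally have e: "?E * ?k z * (exp (- ?s) * - 1) / \<eta> = - ?k z / \<eta>" .
        show ?thesis unfolding h'_def arg e y_def by (simp add: algebra_simps)
      qed
      have wv: "w p = ?E * v p" unfolding v_def by (simp add: exp_minus)
      have sg: "sgn (w p - ?E * ?k z) = sgn (v p - ?k z)"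
        unfolding wv right_diff_distrib[symmetric] sgn_mult by simp
      have ab: "\<bar>w p - ?E * ?k z\<bar> = ?E * \<bar>v p - ?k z\<bar>"
        unfolding wv right_diff_distrib[symmetric] abs_mult by simp
      have gg: "g ?t (w p) - g ?t (?E * ?k z) = ?E * (g' ?t (v p) - g' ?t (?k z))"
        unfolding g'_def right_diff_distrib mult.assoc[symmetric] mult.commute[of ?E "exp (- ?s)"] E1 by (simp add: wv)
      have "?E * exp (- 2 * ?s) * ?E = (exp (- ?s) * ?E) * (exp (- ?s) * ?E)" unfolding E2 by (simp only: mult_ac)
      then have EE: "?E * exp (- 2 * ?s) * ?E = 1" unfolding E1 by simp
      have ss: "sgn (v p - ?k z) * (v p - ?k z) = \<bar>v p - ?k z\<bar>" by (simp add: abs_sgn mult.commute)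
      have "\<Theta> \<eta> (?E * ?k z) p * ?E = (?E * exp (- 2 * ?s) * ?E) *
         (\<bar>v p - ?k z\<bar> * (\<psi>t p * bump z - \<psi> p * c ?t * (2 * bump z + y))
          + sgn (v p - ?k z) * (g' ?t (v p) - g' ?t (?k z)) * \<psi>x p * bump z
          + sgn (v p - ?k z) * (a ?t * v p) * \<psi> p * bump z)"
        unfolding \<Theta>_def ef_def hh hh' sg ab gg unfolding wv by (simp add: algebra_simps)
      also have "\<dots> = bump z * (\<bar>v p - ?k z\<bar> * \<psi>t p + sgn (v p - ?k z) * (g' ?t (v p) - g' ?t (?k z)) * \<psi>x p
           + sgn (v p - ?k z) * (a ?t * v p) * \<psi> p) - \<psi> p * c ?t * \<bar>v p - ?k z\<bar> * (2 * bump z + y)"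
        unfolding EE by (simp add: algebra_simps)
      also have "\<dots> = bump z * j (?k z) p - \<psi> p * c ?t / \<eta> * m' z
          + \<psi> p * c ?t * bump z * (sgn (v p - ?k z) * (v p - ?k z) - \<bar>v p - ?k z\<bar>)"
      proof -
        have mm: "\<psi> p * c ?t / \<eta> * m' z = \<psi> p * c ?t * (- sgn (v p - ?k z) * ?k z * bump z + \<bar>v p - ?k z\<bar> * bump z + \<bar>v p - ?k z\<bar> * y)"
          unfolding m'_def y_def using \<eta> by (simp add: field_simps)
        show ?thesis unfolding mm unfolding j_def ef_def a'_def by (simp add: algebra_simps)
      qed
      finally show ?thesis unfolding k ss by simp
    qed
    have kb: "\<bar>?k z\<bar> \<le> B2" if "\<bar>z\<bar> \<le> 1" for z
    proof -
      have "\<bar>\<eta> * z\<bar> \<le> 1" unfolding abs_mult using \<eta> that by (intro mult_le_one) auto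
      then have "\<bar>?k z\<bar> \<le> \<bar>\<kappa>0\<bar> + 1" using abs_triangle_ineq[of \<kappa>0 "\<eta> * z"] by linarith
      moreover have "0 \<le> exp (A * T) * Bw" using Bw0 by simp
      ultimately show ?thesis unfolding B2_def by linarith
    qed
    have b1: "\<exists>Bb. \<forall>z\<in>{-1..1}. \<bar>bump z\<bar> \<le> Bb \<and> \<bar>bd z\<bar> \<le> Bb"
    proof -
      have "bounded (bump ` {-1..1})" "bounded (bd ` {-1..1})"
        by (intro compact_imp_bounded compact_continuous_image continuous_on_subset[OF bump_continuous] continuous_on_subset[OF bd(2)]; simp)+
      then obtain b1 b2 where b: "\<forall>x\<in>bump ` {-1..1}. norm x \<le> b1" "\<forall>x\<in>bd ` {-1..1}. norm x \<le> b2"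
        unfolding bounded_iff by blast
      have "\<bar>bump z\<bar> \<le> max b1 b2 \<and> \<bar>bd z\<bar> \<le> max b1 b2" if "z \<in> {-1..1}" for z
      proof -
        have "norm (bump z) \<le> b1" "norm (bd z) \<le> b2" using b that by blast+
        then show ?thesis by (simp add: le_max_iff_disj)
      qed
      then show ?thesis by blast
    qed
    then obtain Bb where Bb: "\<forall>z\<in>{-1..1}. \<bar>bump z\<bar> \<le> Bb \<and> \<bar>bd z\<bar> \<le> Bb" by blast
    have zout: "bump z = 0 \<and> bd z = 0" if "z \<notin> {-1..1}" for z
      using that bump_outside[of z] bd(3)[of z] by (auto simp: abs_real_def)
    have ji: "integrable lborel (\<lambda>z. bump z * j (?k z) p)"
    proof (rule integrable_bounded_support[where K = "{-1..1}" and B = "Bb * C"])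
      show "\<bar>bump z * j (?k z) p\<bar> \<le> Bb * C" if "z \<in> {-1..1}" for z
        unfolding abs_mult using Bb that jb[OF True kb[of z]] by (intro mult_mono) (auto simp: abs_le_iff)
    qed (use j_meas zout in auto)
    have m'm [measurable]: "m' \<in> borel_measurable borel" unfolding m'_def[abs_def] by measurable
    have vk: "\<bar>v p - ?k z\<bar> \<le> 2 * B2" if "\<bar>z\<bar> \<le> 1" for z
      using B2[OF True] kb[OF that] abs_triangle_ineq4[of "v p" "?k z"] by linarith
    have m'i: "integrable lborel m'"
    proof (rule integrable_bounded_support[where K = "{-1..1}" and B = "1 * 1 * B2 * Bb + 2 * B2 * 1 * Bb + 2 * B2 * B2 * Bb"])
      show "\<bar>m' z\<bar> \<le> 1 * 1 * B2 * Bb + 2 * B2 * 1 * Bb + 2 * B2 * B2 * Bb" if z: "z \<in> {-1..1}" for z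
      proof -
        have z1: "\<bar>z\<bar> \<le> 1" using z by auto
        have bz: "\<bar>bump z\<bar> \<le> Bb" "\<bar>bd z\<bar> \<le> Bb" using Bb z by blast+
        have e: "\<bar>- \<eta>\<bar> \<le> 1" "\<bar>\<eta>\<bar> \<le> 1" using \<eta> by auto
        have s: "\<bar>sgn (v p - ?k z)\<bar> \<le> 1" by (simp add: sgn_real_def)
        have B20: "0 \<le> B2" using kb[OF z1] by linarith
        have Bb0: "0 \<le> Bb" using bz by linarith
        have va: "\<bar>\<bar>v p - ?k z\<bar>\<bar> \<le> 2 * B2" using vk[OF z1] by simp
        have "\<bar>- \<eta> * sgn (v p - ?k z) * ?k z * bump z\<bar> \<le> 1 * 1 * B2 * Bb"
          unfolding abs_mult by (rule mult_mono[OF mult_mono[OF mult_mono[OF e(1) s] kb[OF z1]] bz(1)]) (simp_all add: B20)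
        moreover have "\<bar>\<bar>v p - ?k z\<bar> * \<eta> * bump z\<bar> \<le> 2 * B2 * 1 * Bb"
          unfolding abs_mult by (rule mult_mono[OF mult_mono[OF va e(2)] bz(1)]) (simp_all add: B20)
        moreover have "\<bar>\<bar>v p - ?k z\<bar> * ?k z * bd z\<bar> \<le> 2 * B2 * B2 * Bb"
          unfolding abs_mult by (rule mult_mono[OF mult_mono[OF va kb[OF z1]] bz(2)]) (simp_all add: B20)
        ultimately show ?thesis unfolding m'_def by linarith
      qed
      show "m' z = 0" if "z \<notin> {-1..1}" for z using zout[OF that] by (simp add: m'_def)
    qed auto
    have m'0: "(\<integral>z. m' z \<partial>lborel) = 0"
    proof (rule integral_deriv_except_zero[where l = "-1" and r = 1 and m = "\<lambda>z. \<bar>v p - ?k z\<bar> * ?k z * bump z" and ?x0.0 = "(v p - \<kappa>0) / \<eta>"])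
      show "continuous_on {-1..1} (\<lambda>z. \<bar>v p - ?k z\<bar> * ?k z * bump z)"
        by (intro continuous_intros continuous_on_subset[OF bump_continuous]) auto
      fix z assume "z \<noteq> (v p - \<kappa>0) / \<eta>"
      then have ne: "v p - ?k z \<noteq> 0" using \<eta> by (auto simp: field_simps)
      have dk: "(?k has_real_derivative \<eta>) (at z)"
        using DERIV_add[OF DERIV_const[of \<kappa>0 "at z"] DERIV_cmult_Id[of \<eta> z UNIV]] by simp
      have da: "((\<lambda>z. \<bar>v p - ?k z\<bar>) has_real_derivative sgn (v p - ?k z) * - \<eta>) (at z)"
        using DERIV_chain2[OF DERIV_abs_sgn[OF ne] DERIV_diff[OF DERIV_const[of "v p" "at z"] dk]] by simp
      show "((\<lambda>z. \<bar>v p - ?k z\<bar> * ?k z * bump z) has_real_derivative m' z) (at z)"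
        using DERIV_mult[OF DERIV_mult[OF da dk] bd(1)[of z]] by (simp add: m'_def algebra_simps)
    next
      show "m' z = 0" if "z \<notin> {-1..1}" for z using zout[OF that] by (simp add: m'_def)
    qed (use bump_outside in \<open>auto intro: m'i\<close>)
    have "(\<integral>k. \<Theta> \<eta> k p \<partial>lborel) = \<bar>?E * \<eta>\<bar> *\<^sub>R (\<integral>z. \<Theta> \<eta> (?E * \<kappa>0 + ?E * \<eta> * z) p \<partial>lborel)"
      using \<eta> by (intro lborel_integral_real_affine) simp
    also have "\<dots> = \<eta> * (\<integral>z. \<Theta> \<eta> (?E * \<kappa>0 + ?E * \<eta> * z) p * ?E \<partial>lborel)"
      using \<eta> by (simp add: mult_ac)
    also have "\<dots> = \<eta> * (\<integral>z. bump z * j (?k z) p - \<psi> p * c ?t / \<eta> * m' z \<partial>lborel)"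
      unfolding th ..
    also have "\<dots> = \<eta> * ((\<integral>z. bump z * j (?k z) p \<partial>lborel) - \<psi> p * c ?t / \<eta> * (\<integral>z. m' z \<partial>lborel))"
      using ji m'i by simp
    finally show ?thesis unfolding m'0 J_def by simp
  qed
  have Jpos: "0 \<le> (\<integral>p. J \<eta> p \<partial>lborel)" if \<eta>: "0 < \<eta>" "\<eta> \<le> 1" for \<eta>
  proof -
    \<comment> \<open>On K the weight vanishes for |k| > \<open>Kb\<close>, since exp (- \<gamma>)
      is at least exp (- A T) there. The integrand in (k, p) thus has bounded support, and Fubini
      applies.\<close>
    define Kb where "Kb = (\<bar>\<kappa>0\<bar> + \<eta>) * exp (A * T)"
    have \<Theta>z: "\<Theta> \<eta> k p = 0" if "(k, p) \<notin> {-Kb..Kb} \<times> K" for k p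
    proof (cases "p \<in> K")
      case True
      then have k: "\<bar>k\<bar> > Kb" using that by auto
      have g: "exp (- (A * T)) \<le> exp (- \<gamma> (snd p))" using gamma_bdd[of "snd p"] K_mem[OF True] by (auto simp: abs_le_iff)
      have "\<bar>\<kappa>0\<bar> + \<eta> = Kb * exp (- (A * T))" by (simp add: Kb_def exp_minus)
      also have "\<dots> \<le> \<bar>k\<bar> * exp (- \<gamma> (snd p))" using k g by (intro mult_mono) auto
      also have "\<dots> = \<bar>k * exp (- \<gamma> (snd p))\<bar>" by (simp add: abs_mult)
      finally have "\<eta> \<le> \<bar>k * exp (- \<gamma> (snd p)) - \<kappa>0\<bar>" by linarith
      then have "1 \<le> \<bar>(k * exp (- \<gamma> (snd p)) - \<kappa>0) / \<eta>\<bar>" using \<eta> by (simp add: abs_divide)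
      then show ?thesis using bump_outside bd(3) by (simp add: \<Theta>_def ef_def h_def h'_def)
    next
      case False
      then show ?thesis using C1test_outside[OF \<psi> False] by (simp add: \<Theta>_def ef_def)
    qed
    have \<Theta>m: "(\<lambda>(k, p). \<Theta> \<eta> k p) \<in> borel_measurable (lborel \<Otimes>\<^sub>M lborel)"
      unfolding \<Theta>_def ef_def h_def h'_def by measurable
    have \<Theta>i: "integrable (lborel \<Otimes>\<^sub>M lborel) (\<lambda>(k, p). \<Theta> \<eta> k p)"
    proof -
      define B where "B = max Bw Kb"
      obtain D where D: "\<And>t v. t \<in> {\<tau>..T} \<Longrightarrow> \<bar>v\<bar> \<le> B \<Longrightarrow> \<bar>g t v\<bar> \<le> D" using g_bdd by blast
      let ?S = "{-Kb..Kb} \<times> {- (A * T)..A * T}"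
      have "bounded ((\<lambda>q. h \<eta> (fst q) (snd q)) ` ?S)" "bounded ((\<lambda>q. h' \<eta> (fst q) (snd q)) ` ?S)"
        by (intro compact_imp_bounded compact_continuous_image continuous_on_subset[OF hc2(1)[OF \<eta>(1)]] continuous_on_subset[OF hc2(2)[OF \<eta>(1)]] compact_Times; simp)+
      then obtain H1 H2 where H: "\<forall>x\<in>(\<lambda>q. h \<eta> (fst q) (snd q)) ` ?S. norm x \<le> H1" "\<forall>x\<in>(\<lambda>q. h' \<eta> (fst q) (snd q)) ` ?S. norm x \<le> H2"
        unfolding bounded_iff by blast
      have hb: "\<bar>h \<eta> k s\<bar> \<le> \<bar>H1\<bar>" "\<bar>h' \<eta> k s\<bar> \<le> \<bar>H2\<bar>" if "k \<in> {-Kb..Kb}" "\<bar>s\<bar> \<le> A * T" for k s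
      proof -
        have "(k, s) \<in> ?S" using that by auto
        then have "norm (h \<eta> k s) \<le> H1" "norm (h' \<eta> k s) \<le> H2" using H by force+
        then show "\<bar>h \<eta> k s\<bar> \<le> \<bar>H1\<bar>" "\<bar>h' \<eta> k s\<bar> \<le> \<bar>H2\<bar>" by auto
      qed
      define M' where "M' = M * \<bar>H1\<bar> + M * (\<bar>H2\<bar> * A)"
      have bound: "\<bar>\<Theta> \<eta> k p\<bar> \<le> 2 * B * M' + 2 * D * M' + A * B * M'" if k: "k \<in> {-Kb..Kb}" and p: "p \<in> K" for k p
      proof -
        have t: "snd p \<in> {\<tau>..T}" using K_mem p by blast
        note hb' = hb[OF k gamma_bdd[OF t]]
        have 1: "\<bar>x * h \<eta> k (\<gamma> (snd p))\<bar> \<le> M * \<bar>H1\<bar>" if "\<bar>x\<bar> \<le> M" for x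
          unfolding abs_mult using that hb' M(1) by (intro mult_mono) auto
        have 2: "\<bar>\<psi> p * (h' \<eta> k (\<gamma> (snd p)) * c (snd p))\<bar> \<le> M * (\<bar>H2\<bar> * A)"
          unfolding abs_mult using hb' M c_bdd[of "snd p"] A0 by (intro mult_mono) auto
        have 0: "0 \<le> M * (\<bar>H2\<bar> * A)" using M A0 by simp
        show ?thesis unfolding \<Theta>_def
        proof (rule ef_bound)
          show "\<bar>\<psi>t p * h \<eta> k (\<gamma> (snd p)) + \<psi> p * (h' \<eta> k (\<gamma> (snd p)) * c (snd p))\<bar> \<le> M'"
            using 1[OF M(4)[of p]] 2 unfolding M'_def by linarith
          show "\<bar>\<psi> p * h \<eta> k (\<gamma> (snd p))\<bar> \<le> M'" using 1[OF M(2)[of p]] 0 unfolding M'_def by linarith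
          show "\<bar>\<psi>x p * h \<eta> k (\<gamma> (snd p))\<bar> \<le> M'" using 1[OF M(3)[of p]] 0 unfolding M'_def by linarith
          show wB: "\<bar>w p\<bar> \<le> B" "\<bar>k\<bar> \<le> B" using w_bdd[of p] k by (auto simp: B_def)
          show "\<bar>g (snd p) (w p)\<bar> \<le> D" "\<bar>g (snd p) k\<bar> \<le> D" using D[OF t wB(1)] D[OF t wB(2)] .
        qed (rule a_bdd)
      qed
      have "integrable lborel (\<lambda>(k, p). \<Theta> \<eta> k p)"
      proof (rule integrable_bounded_support[where K = "{-Kb..Kb} \<times> K" and B = "2 * B * M' + 2 * D * M' + A * B * M'"])
        show "(\<lambda>(k, p). \<Theta> \<eta> k p) \<in> borel_measurable borel" using \<Theta>m unfolding lborel_prod by simp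
        show "bounded ({-Kb..Kb} \<times> K)" using K_props(2) by (intro bounded_Times) auto
        fix q :: "real \<times> real \<times> real"
        show "(case q of (k, p) \<Rightarrow> \<Theta> \<eta> k p) = 0" if "q \<notin> {-Kb..Kb} \<times> K"
          using \<Theta>z[of "fst q" "snd q"] that by (simp add: split_beta)
        show "\<bar>case q of (k, p) \<Rightarrow> \<Theta> \<eta> k p\<bar> \<le> 2 * B * M' + 2 * D * M' + A * B * M'" if "q \<in> {-Kb..Kb} \<times> K"
          using bound[of "fst q" "snd q"] that by (simp add: split_beta mem_Times_iff)
      qed
      then show ?thesis unfolding lborel_prod .
    qed
    have "0 \<le> (\<integral>k. (\<integral>p. \<Theta> \<eta> k p \<partial>lborel) \<partial>lborel)"
      by (rule Bochner_Integration.integral_nonneg) (rule pos[OF \<eta>(1)])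
    also have "\<dots> = (\<integral>p. (\<integral>k. \<Theta> \<eta> k p \<partial>lborel) \<partial>lborel)"
      by (rule lborel_pair.Fubini_integral[OF \<Theta>i, symmetric])
    also have "\<dots> = \<eta> * (\<integral>p. J \<eta> p \<partial>lborel)" unfolding inner[OF \<eta>] by simp
    finally show ?thesis using \<eta> by (simp add: zero_le_mult_iff)
  qed
  define m where "m = (\<integral>z. bump z \<partial>lborel)"
  have C0: "\<bar>j (\<kappa>0 + 1 / real (Suc n) * z) p\<bar> \<le> \<bar>C\<bar>" if "\<bar>z\<bar> \<le> 1" for n z p
  proof (cases "p \<in> K")
    case True
    have "\<bar>1 / real (Suc n) * z\<bar> \<le> 1" unfolding abs_mult using that by (intro mult_le_one) auto
    then have "\<bar>\<kappa>0 + 1 / real (Suc n) * z\<bar> \<le> \<bar>\<kappa>0\<bar> + 1" using abs_triangle_ineq[of \<kappa>0 "1 / real (Suc n) * z"] by linarith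
    moreover have "0 \<le> exp (A * T) * Bw" using Bw0 by simp
    ultimately have "\<bar>\<kappa>0 + 1 / real (Suc n) * z\<bar> \<le> B2" unfolding B2_def by linarith
    then show ?thesis using jb[OF True] by (meson abs_ge_self order_trans)
  qed (simp add: jz)
  have C0': "\<bar>bump z * j (\<kappa>0 + 1 / real (Suc n) * z) p\<bar> \<le> bump z * (\<bar>C\<bar> * indicator K p)" for n z p
  proof (cases "\<bar>z\<bar> \<le> 1")
    case True
    show ?thesis
    proof (cases "p \<in> K")
      case pK: True
      then show ?thesis unfolding abs_mult using C0[OF True] bump_nonneg[of z] by (simp add: mult_left_mono)
    qed (simp add: jz)
  qed (simp add: bump_outside)
  have "(\<lambda>n. \<integral>p. J (1 / real (Suc n)) p \<partial>lborel) \<longlonglongrightarrow> (\<integral>p. m * j \<kappa>0 p \<partial>lborel)"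
  proof (rule integral_dominated_convergence[where w = "\<lambda>p. m * \<bar>C\<bar> * indicator K p"])
    show "(\<lambda>p. m * j \<kappa>0 p) \<in> borel_measurable lborel" unfolding j_def ef_def by measurable
    show "J (1 / real (Suc n)) \<in> borel_measurable lborel" for n
    proof -
      have "(\<lambda>(p, z). bump z * j (\<kappa>0 + 1 / real (Suc n) * z) p) \<in> borel_measurable (lborel \<Otimes>\<^sub>M lborel)"
        unfolding j_def ef_def by measurable
      from lborel.borel_measurable_lebesgue_integral[OF this] show ?thesis unfolding J_def[abs_def] .
    qed
    show "integrable lborel (\<lambda>p. m * \<bar>C\<bar> * indicator K p)"
      unfolding K_def by (intro integrable_mult_right integrable_real_indicator) (auto simp: emeasure_lborel_cbox_eq)
    show "AE p in lborel. norm (J (1 / real (Suc n)) p) \<le> m * \<bar>C\<bar> * indicator K p" for n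
    proof (rule AE_I2)
      fix p
      have "norm (J (1 / real (Suc n)) p) \<le> (\<integral>z. bump z * (\<bar>C\<bar> * indicator K p) \<partial>lborel)"
        unfolding J_def
        by (rule order_trans[OF integral_norm_bound integral_mono'])
          (use C0' bump_integrable bump_nonneg in auto)
      also have "\<dots> = m * \<bar>C\<bar> * indicator K p" by (simp add: m_def)
      finally show "norm (J (1 / real (Suc n)) p) \<le> m * \<bar>C\<bar> * indicator K p" .
    qed
    show "AE p in lborel. (\<lambda>n. J (1 / real (Suc n)) p) \<longlonglongrightarrow> m * j \<kappa>0 p"
    proof (rule AE_I2)
      fix p :: "real \<times> real"
      let ?t = "snd p"
      \<comment> \<open>The pointwise limit of the averaged integrand. If v p = \<kappa>0, the sign
        of v p - \<kappa>0 - \<eta> z is - sgn z for every \<eta>, so the source term keeps a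
        dependence on z which only the odd average removes.\<close>
      define L where "L z = (if v p = \<kappa>0 then bump z * (- sgn z * (a' ?t * v p) * \<psi> p) else bump z * j \<kappa>0 p)" for z
      have "(\<lambda>n. J (1 / real (Suc n)) p) \<longlonglongrightarrow> (\<integral>z. L z \<partial>lborel)"
        unfolding J_def
      proof (rule integral_dominated_convergence[where w = "\<lambda>z. bump z * (\<bar>C\<bar> * indicator K p)"])
        show "L \<in> borel_measurable lborel" unfolding L_def[abs_def] by measurable
        show "(\<lambda>z. bump z * j (\<kappa>0 + 1 / real (Suc n) * z) p) \<in> borel_measurable lborel" for n by (subst measurable_lborel2) (rule j_meas)
        show "integrable lborel (\<lambda>z. bump z * (\<bar>C\<bar> * indicator K p))" using bump_integrable by simp
        show "AE z in lborel. norm (bump z * j (\<kappa>0 + 1 / real (Suc n) * z) p) \<le> bump z * (\<bar>C\<bar> * indicator K p)" for n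
          using C0' by simp
        show "AE z in lborel. (\<lambda>n. bump z * j (\<kappa>0 + 1 / real (Suc n) * z) p) \<longlonglongrightarrow> L z"
        proof (rule AE_I2)
          fix z :: real
          let ?k = "\<lambda>n. \<kappa>0 + 1 / real (Suc n) * z"
          have l: "(\<lambda>n. 1 / real (Suc n)) \<longlonglongrightarrow> 0"
            using LIMSEQ_inverse_real_of_nat by (simp add: inverse_eq_divide)
          have "?k \<longlonglongrightarrow> \<kappa>0 + 0 * z" by (intro tendsto_add tendsto_const tendsto_mult l)
          then have kl: "?k \<longlonglongrightarrow> \<kappa>0" unfolding mult_zero_left add_0_right .
          have gl: "(\<lambda>n. g' ?t (?k n)) \<longlonglongrightarrow> g' ?t \<kappa>0" by (rule continuous_on_tendsto_compose[OF g'k kl]) simp_all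
          show "(\<lambda>n. bump z * j (?k n) p) \<longlonglongrightarrow> L z"
          proof (cases "v p = \<kappa>0")
            case False
            have "(\<lambda>n. sgn (v p - ?k n)) \<longlonglongrightarrow> sgn (v p - \<kappa>0)" using False by (intro tendsto_sgn tendsto_diff tendsto_const kl) auto
            then show ?thesis using False unfolding L_def j_def ef_def by (simp only: if_False) (intro tendsto_intros kl gl; simp)
          next
            case True
            have s: "sgn (v p - ?k n) = - sgn z" for n
            proof -
              have e: "v p - ?k n = - (1 / real (Suc n) * z)" using True by simp
              have "sgn (1 / real (Suc n)) = 1" by (intro sgn_pos) simp
              then show ?thesis unfolding e sgn_minus sgn_mult by simp
            qed
            have "(\<lambda>n. bump z * (\<bar>v p - ?k n\<bar> * \<psi>t p + - sgn z * (g' ?t (v p) - g' ?t (?k n)) * \<psi>x p + - sgn z * (a' ?t * v p) * \<psi> p))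
              \<longlonglongrightarrow> bump z * (\<bar>v p - \<kappa>0\<bar> * \<psi>t p + - sgn z * (g' ?t (v p) - g' ?t \<kappa>0) * \<psi>x p + - sgn z * (a' ?t * v p) * \<psi> p)"
              by (intro tendsto_intros kl gl)
            moreover have "L z = bump z * (\<bar>v p - \<kappa>0\<bar> * \<psi>t p + - sgn z * (g' ?t (v p) - g' ?t \<kappa>0) * \<psi>x p + - sgn z * (a' ?t * v p) * \<psi> p)"
              using True by (simp add: L_def)
            moreover have "bump z * j (?k n) p = bump z * (\<bar>v p - ?k n\<bar> * \<psi>t p + - sgn z * (g' ?t (v p) - g' ?t (?k n)) * \<psi>x p + - sgn z * (a' ?t * v p) * \<psi> p)" for n
              unfolding j_def ef_def s ..
            ultimately show ?thesis by (simp only:)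
          qed
        qed
      qed
      moreover have "(\<integral>z. L z \<partial>lborel) = m * j \<kappa>0 p"
      proof (cases "v p = \<kappa>0")
        case True
        have "(\<integral>z. L z \<partial>lborel) = (\<integral>z. (bump z * sgn z) * (- (a' ?t * v p) * \<psi> p) \<partial>lborel)"
          using True by (intro Bochner_Integration.integral_cong) (auto simp: L_def)
        also have "\<dots> = 0" by (simp add: bump_sgn_integral)
        finally show ?thesis using True by (simp add: j_def ef_def)
      qed (simp add: L_def m_def)
      ultimately show "(\<lambda>n. J (1 / real (Suc n)) p) \<longlonglongrightarrow> m * j \<kappa>0 p" by simp
    qed
  qed
  then have "0 \<le> (\<integral>p. m * j \<kappa>0 p \<partial>lborel)"
    by (rule tendsto_lowerbound) (auto intro!: always_eventually Jpos)
  then have "0 \<le> (\<integral>p. j \<kappa>0 p \<partial>lborel)" using bump_integral_pos by (simp add: m_def zero_le_mult_iff)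
  then show "0 \<le> (\<integral>p. ef (\<lambda>t v. exp (- \<gamma> t) * g t (exp (\<gamma> t) * v)) (\<lambda>t. a t - c t) (\<lambda>p. exp (- \<gamma> (snd p)) * w p) \<kappa>0 \<psi> \<psi>x \<psi>t p \<partial>lborel)"
    unfolding j_def g'_def[abs_def] a'_def[abs_def] v_def[abs_def] .
qed

end

section \<open>Uniqueness by cone test functions\<close>

lemma borel_measurable_lebesgue_AE:
  fixes f g :: "'a::euclidean_space \<Rightarrow> real"
  assumes g [measurable]: "g \<in> borel_measurable borel" and ae: "AE x in lborel. f x = g x"
  shows "f \<in> borel_measurable lebesgue"
proof (rule measurableI)
  fix S :: "real set" assume S [measurable]: "S \<in> sets borel"
  have "AE x in lborel. \<not> (f x \<noteq> g x)" using ae by simp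
  then have 1: "Measurable.pred lebesgue (\<lambda>x. f x \<noteq> g x)" by (rule sets_completion_AE)
  have "AE x in lborel. \<not> (f x \<in> S \<and> f x \<noteq> g x)" using ae by eventually_elim simp
  then have 2: "Measurable.pred lebesgue (\<lambda>x. f x \<in> S \<and> f x \<noteq> g x)" by (rule sets_completion_AE)
  have "g \<in> borel_measurable lebesgue" by (simp add: measurable_completion)
  then have 3: "Measurable.pred lebesgue (\<lambda>x. g x \<in> S)" using S by measurable
  have "Measurable.pred lebesgue (\<lambda>x. (g x \<in> S \<and> \<not> (f x \<noteq> g x)) \<or> (f x \<in> S \<and> f x \<noteq> g x))"
    using 1 2 3 by measurable
  also have "(\<lambda>x. (g x \<in> S \<and> \<not> (f x \<noteq> g x)) \<or> (f x \<in> S \<and> f x \<noteq> g x)) = (\<lambda>x. f x \<in> S)" by auto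
  finally show "f -` S \<inter> space lebesgue \<in> sets lebesgue" by (simp add: pred_def vimage_def)
qed simp

text \<open>A bridge from the completed measure in \<open>entropy_solution\<close> to Borel
  integrands on \<open>lborel\<close>, to which Fubini applies directly.\<close>

lemma integral_lebesgue_on_AE_eq:
  fixes X h :: "'a::euclidean_space \<Rightarrow> real"
  assumes S: "S \<in> sets borel" and h: "h \<in> borel_measurable borel"
    and ae: "AE p in lborel. indicator S p * X p = h p"
  shows "integral\<^sup>L (lebesgue_on S) X = (\<integral>p. h p \<partial>lborel)"
proof -
  have "integral\<^sup>L (lebesgue_on S) X = (\<integral>p. indicator S p *\<^sub>R X p \<partial>lebesgue)"
    using S by (intro integral_restrict_space) auto
  also have "\<dots> = (\<integral>p. h p \<partial>lebesgue)"
  proof (rule integral_cong_AE)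
    show "(\<lambda>p. indicator S p *\<^sub>R X p) \<in> borel_measurable lebesgue"
      using borel_measurable_lebesgue_AE[OF h ae] by simp
    show "h \<in> borel_measurable lebesgue" using h by (simp add: measurable_completion)
    show "AE p in lebesgue. indicator S p *\<^sub>R X p = h p" using ae by (simp add: AE_completion_iff)
  qed
  also have "\<dots> = (\<integral>p. h p \<partial>lborel)" using h by (intro integral_completion) simp
  finally show ?thesis .
qed

text \<open>Clamping turns the almost-everywhere bound into one valid at every point; |M| keeps the
  clamp meaningful should M be negative.\<close>

lemma Linfty_on_Borel:
  fixes g :: "'a::euclidean_space \<Rightarrow> real"
  assumes S: "S \<in> sets borel" and g: "Linfty_on S g"
  obtains g' M where "g' \<in> borel_measurable borel" "\<And>x. \<bar>g' x\<bar> \<le> M" "AE x in lborel. x \<in> S \<longrightarrow> g x = g' x"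
proof -
  obtain M where m: "g \<in> borel_measurable (lebesgue_on S)" and M: "AE x in lebesgue_on S. \<bar>g x\<bar> \<le> M"
    using g by (auto simp: Linfty_on_def)
  have "(\<lambda>x. if x \<in> S then g x else 0) \<in> borel_measurable lebesgue"
    using m S by (intro borel_measurable_if_I) auto
  then obtain g0 where g0: "g0 \<in> borel_measurable lborel" "AE x in lborel. (if x \<in> S then g x else 0) = g0 x"
    using completion_ex_borel_measurable_real[of "\<lambda>x. if x \<in> S then g x else 0" lborel] by blast
  have [measurable]: "g0 \<in> borel_measurable borel" using g0(1) by simp
  have "AE x in lebesgue. x \<in> S \<longrightarrow> \<bar>g x\<bar> \<le> M" using M S by (simp add: AE_restrict_space_iff)
  then have M': "AE x in lborel. x \<in> S \<longrightarrow> \<bar>g x\<bar> \<le> M" by (simp add: AE_completion_iff)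
  let ?m = "\<bar>M\<bar>"
  show thesis
  proof
    show "(\<lambda>x. max (- ?m) (min ?m (g0 x))) \<in> borel_measurable borel" by measurable
    show "\<bar>max (- ?m) (min ?m (g0 x))\<bar> \<le> ?m" for x by auto
    show "AE x in lborel. x \<in> S \<longrightarrow> g x = max (- ?m) (min ?m (g0 x))"
      using g0(2) M' by eventually_elim auto
  qed
qed

lemma AE_lborel_slices:
  assumes "AE p in (lborel :: (real \<times> real) measure). Q p"
  shows "AE t in lborel. AE x in lborel. Q (x, t)"
proof -
  obtain N where N: "{p\<in>space lborel. \<not> Q p} \<subseteq> N" "emeasure lborel N = 0" "N \<in> sets lborel"
    using AE_E[OF assms] by metis
  have Nb: "N \<in> sets (lborel \<Otimes>\<^sub>M lborel)" using N(3) unfolding lborel_prod .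
  have "(\<integral>\<^sup>+ t. emeasure lborel ((\<lambda>x. (x, t)) -` N) \<partial>lborel) = emeasure (lborel \<Otimes>\<^sub>M lborel) N"
    by (rule lborel_pair.emeasure_pair_measure_alt2[OF Nb, symmetric])
  also have "\<dots> = 0" using N(2) unfolding lborel_prod .
  finally have "AE t in lborel. emeasure lborel ((\<lambda>x. (x, t)) -` N) = 0"
    using lborel_pair.measurable_emeasure_Pair2[OF Nb] by (subst (asm) nn_integral_0_iff_AE) auto
  then show ?thesis
  proof eventually_elim
    case (elim t)
    have "(\<lambda>x. (x, t)) -` N \<in> sets lborel" using sets_Pair2[OF Nb, of t] by simp
    then have "(\<lambda>x. (x, t)) -` N \<in> null_sets lborel" using elim by auto
    then have "AE x in lborel. x \<notin> (\<lambda>x. (x, t)) -` N" by (rule AE_not_in)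
    then show ?case by eventually_elim (use N(1) in auto)
  qed
qed

lemma integral_lborel_slices:
  fixes D :: "real \<times> real \<Rightarrow> real"
  assumes "integrable lborel D"
  shows "(\<integral>p. D p \<partial>lborel) = (\<integral>t. (\<integral>x. D (x, t) \<partial>lborel) \<partial>lborel)"
    and "integrable lborel (\<lambda>t. \<integral>x. D (x, t) \<partial>lborel)"
proof -
  have i: "integrable (lborel \<Otimes>\<^sub>M lborel) (\<lambda>(x, t). D (x, t))" using assms unfolding lborel_prod by simp
  show "(\<integral>p. D p \<partial>lborel) = (\<integral>t. (\<integral>x. D (x, t) \<partial>lborel) \<partial>lborel)"
    using lborel_pair.integral_snd[OF i] unfolding lborel_prod by simp
  show "integrable lborel (\<lambda>t. \<integral>x. D (x, t) \<partial>lborel)"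
    using lborel_pair.integrable_snd[OF i] .
qed

context flux
begin

text \<open>The test function is \<theta> (t) g (x, t) with g = h (x + L t) h (- x + L t), a cone
  shrinking with the Lipschitz constant L of F as its speed, so that L |gx| \<le> - gt absorbs the
  flux term. The factor d in \<theta> decreases strictly on (0, T); the integral of |w - W| g (- d')
  is thus bounded by the contribution of an initial layer, which vanishes in the limit by
  \<open>N0\<close>.\<close>

lemma L1_unique:
  fixes w W :: "real \<times> real \<Rightarrow> real"
  assumes T: "T > 0"
    and w [measurable]: "w \<in> borel_measurable borel" "W \<in> borel_measurable borel"
    and B: "\<And>p. \<bar>w p\<bar> \<le> B" "\<And>p. \<bar>W p\<bar> \<le> B"
    and KI: "\<And>R \<tau> \<psi> \<psi>x \<psi>t. 0 < \<tau> \<Longrightarrow> \<tau> \<le> T \<Longrightarrow> C1test (cbox (-R, \<tau>) (R, T)) \<psi> \<psi>x \<psi>t \<Longrightarrow> (\<And>p. \<psi> p \<le> 1) \<Longrightarrow>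
       0 \<le> (\<integral>p. \<bar>w p - W p\<bar> * \<psi>t p + sgn (w p - W p) * (F (snd p) (w p) - F (snd p) (W p)) * \<psi>x p \<partial>lborel)"
    and N0: "\<And>\<rho> \<epsilon>. \<epsilon> > 0 \<Longrightarrow> \<exists>\<delta>>0. AE t in lborel. 0 < t \<longrightarrow> t < \<delta> \<longrightarrow> (\<integral>x. indicator {-\<rho>..\<rho>} x * \<bar>w (x, t) - W (x, t)\<bar> \<partial>lborel) \<le> \<epsilon>"
  shows "AE p in lborel. 0 < snd p \<longrightarrow> snd p < T \<longrightarrow> w p = W p"
proof -
  obtain L where L: "L \<ge> 0" "\<forall>t\<in>{0..T}. \<forall>a\<in>{-B..B}. \<forall>b\<in>{-B..B}. \<bar>F t a - F t b\<bar> \<le> L * \<bar>a - b\<bar>"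
    using F_lip[of 0 T B] by blast
  have B0: "B \<ge> 0" using B(1)[of undefined] by linarith
  have cone: "AE p in lborel. 0 < snd p \<longrightarrow> snd p < T \<longrightarrow> \<bar>fst p\<bar> + L * snd p \<le> R0 \<longrightarrow> w p = W p" for R0 :: real
  proof -
    define h h' where "h y = 1 - chi (y - R0)" and "h' y = - chi' (y - R0)" for y
    define d d' where "d t = 1 - chi (t / T)" and "d' t = - chi' (t / T) / T" for t
    have hd: "(h has_real_derivative h' y) (at y)" for y
    proof -
      have "((\<lambda>y. chi (y - R0)) has_real_derivative chi' (y - R0) * (1 - 0)) (at y)"
        by (intro DERIV_chain2[OF DERIV_chi] DERIV_diff DERIV_ident DERIV_const)
      then show ?thesis unfolding h_def[abs_def] h'_def using DERIV_diff[OF DERIV_const[of 1 "at y"]] by fastforce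
    qed
    have dd: "(d has_real_derivative d' t) (at t)" for t
    proof -
      have "((\<lambda>t. chi (t / T)) has_real_derivative chi' (t / T) * (1 / T)) (at t)"
        by (intro DERIV_chain2[OF DERIV_chi] DERIV_cdivide DERIV_ident)
      then show ?thesis unfolding d_def[abs_def] d'_def using DERIV_diff[OF DERIV_const[of 1 "at t"]] by fastforce
    qed
    have hb: "0 \<le> h y" "h y \<le> 1" "h' y \<le> 0" for y using chi_bounds[of "y - R0"] chi'_nonneg[of "y - R0"] by (auto simp: h_def h'_def)
    have db: "0 \<le> d t" "d t \<le> 1" "d' t \<le> 0" for t
      using chi_bounds[of "t / T"] chi'_nonneg[of "t / T"] T by (auto simp: d_def d'_def divide_nonpos_pos)
    have hz: "h y = 0" "h' y = 0" if "y > R0 + 1" for y using that chi_ge1[of "y - R0"] chi'_outside[of "y - R0"] by (auto simp: h_def h'_def)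
    have dz: "d t = 0" "d' t = 0" if "t > T" for t using that T chi_ge1[of "t / T"] chi'_outside[of "t / T"] by (auto simp: d_def d'_def)
    have chic: "continuous_on S (\<lambda>x. chi (f x))" "continuous_on S (\<lambda>x. chi' (f x))" if "continuous_on S f" for S :: "(real \<times> real) set" and f
      by (rule continuous_on_compose2[OF continuous_on_chi(1) that]; simp) (rule continuous_on_compose2[OF continuous_on_chi(2) that]; simp)
    have [measurable]: "chi \<in> borel_measurable borel" "chi' \<in> borel_measurable borel"
      by (auto intro: borel_measurable_continuous_onI continuous_on_chi)
    define g where "g p = h (fst p + L * snd p) * h (- fst p + L * snd p)" for p
    define gx where "gx p = h' (fst p + L * snd p) * h (- fst p + L * snd p) - h (fst p + L * snd p) * h' (- fst p + L * snd p)" for p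
    define gt where "gt p = L * (h' (fst p + L * snd p) * h (- fst p + L * snd p) + h (fst p + L * snd p) * h' (- fst p + L * snd p))" for p
    have [measurable]: "g \<in> borel_measurable borel" "d \<in> borel_measurable borel" "d' \<in> borel_measurable borel"
      unfolding g_def[abs_def] h_def d_def[abs_def] d'_def[abs_def] by measurable
    have gb: "0 \<le> g p" "g p \<le> 1" for p using hb unfolding g_def by (auto intro: mult_nonneg_nonneg mult_le_one)
    have gxt: "L * \<bar>gx p\<bar> \<le> - gt p" for p
    proof -
      let ?a = "h' (fst p + L * snd p) * h (- fst p + L * snd p)" and ?b = "h (fst p + L * snd p) * h' (- fst p + L * snd p)"
      have "?a \<le> 0" "?b \<le> 0" using hb by (auto intro: mult_nonpos_nonneg mult_nonneg_nonpos)
      then have "\<bar>?a - ?b\<bar> \<le> - (?a + ?b)" by linarith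
      then have "L * \<bar>?a - ?b\<bar> \<le> L * (- (?a + ?b))" using L(1) by (rule mult_left_mono)
      then show ?thesis by (simp only: gx_def gt_def mult_minus_right)
    qed
    have gz: "g p = 0" "gx p = 0" "gt p = 0" if "\<bar>fst p\<bar> > R0 + 1" "snd p \<ge> 0" for p
    proof -
      have "0 \<le> L * snd p" using L(1) that by simp
      then have "fst p + L * snd p > R0 + 1 \<or> - fst p + L * snd p > R0 + 1" using that by linarith
      then show "g p = 0" "gx p = 0" "gt p = 0" using hz by (auto simp: g_def gx_def gt_def)
    qed
    define D where "D p = (if snd p > 0 then \<bar>w p - W p\<bar> * g p else 0)" for p
    have Dm [measurable]: "D \<in> borel_measurable borel" unfolding D_def[abs_def] by measurable
    have D0: "0 \<le> D p" "D p \<le> 2 * B" for p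
    proof -
      have "\<bar>w p - W p\<bar> \<le> 2 * B" using B(1)[of p] B(2)[of p] by linarith
      then have "\<bar>w p - W p\<bar> * g p \<le> 2 * B * 1" using gb[of p] B0 by (intro mult_mono) auto
      then show "0 \<le> D p" "D p \<le> 2 * B" using gb[of p] B0 by (auto simp: D_def)
    qed
    have Dz: "D p = 0" if "\<bar>fst p\<bar> > R0 + 1 \<or> snd p \<le> 0" for p using gz[of p] that by (auto simp: D_def)
    let ?Box = "cbox (- (R0 + 1), 0) (R0 + 1, T)"
    have Di: "integrable lborel (\<lambda>p. D p * e (snd p))"
      if [measurable]: "e \<in> borel_measurable borel" and e: "\<And>t. \<bar>e t\<bar> \<le> Ce" "\<And>t. t > T \<Longrightarrow> e t = 0" for e :: "real \<Rightarrow> real" and Ce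
    proof (rule integrable_bounded_support[where K = ?Box and B = "2 * B * Ce"])
      show "D p * e (snd p) = 0" if "p \<notin> ?Box" for p
      proof -
        have "\<bar>fst p\<bar> > R0 + 1 \<or> snd p \<le> 0 \<or> snd p > T" using that by (cases p) (auto simp: cbox_Pair_eq abs_le_iff not_le)
        then show ?thesis using Dz[of p] e(2)[of "snd p"] by auto
      qed
      show "\<bar>D p * e (snd p)\<bar> \<le> 2 * B * Ce" for p
        unfolding abs_mult using D0[of p] e(1)[of "snd p"] B0 by (intro mult_mono) auto
    qed auto
    \<comment> \<open>The derivative of \<theta> = chi (n t - 1) d is
      \<open>\<theta>a - \<theta>b\<close>: the first part lives on the layer 1/n \<le> t \<le> 2/n,
      the second carries the decrease of d. The shift by 1 keeps the support of \<theta> away from t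
      = 0.\<close>
    define \<theta>a where "\<theta>a n t = real n * chi' (real n * t - 1) * d t" for n :: nat and t
    define \<theta>b where "\<theta>b n t = chi (real n * t - 1) * (- d' t)" for n :: nat and t
    have d'2: "\<bar>d' t\<bar> \<le> 2 / T" for t using chi'_le[of "t / T"] chi'_nonneg[of "t / T"] T by (simp add: d'_def abs_divide divide_right_mono)
    have ia: "integrable lborel (\<lambda>p. D p * \<theta>a n (snd p))" for n
    proof (rule Di[where Ce = "real n * 2 * 1"])
      show "\<theta>a n \<in> borel_measurable borel" unfolding \<theta>a_def[abs_def] by measurable
      show "\<bar>\<theta>a n t\<bar> \<le> real n * 2 * 1" for t
        unfolding \<theta>a_def abs_mult using chi'_le[of "real n * t - 1"] chi'_nonneg[of "real n * t - 1"] db[of t] by (intro mult_mono) auto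
    qed (simp add: \<theta>a_def dz)
    have ib: "integrable lborel (\<lambda>p. D p * \<theta>b n (snd p))" for n
    proof (rule Di[where Ce = "1 * (2 / T)"])
      show "\<theta>b n \<in> borel_measurable borel" unfolding \<theta>b_def[abs_def] by measurable
      show "\<bar>\<theta>b n t\<bar> \<le> 1 * (2 / T)" for t
        unfolding \<theta>b_def abs_mult using chi_bounds[of "real n * t - 1"] d'2[of t] by (intro mult_mono) auto
    qed (simp add: \<theta>b_def dz)
    have id: "integrable lborel (\<lambda>p. D p * (- d' (snd p)))"
      by (rule Di[where Ce = "2 / T"]) (use d'2 dz in auto)
    have le: "(\<integral>p. D p * \<theta>b n (snd p) \<partial>lborel) \<le> (\<integral>p. D p * \<theta>a n (snd p) \<partial>lborel)" if n: "n > 0" "1 / real n \<le> T" for n :: nat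
    proof -
      define \<theta> where "\<theta> t = chi (real n * t - 1) * d t" for t
      define \<theta>' where "\<theta>' t = real n * chi' (real n * t - 1) * d t + chi (real n * t - 1) * d' t" for t
      have \<theta>d: "(\<theta> has_real_derivative \<theta>' t) (at t)" for t
      proof -
        have "((\<lambda>t. chi (real n * t - 1)) has_real_derivative chi' (real n * t - 1) * (real n - 0)) (at t)"
          by (intro DERIV_chain2[OF DERIV_chi] DERIV_diff DERIV_cmult_Id DERIV_const)
        from DERIV_mult[OF this dd] show ?thesis unfolding \<theta>_def[abs_def] \<theta>'_def by (simp add: algebra_simps)
      qed
      have \<theta>b0: "0 \<le> \<theta> t" "\<theta> t \<le> 1" for t
        unfolding \<theta>_def using chi_bounds[of "real n * t - 1"] db[of t] by (auto intro: mult_nonneg_nonneg mult_le_one)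
      have \<theta>z: "\<theta> t = 0" "\<theta>' t = 0" if "t < 1 / real n \<or> t > T" for t
      proof -
        have "real n * t - 1 \<le> 0 \<or> t > T" using that n by (auto simp: field_simps)
        then show "\<theta> t = 0" "\<theta>' t = 0"
          using chi_le0[of "real n * t - 1"] chi'_outside[of "real n * t - 1"] dz[of t] by (auto simp: \<theta>_def \<theta>'_def)
      qed
      define \<psi> where "\<psi> p = \<theta> (snd p) * g p" for p
      define \<psi>x where "\<psi>x p = \<theta> (snd p) * gx p" for p
      define \<psi>t where "\<psi>t p = \<theta>' (snd p) * g p + \<theta> (snd p) * gt p" for p
      have C: "C1test (cbox (- (R0 + 1), 1 / real n) (R0 + 1, T)) \<psi> \<psi>x \<psi>t"
        unfolding C1test_def
      proof (intro conjI allI impI)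
        note ci = continuous_intros chic
        show "continuous_on UNIV \<psi>"
          unfolding \<psi>_def[abs_def] \<theta>_def g_def h_def d_def by (intro ci) (use T in auto)
        show "continuous_on UNIV \<psi>x"
          unfolding \<psi>x_def[abs_def] \<theta>_def gx_def h_def h'_def d_def by (intro ci) (use T in auto)
        show "continuous_on UNIV \<psi>t"
          unfolding \<psi>t_def[abs_def] \<theta>_def \<theta>'_def g_def gt_def h_def h'_def d_def d'_def by (intro ci) (use T in auto)
        fix x t :: real
        have a1: "((\<lambda>y. h (y + L * t)) has_real_derivative h' (x + L * t) * (1 + 0)) (at x)"
          by (intro DERIV_chain2[OF hd] DERIV_add DERIV_ident DERIV_const)
        have a2: "((\<lambda>y. h (- y + L * t)) has_real_derivative h' (- x + L * t) * (- 1 + 0)) (at x)"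
          by (intro DERIV_chain2[OF hd] DERIV_add DERIV_minus DERIV_ident DERIV_const)
        show "((\<lambda>y. \<psi> (y, t)) has_real_derivative \<psi>x (x, t)) (at x)"
          using DERIV_cmult[OF DERIV_mult[OF a1 a2], of "\<theta> t"] by (simp add: \<psi>_def \<psi>x_def g_def gx_def algebra_simps)
        have b1: "((\<lambda>s. h (x + L * s)) has_real_derivative h' (x + L * t) * (0 + L)) (at t)"
          by (intro DERIV_chain2[OF hd] DERIV_add DERIV_cmult_Id DERIV_const)
        have b2: "((\<lambda>s. h (- x + L * s)) has_real_derivative h' (- x + L * t) * (0 + L)) (at t)"
          by (intro DERIV_chain2[OF hd] DERIV_add DERIV_cmult_Id DERIV_const)
        show "((\<lambda>s. \<psi> (x, s)) has_real_derivative \<psi>t (x, t)) (at t)"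
          using DERIV_mult[OF \<theta>d[of t] DERIV_mult[OF b1 b2]] by (simp add: \<psi>_def \<psi>t_def g_def gt_def algebra_simps)
      next
        show "0 \<le> \<psi> p" for p unfolding \<psi>_def using \<theta>b0 gb by simp
      next
        fix p assume "p \<notin> cbox (- (R0 + 1), 1 / real n) (R0 + 1, T)"
        then have "(snd p < 1 / real n \<or> snd p > T) \<or> (\<bar>fst p\<bar> > R0 + 1 \<and> snd p \<ge> 1 / real n)"
          by (cases p) (auto simp: cbox_Pair_eq abs_le_iff not_le)
        moreover have "0 \<le> 1 / real n" by simp
        ultimately have "(snd p < 1 / real n \<or> snd p > T) \<or> (\<bar>fst p\<bar> > R0 + 1 \<and> snd p \<ge> 0)" by linarith
        then show "\<psi> p = 0" "\<psi>x p = 0" "\<psi>t p = 0"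
          using \<theta>z[of "snd p"] gz[of p] by (auto simp: \<psi>_def \<psi>x_def \<psi>t_def)
      qed
      have \<psi>1: "\<psi> p \<le> 1" for p unfolding \<psi>_def using \<theta>b0 gb by (intro mult_le_one) auto
      have "0 \<le> (\<integral>p. \<bar>w p - W p\<bar> * \<psi>t p + sgn (w p - W p) * (F (snd p) (w p) - F (snd p) (W p)) * \<psi>x p \<partial>lborel)"
        using n by (intro KI[OF _ _ C \<psi>1]) auto
      also have "\<dots> \<le> (\<integral>p. D p * \<theta>a n (snd p) - D p * \<theta>b n (snd p) \<partial>lborel)"
      proof (cases "integrable lborel (\<lambda>p. \<bar>w p - W p\<bar> * \<psi>t p + sgn (w p - W p) * (F (snd p) (w p) - F (snd p) (W p)) * \<psi>x p)")
        case True
        then show ?thesis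
        proof (rule integral_mono)
          show "integrable lborel (\<lambda>p. D p * \<theta>a n (snd p) - D p * \<theta>b n (snd p))" using ia[of n] ib[of n] by simp
          fix p
          let ?t = "snd p" and ?m = "\<bar>w p - W p\<bar>"
          show "?m * \<psi>t p + sgn (w p - W p) * (F ?t (w p) - F ?t (W p)) * \<psi>x p \<le> D p * \<theta>a n ?t - D p * \<theta>b n ?t"
          proof (cases "1 / real n \<le> ?t \<and> ?t \<le> T")
            case True
            have "0 < 1 / real n" using n by simp
            then have t0: "0 < ?t" using True by linarith
            then have t: "0 < ?t" "?t \<in> {0..T}" using True by simp_all
            have "w p \<in> {-B..B}" "W p \<in> {-B..B}" using B[of p] by (auto simp: abs_le_iff)
            then have "\<bar>F ?t (w p) - F ?t (W p)\<bar> \<le> L * ?m" using L(2) t by blast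
            then have "\<bar>sgn (w p - W p)\<bar> * \<bar>F ?t (w p) - F ?t (W p)\<bar> \<le> 1 * (L * ?m)"
              by (intro mult_mono) (auto simp: sgn_real_def)
            then have "\<bar>sgn (w p - W p) * (F ?t (w p) - F ?t (W p))\<bar> * \<bar>\<psi>x p\<bar> \<le> L * ?m * \<bar>\<psi>x p\<bar>"
              by (intro mult_right_mono) (auto simp: abs_mult)
            then have "sgn (w p - W p) * (F ?t (w p) - F ?t (W p)) * \<psi>x p \<le> L * ?m * \<bar>\<psi>x p\<bar>"
              by (metis abs_le_D1 abs_mult)
            also have "\<dots> = ?m * \<theta> ?t * (L * \<bar>gx p\<bar>)" using \<theta>b0 by (simp add: \<psi>x_def abs_mult)
            also have "\<dots> \<le> ?m * \<theta> ?t * (- gt p)" using gxt[of p] \<theta>b0 by (intro mult_left_mono) auto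
            finally have 1: "sgn (w p - W p) * (F ?t (w p) - F ?t (W p)) * \<psi>x p \<le> ?m * \<theta> ?t * (- gt p)" .
            have "?m * \<psi>t p + ?m * \<theta> ?t * (- gt p) = D p * \<theta>a n ?t - D p * \<theta>b n ?t"
              using t by (simp add: \<psi>t_def D_def \<theta>'_def \<theta>a_def \<theta>b_def algebra_simps)
            then show ?thesis using 1 by linarith
          next
            case False
            then have z: "\<theta> ?t = 0" "\<theta>' ?t = 0" using \<theta>z[of ?t] by (auto simp: not_le)
            have "\<theta>a n ?t - \<theta>b n ?t = \<theta>' ?t" by (simp add: \<theta>a_def \<theta>b_def \<theta>'_def)
            then have "\<theta>a n ?t = \<theta>b n ?t" using z by simp
            then show ?thesis using z by (simp add: \<psi>t_def \<psi>x_def)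
          qed
        qed
      next
        case False
        have [measurable]: "\<psi>x \<in> borel_measurable borel" "\<psi>t \<in> borel_measurable borel"
          using C by (auto simp: C1test_def intro: borel_measurable_continuous_onI)
        have Fm [measurable]: "(\<lambda>p. F (snd p) (e p)) \<in> borel_measurable borel" if [measurable]: "e \<in> borel_measurable borel" for e :: "real \<times> real \<Rightarrow> real"
          using measurable_compose[OF borel_measurable_Pair[OF borel_measurable_fst_snd(2) that] borel_measurable_continuous_onI[OF F_continuous]] by simp
        \<comment> \<open>This case is void: the integrand is that of the comparison locale, whose
          integrability contradicts the case assumption.\<close>
        have adm: "flux_test f f' \<beta> (1 / real n) T w"
          by unfold_locales (use n w B in auto)
        interpret ft: flux_test f f' \<beta> "R0 + 1" "1 / real n" T w by (rule adm)
        have "ft.adm W" unfolding ft.adm_def using w B by blast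
        from ft.I_integrable[OF this, of \<psi> \<psi>x \<psi>t] C False
        show ?thesis unfolding ft.K_def ft.I_def[abs_def] ft.Q_def by simp
      qed
      also have "\<dots> = (\<integral>p. D p * \<theta>a n (snd p) \<partial>lborel) - (\<integral>p. D p * \<theta>b n (snd p) \<partial>lborel)"
        using ia[of n] ib[of n] by simp
      finally show ?thesis by simp
    qed
    have lim: "(\<lambda>n. \<integral>p. D p * \<theta>b n (snd p) \<partial>lborel) \<longlonglongrightarrow> (\<integral>p. D p * (- d' (snd p)) \<partial>lborel)"
    proof (rule integral_dominated_convergence[where w = "\<lambda>p. D p * (- d' (snd p))"])
      show "AE p in lborel. norm (D p * \<theta>b n (snd p)) \<le> D p * (- d' (snd p))" for n
      proof (rule AE_I2)
        fix p
        have "chi (real n * snd p - 1) * (D p * (- d' (snd p))) \<le> 1 * (D p * (- d' (snd p)))"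
          using chi_bounds D0 db by (intro mult_right_mono mult_nonneg_nonneg) auto
        moreover have "0 \<le> chi (real n * snd p - 1) * (D p * (- d' (snd p)))"
          using chi_bounds D0 db by (intro mult_nonneg_nonneg) auto
        ultimately show "norm (D p * \<theta>b n (snd p)) \<le> D p * (- d' (snd p))"
          by (simp add: \<theta>b_def mult_ac)
      qed
      show "AE p in lborel. (\<lambda>n. D p * \<theta>b n (snd p)) \<longlonglongrightarrow> D p * (- d' (snd p))"
      proof (rule AE_I2)
        fix p
        show "(\<lambda>n. D p * \<theta>b n (snd p)) \<longlonglongrightarrow> D p * (- d' (snd p))"
        proof (cases "snd p > 0")
          case True
          obtain N where N: "real N * snd p > 2" using reals_Archimedean3[OF True] by blast
          have "D p * \<theta>b n (snd p) = D p * (- d' (snd p))" if "n \<ge> N" for n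
          proof -
            have "real N * snd p \<le> real n * snd p" using that True by simp
            then have "chi (real n * snd p - 1) = 1" using N by (intro chi_ge1) linarith
            then show ?thesis by (simp add: \<theta>b_def)
          qed
          then show ?thesis by (intro tendsto_eventually) (auto simp: eventually_sequentially)
        qed (use Dz in simp)
      qed
      show "integrable lborel (\<lambda>p. D p * (- d' (snd p)))" by (rule id)
    qed (use ib id in \<open>auto dest: borel_measurable_integrable\<close>)
    have upper: "(\<integral>p. D p * (- d' (snd p)) \<partial>lborel) \<le> 2 * \<epsilon>" if \<epsilon>: "\<epsilon> > 0" for \<epsilon>
    proof -
      obtain \<delta> where \<delta>: "\<delta> > 0" "AE t in lborel. 0 < t \<longrightarrow> t < \<delta> \<longrightarrow> (\<integral>x. indicator {-(R0+1)..R0+1} x * \<bar>w (x, t) - W (x, t)\<bar> \<partial>lborel) \<le> \<epsilon>"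
        using N0[OF \<epsilon>, of "R0 + 1"] by blast
      obtain N :: nat where N: "2 / min \<delta> T < real N" using reals_Archimedean2 by blast
      have "(\<integral>p. D p * \<theta>b n (snd p) \<partial>lborel) \<le> 2 * \<epsilon>" if n: "n \<ge> N" for n
      proof -
        have mT: "0 < min \<delta> T" using \<delta> T by simp
        have "2 / min \<delta> T < real n" using N n by linarith
        moreover have "0 < 2 / min \<delta> T" using mT by simp
        ultimately have npos: "real n > 0" by linarith
        have "2 < real n * min \<delta> T" using \<open>2 / min \<delta> T < real n\<close> unfolding pos_divide_less_eq[OF mT] .
        then have "2 < min \<delta> T * real n" by (simp only: mult.commute)
        then have "2 / real n < min \<delta> T" unfolding pos_divide_less_eq[OF npos] .
        then have n2: "2 / real n < \<delta>" "2 / real n < T" by auto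
        have "1 / real n \<le> 2 / real n" using npos by (simp add: divide_right_mono)
        then have n1: "1 / real n \<le> T" using n2 by linarith
        have n0: "n > 0" using npos by simp
        have "(\<integral>p. D p * \<theta>b n (snd p) \<partial>lborel) \<le> (\<integral>p. D p * \<theta>a n (snd p) \<partial>lborel)" by (rule le[OF n0 n1])
        also have "\<dots> = (\<integral>t. (\<integral>x. D (x, t) * \<theta>a n t \<partial>lborel) \<partial>lborel)"
          using integral_lborel_slices(1)[OF ia[of n]] by simp
        \<comment> \<open>A slope of at most 2 n acts over a layer of width 1/n, in which the L^1
          distance is at most \<epsilon> for almost every t; this gives 2 \<epsilon> whatever n
          is.\<close>
        also have "\<dots> \<le> (\<integral>t. 2 * real n * \<epsilon> * indicator {1 / real n..2 / real n} t \<partial>lborel)"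
        proof (rule integral_mono_AE)
          show "integrable lborel (\<lambda>t. \<integral>x. D (x, t) * \<theta>a n t \<partial>lborel)" using integral_lborel_slices(2)[OF ia[of n]] by simp
          show "integrable lborel (\<lambda>t. 2 * real n * \<epsilon> * indicator {1 / real n..2 / real n} t)"
            by (intro integrable_mult_right integrable_real_indicator) (auto simp: emeasure_lborel_Icc_eq)
          show "AE t in lborel. (\<integral>x. D (x, t) * \<theta>a n t \<partial>lborel) \<le> 2 * real n * \<epsilon> * indicator {1 / real n..2 / real n} t"
            using \<delta>(2)
          proof eventually_elim
            case (elim t)
            show ?case
            proof (cases "t \<in> {1 / real n..2 / real n}")
              case True
              have "0 < 1 / real n" using npos by simp
              moreover have "1 / real n \<le> t" using True by simp
              ultimately have tpos: "0 < t" by linarith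
              have bnd: "(\<integral>x. indicator {-(R0+1)..R0+1} x * \<bar>w (x, t) - W (x, t)\<bar> \<partial>lborel) \<le> \<epsilon>"
                using elim tpos True n2 by auto
              have th: "\<theta>a n t \<le> 2 * real n" "0 \<le> \<theta>a n t"
              proof -
                have "real n * chi' (real n * t - 1) * d t \<le> real n * 2 * 1"
                  using chi'_le[of "real n * t - 1"] chi'_nonneg[of "real n * t - 1"] db[of t] by (intro mult_mono) auto
                then show "\<theta>a n t \<le> 2 * real n" by (simp add: \<theta>a_def)
                show "0 \<le> \<theta>a n t" unfolding \<theta>a_def using chi'_nonneg db by simp
              qed
              have [measurable]: "(\<lambda>x. w (x, t)) \<in> borel_measurable borel" "(\<lambda>x. W (x, t)) \<in> borel_measurable borel"
                by (rule measurable_compose[OF _ w(1)]; intro borel_measurable_continuous_onI continuous_intros)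
                   (rule measurable_compose[OF _ w(2)]; intro borel_measurable_continuous_onI continuous_intros)
              have ii: "integrable lborel (\<lambda>x. indicator {-(R0+1)..R0+1} x * \<bar>w (x, t) - W (x, t)\<bar>)"
              proof (rule integrable_bounded_support[where K = "{-(R0+1)..R0+1}" and B = "2 * B"])
                show "\<bar>indicator {-(R0+1)..R0+1} x * \<bar>w (x, t) - W (x, t)\<bar>\<bar> \<le> 2 * B" for x
                  using B(1)[of "(x, t)"] B(2)[of "(x, t)"] B0 by (auto simp: indicator_def)
              qed auto
              have "(\<integral>x. D (x, t) * \<theta>a n t \<partial>lborel) \<le> (\<integral>x. (2 * real n) * (indicator {-(R0+1)..R0+1} x * \<bar>w (x, t) - W (x, t)\<bar>) \<partial>lborel)"
              proof (rule integral_mono')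
                show "integrable lborel (\<lambda>x. (2 * real n) * (indicator {-(R0+1)..R0+1} x * \<bar>w (x, t) - W (x, t)\<bar>))" using ii by simp
                fix x
                have "D (x, t) \<le> indicator {-(R0+1)..R0+1} x * \<bar>w (x, t) - W (x, t)\<bar>"
                proof (cases "x \<in> {-(R0+1)..R0+1}")
                  case True
                  then show ?thesis using gb(2)[of "(x, t)"] by (auto simp: D_def intro: mult_left_le)
                next
                  case False
                  then have "\<bar>fst (x, t)\<bar> > R0 + 1" by auto
                  then show ?thesis using Dz[of "(x, t)"] by (auto simp: indicator_def)
                qed
                then have "D (x, t) * \<theta>a n t \<le> (indicator {-(R0+1)..R0+1} x * \<bar>w (x, t) - W (x, t)\<bar>) * (2 * real n)"
                  using th D0 by (intro mult_mono) auto
                then show "D (x, t) * \<theta>a n t \<le> (2 * real n) * (indicator {-(R0+1)..R0+1} x * \<bar>w (x, t) - W (x, t)\<bar>)" by (simp add: mult.commute)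
              qed simp
              also have "\<dots> = (2 * real n) * (\<integral>x. indicator {-(R0+1)..R0+1} x * \<bar>w (x, t) - W (x, t)\<bar> \<partial>lborel)" by simp
              also have "\<dots> \<le> (2 * real n) * \<epsilon>" using bnd by (intro mult_left_mono) auto
              finally show ?thesis using True by simp
            next
              case False
              have "t < 1 / real n \<or> t > 2 / real n" using False by auto
              then have "real n * t - 1 \<le> 0 \<or> real n * t - 1 \<ge> 1" using npos by (auto simp: field_simps)
              then have "\<theta>a n t = 0" using chi'_outside by (simp add: \<theta>a_def)
              then show ?thesis using False by simp
            qed
          qed
        qed
        also have "\<dots> = 2 * real n * \<epsilon> * (2 / real n - 1 / real n)"
          using \<open>1 / real n \<le> 2 / real n\<close> by simp
        also have "\<dots> = 2 * \<epsilon>" using npos by (simp add: field_simps)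
        finally show ?thesis .
      qed
      then have "\<forall>\<^sub>F n in sequentially. (\<integral>p. D p * \<theta>b n (snd p) \<partial>lborel) \<le> 2 * \<epsilon>" unfolding eventually_sequentially by blast
      then show ?thesis by (rule tendsto_upperbound[OF lim]) simp
    qed
    have nn: "0 \<le> D p * (- d' (snd p))" for p using D0 db by (intro mult_nonneg_nonneg) auto
    have "(\<integral>p. D p * (- d' (snd p)) \<partial>lborel) \<le> 0"
    proof (rule field_le_epsilon)
      fix e :: real assume "e > 0"
      then show "(\<integral>p. D p * (- d' (snd p)) \<partial>lborel) \<le> 0 + e" using upper[of "e / 2"] by simp
    qed
    moreover have "0 \<le> (\<integral>p. D p * (- d' (snd p)) \<partial>lborel)" by (rule Bochner_Integration.integral_nonneg) (rule nn)
    ultimately have "(\<integral>p. D p * (- d' (snd p)) \<partial>lborel) = 0" by linarith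
    then have "AE p in lborel. D p * (- d' (snd p)) = 0"
      using integral_nonneg_eq_0_iff_AE[OF id] nn by auto
    then show ?thesis
    proof eventually_elim
      case (elim p)
      show ?case
      proof (intro impI)
        assume t: "0 < snd p" "snd p < T" and c: "\<bar>fst p\<bar> + L * snd p \<le> R0"
        have "d' (snd p) \<noteq> 0"
        proof -
          have z: "0 < snd p / T" "snd p / T < 1" using t T by auto
          then have "chi' (snd p / T) > 0" by (auto simp: chi'_def max_def)
          then show ?thesis using T by (simp add: d'_def)
        qed
        then have "D p = 0" using elim by simp
        moreover have "g p = 1"
        proof -
          have "chi (fst p + L * snd p - R0) = 0" "chi (- fst p + L * snd p - R0) = 0" using c by (intro chi_le0; linarith)+
          then show ?thesis by (simp add: g_def h_def)
        qed
        ultimately show "w p = W p" using t by (simp add: D_def)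
      qed
    qed
  qed
  have "AE p in lborel. \<forall>n::nat. 0 < snd p \<longrightarrow> snd p < T \<longrightarrow> \<bar>fst p\<bar> + L * snd p \<le> real n \<longrightarrow> w p = W p"
    using cone by (subst AE_all_countable) blast
  then show ?thesis
  proof eventually_elim
    case (elim p)
    obtain n :: nat where "\<bar>fst p\<bar> + L * snd p \<le> real n" using real_arch_simple by blast
    then show ?case using elim by blast
  qed
qed

end

text \<open>A set of full measure meets every interval; used to choose points near a shock and times
  near a given one.\<close>

lemma AE_lborel_ex:
  assumes "AE x in lborel. Q x" "a < (b::real)"
  shows "\<exists>x. a < x \<and> x < b \<and> Q x"
proof (rule ccontr)
  assume "\<not> ?thesis"
  then have n: "\<And>x. a < x \<Longrightarrow> x < b \<Longrightarrow> \<not> Q x" by blast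
  have "AE x in lborel. x \<notin> {a<..<b}" using assms(1) by eventually_elim (use n in auto)
  then have "{a<..<b} \<in> null_sets lborel" by (subst AE_iff_null_sets) auto
  then have "emeasure lborel {a<..<b} = 0" by auto
  then show False using assms(2) by simp
qed

section \<open>Fractional variation of the glued fans\<close>

text \<open>With n = i + 3 the gap is at least 1 / (n (ln n)^2), and ln n \<le> n^a / a turns this
  into a^2 n^(-(1 + 2 a)). Choosing 1 + 2 a = 1 / p makes the p-th power a multiple of 1 / n. This
  is what the logarithm in the nodes is for: bounded nodes whose gaps, raised to any p < 1, are at
  least harmonic.\<close>

lemma ln_gap_bound:
  assumes "p > 0" "p < (1::real)"
  obtains k where "k > 0" "\<And>i::nat. k / real (i + 3) \<le> (1 / ln (real (i + 2)) - 1 / ln (real (i + 3))) powr p"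
proof -
  define a where "a = (1 - p) / (2 * p)"
  have a: "a > 0" using assms by (simp add: a_def)
  have e: "1 + 2 * a = 1 / p" using assms by (simp add: a_def field_simps)
  have gap: "(a powr (2 * p)) / real (i + 3) \<le> (1 / ln (real (i + 2)) - 1 / ln (real (i + 3))) powr p" for i :: nat
  proof -
    define n where "n = real (i + 3)"
    have n: "n \<ge> 3" by (simp add: n_def)
    have n1: "real (i + 2) = n - 1" by (simp add: n_def)
    have l: "0 < ln (n - 1)" "0 < ln n" "ln (n - 1) \<le> ln n" using n by simp_all
    have "1 / n \<le> ln n - ln (n - 1)"
    proof -
      have "ln ((n - 1) / n) \<le> (n - 1) / n - 1" using n by (intro ln_le_minus_one) simp
      also have "(n - 1) / n - 1 = - (1 / n)" using n by (simp add: field_simps)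
      also have "ln ((n - 1) / n) = ln (n - 1) - ln n" using n by (simp add: ln_div)
      finally show ?thesis by simp
    qed
    then have "(1 / n) / (ln n * ln n) \<le> (ln n - ln (n - 1)) / (ln (n - 1) * ln n)"
      using l n by (intro frac_le mult_right_mono) auto
    also have "\<dots> = 1 / ln (n - 1) - 1 / ln n" using l by (simp add: field_simps)
    finally have 1: "(1 / n) / (ln n * ln n) \<le> 1 / ln (n - 1) - 1 / ln n" .
    have "ln n \<le> n powr a / a" using n a by (intro ln_powr_bound) auto
    then have "ln n * ln n \<le> (n powr a / a) * (n powr a / a)" using l by (intro mult_mono) auto
    then have "(1 / n) / ((n powr a / a) * (n powr a / a)) \<le> (1 / n) / (ln n * ln n)"
    proof -
      have "0 < n powr a / a" using n a by simp
      then show ?thesis using l n \<open>ln n * ln n \<le> (n powr a / a) * (n powr a / a)\<close>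
        by (intro divide_left_mono mult_pos_pos) auto
    qed
    moreover have "(1 / n) / ((n powr a / a) * (n powr a / a)) = a powr 2 * n powr (- (1 + 2 * a))"
    proof -
      have "1 + 2 * a = 1 + a + a" by simp
      then have "n powr (1 + 2 * a) = n powr 1 * n powr a * n powr a" by (simp only: powr_add)
      then have "n powr (- (1 + 2 * a)) = 1 / (n powr 1 * n powr a * n powr a)"
        by (simp only: powr_minus inverse_eq_divide)
      then show ?thesis using n a by (simp add: power2_eq_square field_simps)
    qed
    ultimately have "a powr 2 * n powr (- (1 / p)) \<le> 1 / ln (n - 1) - 1 / ln n" using 1 e by simp
    then have "(a powr 2 * n powr (- (1 / p))) powr p \<le> (1 / ln (n - 1) - 1 / ln n) powr p"
      using assms by (intro powr_mono2) auto
    moreover have "(a powr 2 * n powr (- (1 / p))) powr p = a powr (2 * p) / n"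
    proof -
      have 1: "(n powr (- (1 / p))) powr p = n powr (- 1)" unfolding powr_powr using assms by simp
      have 2: "n powr (- 1) = 1 / n" using n by (simp add: powr_minus_divide)
      have 3: "(a powr 2) powr p = a powr (2 * p)" by (rule powr_powr)
      have "(a powr 2 * n powr (- (1 / p))) powr p = (a powr 2) powr p * (n powr (- (1 / p))) powr p"
        by (rule powr_mult)
      then show ?thesis unfolding 1 2 3 by simp
    qed
    ultimately show ?thesis unfolding n_def[symmetric] n1 by simp
  qed
  show thesis by (rule that[of "a powr (2 * p)"]) (use a gap in auto)
qed

text \<open>The two families interleave into one increasing sequence of points; the increments from
  \<open>xp j\<close> to \<open>xm (Suc j)\<close> contribute nonnegative terms and are
  dropped.\<close>

lemma TVs_alternating_lower:
  fixes xm xp :: "nat \<Rightarrow> real"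
  assumes ord: "\<And>j. xm j < xp j" "\<And>j. xp j < xm (Suc j)" and ab: "\<And>j. a \<le> xm j" "\<And>j. xp j \<le> b"
    and N: "N > 0"
  shows "ereal (\<Sum>j<N. \<bar>v (xp j) - v (xm j)\<bar> powr (1 / s)) \<le> TVs s v a b"
proof -
  \<comment> \<open>Indices start at 1 as in \<open>TVs\<close>: odd k gives a point of
    \<open>xm\<close>, even k one of \<open>xp\<close>, and the increments kept are those with index
    2 j + 2.\<close>
  define X where "X k = (if odd k then xm (k div 2) else xp (k div 2 - 1))" for k :: nat
  have Xs: "X k < X (Suc k)" if "k \<ge> 1" for k
  proof (cases "odd k")
    case True
    then obtain m where "k = 2 * m + 1" by (elim oddE)
    then show ?thesis using ord(1)[of m] by (simp add: X_def)
  next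
    case False
    then obtain m where m: "k = 2 * m" by (auto elim: evenE)
    have "m \<noteq> 0" using m that by auto
    then obtain j where "m = Suc j" by (cases m) auto
    then show ?thesis using ord(2)[of j] m by (simp add: X_def)
  qed
  have Xm: "X k < X l" if "1 \<le> k" "k < l" for k l
    using that(2,1)
  proof (induction l)
    case (Suc l)
    then show ?case using Xs[of l] by (cases "k = l") auto
  qed simp
  let ?n = "2 * N"
  let ?f = "\<lambda>i. \<bar>v (X i) - v (X (i - 1))\<bar> powr (1 / s)"
  have "(\<Sum>j<N. \<bar>v (xp j) - v (xm j)\<bar> powr (1 / s)) = (\<Sum>j<N. ?f (2 * j + 2))"
    by (intro sum.cong) (auto simp: X_def)
  also have "\<dots> = sum ?f ((\<lambda>j. 2 * j + 2) ` {..<N})"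
    by (subst sum.reindex) (auto simp: inj_on_def)
  also have "\<dots> \<le> (\<Sum>i=2..?n. ?f i)"
    by (rule sum_mono2) auto
  finally have le: "(\<Sum>j<N. \<bar>v (xp j) - v (xm j)\<bar> powr (1 / s)) \<le> (\<Sum>i=2..?n. ?f i)" .
  have "ereal (\<Sum>i=2..?n. ?f i) \<le> TVs s v a b"
    unfolding TVs_def
  proof (rule Sup_upper, rule CollectI, intro exI conjI)
    show "2 \<le> ?n" using N by simp
    show "strict_mono_on {1..?n} X" using Xm by (auto simp: strict_mono_on_def)
    show "a \<le> X 1" using ab(1)[of 0] by (simp add: X_def)
    show "X ?n \<le> b" using ab(2)[of "N - 1"] by (simp add: X_def)
  qed simp
  then show ?thesis using le order_trans ereal_less_eq(3) by blast
qed

section \<open>Continuity in time, down to t = 0\<close>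

context flux
begin

lemma G_continuous_y: "t \<ge> 0 \<Longrightarrow> continuous_on UNIV (\<lambda>y. G y t)"
proof -
  assume t: "t \<ge> 0"
  have r: "range (\<lambda>y. (y, t)) \<subseteq> UNIV \<times> {0..}" using t by auto
  have c: "continuous_on UNIV (\<lambda>y. (y, t))" by (intro continuous_intros)
  show ?thesis using continuous_on_compose2[OF G_continuous c r] by simp
qed

lemma G_continuous_t: "continuous_on {0..} (\<lambda>t. G y t)"
proof -
  have r: "(\<lambda>t. (y, t)) ` {0..} \<subseteq> UNIV \<times> {0..}" by auto
  have c: "continuous_on {0..} (\<lambda>t. (y, t))" by (intro continuous_intros)
  show ?thesis using continuous_on_compose2[OF G_continuous c r] by simp
qed

lemma E_continuous_y: assumes "t \<ge> 0" shows "continuous_on UNIV (\<lambda>y. E y t)"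
  by (rule DERIV_continuous_on, rule has_field_derivative_at_within[OF E_deriv_y[OF assms]])

lemma Phi_ge: "t \<ge> 0 \<Longrightarrow> f v \<le> Phi v t"
  unfolding Phi_def using F_nonneg F'_int(2) by (simp add: integral_nonneg)

text \<open>For t > 0 this is differentiability. At t = 0 a squeeze is used: from below the
  Fenchel-Young inequality with the fixed competitor G y 0, from above E y t \<le> E y 0 because Phi
  v t \<ge> f v = Phi v 0.\<close>

lemma E_continuous_t: "continuous_on {0..} (\<lambda>t. E y t)"
  unfolding continuous_on_def
proof (intro ballI)
  fix t :: real assume "t \<in> {0..}"
  then consider "t > 0" | "t = 0" by (auto simp: order_less_le)
  then show "((\<lambda>t. E y t) \<longlongrightarrow> E y t) (at t within {0..})"
  proof cases
    case 1
    have "isCont (\<lambda>t. E y t) t" by (rule DERIV_isCont[OF E_deriv_t[OF 1]])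
    then have "((\<lambda>t. E y t) \<longlongrightarrow> E y t) (at t)" by (simp add: isCont_def)
    then show ?thesis by (rule tendsto_within_subset) simp
  next
    case 2
    let ?g = "G y 0"
    have pc: "continuous_on {0..1} (\<lambda>t. integral {0..t} (\<lambda>\<tau>. F \<tau> ?g))"
      by (rule indefinite_integral_continuous_1[OF F'_int(2)])
    have "at 0 within {0::real..} = at 0 within {0..1}" by (rule at_within_nhd[of 0 "{..<1}"]) auto
    moreover have "((\<lambda>t. integral {0..t} (\<lambda>\<tau>. F \<tau> ?g)) \<longlongrightarrow> integral {0..0} (\<lambda>\<tau>. F \<tau> ?g)) (at 0 within {0..1})"
      using pc unfolding continuous_on_def by (rule bspec) simp
    ultimately have "((\<lambda>t. integral {0..t} (\<lambda>\<tau>. F \<tau> ?g)) \<longlongrightarrow> 0) (at 0 within {0..})" by simp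
    then have "((\<lambda>t. y * ?g - (f ?g + integral {0..t} (\<lambda>\<tau>. F \<tau> ?g))) \<longlongrightarrow> y * ?g - (f ?g + 0)) (at 0 within {0..})"
      by (intro tendsto_intros)
    then have l: "((\<lambda>t. y * ?g - Phi ?g t) \<longlongrightarrow> E y 0) (at 0 within {0..})" by (simp add: Phi_def E_def)
    have "((\<lambda>t. E y t) \<longlongrightarrow> E y 0) (at 0 within {0..})"
    proof (rule tendsto_sandwich[OF _ _ l tendsto_const])
      show "\<forall>\<^sub>F t in at 0 within {0..}. y * ?g - Phi ?g t \<le> E y t"
        using E_ge by (auto simp: eventually_at_filter)
      have "E y t \<le> E y 0" if "t \<ge> 0" for t
      proof -
        have "E y t = y * G y t - Phi (G y t) t" by (simp add: E_def)
        also have "\<dots> \<le> y * G y t - Phi (G y t) 0" using Phi_ge[OF that, of "G y t"] by (simp add: Phi_def)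
        also have "\<dots> \<le> E y 0" by (rule E_ge) simp
        finally show ?thesis .
      qed
      then show "\<forall>\<^sub>F t in at 0 within {0..}. E y t \<le> E y 0" by (auto simp: eventually_at_filter)
    qed
    then show ?thesis using 2 by simp
  qed
qed

end

context packets
begin

lemma P_continuous_t: "continuous_on {0..} (\<lambda>t. P i x t)"
  unfolding P_def by (intro continuous_intros E_continuous_t)

lemma P_continuous_x: "t \<ge> 0 \<Longrightarrow> continuous_on UNIV (\<lambda>x. P i x t)"
  unfolding P_def by (intro continuous_intros continuous_on_compose2[OF E_continuous_y]) auto

text \<open>Off the shock the sign of P, hence the active fan, does not change for nearby
  times.\<close>

lemma W_tendsto:
  assumes t: "t \<ge> 0" and ne: "P i x t \<noteq> 0"
  shows "((\<lambda>s. W i x s) \<longlongrightarrow> W i x t) (at t within {0..})"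
proof -
  let ?A = "at t within {0..}"
  have Pl: "((\<lambda>s. P i x s) \<longlongrightarrow> P i x t) ?A" using P_continuous_t[of i x] t by (auto simp: continuous_on_def)
  have Gl: "((\<lambda>s. G y s) \<longlongrightarrow> G y t) ?A" for y using G_continuous_t[of y] t by (auto simp: continuous_on_def)
  show ?thesis
  proof (cases "P i x t > 0")
    case True
    then have "\<forall>\<^sub>F s in ?A. P i x s > 0" using order_tendstoD(1)[OF Pl] by blast
    then have "\<forall>\<^sub>F s in ?A. G (x - z (Suc i)) s = W i x s" by eventually_elim (simp add: W_def)
    then show ?thesis using Lim_transform_eventually[OF Gl] True by (simp add: W_def)
  next
    case False
    then have "P i x t < 0" using ne by simp
    then have "\<forall>\<^sub>F s in ?A. P i x s < 0" using order_tendstoD(2)[OF Pl] by blast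
    then have "\<forall>\<^sub>F s in ?A. G (x - z i) s = W i x s" by eventually_elim (simp add: W_def)
    then show ?thesis using Lim_transform_eventually[OF Gl] False by (simp add: W_def)
  qed
qed

lemma V_tendsto:
  assumes t: "t \<ge> 0" and ne: "\<And>i. P i x t \<noteq> 0"
  shows "((\<lambda>s. V x s) \<longlongrightarrow> V x t) (at t within {0..})"
proof (cases "\<exists>i. z i < x \<and> x \<le> z (Suc i)")
  case True
  then obtain i where i: "z i < x" "x \<le> z (Suc i)" by blast
  show ?thesis unfolding V_packet[OF i] by (rule W_tendsto[OF t ne])
next
  case False
  then have "V x s = 0" for s by (intro V_outside) blast
  then show ?thesis by simp
qed

text \<open>Each P i has at most one zero at a given time and there are countably many packets;
  together with \<open>V_tendsto\<close> this yields convergence for almost every x.\<close>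

lemma P_zero_AE: assumes "t \<ge> 0" shows "AE x in lborel. \<forall>i. P i x t \<noteq> 0"
proof -
  have "AE x in lborel. P i x t \<noteq> 0" for i
  proof -
    have "x = y" if "P i x t = 0" "P i y t = 0" for x y
      using P_mono[OF assms, of x y i] P_mono[OF assms, of y x i] that by (cases x y rule: linorder_cases) auto
    then have "\<exists>y. {x. P i x t = 0} \<subseteq> {y}" by blast
    then obtain y where "{x. P i x t = 0} \<subseteq> {y}" by blast
    moreover have "AE x in lborel. x \<notin> {y}" by (rule AE_not_in) auto
    ultimately show ?thesis by (auto elim: eventually_mono)
  qed
  then show ?thesis by (simp add: AE_all_countable)
qed

lemma V_measurable: assumes "t \<ge> 0" shows "(\<lambda>x. V x t) \<in> borel_measurable borel"
proof (rule borel_measurable_LIMSEQ_real)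
  let ?S = "\<lambda>N x. \<Sum>i<N. indicator {z i<..z (Suc i)} x * W i x t"
  show "?S N \<in> borel_measurable borel" for N
  proof -
    have [measurable]: "(\<lambda>x. P i x t) \<in> borel_measurable borel" "(\<lambda>x. G (x - c) t) \<in> borel_measurable borel" for i c
      using P_continuous_x[OF assms] G_continuous_y[OF assms]
      by (auto intro!: borel_measurable_continuous_onI continuous_on_compose2[OF G_continuous_y[OF assms]] continuous_intros)
    show ?thesis unfolding W_def by measurable
  qed
  fix x
  show "(\<lambda>N. ?S N x) \<longlonglongrightarrow> V x t"
  proof (cases "\<exists>i. z i < x \<and> x \<le> z (Suc i)")
    case True
    then obtain i where i: "z i < x" "x \<le> z (Suc i)" by blast
    have "?S N x = V x t" if "N \<ge> Suc i" for N
    proof -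
      have "?S N x = (\<Sum>j\<in>{i}. indicator {z j<..z (Suc j)} x * W j x t)"
        using that packet_unique[OF i] by (intro sum.mono_neutral_right) (auto simp: indicator_def)
      then show ?thesis using i V_packet[OF i] by simp
    qed
    then show ?thesis by (intro tendsto_eventually) (auto simp: eventually_sequentially)
  next
    case False
    then have "?S N x = 0" for N by (intro sum.neutral) (auto simp: indicator_def)
    moreover have "V x t = 0" using False by (intro V_outside) blast
    ultimately show ?thesis by simp
  qed
qed

text \<open>Converging gaps are bounded and f' is unbounded in both directions, so a single e
  dominates all packets at all times.\<close>

lemma V_bounded: obtains B where "B \<ge> 0" "\<And>x t. \<bar>V x t\<bar> \<le> B"
proof -
  have "Bseq (\<lambda>i. z (Suc i) - z i)" by (rule convergent_imp_Bseq[OF convergentI[OF z_gap]])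
  then obtain D where D': "\<forall>i. norm (z (Suc i) - z i) \<le> D" by (elim BseqE)
  have D: "z (Suc i) - z i \<le> D" for i using spec[OF D', of i] by simp
  obtain e1 where e1: "\<And>e. e \<ge> e1 \<Longrightarrow> D + 1 \<le> f' e" using f'_top unfolding filterlim_at_top eventually_at_top_linorder by blast
  obtain e2 where e2: "\<And>e. e \<le> e2 \<Longrightarrow> f' e \<le> - (D + 1)" using f'_bot unfolding filterlim_at_bot eventually_at_bot_linorder by blast
  define e where "e = \<bar>e1\<bar> + \<bar>e2\<bar> + 1"
  have e: "e > 0" "D + 1 \<le> f' e" "f' (- e) \<le> - (D + 1)" using e1[of e] e2[of "- e"] by (auto simp: e_def)
  have "\<bar>V x t\<bar> \<le> e" for x t
  proof (cases "\<exists>i. z i < x \<and> x \<le> z (Suc i)")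
    case True
    then obtain i where i: "z i < x" "x \<le> z (Suc i)" by blast
    show ?thesis using W_small[OF i e(1), of t] D[of i] e V_packet[OF i] by simp
  next
    case False
    then have "V x t = 0" by (intro V_outside) blast
    then show ?thesis using e by simp
  qed
  then show thesis using that[of e] e by simp
qed

lemma V_support: assumes "V x t \<noteq> 0" "\<And>i. z i \<le> b" shows "z 0 \<le> x" "x \<le> b"
proof -
  obtain i where "z i < x" "x \<le> z (Suc i)" using V_outside[of x t] assms(1) by blast
  then show "z 0 \<le> x" "x \<le> b" using z_le[of 0 i] assms(2)[of "Suc i"] by linarith+
qed

text \<open>The shock position s is the zero of P, and a, b are the one-sided values there, so H a t
  = s - z i and H b t = s - z (i + 1), and the packet length is their difference. As solutions are
  determined only almost everywhere, x and y are taken near s inside the set Q of full measure;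
  staying within (a - b) / 4 of the one-sided values, they retain half of the jump.\<close>

lemma jump_points:
  assumes t: "t \<ge> 0" and ae: "AE x in lborel. Q x"
  shows "\<exists>a b x y. 0 < a \<and> b < 0 \<and> H a t - H b t = z (Suc i) - z i \<and> H a t < z (Suc i) - z i \<and> - (z (Suc i) - z i) < H b t \<and>
    z i < x \<and> x < y \<and> y < z (Suc i) \<and> Q x \<and> Q y \<and> (a - b) / 2 \<le> V x t - V y t"
proof -
  have zi: "z i < z (Suc i)" by (rule z_less) simp
  have Pc: "continuous_on {z i..z (Suc i)} (\<lambda>x. P i x t)" by (rule continuous_on_subset[OF P_continuous_x[OF t]]) simp
  obtain s where s: "z i \<le> s" "s \<le> z (Suc i)" "P i s t = 0"
    using IVT'[of "\<lambda>x. P i x t" "z i" 0 "z (Suc i)"] Pc P_nodes[OF t, of i] zi by (auto simp: less_imp_le)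
  have s': "z i < s" "s < z (Suc i)" using s P_nodes[OF t, of i] by (auto simp: order_less_le)
  define a b where "a = G (s - z i) t" and "b = G (s - z (Suc i)) t"
  have ab: "0 < a" "b < 0" using s' by (simp_all add: a_def b_def G_less_iff)
  have Gc: "isCont (\<lambda>x. G (x - c) t) s" for c
  proof -
    have "continuous_on UNIV (\<lambda>x. G (x - c) t)"
      by (rule continuous_on_compose2[OF G_continuous_y[OF t]]) (auto intro!: continuous_intros)
    then show ?thesis by (simp add: continuous_on_eq_continuous_at)
  qed
  have J4: "(a - b) / 4 > 0" using ab by simp
  obtain d1 where d1: "d1 > 0" "\<And>x. dist x s < d1 \<Longrightarrow> dist (G (x - z i) t) a < (a - b) / 4"
    using Gc[of "z i"] J4 unfolding continuous_at_eps_delta a_def[symmetric] by metis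
  obtain d2 where d2: "d2 > 0" "\<And>x. dist x s < d2 \<Longrightarrow> dist (G (x - z (Suc i)) t) b < (a - b) / 4"
    using Gc[of "z (Suc i)"] J4 unfolding continuous_at_eps_delta b_def[symmetric] by metis
  have "max (z i) (s - d1) < s" using s' d1(1) by simp
  from AE_lborel_ex[OF ae this] obtain x where x: "max (z i) (s - d1) < x" "x < s" "Q x" by blast
  have "s < min (z (Suc i)) (s + d2)" using s' d2(1) by simp
  from AE_lborel_ex[OF ae this] obtain y where y: "s < y" "y < min (z (Suc i)) (s + d2)" "Q y" by blast
  have "P i x t < 0" using P_mono[OF t x(2), of i] s(3) by simp
  then have Vx: "V x t = G (x - z i) t" using V_packet[of i x t] x s' by (simp add: W_def)
  have "P i y t > 0" using P_mono[OF t y(1), of i] s(3) by simp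
  then have Vy: "V y t = G (y - z (Suc i)) t" using V_packet[of i y t] y s' by (simp add: W_def)
  have "\<bar>V x t - a\<bar> < (a - b) / 4" using d1(2)[of x] x Vx by (simp add: dist_real_def)
  moreover have "\<bar>V y t - b\<bar> < (a - b) / 4" using d2(2)[of y] y Vy by (simp add: dist_real_def)
  moreover have "a - V x t \<le> \<bar>V x t - a\<bar>" "V y t - b \<le> \<bar>V y t - b\<bar>" by (simp_all add: abs_if)
  ultimately have "a - V x t + (V y t - b) \<le> (a - b) / 4 + (a - b) / 4" by linarith
  also have "(a - b) / 4 + (a - b) / 4 = (a - b) - (a - b) / 2" by (simp add: field_simps)
  finally have "(a - b) / 2 \<le> V x t - V y t" by linarith
  then show ?thesis using ab x y s'
    by (intro exI[of _ a] exI[of _ b] exI[of _ x] exI[of _ y]) (simp add: a_def b_def)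
qed

text \<open>The packet length is at most Ct (a - b)^q, so (a - b)^(1/s) dominates a multiple of its
  power p = 1 / (q s) < 1, and \<open>ln_gap_bound\<close> makes the sum over the packets at least
  harmonic. Equality of w and c V almost everywhere suffices, which covers every
  representative.\<close>

lemma not_BVs_loc:
  assumes t: "t \<ge> 0" and M: "M \<ge> 1" "\<And>\<tau>. \<tau> \<in> {0..t} \<Longrightarrow> exp (\<beta> \<tau>) \<le> M"
    and q: "q > 1" and r: "r > 0" and C: "C > 0"
    and hyp: "\<And>a b. b \<in> {-r<..<0} \<Longrightarrow> a \<in> {0<..<r} \<Longrightarrow> f' a - f' b \<le> C * (a - b) powr q"
    and s: "s > 1 / q" and c: "c > 0" and w: "AE x in lborel. w x = c * V x t"
    and z: "\<And>i. z i = - 1 / ln (real (i + 2))"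
  shows "\<not> BVs_loc s w"
proof
  assume BV: "BVs_loc s w"
  have s0: "s > 0" using s q by (auto intro: less_trans[of 0 "1 / q"])
  define p where "p = 1 / (q * s)"
  have qs: "q * s > 1" using s q by (simp add: field_simps)
  have p: "0 < p" "p < 1" using qs q s0 by (simp_all add: p_def)
  obtain k where k: "k > 0" "\<And>i::nat. k / real (i + 3) \<le> (1 / ln (real (i + 2)) - 1 / ln (real (i + 3))) powr p"
    using ln_gap_bound[OF p] by blast
  have zgap: "z (Suc i) - z i = 1 / ln (real (i + 2)) - 1 / ln (real (i + 3))" for i
    unfolding z by (simp add: algebra_simps)
  have zneg: "z i < 0" for i unfolding z by simp
  \<comment> \<open>Shock values of modulus below e remain below r after multiplication by exp
    (\<beta> \<tau>) \<le> M, so the hypothesis on f' applies to the rescaled arguments at all times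
    up to t.\<close>
  define e where "e = r / M"
  have e: "e > 0" "M * e = r" using M r by (simp_all add: e_def)
  obtain n0 where n0: "\<forall>i\<ge>n0. z (Suc i) - z i < f' e \<and> z (Suc i) - z i < - f' (-e)" using gap_eventually_small[OF e(1)] by blast
  \<comment> \<open>The 1 stands for the initial age of the fans, that is the term f' in H; t M^q
    stands for the time integral of \<open>F'\<close>.\<close>
  define Ct where "Ct = C * (1 + t * M powr q)"
  have Ct: "Ct > 0" using C t by (simp add: Ct_def add_pos_nonneg)
  have jump: "\<exists>x y. z i < x \<and> x < y \<and> y < z (Suc i) \<and> (c / 2) powr (1 / s) * Ct powr (- p) * (z (Suc i) - z i) powr p \<le> \<bar>w y - w x\<bar> powr (1 / s)"
    if i: "i \<ge> n0" for i
  proof -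
    obtain a b x y where ab: "0 < a" "b < 0" "H a t - H b t = z (Suc i) - z i" "H a t < z (Suc i) - z i" "- (z (Suc i) - z i) < H b t"
      and xy: "z i < x" "x < y" "y < z (Suc i)" "w x = c * V x t" "w y = c * V y t" "(a - b) / 2 \<le> V x t - V y t"
      using jump_points[OF t w, of i] by blast
    have gp: "0 < z (Suc i) - z i" using z_less[of i "Suc i"] by simp
    have ae: "a < e"
    proof -
      have "f' a < f' e" using H_ge[of a t] ab n0 i by fastforce
      then show ?thesis using strict_mono_less[OF f'_mono] by blast
    qed
    have be: "- e < b"
    proof -
      have "f' (- e) < f' b" using H_le[of b t] ab n0 i by fastforce
      then show ?thesis using strict_mono_less[OF f'_mono] by blast
    qed
    have "r * 1 \<le> r * M" using M(1) r by (intro mult_left_mono) auto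
    then have re: "e \<le> r" using M(1) by (simp add: e_def pos_divide_le_eq)
    have F'd: "F' \<tau> a - F' \<tau> b \<le> C * (M powr q * (a - b) powr q)" if \<tau>: "\<tau> \<in> {0..t}" for \<tau>
    proof -
      let ?E = "exp (\<beta> \<tau>)"
      have "?E * a \<le> M * a" "?E * (- b) \<le> M * (- b)" using M(2)[OF \<tau>] ab by (intro mult_right_mono; simp)+
      moreover have "M * a < M * e" "M * (- b) < M * e" using M ae be by (intro mult_strict_left_mono; simp)+
      ultimately have "?E * a < r" "- r < ?E * b" unfolding e(2) by simp_all
      then have "f' (?E * a) - f' (?E * b) \<le> C * (?E * a - ?E * b) powr q"
        using ab by (intro hyp) (auto simp: mult_pos_neg)
      also have "\<dots> \<le> C * (M * (a - b)) powr q"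
      proof -
        have "?E * a - ?E * b = ?E * (a - b)" by (simp add: algebra_simps)
        also have "\<dots> \<le> M * (a - b)" using M(2)[OF \<tau>] ab by (intro mult_right_mono) auto
        finally have "?E * a - ?E * b \<le> M * (a - b)" .
        moreover have "0 \<le> ?E * a - ?E * b" using ab by (simp add: mult_le_cancel_left)
        ultimately show ?thesis using C q by (intro mult_left_mono powr_mono2) auto
      qed
      finally show ?thesis using M ab by (simp add: F'_def powr_mult)
    qed
    have "z (Suc i) - z i \<le> Ct * (a - b) powr q"
    proof -
      have "integral {0..t} (\<lambda>\<tau>. F' \<tau> a) - integral {0..t} (\<lambda>\<tau>. F' \<tau> b) = integral {0..t} (\<lambda>\<tau>. F' \<tau> a - F' \<tau> b)"
        by (rule Henstock_Kurzweil_Integration.integral_diff[symmetric]; rule F'_int(1))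
      also have "\<dots> \<le> integral {0..t} (\<lambda>\<tau>. C * (M powr q * (a - b) powr q))"
        by (intro integral_le integrable_diff F'_int(1) integrable_const_ivl F'd)
      also have "\<dots> = t * (C * (M powr q * (a - b) powr q))" using t by simp
      finally have 1: "integral {0..t} (\<lambda>\<tau>. F' \<tau> a) - integral {0..t} (\<lambda>\<tau>. F' \<tau> b) \<le> t * (C * (M powr q * (a - b) powr q))" .
      have "f' a - f' b \<le> C * (a - b) powr q" using ab ae be re by (intro hyp) auto
      then have "H a t - H b t \<le> C * (a - b) powr q + t * (C * (M powr q * (a - b) powr q))"
        using 1 unfolding H_def by linarith
      also have "\<dots> = Ct * (a - b) powr q" by (simp add: Ct_def algebra_simps)
      finally show ?thesis using ab(3) by simp
    qed
    then have "(z (Suc i) - z i) / Ct \<le> (a - b) powr q" using Ct by (simp add: pos_divide_le_eq mult.commute)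
    then have "((z (Suc i) - z i) / Ct) powr p \<le> ((a - b) powr q) powr p"
      using gp Ct p by (intro powr_mono2) auto
    also have "\<dots> = (a - b) powr (1 / s)" using q s0 by (simp add: powr_powr p_def)
    finally have J: "((z (Suc i) - z i) / Ct) powr p \<le> (a - b) powr (1 / s)" .
    have "(c / 2) powr (1 / s) * Ct powr (- p) * (z (Suc i) - z i) powr p = (c / 2) powr (1 / s) * ((z (Suc i) - z i) / Ct) powr p"
      unfolding powr_divide powr_minus_divide by simp
    also have "\<dots> \<le> (c / 2) powr (1 / s) * (a - b) powr (1 / s)" using J by (intro mult_left_mono) auto
    also have "\<dots> = (c / 2 * (a - b)) powr (1 / s)" by (rule powr_mult[symmetric])
    also have "\<dots> \<le> \<bar>w y - w x\<bar> powr (1 / s)"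
    proof (rule powr_mono2)
      have "c * ((a - b) / 2) \<le> c * (V x t - V y t)" using xy(6) c by (intro mult_left_mono) auto
      then show "c / 2 * (a - b) \<le> \<bar>w y - w x\<bar>" unfolding xy(4,5) by (simp add: right_diff_distrib)
    qed (use s0 c ab in auto)
    finally show ?thesis using xy by blast
  qed
  then have "\<forall>j. \<exists>x y. z (n0 + j) < x \<and> x < y \<and> y < z (Suc (n0 + j)) \<and> (c / 2) powr (1 / s) * Ct powr (- p) * (z (Suc (n0 + j)) - z (n0 + j)) powr p \<le> \<bar>w y - w x\<bar> powr (1 / s)"
    by simp
  then obtain xm xp where X: "\<And>j. z (n0 + j) < xm j" "\<And>j. xm j < xp j" "\<And>j. xp j < z (Suc (n0 + j))"
    "\<And>j. (c / 2) powr (1 / s) * Ct powr (- p) * (z (Suc (n0 + j)) - z (n0 + j)) powr p \<le> \<bar>w (xp j) - w (xm j)\<bar> powr (1 / s)"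
    by metis
  define K where "K = (c / 2) powr (1 / s) * Ct powr (- p) * k"
  have K: "K > 0" using c Ct k by (simp add: K_def)
  have summand: "K / real (n0 + j + 3) \<le> \<bar>w (xp j) - w (xm j)\<bar> powr (1 / s)" for j
  proof -
    have "K / real (n0 + j + 3) = (c / 2) powr (1 / s) * Ct powr (- p) * (k / real (n0 + j + 3))" by (simp add: K_def)
    also have "\<dots> \<le> (c / 2) powr (1 / s) * Ct powr (- p) * (z (Suc (n0 + j)) - z (n0 + j)) powr p"
      unfolding zgap using k(2)[of "n0 + j"] by (intro mult_left_mono) auto
    also have "\<dots> \<le> \<bar>w (xp j) - w (xm j)\<bar> powr (1 / s)" by (rule X(4))
    finally show ?thesis .
  qed
  have "TVs s w (z 0) 0 < \<infinity>" using BV zneg[of 0] by (simp add: BVs_loc_def)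
  moreover have lower: "ereal (\<Sum>j<N. \<bar>w (xp j) - w (xm j)\<bar> powr (1 / s)) \<le> TVs s w (z 0) 0" if "N > 0" for N
  proof (rule TVs_alternating_lower[OF X(2) _ _ _ that])
    show "xp j < xm (Suc j)" for j using X(3)[of j] X(1)[of "Suc j"] by simp
    show "z 0 \<le> xm j" for j using X(1)[of j] z_le[of 0 "n0 + j"] by simp
    show "xp j \<le> 0" for j using X(3)[of j] zneg[of "Suc (n0 + j)"] by linarith
  qed
  \<comment> \<open>Excludes minus infinity, so that the variation is a real number.\<close>
  moreover have "0 \<le> TVs s w (z 0) 0"
  proof -
    have "0 \<le> ereal (\<Sum>j<1. \<bar>w (xp j) - w (xm j)\<bar> powr (1 / s))"
      unfolding ereal_less_eq(5) by (intro sum_nonneg) simp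
    then show ?thesis using lower[of 1] by (rule order_trans) simp
  qed
  ultimately obtain Bd where Bd: "TVs s w (z 0) 0 = ereal Bd" by (cases "TVs s w (z 0) 0") auto
  have bnd: "(\<Sum>j<N. K / real (n0 + j + 3)) \<le> \<bar>Bd\<bar>" for N
  proof (cases "N = 0")
    case False
    have "(\<Sum>j<N. K / real (n0 + j + 3)) \<le> (\<Sum>j<N. \<bar>w (xp j) - w (xm j)\<bar> powr (1 / s))" by (intro sum_mono summand)
    also have "\<dots> \<le> Bd" using lower[of N] False Bd by simp
    finally show ?thesis by simp
  qed simp
  have "summable (\<lambda>j. K / real (n0 + j + 3))"
    by (rule summableI_nonneg_bounded[of _ "\<bar>Bd\<bar>"]) (use K bnd in auto)
  then have "summable (\<lambda>j. (1 / K) * (K / real (n0 + j + 3)))" by (rule summable_mult)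
  then have "summable (\<lambda>j. inverse (real (j + (n0 + 3))))" using K by (simp add: inverse_eq_divide add_ac)
  then have "summable (\<lambda>j. inverse (real j))" by (subst (asm) summable_iff_shift[of "\<lambda>j. inverse (real j)" "n0 + 3"])
  then show False using not_summable_harmonic[where 'a=real] by simp
qed

end

section \<open>The Cauchy problem\<close>

text \<open>A compact support at positive times has a smallest time \<tau> > 0. Off the closed
  support the function vanishes in a neighbourhood, so its derivative vanishes as well.\<close>

lemma test_function_C1test:
  assumes \<phi>: "test_function \<phi>"
  obtains R \<tau> T \<phi>x \<phi>t where "0 < \<tau>" "\<tau> \<le> T" "C1test (cbox (-R, \<tau>) (R, T)) \<phi> \<phi>x \<phi>t"
proof -
  define S where "S = closure {p. \<phi> p \<noteq> 0}"
  define \<phi>x \<phi>t where "\<phi>x p = frechet_derivative \<phi> (at p) (1, 0)" and "\<phi>t p = frechet_derivative \<phi> (at p) (0, 1)" for p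
  have S: "compact S" "S \<subseteq> UNIV \<times> {0<..}" and nn: "\<And>p. 0 \<le> \<phi> p" and C1: "Ck (Suc 0) \<phi>"
    using \<phi> unfolding test_function_def S_def by blast+
  have dif: "\<phi> differentiable (at p)" for p using C1 unfolding Ck.simps differentiable_on_def by blast
  then have D: "(\<phi> has_derivative frechet_derivative \<phi> (at p)) (at p)" for p by (simp add: frechet_derivative_works)
  have cx: "continuous_on UNIV \<phi>x" "continuous_on UNIV \<phi>t"
    using C1 by (auto simp: \<phi>x_def[abs_def] \<phi>t_def[abs_def] Basis_prod_def)
  have c: "continuous_on UNIV \<phi>" using C1 by (auto intro: differentiable_imp_continuous_on)
  have lin: "linear (frechet_derivative \<phi> (at p))" for p by (rule has_derivative_linear[OF D])
  have dx: "((\<lambda>y. \<phi> (y, t)) has_real_derivative \<phi>x (x, t)) (at x)" for x t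
  proof -
    have i: "((\<lambda>y::real. (y, t)) has_derivative (\<lambda>h. (h, 0))) (at x)" by (intro has_derivative_Pair has_derivative_ident has_derivative_const)
    have "((\<lambda>y. \<phi> (y, t)) has_derivative (\<lambda>h. frechet_derivative \<phi> (at (x, t)) (h, 0))) (at x)"
      using has_derivative_compose[OF i D] by simp
    moreover have "frechet_derivative \<phi> (at (x, t)) (h, 0) = \<phi>x (x, t) * h" for h
      using linear_scale[OF lin, of "(x, t)" h "(1, 0)"] by (simp add: \<phi>x_def mult.commute)
    ultimately show ?thesis by (simp add: has_field_derivative_def)
  qed
  have dt: "((\<lambda>s. \<phi> (x, s)) has_real_derivative \<phi>t (x, t)) (at t)" for x t
  proof -
    have i: "((\<lambda>s::real. (x, s)) has_derivative (\<lambda>h. (0, h))) (at t)" by (intro has_derivative_Pair has_derivative_ident has_derivative_const)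
    have "((\<lambda>s. \<phi> (x, s)) has_derivative (\<lambda>h. frechet_derivative \<phi> (at (x, t)) (0, h))) (at t)"
      using has_derivative_compose[OF i D] by simp
    moreover have "frechet_derivative \<phi> (at (x, t)) (0, h) = \<phi>t (x, t) * h" for h
      using linear_scale[OF lin, of "(x, t)" h "(0, 1)"] by (simp add: \<phi>t_def mult.commute)
    ultimately show ?thesis by (simp add: has_field_derivative_def)
  qed
  have z0: "\<phi> p = 0" if "p \<notin> S" for p using that closure_subset[of "{p. \<phi> p \<noteq> 0}"] unfolding S_def by blast
  have zd: "frechet_derivative \<phi> (at p) = (\<lambda>h. 0)" if p: "p \<notin> S" for p
  proof -
    have "open (- S)" using S(1) by (simp add: compact_imp_closed open_Compl)
    then have "(\<phi> has_derivative (\<lambda>h. 0)) (at p)"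
      by (rule has_derivative_transform_within_open[OF has_derivative_const[of 0]]) (use p z0 in auto)
    then show ?thesis using frechet_derivative_at by metis
  qed
  obtain a where a: "S \<subseteq> cbox (- a) a" using bounded_subset_cbox_symmetric[OF compact_imp_bounded[OF S(1)]] by metis
  obtain \<tau> where \<tau>: "\<tau> > 0" "\<And>p. p \<in> S \<Longrightarrow> \<tau> \<le> snd p"
  proof (cases "S = {}")
    case False
    obtain p where p: "p \<in> S" "\<And>y. y \<in> S \<Longrightarrow> snd p \<le> snd y"
      using continuous_attains_inf[OF S(1) False continuous_on_snd[OF continuous_on_id]] by blast
    moreover have "snd p > 0" using S(2) p(1) by auto
    ultimately show thesis using that by blast
  qed (use that[of 1] in auto)
  have Sub: "S \<subseteq> cbox (- fst a, \<tau>) (fst a, max \<tau> (snd a))"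
  proof
    fix p assume p: "p \<in> S"
    then have "p \<in> cbox (- a) a" using a by blast
    then show "p \<in> cbox (- fst a, \<tau>) (fst a, max \<tau> (snd a))"
      using \<tau>(2)[OF p] by (cases p; cases a) (auto simp: cbox_Pair_eq)
  qed
  have "C1test (cbox (- fst a, \<tau>) (fst a, max \<tau> (snd a))) \<phi> \<phi>x \<phi>t"
    unfolding C1test_def
  proof (intro conjI allI impI)
    fix p assume "p \<notin> cbox (- fst a, \<tau>) (fst a, max \<tau> (snd a))"
    then have "p \<notin> S" using Sub by blast
    then show "\<phi> p = 0" "\<phi>x p = 0" "\<phi>t p = 0" using z0 zd by (auto simp: \<phi>x_def \<phi>t_def)
  qed (use c cx dx dt nn in auto)
  then show thesis using that \<tau>(1) by (metis max.cobounded1)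
qed

text \<open>The integrand of \<open>entropy_solution\<close> verbatim, so that either can be
  exchanged for the other by unfolding.\<close>

definition entropy_integrand where
  "entropy_integrand f \<alpha> u k \<phi> = (\<lambda>(x, t). \<bar>u x t - k\<bar> * deriv (\<lambda>\<tau>. \<phi> (x, \<tau>)) t
                      + sgn (u x t - k) * (f (u x t) - f k) * deriv (\<lambda>\<xi>. \<phi> (\<xi>, t)) x
                      + sgn (u x t - k) * \<alpha> t * u x t * \<phi> (x, t))"
  for f \<alpha> :: "real \<Rightarrow> real" and u :: "real \<Rightarrow> real \<Rightarrow> real" and \<phi> :: "real \<times> real \<Rightarrow> real"

text \<open>Altering u on a null set of the plane and \<open>\<alpha>\<close> on a null set of times
  does not change the integral. Bounded representatives of u come from finite time strips, hence the
  restriction of K to times below T.\<close>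

lemma entropy_integral_eq:
  assumes \<phi>: "C1test K \<phi> \<phi>x \<phi>t" and K: "K \<subseteq> UNIV \<times> {0<..<T}"
    and u: "AE p in lborel. 0 < snd p \<longrightarrow> snd p < T \<longrightarrow> u (fst p) (snd p) = w p"
    and a: "AE t in lborel. 0 < t \<longrightarrow> \<alpha> t = a t"
    and [measurable]: "w \<in> borel_measurable borel" "a \<in> borel_measurable borel" and f: "continuous_on UNIV f"
  shows "integral\<^sup>L (lebesgue_on (UNIV \<times> {0<..})) (entropy_integrand f \<alpha> u k \<phi>) = (\<integral>p. ef (\<lambda>_. f) a w k \<phi> \<phi>x \<phi>t p \<partial>lborel)"
proof (rule integral_lebesgue_on_AE_eq)
  have [measurable]: "\<phi> \<in> borel_measurable borel" "\<phi>x \<in> borel_measurable borel" "\<phi>t \<in> borel_measurable borel"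
    using \<phi> unfolding C1test_def by (auto intro: borel_measurable_continuous_onI)
  have [measurable]: "f \<in> borel_measurable borel" by (rule borel_measurable_continuous_onI[OF f])
  show "UNIV \<times> {0<..} \<in> sets (borel :: (real \<times> real) measure)" by (simp add: open_Times)
  show "ef (\<lambda>_. f) a w k \<phi> \<phi>x \<phi>t \<in> borel_measurable borel" unfolding ef_def[abs_def] by measurable
  have d: "deriv (\<lambda>\<xi>. \<phi> (\<xi>, t)) x = \<phi>x (x, t)" "deriv (\<lambda>\<tau>. \<phi> (x, \<tau>)) t = \<phi>t (x, t)" for x t
    using \<phi> unfolding C1test_def by (blast intro: DERIV_imp_deriv)+
  show "AE p in lborel. indicator (UNIV \<times> {0<..}) p * entropy_integrand f \<alpha> u k \<phi> p = ef (\<lambda>_. f) a w k \<phi> \<phi>x \<phi>t p"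
    using u AE_lborel_snd[OF a]
  proof eventually_elim
    case (elim p)
    obtain x t where p: "p = (x, t)" by (cases p)
    show ?case
    proof (cases "p \<in> K")
      case True
      then have t: "0 < t" "t < T" using K p by auto
      then have "u x t = w p" "\<alpha> t = a t" using elim p by auto
      then show ?thesis using t by (simp add: entropy_integrand_def p d ef_def mult.assoc)
    next
      case False
      then show ?thesis using C1test_outside[OF \<phi> False] by (simp add: entropy_integrand_def p d ef_def)
    qed
  qed
qed

section \<open>From smooth to C^1 test functions\<close>

context conv
begin

text \<open>C is fixed before the test triple, so the integral is controlled linearly by the C^1
  size M. The triple is arbitrary instead of a \<open>C1test\<close> because the estimate is applied
  to differences of test functions, which have no sign.\<close>

lemma ef_estimate:
  "\<exists>C\<ge>0. \<forall>\<psi> \<psi>x \<psi>t M. \<psi> \<in> borel_measurable borel \<longrightarrow> \<psi>x \<in> borel_measurable borel \<longrightarrow> \<psi>t \<in> borel_measurable borel \<longrightarrow>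
     (\<forall>p. p \<notin> K \<longrightarrow> \<psi> p = 0 \<and> \<psi>x p = 0 \<and> \<psi>t p = 0) \<longrightarrow> (\<forall>p. \<bar>\<psi> p\<bar> \<le> M \<and> \<bar>\<psi>x p\<bar> \<le> M \<and> \<bar>\<psi>t p\<bar> \<le> M) \<longrightarrow>
     integrable lborel (ef g a w k \<psi> \<psi>x \<psi>t) \<and> \<bar>\<integral>p. ef g a w k \<psi> \<psi>x \<psi>t p \<partial>lborel\<bar> \<le> C * M"
proof -
  define B where "B = max Bw \<bar>k\<bar>"
  obtain D where D: "\<And>t v. t \<in> {\<tau>..T} \<Longrightarrow> \<bar>v\<bar> \<le> B \<Longrightarrow> \<bar>g t v\<bar> \<le> D" using g_bdd by blast
  define C where "C = \<bar>2 * B + 2 * D + A * B\<bar> * measure lborel K"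
  have fin: "emeasure lborel K < \<infinity>" "K \<in> sets lborel" by (auto simp: K_def emeasure_lborel_cbox_eq)
  show ?thesis
  proof (intro exI[of _ C] conjI allI impI)
    show "0 \<le> C" by (simp add: C_def)
    fix \<psi> \<psi>x \<psi>t :: "real \<times> real \<Rightarrow> real" and M :: real
    assume [measurable]: "\<psi> \<in> borel_measurable borel" "\<psi>x \<in> borel_measurable borel" "\<psi>t \<in> borel_measurable borel"
      and z: "\<forall>p. p \<notin> K \<longrightarrow> \<psi> p = 0 \<and> \<psi>x p = 0 \<and> \<psi>t p = 0"
      and M: "\<forall>p. \<bar>\<psi> p\<bar> \<le> M \<and> \<bar>\<psi>x p\<bar> \<le> M \<and> \<bar>\<psi>t p\<bar> \<le> M"
    have M0: "M \<ge> 0" using M abs_ge_zero order_trans by blast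
    have efz: "ef g a w k \<psi> \<psi>x \<psi>t p = 0" if "p \<notin> K" for p using mp[OF spec[OF z, of p] that] by (simp add: ef_def)
    have efb: "\<bar>ef g a w k \<psi> \<psi>x \<psi>t p\<bar> \<le> \<bar>2 * B + 2 * D + A * B\<bar> * M" if p: "p \<in> K" for p
    proof -
      have t: "snd p \<in> {\<tau>..T}" using K_mem[OF p] by blast
      have wB: "\<bar>w p\<bar> \<le> B" "\<bar>k\<bar> \<le> B" using w_bdd[of p] by (auto simp: B_def)
      have "\<bar>ef g a w k \<psi> \<psi>x \<psi>t p\<bar> \<le> 2 * B * M + 2 * D * M + A * B * M"
        by (rule ef_bound) (use wB D[OF t] spec[OF M, of p] a_bdd in auto)
      also have "\<dots> = (2 * B + 2 * D + A * B) * M" by (simp add: algebra_simps)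
      also have "\<dots> \<le> \<bar>2 * B + 2 * D + A * B\<bar> * M" using M0 by (intro mult_right_mono) auto
      finally show ?thesis .
    qed
    have efm: "ef g a w k \<psi> \<psi>x \<psi>t \<in> borel_measurable borel" unfolding ef_def[abs_def] by measurable
    show i: "integrable lborel (ef g a w k \<psi> \<psi>x \<psi>t)"
      by (rule integrable_bounded_support[OF efm efz K_props(2) efb])
    have "\<bar>\<integral>p. ef g a w k \<psi> \<psi>x \<psi>t p \<partial>lborel\<bar> \<le> (\<integral>p. \<bar>ef g a w k \<psi> \<psi>x \<psi>t p\<bar> \<partial>lborel)" by (rule integral_abs_bound)
    also have "\<dots> \<le> (\<integral>p. \<bar>2 * B + 2 * D + A * B\<bar> * M * indicator K p \<partial>lborel)"
    proof (rule integral_mono)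
      show "integrable lborel (\<lambda>p. \<bar>2 * B + 2 * D + A * B\<bar> * M * indicator K p)"
        using fin by (intro integrable_mult_right integrable_real_indicator)
      show "\<bar>ef g a w k \<psi> \<psi>x \<psi>t p\<bar> \<le> \<bar>2 * B + 2 * D + A * B\<bar> * M * indicator K p" for p
        using efz[of p] efb[of p] by (cases "p \<in> K") auto
    qed (use i in auto)
    also have "\<dots> = C * M" by (simp add: C_def)
    finally show "\<bar>\<integral>p. ef g a w k \<psi> \<psi>x \<psi>t p \<partial>lborel\<bar> \<le> C * M" .
  qed
qed

end

text \<open>The integrand \<open>ef\<close> is linear in the test triple, so mollifying \<psi>
  changes the integral by at most C e, and e tends to 0. The distance between T' and T leaves room
  for the enlarged support.\<close>

lemma EI_of_test_functions:
  fixes g :: "real \<Rightarrow> real \<Rightarrow> real" and a :: "real \<Rightarrow> real" and w :: "real \<times> real \<Rightarrow> real"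
  assumes tau: "0 < \<tau>" "\<tau> \<le> T'" "T' < T"
    and g: "continuous_on UNIV (\<lambda>q. g (fst q) (snd q))"
    and a: "a \<in> borel_measurable borel" "\<And>t. \<bar>a t\<bar> \<le> A"
    and w: "w \<in> borel_measurable borel" "\<And>p. \<bar>w p\<bar> \<le> Bw"
    and ent: "\<And>k \<phi> \<phi>x \<phi>t K. test_function \<phi> \<Longrightarrow> K \<subseteq> UNIV \<times> {0<..<T} \<Longrightarrow> C1test K \<phi> \<phi>x \<phi>t \<Longrightarrow>
       0 \<le> (\<integral>p. ef g a w k \<phi> \<phi>x \<phi>t p \<partial>lborel)"
  shows "EI (cbox (-R, \<tau>) (R, T')) g a w"
  unfolding EI_def
proof (intro allI impI)
  fix k \<psi> \<psi>x \<psi>t assume \<psi>: "C1test (cbox (-R, \<tau>) (R, T')) \<psi> \<psi>x \<psi>t"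
  \<comment> \<open>A margin of at most half the distance from [\<tau>, T'] to 0 and to T: all
    mollified supports stay in one fixed box, so that C does not depend on e.\<close>
  define e0 where "e0 = min (\<tau> / 2) ((T - T') / 2)"
  have e0: "0 < e0" "e0 < \<tau>" "T' + e0 < T" using tau by (auto simp: e0_def min_def field_simps)
  interpret c: conv "R + e0" "\<tau> - e0" "T' + e0" g a a w A Bw
    using e0 tau g a w by unfold_locales auto
  obtain C where C: "C \<ge> 0" "\<forall>\<psi> \<psi>x \<psi>t M. \<psi> \<in> borel_measurable borel \<longrightarrow> \<psi>x \<in> borel_measurable borel \<longrightarrow> \<psi>t \<in> borel_measurable borel \<longrightarrow>
     (\<forall>p. p \<notin> c.K \<longrightarrow> \<psi> p = 0 \<and> \<psi>x p = 0 \<and> \<psi>t p = 0) \<longrightarrow> (\<forall>p. \<bar>\<psi> p\<bar> \<le> M \<and> \<bar>\<psi>x p\<bar> \<le> M \<and> \<bar>\<psi>t p\<bar> \<le> M) \<longrightarrow>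
     integrable lborel (ef g a w k \<psi> \<psi>x \<psi>t) \<and> \<bar>\<integral>p. ef g a w k \<psi> \<psi>x \<psi>t p \<partial>lborel\<bar> \<le> C * M"
    using c.ef_estimate by blast
  have meas: "f1 \<in> borel_measurable borel \<and> f2 \<in> borel_measurable borel \<and> f3 \<in> borel_measurable borel" if "C1test K f1 f2 f3" for K f1 f2 f3
    using that unfolding C1test_def by (auto intro: borel_measurable_continuous_onI)
  have Ksub: "cbox (- R - e, \<tau> - e) (R + e, T' + e) \<subseteq> c.K" if "0 \<le> e" "e \<le> e0" for e
    using that unfolding c.K_def by (auto simp: cbox_Pair_eq)
  have sub0: "cbox (-R, \<tau>) (R, T') \<subseteq> c.K" using Ksub[of 0] e0 by simp
  have int: "integrable lborel (ef g a w k f1 f2 f3)" if f: "C1test K f1 f2 f3" "K \<subseteq> c.K" for K f1 f2 f3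
  proof -
    have f': "C1test c.K f1 f2 f3" using f unfolding C1test_def by blast
    obtain M where M: "M \<ge> 0" "\<And>p. \<bar>f1 p\<bar> \<le> M" "\<And>p. \<bar>f2 p\<bar> \<le> M" "\<And>p. \<bar>f3 p\<bar> \<le> M" using c.test_bdd[OF f'] by metis
    have "f1 \<in> borel_measurable borel" "f2 \<in> borel_measurable borel" "f3 \<in> borel_measurable borel" using meas[OF f'] by auto
    then show ?thesis using C(2)[rule_format, of f1 f2 f3 M] C1test_outside[OF f'] M(2-4) by blast
  qed
  have low: "- (C * e) \<le> (\<integral>p. ef g a w k \<psi> \<psi>x \<psi>t p \<partial>lborel)" if e: "0 < e" "e \<le> e0" for e
  proof -
    have "e < \<tau>" using e e0 by simp
    then obtain \<phi> \<phi>x \<phi>t where \<phi>: "test_function \<phi>" "C1test (cbox (-R-e, \<tau>-e) (R+e, T'+e)) \<phi> \<phi>x \<phi>t"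
      "\<And>p. \<bar>\<phi> p - \<psi> p\<bar> \<le> e" "\<And>p. \<bar>\<phi>x p - \<psi>x p\<bar> \<le> e" "\<And>p. \<bar>\<phi>t p - \<psi>t p\<bar> \<le> e"
      using C1test_approx[OF \<psi> e(1)] by metis
    note Ks = Ksub[of e]
    have Ke: "cbox (- R - e, \<tau> - e) (R + e, T' + e) \<subseteq> c.K" using Ks e by simp
    have "cbox (-R-e, \<tau>-e) (R+e, T'+e) \<subseteq> UNIV \<times> {0<..<T}" using e e0 by (auto simp: cbox_Pair_eq)
    then have "0 \<le> (\<integral>p. ef g a w k \<phi> \<phi>x \<phi>t p \<partial>lborel)" using ent \<phi>(1,2) by blast
    moreover have "(\<integral>p. ef g a w k \<phi> \<phi>x \<phi>t p \<partial>lborel) - (\<integral>p. ef g a w k \<psi> \<psi>x \<psi>t p \<partial>lborel)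
      = (\<integral>p. ef g a w k (\<lambda>p. \<phi> p - \<psi> p) (\<lambda>p. \<phi>x p - \<psi>x p) (\<lambda>p. \<phi>t p - \<psi>t p) p \<partial>lborel)"
    proof -
      have "(\<integral>p. ef g a w k \<phi> \<phi>x \<phi>t p \<partial>lborel) - (\<integral>p. ef g a w k \<psi> \<psi>x \<psi>t p \<partial>lborel)
        = (\<integral>p. ef g a w k \<phi> \<phi>x \<phi>t p - ef g a w k \<psi> \<psi>x \<psi>t p \<partial>lborel)"
        by (rule Bochner_Integration.integral_diff[symmetric]) (rule int[OF \<phi>(2) Ke], rule int[OF \<psi> sub0])
      then show ?thesis by (simp add: ef_def algebra_simps)
    qed
    moreover have "\<bar>\<integral>p. ef g a w k (\<lambda>p. \<phi> p - \<psi> p) (\<lambda>p. \<phi>x p - \<psi>x p) (\<lambda>p. \<phi>t p - \<psi>t p) p \<partial>lborel\<bar> \<le> C * e"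
    proof -
      have z: "\<phi> p - \<psi> p = 0 \<and> \<phi>x p - \<psi>x p = 0 \<and> \<phi>t p - \<psi>t p = 0" if "p \<notin> c.K" for p
      proof -
        have 1: "p \<notin> cbox (-R-e, \<tau>-e) (R+e, T'+e)" "p \<notin> cbox (-R, \<tau>) (R, T')" using that Ke sub0 by blast+
        show ?thesis using C1test_outside[OF \<phi>(2) 1(1)] C1test_outside[OF \<psi> 1(2)] by simp
      qed
      have m: "(\<lambda>p. \<phi> p - \<psi> p) \<in> borel_measurable borel" "(\<lambda>p. \<phi>x p - \<psi>x p) \<in> borel_measurable borel" "(\<lambda>p. \<phi>t p - \<psi>t p) \<in> borel_measurable borel"
        using meas[OF \<phi>(2)] meas[OF \<psi>] by (simp_all add: borel_measurable_diff)
      show ?thesis using C(2)[rule_format, OF m, of e] z \<phi>(3-5) by blast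
    qed
    ultimately show ?thesis by linarith
  qed
  have "((\<lambda>e. - (C * e)) \<longlongrightarrow> - (C * 0)) (at_right 0)" by (intro tendsto_intros)
  then have "- (C * 0) \<le> (\<integral>p. ef g a w k \<psi> \<psi>x \<psi>t p \<partial>lborel)"
    by (rule tendsto_upperbound) (use low e0 in \<open>auto simp: eventually_at_right_field intro!: exI[of _ e0]\<close>)
  then show "0 \<le> (\<integral>p. ef g a w k \<psi> \<psi>x \<psi>t p \<partial>lborel)" by simp
qed

lemma integral_deriv_support_zero:
  fixes m m' :: "real \<Rightarrow> real"
  assumes d: "\<And>x. (m has_real_derivative m' x) (at x)" and lr: "l \<le> r"
    and z: "\<And>x. x \<notin> {l<..<r} \<Longrightarrow> m x = 0" "\<And>x. x \<notin> {l..r} \<Longrightarrow> m' x = 0" and i: "integrable lborel m'"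
  shows "(\<integral>x. m' x \<partial>lborel) = 0"
proof (rule integral_deriv_except_zero[where m = m and ?x0.0 = l and l = l and r = r])
  show "continuous_on {l..r} m" using d by (meson DERIV_continuous_on has_field_derivative_at_within)
qed (use assms in auto)

context flux
begin

text \<open>Both terms are exact derivatives, since Q depends on time alone; integrating the first
  along t and the second along x gives 0. Thus constants satisfy Kruzhkov's relation with
  equality.\<close>

lemma const_kruzhkov:
  assumes tau: "0 < \<tau>" "\<tau> \<le> T" and \<psi>: "C1test (cbox (-R, \<tau>) (R, T)) \<psi> \<psi>x \<psi>t"
    and Q: "continuous_on UNIV Q"
  shows "(\<integral>p. c1 * \<psi>t p + Q (snd p) * \<psi>x p \<partial>lborel) = 0"
proof -
  let ?K = "cbox (-R, \<tau>) (R, T)"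
  have c: "continuous_on UNIV \<psi>x" "continuous_on UNIV \<psi>t"
    and dx: "\<And>x t. ((\<lambda>y. \<psi> (y, t)) has_real_derivative \<psi>x (x, t)) (at x)"
    and dt: "\<And>x t. ((\<lambda>s. \<psi> (x, s)) has_real_derivative \<psi>t (x, t)) (at t)"
    and z: "\<And>p. p \<notin> ?K \<Longrightarrow> \<psi> p = 0 \<and> \<psi>x p = 0 \<and> \<psi>t p = 0"
    using \<psi> unfolding C1test_def by blast+
  have i1: "integrable lborel (\<lambda>p. Q (snd p) * \<psi>x p)"
    by (rule integrable_continuous_support[where K = ?K])
      (use z in \<open>auto intro!: continuous_on_mult c continuous_on_compose2[OF Q] continuous_on_snd continuous_on_id\<close>)
  have i2: "integrable lborel \<psi>t" by (rule integrable_continuous_support[OF c(2), where K = ?K]) (use z in auto)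
  have s1: "integrable lborel (\<lambda>x. \<psi>x (x, t))" for t
  proof (rule integrable_continuous_support[where K = "{-R..R}"])
    show "continuous_on UNIV (\<lambda>x. \<psi>x (x, t))" by (rule continuous_on_compose2[OF c(1)]) (auto intro!: continuous_intros)
  qed (use z in \<open>auto simp: cbox_Pair_eq\<close>)
  have s2: "integrable lborel (\<lambda>t. \<psi>t (x, t))" for x
  proof (rule integrable_continuous_support[where K = "{\<tau>..T}"])
    show "continuous_on UNIV (\<lambda>t. \<psi>t (x, t))" by (rule continuous_on_compose2[OF c(2)]) (auto intro!: continuous_intros)
  qed (use z in \<open>auto simp: cbox_Pair_eq\<close>)
  have zx: "\<psi> (x, t) = 0" "\<psi>x (x, t) = 0" if "x < - \<bar>R\<bar> \<or> \<bar>R\<bar> < x" for x t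
  proof -
    have "(x, t) \<notin> ?K" using that by (auto simp: cbox_Pair_eq)
    then show "\<psi> (x, t) = 0" "\<psi>x (x, t) = 0" using z by blast+
  qed
  have zt: "\<psi> (x, t) = 0" "\<psi>t (x, t) = 0" if "t < \<tau> \<or> T < t" for x t
  proof -
    have "(x, t) \<notin> ?K" using that by (auto simp: cbox_Pair_eq)
    then show "\<psi> (x, t) = 0" "\<psi>t (x, t) = 0" using z by blast+
  qed
  have 1: "(\<integral>x. \<psi>x (x, t) \<partial>lborel) = 0" for t
  proof (rule integral_deriv_support_zero[where l = "- \<bar>R\<bar> - 1" and r = "\<bar>R\<bar> + 1", OF dx _ _ _ s1])
    show "\<psi> (x, t) = 0" if "x \<notin> {- \<bar>R\<bar> - 1<..<\<bar>R\<bar> + 1}" for x by (rule zx) (use that in auto)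
    show "\<psi>x (x, t) = 0" if "x \<notin> {- \<bar>R\<bar> - 1..\<bar>R\<bar> + 1}" for x by (rule zx) (use that in auto)
  qed simp
  have 2: "(\<integral>t. \<psi>t (x, t) \<partial>lborel) = 0" for x
  proof (rule integral_deriv_support_zero[where l = "\<tau> - 1" and r = "T + 1", OF dt _ _ _ s2])
    show "\<psi> (x, t) = 0" if "t \<notin> {\<tau> - 1<..<T + 1}" for t by (rule zt) (use that in auto)
    show "\<psi>t (x, t) = 0" if "t \<notin> {\<tau> - 1..T + 1}" for t by (rule zt) (use that in auto)
  qed (use tau in simp)
  have "(\<integral>p. Q (snd p) * \<psi>x p \<partial>lborel) = (\<integral>t. (\<integral>x. Q t * \<psi>x (x, t) \<partial>lborel) \<partial>lborel)"
    using integral_lborel_slices(1)[OF i1] by simp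
  also have "\<dots> = 0" using 1 by simp
  finally have a: "(\<integral>p. Q (snd p) * \<psi>x p \<partial>lborel) = 0" .
  have "integrable (lborel \<Otimes>\<^sub>M lborel) (\<lambda>(x, t). \<psi>t (x, t))" using i2 unfolding lborel_prod by simp
  from lborel_pair.integral_fst[OF this] have "(\<integral>p. \<psi>t p \<partial>lborel) = (\<integral>x. (\<integral>t. \<psi>t (x, t) \<partial>lborel) \<partial>lborel)"
    unfolding lborel_prod by simp
  also have "\<dots> = 0" using 2 by simp
  finally have b: "(\<integral>p. \<psi>t p \<partial>lborel) = 0" .
  show ?thesis using a b i1 i2 by simp
qed

end

lemma C1test_scale:
  assumes "C1test K \<psi> \<psi>x \<psi>t" "c \<ge> 0"
  shows "C1test K (\<lambda>p. c * \<psi> p) (\<lambda>p. c * \<psi>x p) (\<lambda>p. c * \<psi>t p)"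
  using assms unfolding C1test_def by (auto intro: continuous_intros DERIV_cmult)

lemma integrable_lebesgue_on_Icc:
  fixes g :: "real \<Rightarrow> real"
  assumes "g \<in> borel_measurable borel" "\<And>x. \<bar>g x\<bar> \<le> B"
  shows "integrable (lebesgue_on {a..b}) g"
proof (rule finite_measure.integrable_const_bound)
  show "finite_measure (lebesgue_on {a..b})" by (intro finite_measure_lebesgue_on) auto
  show "AE x in lebesgue_on {a..b}. norm (g x) \<le> B" using assms(2) by simp
  have "g \<in> borel_measurable lebesgue" using assms(1) by (simp add: measurable_completion)
  then show "g \<in> borel_measurable (lebesgue_on {a..b})" by (rule measurable_restrict_space1)
qed

lemma L1_diff_tendsto:
  assumes u: "continuous_L1_loc u" and U: "continuous_L1_loc U" and t: "t \<ge> 0"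
  shows "((\<lambda>s. integral\<^sup>L (lebesgue_on {a..b}) (\<lambda>x. \<bar>u x s - U x s\<bar>)) \<longlongrightarrow>
     integral\<^sup>L (lebesgue_on {a..b}) (\<lambda>x. \<bar>u x t - U x t\<bar>)) (at t within {0..})"
proof -
  let ?M = "lebesgue_on {a..b}"
  let ?N = "\<lambda>s. integral\<^sup>L ?M (\<lambda>x. \<bar>u x s - U x s\<bar>)"
  have i: "integrable ?M (\<lambda>x. u x s)" "integrable ?M (\<lambda>x. U x s)" if "s \<ge> 0" for s
    using u U that unfolding continuous_L1_loc_def by blast+
  have l: "((\<lambda>s. integral\<^sup>L ?M (\<lambda>x. \<bar>u x s - u x t\<bar>) + integral\<^sup>L ?M (\<lambda>x. \<bar>U x s - U x t\<bar>)) \<longlongrightarrow> 0 + 0) (at t within {0..})"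
    using u U t unfolding continuous_L1_loc_def by (intro tendsto_add) blast+
  have "((\<lambda>s. ?N s - ?N t) \<longlongrightarrow> 0) (at t within {0..})"
  proof (rule Lim_null_comparison)
    show "((\<lambda>s. integral\<^sup>L ?M (\<lambda>x. \<bar>u x s - u x t\<bar>) + integral\<^sup>L ?M (\<lambda>x. \<bar>U x s - U x t\<bar>)) \<longlongrightarrow> 0) (at t within {0..})"
      using l by simp
    have "norm (?N s - ?N t) \<le> integral\<^sup>L ?M (\<lambda>x. \<bar>u x s - u x t\<bar>) + integral\<^sup>L ?M (\<lambda>x. \<bar>U x s - U x t\<bar>)" if s: "s \<ge> 0" for s
    proof -
      have "?N s - ?N t = integral\<^sup>L ?M (\<lambda>x. \<bar>u x s - U x s\<bar> - \<bar>u x t - U x t\<bar>)"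
        using i[OF s] i[OF t] by (intro Bochner_Integration.integral_diff[symmetric] integrable_abs Bochner_Integration.integrable_diff) auto
      also have "norm \<dots> \<le> integral\<^sup>L ?M (\<lambda>x. norm (\<bar>u x s - U x s\<bar> - \<bar>u x t - U x t\<bar>))"
        by (rule integral_norm_bound)
      also have "\<dots> \<le> integral\<^sup>L ?M (\<lambda>x. \<bar>u x s - u x t\<bar> + \<bar>U x s - U x t\<bar>)"
        using i[OF s] i[OF t]
        by (intro integral_mono integrable_norm Bochner_Integration.integrable_diff Bochner_Integration.integrable_add integrable_abs) auto
      also have "\<dots> = integral\<^sup>L ?M (\<lambda>x. \<bar>u x s - u x t\<bar>) + integral\<^sup>L ?M (\<lambda>x. \<bar>U x s - U x t\<bar>)"
        using i[OF s] i[OF t] by (intro Bochner_Integration.integral_add integrable_abs Bochner_Integration.integrable_diff) auto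
      finally show ?thesis .
    qed
    then show "\<forall>\<^sub>F s in at t within {0..}. norm (?N s - ?N t) \<le> integral\<^sup>L ?M (\<lambda>x. \<bar>u x s - u x t\<bar>) + integral\<^sup>L ?M (\<lambda>x. \<bar>U x s - U x t\<bar>)"
      by (simp add: eventually_at_filter)
  qed
  then show ?thesis by (rule LIM_zero_cancel)
qed

section \<open>The glued function as the unique entropy solution\<close>

locale cauchy = packets f f' "prim a0" z for f f' a0 :: "real \<Rightarrow> real" and z +
  fixes A zb :: real
  assumes a0_meas [measurable]: "a0 \<in> borel_measurable borel" and a0_bdd: "\<And>t. \<bar>a0 t\<bar> \<le> A"
    and z_bdd: "\<And>i. z i \<le> zb"
begin

definition U where "U x t = exp (prim a0 t) * V x t"
definition Vp where "Vp p = (if snd p > 0 then V (fst p) (snd p) else 0)"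

lemma prim_cont: "continuous_on UNIV (prim a0)"
  by (rule continuous_on_prim[OF a0_meas a0_bdd])

lemma prim_meas [measurable]: "prim a0 \<in> borel_measurable borel"
  by (rule borel_measurable_continuous_onI[OF prim_cont])

lemma exp_prim_le: assumes "t \<le> T" "0 \<le> T" shows "exp (prim a0 t) \<le> exp (A * T)" "exp (- prim a0 t) \<le> exp (A * T)"
  using prim_bound[OF a0_meas a0_bdd assms] by (auto simp: abs_le_iff)

lemma packets_test_const:
  assumes "0 < \<tau>" "\<tau> \<le> T"
  shows "packets_test f f' (prim a0) z R \<tau> T (\<lambda>_. k)"
proof -
  interpret ft: flux_test f f' "prim a0" R \<tau> T "\<lambda>_. k" by unfold_locales (use assms in auto)
  show ?thesis
  proof unfold_locales
    fix k'
    show "ft.KI 0 (\<lambda>_. k')"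
      unfolding ft.KI_def
    proof (intro allI impI)
      fix \<psi> \<psi>x \<psi>t assume "C1test ft.K \<psi> \<psi>x \<psi>t"
      then have \<psi>: "C1test (cbox (-R, \<tau>) (R, T)) \<psi> \<psi>x \<psi>t" by (simp add: ft.K_def)
      have "continuous_on UNIV (\<lambda>t. sgn (k - k') * (F t k - F t k'))" by (intro continuous_intros)
      from const_kruzhkov[OF assms \<psi> this, of "\<bar>k - k'\<bar>"]
      show "- 0 \<le> (\<integral>p. ft.I (\<lambda>_. k') \<psi>x \<psi>t p \<partial>lborel)" by (simp add: ft.I_def ft.Q_def)
    qed
  qed
qed

lemma Vp_meas [measurable]: "Vp \<in> borel_measurable borel"
proof -
  interpret pt: packets_test f f' "prim a0" z 1 1 1 "\<lambda>_. 0" by (rule packets_test_const) auto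
  show ?thesis using pt.Vr_meas unfolding pt.Vr_def[abs_def] Vp_def[abs_def] .
qed

text \<open>\<open>KI_Vr\<close> with the constant k in the role of w; entropy and entropy flux are
  symmetric, so the result reads as the inequality of V against k.\<close>

lemma EI_Vp:
  assumes "0 < \<tau>" "\<tau> \<le> T"
  shows "EI (cbox (-R, \<tau>) (R, T)) F (\<lambda>_. 0) Vp"
  unfolding EI_def
proof (intro allI impI)
  fix k \<psi> \<psi>x \<psi>t assume \<psi>: "C1test (cbox (-R, \<tau>) (R, T)) \<psi> \<psi>x \<psi>t"
  interpret pt: packets_test f f' "prim a0" z R \<tau> T "\<lambda>_. k" by (rule packets_test_const[OF assms])
  have Vr: "pt.Vr = Vp" by (rule ext) (simp add: pt.Vr_def Vp_def)
  have \<psi>': "C1test pt.K \<psi> \<psi>x \<psi>t" using \<psi> by (simp add: pt.K_def)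
  obtain M where M: "M \<ge> 0" "\<And>p. \<bar>\<psi> p\<bar> \<le> M" using pt.C1test_bdd[OF \<psi>'] by metis
  \<comment> \<open>Scales the test function to meet the normalisation in \<open>KI\<close>; the
    summand 1 avoids a division by 0.\<close>
  define c where "c = 1 / (M + 1)"
  have c: "c > 0" using M by (simp add: c_def)
  have "\<forall>p. c * \<psi> p \<le> 1"
  proof
    fix p
    have "\<psi> p \<le> M + 1" using M(2)[of p] by linarith
    then show "c * \<psi> p \<le> 1" using M(1) by (simp add: c_def divide_le_eq)
  qed
  moreover have "C1test pt.K (\<lambda>p. c * \<psi> p) (\<lambda>p. c * \<psi>x p) (\<lambda>p. c * \<psi>t p)" by (rule C1test_scale[OF \<psi>']) (use c in simp)
  ultimately have "0 \<le> (\<integral>p. pt.I Vp (\<lambda>p. c * \<psi>x p) (\<lambda>p. c * \<psi>t p) p \<partial>lborel)"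
    using pt.KI_Vr unfolding pt.KI_def Vr by fastforce
  also have "(\<lambda>p. pt.I Vp (\<lambda>p. c * \<psi>x p) (\<lambda>p. c * \<psi>t p) p) = (\<lambda>p. c * ef F (\<lambda>_. 0) Vp k \<psi> \<psi>x \<psi>t p)"
  proof
    fix p
    have "sgn (k - Vp p) = - sgn (Vp p - k)" by (metis minus_diff_eq sgn_minus)
    then show "pt.I Vp (\<lambda>p. c * \<psi>x p) (\<lambda>p. c * \<psi>t p) p = c * ef F (\<lambda>_. 0) Vp k \<psi> \<psi>x \<psi>t p"
      by (simp add: pt.I_def pt.Q_def ef_def abs_minus_commute algebra_simps)
  qed
  finally show "0 \<le> (\<integral>p. ef F (\<lambda>_. 0) Vp k \<psi> \<psi>x \<psi>t p \<partial>lborel)" using c by (simp add: zero_le_mult_iff)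
qed

text \<open>The rescaling run backwards: starting without a source, the rate - a0 produces the
  source 0 - (- a0) = a0 and turns F back into f.\<close>

lemma U_entropy:
  assumes a: "AE t in lborel. 0 < t \<longrightarrow> \<alpha> t = a0 t" and \<phi>: "test_function \<phi>"
  shows "0 \<le> integral\<^sup>L (lebesgue_on (UNIV \<times> {0<..})) (entropy_integrand f \<alpha> U k \<phi>)"
proof -
  obtain R \<tau> T \<phi>x \<phi>t where b: "0 < \<tau>" "\<tau> \<le> T" and C: "C1test (cbox (-R, \<tau>) (R, T)) \<phi> \<phi>x \<phi>t"
    using test_function_C1test[OF \<phi>] by metis
  obtain B where B: "B \<ge> 0" "\<And>x t. \<bar>V x t\<bar> \<le> B" using V_bounded by metis
  let ?c = "\<lambda>t. - a0 t"
  have pc: "prim ?c t = - prim a0 t" for t by (simp add: prim_def)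
  interpret c: conv R \<tau> T F "\<lambda>_. 0" ?c Vp A B
    by unfold_locales (use b F_continuous a0_bdd B in \<open>auto simp: Vp_def intro: order_trans[OF abs_ge_zero a0_bdd]\<close>)
  have "EI c.K F (\<lambda>_. 0) Vp" unfolding c.K_def by (rule EI_Vp[OF b])
  from c.EI_scale[OF this]
  have E: "EI c.K (\<lambda>t v. exp (prim a0 t) * F t (exp (- prim a0 t) * v)) (\<lambda>t. a0 t) (\<lambda>p. exp (prim a0 (snd p)) * Vp p)"
    by (simp add: pc)
  have ff: "(\<lambda>t v. exp (prim a0 t) * F t (exp (- prim a0 t) * v)) = (\<lambda>_. f)"
  proof (intro ext)
    fix t v
    have e: "exp (prim a0 t) * exp (- prim a0 t) = 1" by (simp add: exp_minus)
    show "exp (prim a0 t) * F t (exp (- prim a0 t) * v) = f v"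
      unfolding F_def mult.assoc[symmetric] e by simp
  qed
  have "integral\<^sup>L (lebesgue_on (UNIV \<times> {0<..})) (entropy_integrand f \<alpha> U k \<phi>) =
      (\<integral>p. ef (\<lambda>_. f) a0 (\<lambda>p. exp (prim a0 (snd p)) * Vp p) k \<phi> \<phi>x \<phi>t p \<partial>lborel)"
  proof (rule entropy_integral_eq[OF C])
    show "cbox (-R, \<tau>) (R, T) \<subseteq> UNIV \<times> {0<..<T + 1}" using b by (auto simp: cbox_Pair_eq)
    show "AE p in lborel. 0 < snd p \<longrightarrow> snd p < T + 1 \<longrightarrow> U (fst p) (snd p) = exp (prim a0 (snd p)) * Vp p"
      by (rule AE_I2) (simp add: U_def Vp_def)
    show "continuous_on UNIV f" by (rule f_cont)
  qed (use a in measurable)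
  also have "0 \<le> \<dots>" using E C unfolding EI_def ff c.K_def by blast
  finally show ?thesis .
qed

lemma U_slice_meas: "t \<ge> 0 \<Longrightarrow> (\<lambda>x. U x t) \<in> borel_measurable borel"
  unfolding U_def using V_measurable by measurable

text \<open>At fixed t, convergence holds at every x that is not a shock position. The uniform bound
  on V and the bound on the exponential over a bounded time interval give the domination.\<close>

lemma U_L1: "continuous_L1_loc U"
  unfolding continuous_L1_loc_def
proof (intro conjI allI impI)
  obtain B where B: "B \<ge> 0" "\<And>x t. \<bar>V x t\<bar> \<le> B" using V_bounded by metis
  have Ub: "\<bar>U x s\<bar> \<le> exp (A * T) * B" if "s \<le> T" "0 \<le> T" for x s T
    unfolding U_def abs_mult using exp_prim_le(1)[OF that] B by (intro mult_mono) auto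
  fix a b t :: real assume t: "0 \<le> t"
  show "integrable (lebesgue_on {a..b}) (\<lambda>x. U x t)"
    by (rule integrable_lebesgue_on_Icc[OF U_slice_meas[OF t] Ub[OF order_refl t]])
  show "((\<lambda>s. integral\<^sup>L (lebesgue_on {a..b}) (\<lambda>x. \<bar>U x s - U x t\<bar>)) \<longlongrightarrow> 0) (at t within {0..})"
    unfolding tendsto_at_iff_sequentially comp_def
  proof (intro allI impI)
    fix X :: "nat \<Rightarrow> real" assume X: "\<forall>i. X i \<in> {0..} - {t}" "X \<longlonglongrightarrow> t"
    obtain T0 where T0: "\<forall>n. norm (X n) \<le> T0" using convergent_imp_Bseq[OF convergentI[OF X(2)]] by (elim BseqE)
    define T where "T = max T0 t"
    have T: "T \<ge> 0" "t \<le> T" "X n \<le> T" for n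
      using t spec[OF T0, of n] by (auto simp: T_def le_max_iff_disj)
    have Xm: "(\<lambda>x. U x (X n)) \<in> borel_measurable borel" for n using X(1) by (intro U_slice_meas) auto
    have m: "g \<in> borel_measurable (lebesgue_on {a..b})" if "g \<in> borel_measurable borel" for g :: "real \<Rightarrow> real"
      using that by (intro measurable_restrict_space1) (simp add: measurable_completion)
    have "(\<lambda>n. integral\<^sup>L (lebesgue_on {a..b}) (\<lambda>x. \<bar>U x (X n) - U x t\<bar>)) \<longlonglongrightarrow> integral\<^sup>L (lebesgue_on {a..b}) (\<lambda>x. 0)"
    proof (rule integral_dominated_convergence[where w = "\<lambda>x. 2 * (exp (A * T) * B)"])
      show "(\<lambda>x. \<bar>U x (X n) - U x t\<bar>) \<in> borel_measurable (lebesgue_on {a..b})" for n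
        by (rule m) (use Xm U_slice_meas[OF t] in measurable)
      show "integrable (lebesgue_on {a..b}) (\<lambda>x. 2 * (exp (A * T) * B))"
        by (rule integrable_lebesgue_on_Icc[where B = "\<bar>2 * (exp (A * T) * B)\<bar>"]) auto
      show "AE x in lebesgue_on {a..b}. norm \<bar>U x (X n) - U x t\<bar> \<le> 2 * (exp (A * T) * B)" for n
      proof (rule AE_I2)
        fix x
        show "norm \<bar>U x (X n) - U x t\<bar> \<le> 2 * (exp (A * T) * B)"
          using Ub[OF T(3)[of n] T(1), of x] Ub[OF T(2) T(1), of x] abs_triangle_ineq4[of "U x (X n)" "U x t"]
          unfolding real_norm_def abs_abs by linarith
      qed
      have "AE x in lborel. (\<lambda>n. \<bar>U x (X n) - U x t\<bar>) \<longlonglongrightarrow> 0"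
        using P_zero_AE[OF t]
      proof eventually_elim
        case (elim x)
        have "((\<lambda>s. V x s) \<longlongrightarrow> V x t) (at t within {0..})" using V_tendsto[OF t] elim by blast
        then have v: "(\<lambda>n. V x (X n)) \<longlonglongrightarrow> V x t" using X unfolding tendsto_at_iff_sequentially comp_def by blast
        have p: "(\<lambda>n. prim a0 (X n)) \<longlonglongrightarrow> prim a0 t" using continuous_on_tendsto_compose[OF prim_cont X(2)] by simp
        have "(\<lambda>n. \<bar>U x (X n) - U x t\<bar>) \<longlonglongrightarrow> \<bar>U x t - U x t\<bar>"
          unfolding U_def by (intro tendsto_intros v p)
        then show ?case by simp
      qed
      then have "AE x in lebesgue. (\<lambda>n. \<bar>U x (X n) - U x t\<bar>) \<longlonglongrightarrow> 0" by (simp add: AE_completion_iff)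
      then show "AE x in lebesgue_on {a..b}. (\<lambda>n. \<bar>U x (X n) - U x t\<bar>) \<longlonglongrightarrow> 0"
        by (subst AE_restrict_space_iff) auto
    qed simp
    then show "(\<lambda>n. integral\<^sup>L (lebesgue_on {a..b}) (\<lambda>x. \<bar>U x (X n) - U x t\<bar>)) \<longlonglongrightarrow> 0" by simp
  qed
qed

lemma U_Linfty: assumes "T > 0" shows "Linfty_on (UNIV \<times> {0<..<T}) (\<lambda>(x, t). U x t)"
  unfolding Linfty_on_def
proof
  obtain B where B: "B \<ge> 0" "\<And>x t. \<bar>V x t\<bar> \<le> B" using V_bounded by metis
  let ?S = "UNIV \<times> {0<..<T} :: (real \<times> real) set"
  have S': "?S \<in> sets borel" by (rule borel_open[OF open_Times[OF open_UNIV open_greaterThanLessThan]])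
  then have S: "?S \<in> sets lebesgue" by (metis sets_completionI_sets sets_lborel)
  have "(\<lambda>p. exp (prim a0 (snd p)) * Vp p) \<in> borel_measurable borel" by measurable
  then have "(\<lambda>p. exp (prim a0 (snd p)) * Vp p) \<in> borel_measurable (lebesgue_on ?S)"
    by (intro measurable_restrict_space1) (simp add: measurable_completion)
  then show "(\<lambda>(x, t). U x t) \<in> borel_measurable (lebesgue_on ?S)"
    by (rule measurable_cong[THEN iffD1, rotated]) (auto simp: U_def Vp_def space_restrict_space)
  show "\<exists>M. AE p in lebesgue_on ?S. \<bar>case p of (x, t) \<Rightarrow> U x t\<bar> \<le> M"
  proof (intro exI[of _ "exp (A * T) * B"] AE_I2)
    fix p assume "p \<in> space (lebesgue_on ?S)"
    then have "snd p \<le> T" by (auto simp: space_restrict_space)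
    then show "\<bar>case p of (x, t) \<Rightarrow> U x t\<bar> \<le> exp (A * T) * B"
      unfolding split_beta U_def abs_mult using exp_prim_le(1)[of "snd p" T] B assms by (intro mult_mono) auto
  qed
qed

lemma U_0: "U x 0 = V x 0"
  by (simp add: U_def prim_nonpos)

theorem U_solution:
  assumes "AE t in lborel. 0 < t \<longrightarrow> \<alpha> t = a0 t"
  shows "entropy_solution f \<alpha> (\<lambda>x. V x 0) U"
  unfolding entropy_solution_def
  using U_Linfty U_L1 U_0 U_entropy[OF assms] unfolding entropy_integrand_def by simp

text \<open>A Borel representative of u on a finite time strip is rescaled and compared with V by
  \<open>L1_unique\<close>; agreement for almost all (x, t) is upgraded to the given time by
  continuity in L^1. The initial smallness that \<open>L1_unique\<close> asks for comes from the
  same continuity at t = 0.\<close>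

theorem U_unique:
  assumes a: "AE t in lborel. 0 < t \<longrightarrow> \<alpha> t = a0 t" and u: "entropy_solution f \<alpha> (\<lambda>x. V x 0) u" and t0: "t0 > 0"
  shows "AE x in lborel. u x t0 = U x t0"
proof -
  \<comment> \<open>T > t0 leaves times after t0 at which agreement is known; T1 > T leaves room for
    mollifying test functions.\<close>
  define T where "T = t0 + 1"
  define T1 where "T1 = T + 1"
  have T: "T > 0" "T1 > T" "t0 < T" using t0 by (auto simp: T_def T1_def)
  have uL: "Linfty_on (UNIV \<times> {0<..<T1}) (\<lambda>(x, t). u x t)" and uC: "continuous_L1_loc u"
    and u0: "AE x in lebesgue. u x 0 = V x 0"
    and ue: "\<And>k \<phi>. test_function \<phi> \<Longrightarrow> 0 \<le> integral\<^sup>L (lebesgue_on (UNIV \<times> {0<..})) (entropy_integrand f \<alpha> u k \<phi>)"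
    using u T unfolding entropy_solution_def entropy_integrand_def by auto
  have S: "UNIV \<times> {0<..<T1} \<in> sets (borel :: (real \<times> real) measure)" 
    by (rule borel_open[OF open_Times[OF open_UNIV open_greaterThanLessThan]])
  obtain w0 Bw where w0 [measurable]: "w0 \<in> borel_measurable borel" and w0b: "\<And>p. \<bar>w0 p\<bar> \<le> Bw"
    and w0u: "AE p in lborel. p \<in> UNIV \<times> {0<..<T1} \<longrightarrow> (case p of (x, t) \<Rightarrow> u x t) = w0 p"
    by (rule Linfty_on_Borel[OF S uL]) (rule that)
  have w0u': "AE p in lborel. 0 < snd p \<longrightarrow> snd p < T1 \<longrightarrow> u (fst p) (snd p) = w0 p"
    using w0u by eventually_elim (auto simp: split_beta mem_Times_iff)
  obtain B where B: "B \<ge> 0" "\<And>x t. \<bar>V x t\<bar> \<le> B" using V_bounded by metis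
  have EI0: "EI (cbox (-R, \<tau>) (R, T)) (\<lambda>_. f) a0 w0" if "0 < \<tau>" "\<tau> \<le> T" for R \<tau>
  proof (rule EI_of_test_functions[OF that T(2) _ a0_meas a0_bdd w0 w0b])
    show "continuous_on UNIV (\<lambda>q::real \<times> real. f (snd q))" by (rule continuous_on_compose2[OF f_cont]) (auto intro!: continuous_intros)
    fix k \<phi> \<phi>x \<phi>t K assume \<phi>: "test_function \<phi>" and K: "K \<subseteq> UNIV \<times> {0<..<T1}" and C: "C1test K \<phi> \<phi>x \<phi>t"
    show "0 \<le> (\<integral>p. ef (\<lambda>_. f) a0 w0 k \<phi> \<phi>x \<phi>t p \<partial>lborel)"
      using entropy_integral_eq[OF C K w0u' a w0 a0_meas f_cont, of k] ue[OF \<phi>, of k] by simp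
  qed
  define v where "v p = (if 0 < snd p \<and> snd p < T1 then exp (- prim a0 (snd p)) * w0 p else 0)" for p
  have vm [measurable]: "v \<in> borel_measurable borel" unfolding v_def[abs_def] by measurable
  define Bv where "Bv = exp (A * T1) * Bw + B"
  have Bw0: "Bw \<ge> 0" using w0b[of undefined] by linarith
  have vb: "\<bar>v p\<bar> \<le> Bv" for p
  proof (cases "0 < snd p \<and> snd p < T1")
    case True
    then have "\<bar>exp (- prim a0 (snd p)) * w0 p\<bar> \<le> exp (A * T1) * Bw"
      unfolding abs_mult using exp_prim_le(2)[of "snd p" T1] w0b Bw0 T by (intro mult_mono) auto
    then show ?thesis using True B by (simp add: v_def Bv_def)
  next
    case False
    have "0 \<le> exp (A * T1) * Bw" using Bw0 by simp
    moreover have "v p = 0" unfolding v_def by (rule if_not_P[OF False])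
    ultimately show ?thesis using B(1) unfolding Bv_def by simp
  qed
  have Vb: "\<bar>Vp p\<bar> \<le> Bv" for p
  proof -
    have "0 \<le> exp (A * T1) * Bw" using Bw0 by simp
    then show ?thesis using B(1) B(2)[of "fst p" "snd p"] unfolding Vp_def Bv_def by auto
  qed
  have EIv: "EI (cbox (-R, \<tau>) (R, T)) F (\<lambda>_. 0) v" if b: "0 < \<tau>" "\<tau> \<le> T" for R \<tau>
  proof -
    interpret c: conv R \<tau> T "\<lambda>_. f" a0 a0 w0 A Bw
    proof unfold_locales
      show "continuous_on UNIV (\<lambda>q::real \<times> real. f (snd q))" by (rule continuous_on_compose2[OF f_cont]) (auto intro!: continuous_intros)
    qed (use b w0b a0_bdd in auto)
    have "EI c.K (\<lambda>_. f) a0 w0" unfolding c.K_def by (rule EI0[OF b])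
    from c.EI_scale[OF this]
    have E: "EI c.K F (\<lambda>_. 0) (\<lambda>p. exp (- prim a0 (snd p)) * w0 p)" by (simp add: F_def[abs_def])
    show ?thesis
      unfolding EI_def
    proof (intro allI impI)
      fix k \<psi> \<psi>x \<psi>t assume C: "C1test (cbox (-R, \<tau>) (R, T)) \<psi> \<psi>x \<psi>t"
      have "ef F (\<lambda>_. 0) v k \<psi> \<psi>x \<psi>t = ef F (\<lambda>_. 0) (\<lambda>p. exp (- prim a0 (snd p)) * w0 p) k \<psi> \<psi>x \<psi>t"
      proof
        fix p
        show "ef F (\<lambda>_. 0) v k \<psi> \<psi>x \<psi>t p = ef F (\<lambda>_. 0) (\<lambda>p. exp (- prim a0 (snd p)) * w0 p) k \<psi> \<psi>x \<psi>t p"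
        proof (cases "p \<in> cbox (-R, \<tau>) (R, T)")
          case True
          then have "0 < snd p" "snd p < T1" using b T by (cases p; auto simp: cbox_Pair_eq)+
          then show ?thesis by (simp add: v_def ef_def)
        next
          case False
          show ?thesis using C1test_outside[OF C False] by (simp add: ef_def)
        qed
      qed
      then show "0 \<le> (\<integral>p. ef F (\<lambda>_. 0) v k \<psi> \<psi>x \<psi>t p \<partial>lborel)" using E C unfolding EI_def c.K_def by simp
    qed
  qed
  have KIv: "0 \<le> (\<integral>p. \<bar>v p - Vp p\<bar> * \<psi>t p + sgn (v p - Vp p) * (F (snd p) (v p) - F (snd p) (Vp p)) * \<psi>x p \<partial>lborel)"
    if b: "0 < \<tau>" "\<tau> \<le> T" and C: "C1test (cbox (-R, \<tau>) (R, T)) \<psi> \<psi>x \<psi>t" and le1: "\<And>p. \<psi> p \<le> 1" for R \<tau> \<psi> \<psi>x \<psi>t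
  proof -
    interpret ft: flux_test f f' "prim a0" R \<tau> T v by unfold_locales (use b vb in auto)
    interpret pt: packets_test f f' "prim a0" z R \<tau> T v
    proof unfold_locales
      fix k
      show "ft.KI 0 (\<lambda>_. k)"
        unfolding ft.KI_def
      proof (intro allI impI)
        fix \<psi> \<psi>x \<psi>t assume "C1test ft.K \<psi> \<psi>x \<psi>t"
        then have "0 \<le> (\<integral>p. ef F (\<lambda>_. 0) v k \<psi> \<psi>x \<psi>t p \<partial>lborel)" using EIv[OF b, of R] unfolding EI_def ft.K_def by blast
        then show "- 0 \<le> (\<integral>p. ft.I (\<lambda>_. k) \<psi>x \<psi>t p \<partial>lborel)" by (simp add: ef_def ft.I_def ft.Q_def)
      qed
    qed
    have Vr: "pt.Vr = Vp" by (rule ext) (simp add: pt.Vr_def Vp_def)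
    have C': "C1test ft.K \<psi> \<psi>x \<psi>t" using C by (simp add: ft.K_def)
    have "- 0 \<le> (\<integral>p. ft.I Vp \<psi>x \<psi>t p \<partial>lborel)" using pt.KI_Vr C' le1 unfolding ft.KI_def Vr by blast
    then show ?thesis by (simp add: ft.I_def ft.Q_def)
  qed
  \<comment> \<open>The distance is formed with u itself: slices of \<open>w0\<close> agree with
    those of u for almost every t, whereas continuity in time is known for u.\<close>
  define N where "N \<rho> t = integral\<^sup>L (lebesgue_on {-\<rho>..\<rho>}) (\<lambda>x. \<bar>u x t - U x t\<bar>)" for \<rho> t
  have Nlim: "(N \<rho> \<longlongrightarrow> N \<rho> t) (at t within {0..})" if "t \<ge> 0" for \<rho> t
    unfolding N_def[abs_def] by (rule L1_diff_tendsto[OF uC U_L1 that])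
  have N00: "N \<rho> 0 = 0" for \<rho>
  proof -
    have "AE x in lborel. u x 0 = V x 0" using u0 by (simp add: AE_completion_iff)
    then have "AE x in lborel. indicator {-\<rho>..\<rho>} x * \<bar>u x 0 - U x 0\<bar> = 0" by eventually_elim (simp add: U_0)
    then show ?thesis unfolding N_def by (subst integral_lebesgue_on_AE_eq[where h = "\<lambda>_. 0"]) auto
  qed
  have slices: "AE t in lborel. AE x in lborel. 0 < t \<longrightarrow> t < T1 \<longrightarrow> u x t = w0 (x, t)"
    using AE_lborel_slices[OF w0u'] by simp
  have vN: "(\<integral>x. indicator {-\<rho>..\<rho>} x * \<bar>v (x, t) - Vp (x, t)\<bar> \<partial>lborel) = exp (- prim a0 t) * N \<rho> t"
    if t: "0 < t" "t < T1" and ae: "AE x in lborel. 0 < t \<longrightarrow> t < T1 \<longrightarrow> u x t = w0 (x, t)" for t \<rho>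
  proof -
    have [measurable]: "(\<lambda>x. v (x, t)) \<in> borel_measurable borel" "(\<lambda>x. Vp (x, t)) \<in> borel_measurable borel"
      by (rule measurable_compose[OF _ vm]; intro borel_measurable_continuous_onI continuous_intros)
         (rule measurable_compose[OF _ Vp_meas]; intro borel_measurable_continuous_onI continuous_intros)
    have "integral\<^sup>L (lebesgue_on {-\<rho>..\<rho>}) (\<lambda>x. exp (- prim a0 t) * \<bar>u x t - U x t\<bar>) = (\<integral>x. indicator {-\<rho>..\<rho>} x * \<bar>v (x, t) - Vp (x, t)\<bar> \<partial>lborel)"
    proof (rule integral_lebesgue_on_AE_eq)
      show "AE x in lborel. indicator {-\<rho>..\<rho>} x * (exp (- prim a0 t) * \<bar>u x t - U x t\<bar>) = indicator {-\<rho>..\<rho>} x * \<bar>v (x, t) - Vp (x, t)\<bar>"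
        using ae
      proof eventually_elim
        case (elim x)
        have "exp (- prim a0 t) * exp (prim a0 t) = 1" by (simp add: exp_minus)
        then have "exp (- prim a0 t) * (u x t - U x t) = exp (- prim a0 t) * u x t - V x t"
          unfolding U_def right_diff_distrib mult.assoc[symmetric] by simp
        then have "exp (- prim a0 t) * (u x t - U x t) = v (x, t) - Vp (x, t)" using elim t by (simp add: v_def Vp_def)
        then have "exp (- prim a0 t) * \<bar>u x t - U x t\<bar> = \<bar>v (x, t) - Vp (x, t)\<bar>"
          by (metis abs_exp_cancel abs_mult)
        then show ?case by simp
      qed
    qed (auto, measurable)
    then show ?thesis by (simp add: N_def)
  qed
  have N0: "\<exists>\<delta>>0. AE t in lborel. 0 < t \<longrightarrow> t < \<delta> \<longrightarrow> (\<integral>x. indicator {-\<rho>..\<rho>} x * \<bar>v (x, t) - Vp (x, t)\<bar> \<partial>lborel) \<le> \<epsilon>"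
    if e: "\<epsilon> > 0" for \<rho> \<epsilon>
  proof -
    have "\<forall>\<^sub>F t in at 0 within {0..}. dist (N \<rho> t) (N \<rho> 0) < \<epsilon> / exp (A * T1)"
      by (rule tendstoD[OF Nlim]) (use e in auto)
    then obtain d where d: "d > 0" "\<And>t. t \<in> {0..} \<Longrightarrow> t \<noteq> 0 \<Longrightarrow> dist t 0 < d \<Longrightarrow> dist (N \<rho> t) (N \<rho> 0) < \<epsilon> / exp (A * T1)"
      unfolding eventually_at by blast
    show ?thesis
    proof (intro exI[of _ "min d T1"] conjI)
      show "0 < min d T1" using d T by simp
      show "AE t in lborel. 0 < t \<longrightarrow> t < min d T1 \<longrightarrow> (\<integral>x. indicator {-\<rho>..\<rho>} x * \<bar>v (x, t) - Vp (x, t)\<bar> \<partial>lborel) \<le> \<epsilon>"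
        using slices
      proof eventually_elim
        case (elim t)
        show ?case
        proof (intro impI)
          assume t: "0 < t" "t < min d T1"
          have "dist (N \<rho> t) (N \<rho> 0) < \<epsilon> / exp (A * T1)" using d(2)[of t] t by (simp add: dist_real_def)
          then have "N \<rho> t \<le> \<epsilon> / exp (A * T1)" by (simp add: N00 dist_real_def)
          moreover have "0 \<le> N \<rho> t" unfolding N_def by (intro integral_nonneg_AE) auto
          ultimately have "exp (- prim a0 t) * N \<rho> t \<le> exp (A * T1) * (\<epsilon> / exp (A * T1))"
            using exp_prim_le(2)[of t T1] t T by (intro mult_mono) auto
          then show "(\<integral>x. indicator {-\<rho>..\<rho>} x * \<bar>v (x, t) - Vp (x, t)\<bar> \<partial>lborel) \<le> \<epsilon>"
            using vN[of t \<rho>] t elim by simp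
        qed
      qed
    qed
  qed
  have "AE p in lborel. 0 < snd p \<longrightarrow> snd p < T \<longrightarrow> v p = Vp p"
    by (rule L1_unique[OF T(1) vm Vp_meas vb Vb KIv N0])
  from AE_lborel_slices[OF this]
  have "AE t in lborel. AE x in lborel. 0 < t \<longrightarrow> t < T \<longrightarrow> v (x, t) = Vp (x, t)" by simp
  then have Nz: "AE t in lborel. 0 < t \<longrightarrow> t < T \<longrightarrow> (\<forall>\<rho>. N \<rho> t = 0)"
    using slices
  proof eventually_elim
    case (elim t)
    show ?case
    proof (intro impI allI)
      fix \<rho> assume t: "0 < t" "t < T"
      have "AE x in lborel. indicator {-\<rho>..\<rho>} x * \<bar>v (x, t) - Vp (x, t)\<bar> = 0"
        using elim(1) by eventually_elim (use t in auto)
      then have "(\<integral>x. indicator {-\<rho>..\<rho>} x * \<bar>v (x, t) - Vp (x, t)\<bar> \<partial>lborel) = 0" by (rule integral_eq_zero_AE)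
      then show "N \<rho> t = 0" using vN[of t \<rho>] t T elim(2) by simp
    qed
  qed
  \<comment> \<open>N vanishes at almost all times below T, in particular at times arbitrarily close
    after t0, so continuity excludes a nonzero value at t0.\<close>
  have Nt0: "N \<rho> t0 = 0" for \<rho>
  proof (rule ccontr)
    assume "N \<rho> t0 \<noteq> 0"
    then have "\<forall>\<^sub>F s in at t0 within {0..}. dist (N \<rho> s) (N \<rho> t0) < \<bar>N \<rho> t0\<bar>"
      using t0 by (intro tendstoD[OF Nlim]) auto
    then obtain d where d: "d > 0" "\<And>s. s \<in> {0..} \<Longrightarrow> s \<noteq> t0 \<Longrightarrow> dist s t0 < d \<Longrightarrow> dist (N \<rho> s) (N \<rho> t0) < \<bar>N \<rho> t0\<bar>"
      unfolding eventually_at by blast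
    have "t0 < min (t0 + d) T" using d T by simp
    from AE_lborel_ex[OF Nz this] obtain s where s: "t0 < s" "s < min (t0 + d) T" "0 < s \<longrightarrow> s < T \<longrightarrow> (\<forall>\<rho>. N \<rho> s = 0)" by blast
    then have "N \<rho> s = 0" using t0 by auto
    then show False using d(2)[of s] s t0 by (simp add: dist_real_def)
  qed
  have "AE x in lborel. \<forall>n::nat. x \<in> {- real n..real n} \<longrightarrow> u x t0 = U x t0"
  proof (subst AE_all_countable, intro allI)
    fix n :: nat
    let ?M = "lebesgue_on {- real n..real n}"
    have "integrable ?M (\<lambda>x. u x t0)" "integrable ?M (\<lambda>x. U x t0)"
      using uC U_L1 t0 unfolding continuous_L1_loc_def by (meson less_imp_le)+
    then have i: "integrable ?M (\<lambda>x. \<bar>u x t0 - U x t0\<bar>)" by simp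
    have "AE x in ?M. \<bar>u x t0 - U x t0\<bar> = 0"
      using Nt0[of "real n"] integral_nonneg_eq_0_iff_AE[OF i] by (simp add: N_def)
    then have "AE x in lebesgue. x \<in> {- real n..real n} \<longrightarrow> \<bar>u x t0 - U x t0\<bar> = 0"
      by (subst (asm) AE_restrict_space_iff) auto
    then have "AE x in lborel. x \<in> {- real n..real n} \<longrightarrow> \<bar>u x t0 - U x t0\<bar> = 0" by (simp add: AE_completion_iff)
    then show "AE x in lborel. x \<in> {- real n..real n} \<longrightarrow> u x t0 = U x t0" by eventually_elim simp
  qed
  then show ?thesis
  proof eventually_elim
    case (elim x)
    obtain n :: nat where "\<bar>x\<bar> \<le> real n" using real_arch_simple by blast
    then show ?case using elim by (auto simp: abs_le_iff)
  qed
qed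

end

text \<open>Strict convexity at the midpoint of x and y, compared with the tangents at both ends,
  gives (f' x - f' y) (y - x) / 2 < 0.\<close>

lemma strictly_convex_deriv_strict_mono:
  assumes sc: "strictly_convex_on UNIV f" and d: "\<And>x. (f has_real_derivative f' x) (at x)"
  shows "strict_mono f'" and "f' x * (y - x) \<le> f y - f x"
proof -
  have cv: "convex_on UNIV f"
  proof (rule convex_onI)
    fix t x y :: real assume t: "0 < t" "t < 1"
    show "f ((1 - t) *\<^sub>R x + t *\<^sub>R y) \<le> (1 - t) * f x + t * f y"
    proof (cases "x = y")
      case True
      then show ?thesis by (simp add: algebra_simps)
    next
      case False
      then show ?thesis using sc t unfolding strictly_convex_on_def by (simp add: less_imp_le)
    qed
  qed simp
  have tan: "f' x * (y - x) \<le> f y - f x" for x y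
    using convex_on_imp_above_tangent[OF cv, of x y "f' x"] d[of x] by (simp add: connected_UNIV)
  then show "f' x * (y - x) \<le> f y - f x" .
  show "strict_mono f'"
  proof (rule strict_monoI)
    fix x y :: real assume xy: "x < y"
    let ?m = "(x + y) / 2"
    have m: "(1 - 1 / 2) * x + 1 / 2 * y = ?m" "(x + y) / 2 - x = (y - x) / 2" "(x + y) / 2 - y = - ((y - x) / 2)"
      by (simp_all add: field_simps)
    have "f ((1 - 1 / 2) * x + 1 / 2 * y) < (1 - 1 / 2) * f x + 1 / 2 * f y"
      by (rule sc[unfolded strictly_convex_on_def, THEN conjunct2, rule_format, OF UNIV_I UNIV_I]) (use xy in simp_all)
    then have "2 * f ?m < f x + f y" unfolding m(1) by simp
    moreover have "f' x * ((y - x) / 2) \<le> f ?m - f x" using tan[of x ?m] unfolding m .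
    moreover have "- (f' y * ((y - x) / 2)) \<le> f ?m - f y" using tan[of y ?m] unfolding m mult_minus_right .
    ultimately have "f' x * ((y - x) / 2) - f' y * ((y - x) / 2) < 0" by linarith
    then have "(f' x - f' y) * ((y - x) / 2) < 0" by (simp only: left_diff_distrib)
    then show "f' x < f' y" using xy by (simp add: mult_less_0_iff)
  qed
qed

text \<open>The tangent at v evaluated at 0 gives f v \<le> f' v * v; dividing by |v| bounds f v /
  |v| by f' v for v > 0 and by - f' v for v < 0.\<close>

lemma superlinear_deriv_unbounded:
  assumes tan: "\<And>x y. f' x * (y - x) \<le> f y - f x" and f0: "f 0 = (0::real)"
    and sl: "filterlim (\<lambda>v. f v / \<bar>v\<bar>) at_top at_infinity"
  shows "filterlim f' at_top at_top" "filterlim f' at_bot at_bot"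
proof -
  have t0: "f v \<le> f' v * v" for v using tan[of v 0] f0 by simp
  have 1: "filterlim (\<lambda>v. f v / \<bar>v\<bar>) at_top at_top" by (rule filterlim_mono[OF sl order_refl at_top_le_at_infinity])
  have 2: "filterlim (\<lambda>v. f v / \<bar>v\<bar>) at_top at_bot" by (rule filterlim_mono[OF sl order_refl at_bot_le_at_infinity])
  have "\<forall>\<^sub>F v in at_top. f v / \<bar>v\<bar> \<le> f' v"
    using eventually_gt_at_top[of 0] by eventually_elim (use t0 in \<open>simp add: pos_divide_le_eq\<close>)
  then show "filterlim f' at_top at_top" by (rule filterlim_at_top_mono[OF 1])
  have "\<forall>\<^sub>F v in at_bot. f v / \<bar>v\<bar> \<le> - f' v"
    using eventually_gt_at_bot[of 0]
  proof eventually_elim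
    case (elim v)
    then have "\<bar>v\<bar> = - v" "- v > 0" by simp_all
    moreover have "f v \<le> - f' v * - v" using t0[of v] by simp
    ultimately show ?case by (simp only: pos_divide_le_eq)
  qed
  then have "filterlim (\<lambda>v. - f' v) at_top at_bot" by (rule filterlim_at_top_mono[OF 2])
  then show "filterlim f' at_bot at_bot" by (simp add: filterlim_uminus_at_top)
qed

theorem theorem3p4:
  fixes f \<alpha> :: "real \<Rightarrow> real" and q r C :: real
  assumes "f C1_differentiable_on UNIV"
    and "strictly_convex_on UNIV f"
    and "f 0 = 0" and "deriv f 0 = 0"
    and "filterlim (\<lambda>v. f v / \<bar>v\<bar>) at_top at_infinity"
    and "q > 1" and "r > 0" and "C > 0"
    and "\<And>a b. b \<in> {-r<..<0} \<Longrightarrow> a \<in> {0<..<r} \<Longrightarrow>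
           0 \<le> deriv f a - deriv f b \<and> deriv f a - deriv f b \<le> C * (a - b) powr q"
    and "Linfty_on {0<..} \<alpha>"
  shows "\<exists>u0. Linfty_on UNIV u0 \<and> compact (closure {x. u0 x \<noteq> 0}) \<and>
           (\<exists>u. entropy_solution f \<alpha> u0 u) \<and>
           (\<forall>u. entropy_solution f \<alpha> u0 u \<longrightarrow>
              (\<forall>s>1/q. \<forall>t>0. \<not> BVs_loc_ae s (\<lambda>x. u x t)))"
proof -
  obtain D where D: "\<And>x. (f has_vector_derivative D x) (at x)" "continuous_on UNIV D"
    using assms(1) unfolding C1_differentiable_on_def by auto
  have fd: "(f has_real_derivative D x) (at x)" for x
    using D(1) by (simp add: has_real_derivative_iff_has_vector_derivative)
  have dD: "deriv f x = D x" for x by (rule DERIV_imp_deriv[OF fd])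
  note tan = strictly_convex_deriv_strict_mono(2)[OF assms(2) fd]
  \<comment> \<open>\<open>\<alpha>\<close> is given on positive times up to null sets; the
    construction works with a Borel function on the whole line whose bound holds at every
    point.\<close>
  obtain a0 A where a0: "a0 \<in> borel_measurable borel" "\<And>t. \<bar>a0 t\<bar> \<le> A" "AE t in lborel. t \<in> {0<..} \<longrightarrow> \<alpha> t = a0 t"
    using Linfty_on_Borel[OF _ assms(10)] by (metis borel_open open_greaterThan)
  have a: "AE t in lborel. 0 < t \<longrightarrow> \<alpha> t = a0 t" using a0(3) by simp
  define z where "z i = - 1 / ln (real (i + 2))" for i :: nat
  have zlim: "z \<longlonglongrightarrow> 0"
  proof -
    have "filterlim (\<lambda>i. ln (real (i + 2))) at_top sequentially"
      by (rule filterlim_compose[OF ln_at_top]) (rule filterlim_compose[OF filterlim_real_sequentially], rule filterlim_add_const_nat_at_top)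
    then show ?thesis unfolding z_def by (rule tendsto_divide_0[OF tendsto_const filterlim_at_top_imp_at_infinity])
  qed
  have zm: "strict_mono z"
  proof (rule strict_monoI_Suc)
    fix i
    have "ln (real (i + 2)) < ln (real (Suc i + 2))" "0 < ln (real (i + 2))" by simp_all
    then have "1 / ln (real (Suc i + 2)) < 1 / ln (real (i + 2))" by (intro divide_strict_left_mono mult_pos_pos) auto
    then show "z i < z (Suc i)" by (simp add: z_def)
  qed
  have zgap: "(\<lambda>i. z (Suc i) - z i) \<longlonglongrightarrow> 0"
    using tendsto_diff[OF LIMSEQ_Suc[OF zlim] zlim] by simp
  interpret cauchy f D a0 z A 0
  proof unfold_locales
    show "D 0 = 0" using assms(4) dD by simp
    show "strict_mono D" by (rule strictly_convex_deriv_strict_mono(1)[OF assms(2) fd])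
    show "filterlim D at_top at_top" "filterlim D at_bot at_bot"
      using superlinear_deriv_unbounded[of D f] tan assms(3,5) by blast+
    show "continuous_on UNIV (prim a0)" by (rule continuous_on_prim[OF a0(1,2)])
    show "z i \<le> 0" for i by (simp add: z_def)
  qed (use fd D assms(3) zm zgap a0 in auto)
  let ?u0 = "\<lambda>x. V x 0"
  obtain B where B: "B \<ge> 0" "\<And>x t. \<bar>V x t\<bar> \<le> B" using V_bounded by metis
  have "Linfty_on UNIV ?u0"
    unfolding Linfty_on_def
  proof
    have "?u0 \<in> borel_measurable lebesgue" using V_measurable[of 0] by (simp add: measurable_completion)
    then show "?u0 \<in> borel_measurable (lebesgue_on UNIV)" by (rule measurable_restrict_space1)
    show "\<exists>M. AE x in lebesgue_on UNIV. \<bar>V x 0\<bar> \<le> M" using B by (intro exI[of _ B]) auto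
  qed
  moreover have "compact (closure {x. ?u0 x \<noteq> 0})"
  proof -
    have "{x. ?u0 x \<noteq> 0} \<subseteq> {z 0..0}" using V_support[of _ 0 0] z_bdd by auto
    then have "bounded {x. ?u0 x \<noteq> 0}" by (rule bounded_subset[OF bounded_closed_interval])
    then show ?thesis by simp
  qed
  moreover have "entropy_solution f \<alpha> ?u0 U" by (rule U_solution[OF a])
  moreover have "\<not> BVs_loc_ae s (\<lambda>x. u x t)" if u: "entropy_solution f \<alpha> ?u0 u" and s: "s > 1 / q" and t: "t > 0" for u s t
  proof
    assume "BVs_loc_ae s (\<lambda>x. u x t)"
    then obtain w where w: "AE x in lebesgue. w x = u x t" "BVs_loc s w" unfolding BVs_loc_ae_def by blast
    have "AE x in lborel. w x = u x t" using w(1) by (simp add: AE_completion_iff)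
    then have wV: "AE x in lborel. w x = exp (prim a0 t) * V x t"
      using U_unique[OF a u t] by eventually_elim (simp add: U_def)
    have A0: "A \<ge> 0" using a0(2)[of 0] by linarith
    \<comment> \<open>Here w is an arbitrary representative, equal almost everywhere to a positive
      multiple of V by uniqueness; exp (A t) bounds the exponential factor at all times up to
      t.\<close>
    have "\<not> BVs_loc s w"
    proof (rule not_BVs_loc[where M = "exp (A * t)" and r = r and C = C and q = q, OF _ _ _ assms(6-8) _ s _ wV])
      show "exp (prim a0 \<tau>) \<le> exp (A * t)" if "\<tau> \<in> {0..t}" for \<tau> using exp_prim_le(1)[of \<tau> t] that t by simp
      show "D a - D b \<le> C * (a - b) powr q" if "b \<in> {-r<..<0}" "a \<in> {0<..<r}" for a b
        using assms(9)[OF that] by (simp add: dD)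
    qed (use t A0 in \<open>auto simp: z_def\<close>)
    then show False using w(2) by blast
  qed
  ultimately show ?thesis by blast
qed

end
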